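(* Let $(\Omega,\mu)$ be a measure space, $1<p<\infty$, and let $T\colon L^p(\Omega)\to L^p(\Omega)$ be an analytic contractively regular operator. (1) There exist an angle $\gamma\in(0,\pi/2)$ and a constant $C\ge1$ such that for every sequence $(F_n)_{n\ge1}$ of complex polynomials and every $x\in L^p(\Omega)$, $$\Big\|\Big(\sum_{n=1}^\infty|F_n(T)x|^2\Big)^{1/2}\Big\|_p\le C\|x\|_p\sup\Big\{\Big(\sum_{n=1}^\infty|F_n(z)|^2\Big)^{1/2}: z\in B_\gamma\Big\}.$$ (2) For every integer $m\ge1$ there is a constant $C_m$ such that $$\Big\|\Big(\sum_{n=0}^\infty(n+1)^{2m-1}\big|T^n(T-I)^m x\big|^2\Big)^{1/2}\Big\|_p\le C_m\|x\|_p,\qquad x\in L^p(\Omega).$$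
   Context: An operator $T$ on $L^p(\Omega)$ is regular if there is $C\ge0$ with $\|\sup_k|T(x_k)|\|_p\le C\|\sup_k|x_k|\|_p$ for all finite sequences $(x_k)$; the least such $C$ is $\|T\|_r$, and $T$ is contractively regular if $\|T\|_r\le1$. A bounded operator $T$ is analytic if $\sup_{n\ge0}\|T^n\|<\infty$ and $\sup_{n\ge1}n\|T^n-T^{n-1}\|<\infty$. For $\gamma\in(0,\pi/2)$, the Stolz domain $B_\gamma$ is the closed convex hull of the point $1$ and the disc $\{|z|<\sin\gamma\}$. *)

theory Defs
  imports "HOL-Analysis.Analysis" "HOL-Computational_Algebra.Polynomial"
begin

text \<open>Real powers of extended nonnegative reals (r > 0 intended): infinity stays infinity.\<close>
definition enn_powr :: "ennreal \<Rightarrow> real \<Rightarrow> ennreal" where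
  "enn_powr x r = (if x = \<infinity> then \<infinity> else ennreal (enn2real x powr r))"

definition lpn :: "'a measure \<Rightarrow> real \<Rightarrow> ('a \<Rightarrow> ennreal) \<Rightarrow> ennreal" where
  "lpn M p g = enn_powr (\<integral>\<^sup>+ \<omega>. enn_powr (g \<omega>) p \<partial>M) (1 / p)"

definition lp_norm :: "'a measure \<Rightarrow> real \<Rightarrow> ('a \<Rightarrow> complex) \<Rightarrow> ennreal" where
  "lp_norm M p f = lpn M p (\<lambda>\<omega>. ennreal (cmod (f \<omega>)))"

text \<open>Representatives of elements of the complex space L^p(M).\<close>
definition Lp :: "'a measure \<Rightarrow> real \<Rightarrow> ('a \<Rightarrow> complex) set" where
  "Lp M p = {f. f \<in> borel_measurable M \<and> lp_norm M p f < \<infinity>}"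

definition lp_operator :: "'a measure \<Rightarrow> real \<Rightarrow> (('a \<Rightarrow> complex) \<Rightarrow> ('a \<Rightarrow> complex)) \<Rightarrow> bool" where
  "lp_operator M p T \<longleftrightarrow>
     (\<forall>f\<in>Lp M p. T f \<in> Lp M p) \<and>
     (\<forall>f\<in>Lp M p. \<forall>g\<in>Lp M p. (AE \<omega> in M. f \<omega> = g \<omega>) \<longrightarrow> (AE \<omega> in M. T f \<omega> = T g \<omega>)) \<and>
     (\<forall>f\<in>Lp M p. \<forall>g\<in>Lp M p. \<forall>a b::complex.
        AE \<omega> in M. T (\<lambda>\<omega>'. a * f \<omega>' + b * g \<omega>') \<omega> = a * T f \<omega> + b * T g \<omega>) \<and>
     (\<exists>K::real. \<forall>f\<in>Lp M p. lp_norm M p (T f) \<le> ennreal K * lp_norm M p f)"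

definition regular_with :: "'a measure \<Rightarrow> real \<Rightarrow> (('a \<Rightarrow> complex) \<Rightarrow> ('a \<Rightarrow> complex)) \<Rightarrow> real \<Rightarrow> bool" where
  "regular_with M p T C \<longleftrightarrow>
     (\<forall>(N::nat) (xs::nat \<Rightarrow> 'a \<Rightarrow> complex). (\<forall>k<N. xs k \<in> Lp M p) \<longrightarrow>
        lpn M p (\<lambda>\<omega>. SUP k\<in>{..<N}. ennreal (cmod (T (xs k) \<omega>)))
          \<le> ennreal C * lpn M p (\<lambda>\<omega>. SUP k\<in>{..<N}. ennreal (cmod (xs k \<omega>))))"

definition contractively_regular :: "'a measure \<Rightarrow> real \<Rightarrow> (('a \<Rightarrow> complex) \<Rightarrow> ('a \<Rightarrow> complex)) \<Rightarrow> bool" where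
  "contractively_regular M p T \<longleftrightarrow> lp_operator M p T \<and> regular_with M p T 1"

definition analytic_op :: "'a measure \<Rightarrow> real \<Rightarrow> (('a \<Rightarrow> complex) \<Rightarrow> ('a \<Rightarrow> complex)) \<Rightarrow> bool" where
  "analytic_op M p T \<longleftrightarrow> lp_operator M p T \<and>
     (\<exists>K::real. \<forall>n. \<forall>f\<in>Lp M p. lp_norm M p ((T ^^ n) f) \<le> ennreal K * lp_norm M p f) \<and>
     (\<exists>K::real. \<forall>n\<ge>1. \<forall>f\<in>Lp M p.
        of_nat n * lp_norm M p (\<lambda>\<omega>. (T ^^ n) f \<omega> - (T ^^ (n - 1)) f \<omega>) \<le> ennreal K * lp_norm M p f)"

definition poly_op :: "complex poly \<Rightarrow> (('a \<Rightarrow> complex) \<Rightarrow> ('a \<Rightarrow> complex)) \<Rightarrow> ('a \<Rightarrow> complex) \<Rightarrow> ('a \<Rightarrow> complex)" where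
  "poly_op F T x = (\<lambda>\<omega>. \<Sum>k\<le>degree F. coeff F k * (T ^^ k) x \<omega>)"

definition stolz :: "real \<Rightarrow> complex set" where
  "stolz \<gamma> = closure (convex hull (insert 1 (ball 0 (sin \<gamma>))))"

end

theory Submission
 imports Defs "HOL-Complex_Analysis.Complex_Analysis"
begin

text \<open>
A contractively regular \<open>T\<close> is approximated by matrices on finite partitions, each of which factors
through a Markov chain; averaging over its paths transfers an inequality for the shift on scalar sequences to
\<open>T\<close>. In this way dyadic martingales, averaged over translations, give for \<open>n = 2^k\<close> and
\<open>M_n = (1 + z + ... + z^(n-1)) / n\<close>, \<open>P_k = M_n (M_2n^2 - z^n M_n^2)\<close> a square function estimate for
\<open>P_k(T) x\<close> and its dual form.

Analyticity bounds the resolvents, and domination by maximal functions bounds them on \<open>L^p(l^q)\<close> with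
\<open>q\<close> infinite or 1. Interpolating, they act on \<open>L^p(l^2)\<close> with a constant so small that their Neumann
series cross the unit circle and reach the boundary of a Stolz domain. Cauchy's formula on that boundary then
bounds \<open>F_m(T) e_k(T) x_k\<close>, where \<open>e_k = 16 n^6 (1 - z)^6 ((1 + z^n)^10 - 1)\<close>. Since
\<open>e_k P_k^2 = (1 - z^2n)^10 - (1 - z^n)^10\<close>, these sum up with \<open>(1 - z)^10\<close> to 1, which gives (1), for
\<open>s T\<close> with \<open>s < 1\<close> and in the limit for \<open>T\<close>. Part (2) is the case \<open>F_n = (n + 1)^(m - 1/2) z^n (z - 1)^m\<close>.
\<close>

text \<open>One competition decides the size of the angle. A point of the boundary of the Stolz
  domain lies inside the unit circle, where no resolvent bound is available; it is reached by a
  Neumann series from a center \<open>c\<close> on or outside the circle, at distance at most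
  \<open>2 * sin e * |c - 1|\<close>, where \<open>e\<close> is \<open>pi / 2\<close> minus the
  angle. Analyticity bounds \<open>|c - 1|\<close> times one resolvent on \<open>L^p\<close>, but
  near 1 the argument meets sequences of resolvents on \<open>L^p(l^2)\<close>. Domination by
  maximal functions costs a factor \<open>1 / sin e\<close> there and cancels the gain exactly.
  Interpolation lets only a power less than 1 of this factor into the constant, so a small
  \<open>e\<close> wins.

  Elements of \<open>L^p\<close> are representatives, and linearity holds only almost everywhere. No
  operator-valued holomorphic functions occur: each pair \<open>x\<close>, \<open>y\<close> gives
  the scalar moments \<open>s^n <T^n x, y>\<close>, and continuation and contour integrals are
  carried out for these. Norm estimates are recovered by summing the scalar formulas against
  arbitrary \<open>y\<close> and using duality.\<close>

section \<open>Hoelder's inequality and the absorption of powers\<close>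

lemma Holder_nn_integral:
 fixes f g :: "'a => real"
 assumes pq: "1 < p" "1 < q" "1/p + 1/q = 1"
  and meas: "f : borel_measurable M" "g : borel_measurable M"
  and nonneg: "!!x. 0 <= f x" "!!x. 0 <= g x"
  and A: "(\<integral>\<^sup>+x. ennreal (f x powr p) \<partial>M) <= ennreal A" "0 <= A"
  and B: "(\<integral>\<^sup>+x. ennreal (g x powr q) \<partial>M) <= ennreal B" "0 <= B"
 shows "(\<integral>\<^sup>+x. ennreal (f x * g x) \<partial>M) <= ennreal (A powr (1/p) * B powr (1/q))"
proof -
 let ?a = "\<integral>\<^sup>+x. ennreal (f x * g x) \<partial>M"
 let ?c = "\<integral>\<^sup>+x. ennreal (f x powr p) \<partial>M"
 let ?d = "\<integral>\<^sup>+x. ennreal (g x powr q) \<partial>M"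
 have main: "?a <= ennreal (A powr (1/p) * B powr (1/q))"
  if A: "?c <= ennreal A" "0 < A"
  and B: "?d <= ennreal B" "0 < B" for A B
 proof -
  define a b where "a = A powr (1/p)" and "b = B powr (1/q)"
  have ab: "a > 0" "b > 0" "a powr p = A" "b powr q = B"
   using that pq by (auto simp: a_def b_def powr_powr)
  have pt: "f x * g x <= (a*b/(p*A)) * f x powr p + (a*b/(q*B)) * g x powr q" for x
  proof -
   let ?e = "(f x / a) powr p / p + (g x / b) powr q / q"
   have "(f x / a) * (g x / b) <= ?e"
    using Youngs_inequality[OF pq, of "f x / a" "g x / b"] nonneg ab by simp
   hence "a * b * ((f x / a) * (g x / b)) <= a * b * ?e"
    using ab by (intro mult_left_mono) auto
   thus ?thesis using ab nonneg[of x] by (simp add: powr_divide field_simps)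
  qed
  have "(\<integral>\<^sup>+x. ennreal (f x * g x) \<partial>M) <=
   (\<integral>\<^sup>+x. ennreal (a*b/(p*A)) * ennreal (f x powr p) + ennreal (a*b/(q*B)) * ennreal (g x powr q) \<partial>M)"
   using pt ab pq that by (intro nn_integral_mono) (simp flip: ennreal_mult ennreal_plus)
  also have "... = ennreal (a*b/(p*A)) * ?c + ennreal (a*b/(q*B)) * ?d"
   using meas by (simp add: nn_integral_add nn_integral_cmult)
  also have "... <= ennreal (a*b/(p*A)) * ennreal A + ennreal (a*b/(q*B)) * ennreal B"
   using that by (intro add_mono mult_left_mono) auto
  also have "... = ennreal (a*b/p + a*b/q)"
   using ab pq that by (simp flip: ennreal_mult ennreal_plus)
  also have "a*b/p + a*b/q = a * b" using pq
   by (metis mult.right_neutral distrib_left times_divide_eq_right)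
  finally show ?thesis by (simp add: a_def b_def)
 qed
 \<comment> \<open>The normalisation by \<open>a\<close> and \<open>b\<close> needs positive bounds.
   Enlarging \<open>A\<close> and \<open>B\<close> by \<open>d\<close> and letting \<open>d\<close>
   tend to 0 covers vanishing integrals.\<close>
 let ?b = "%d. ennreal ((A + d) powr (1/p) * (B + d) powr (1/q))"
 have "((%d. ?b d) \<longlongrightarrow> ennreal ((A + 0) powr (1/p) * (B + 0) powr (1/q))) (at_right 0)"
  using A B pq by (intro tendsto_ennrealI tendsto_mult tendsto_powr' tendsto_intros)
   (auto intro!: eventually_at_rightI[of 0 1])
 moreover have "\<forall>\<^sub>F d in at_right 0. ?a <= ?b d"
 proof (rule eventually_at_rightI[of 0 1])
  fix d :: real assume d: "d : {0<..<1}"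
  show "?a <= ?b d"
   using A B d by (intro main) (auto intro: order_trans simp: ennreal_leI)
 qed simp
 ultimately show ?thesis
  using tendsto_lowerbound[OF _ _ trivial_limit_at_right_real] by fastforce
qed

lemma Holder_sum:
 fixes f g :: "'a => real"
 assumes pq: "1 < p" "1 < q" "1/p + 1/q = 1" and fin: "finite I"
  and nonneg: "!!x. x : I ==> 0 <= f x" "!!x. x : I ==> 0 <= g x"
 shows "(SUM x:I. f x * g x) <= (SUM x:I. f x powr p) powr (1/p) * (SUM x:I. g x powr q) powr (1/q)"
proof -
 let ?f = "%x. if x : I then f x else 0" and ?g = "%x. if x : I then g x else 0"
 have s: "(\<integral>\<^sup>+x. ennreal (h x) \<partial>count_space I) = ennreal (SUM x:I. h x)" if "!!x. x : I ==> 0 <= h x" for h :: "'a => real"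
  using that fin by (simp add: nn_integral_count_space_finite sum_ennreal)
 have "(\<integral>\<^sup>+x. ennreal (?f x * ?g x) \<partial>count_space I) <=
  ennreal ((SUM x:I. f x powr p) powr (1/p) * (SUM x:I. g x powr q) powr (1/q))"
  by (rule Holder_nn_integral[OF pq]) (use nonneg in "auto simp: s sum_nonneg")
 hence "ennreal (SUM x:I. ?f x * ?g x) <=
  ennreal ((SUM x:I. f x powr p) powr (1/p) * (SUM x:I. g x powr q) powr (1/q))"
  using nonneg by (subst (asm) s) auto
 thus ?thesis by (simp add: ennreal_le_iff)
qed

text \<open>Closes the duality arguments below: testing a quantity \<open>Y\<close> against its own
  power leaves \<open>Y\<close> to the power \<open>1/q\<close> on the right, and since
  \<open>Y\<close> is a finite real it can be divided out.\<close>

lemma powr_absorb: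
 fixes X Y c :: real
 assumes pq: "1 < p" "1 < q" "1/p + 1/q = 1" and "0 <= X" "0 <= Y" "0 <= c"
  and le: "Y <= c * (X powr (1/p) * Y powr (1/q))"
 shows "Y <= c powr p * X"
proof (cases "Y = 0")
 case False
 hence Y: "Y > 0" using assms by simp
 let ?a = "c * X powr (1/p)"
 have "Y powr (1/p) * Y powr (1/q) = Y" using Y pq by (simp flip: powr_add)
 hence "Y powr (1/p) * Y powr (1/q) <= ?a * Y powr (1/q)" using le by (simp add: mult_ac)
 hence "Y powr (1/p) <= ?a" using Y by (simp add: mult_le_cancel_right)
 hence "(Y powr (1/p)) powr p <= ?a powr p" using pq by (intro powr_mono2) auto
 thus ?thesis using pq assms by (simp add: powr_powr powr_mult)
qed (use assms in auto)

section \<open>Maximal averages of sequences and decreasing kernels\<close>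

text \<open>Layer-cake formula: \<open>b^p\<close> is the integral of \<open>p * t^(p-1)\<close>
  over \<open>0 < t < b\<close>, so the weak inequality multiplied by \<open>p * t^(p-2)\<close> and
  integrated over the levels gives the claim. The hypothesis bounds a level set by \<open>a\<close>
  on that same set; this produces the mixed sum of \<open>a * b^(p-1)\<close>, to which Hoelder and
  absorption apply.\<close>

lemma weak_to_strong_aux:
 fixes a b :: "'a => real"
 assumes fin: "finite I" and p: "1 < p" and nn: "!!i. i : I ==> 0 <= a i" "!!i. i : I ==> 0 <= b i"
  and weak: "!!t. 0 < t ==> t * (SUM i:{i:I. t < b i}. 1) <= (SUM i:{i:I. t < b i}. a i)"
 shows "(SUM i:I. b i powr p) <= p / (p - 1) * (SUM i:I. a i * b i powr (p - 1))"
proof (cases "I = {}")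
 case False
 define B where "B = Max (b ` I)"
 have B: "b i <= B" if "i : I" for i using that fin by (auto simp: B_def)
 have B0: "0 <= B" using False B nn(2) by (meson ex_in_conv order_trans)
 have ind: "((%t. if t < b i then t powr e else 0) has_integral b i powr (e+1) / (e+1)) {0..B}" if "i : I" "e > -1" for i e
 proof -
  have "((%t. t powr e) has_integral b i powr (e+1) / (e+1)) {0..b i}"
   using has_integral_powr_from_0[of e "b i"] nn that by simp
  hence "((%t. if t : {0..b i} then t powr e else 0) has_integral b i powr (e+1) / (e+1)) {0..B}"
   using B[OF that(1)] by (subst has_integral_restrict) auto
  thus ?thesis
   by (rule has_integral_spike_finite[of "{b i}", rotated 2]) auto
 qed
 let ?a = "%t i. if t < b i then t powr (p-1) else 0"
 let ?g = "SUM i:I. b i powr p"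
 have L: "((%t. SUM i:I. p * (?a t i)) has_integral ?g) {0..B}"
 proof (intro has_integral_sum fin)
  fix i assume "i : I"
  let ?h = "%t. p * (?a t i)"
  have "(?h has_integral p * (b i powr (p - 1 + 1) / (p-1+1))) {0..B}"
   by (intro has_integral_mult_right ind) (use p \<open>i : I\<close> in auto)
  thus "(?h has_integral b i powr p) {0..B}" using p by simp
 qed
 let ?b = "%t i. if t < b i then t powr (p-2) else 0"
 let ?c = "SUM i:I. p * a i * (b i powr (p-1) / (p-1))"
 have R: "((%t. SUM i:I. p * a i * (?b t i)) has_integral ?c) {0..B}"
 proof (intro has_integral_sum fin)
  fix i assume "i : I"
  let ?e = "%t. p * a i * (?b t i)"
  have "(?e has_integral p * a i * (b i powr (p - 2 + 1) / (p-2+1))) {0..B}"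
   by (intro has_integral_mult_right ind) (use p \<open>i : I\<close> in auto)
  thus "(?e has_integral p * a i * (b i powr (p-1) / (p-1))) {0..B}"
   by (simp add: algebra_simps)
 qed
 have "?g <= ?c"
 proof (rule has_integral_le[OF L R])
  fix t assume t: "t : {0..B}"
  let ?d = "SUM i:I. p * a i * (?b t i)"
  let ?f = "SUM i:I. p * (?a t i)"
  show "?f <= ?d"
  proof (cases "t = 0")
   \<comment> \<open>At \<open>t = 0\<close> both sides vanish because \<open>0 powr r = 0\<close>
     for every exponent.\<close>
   case True thus ?thesis using p by (simp cong: sum.cong if_cong)
  next
   case False
   hence t0: "t > 0" using t by simp
   have e: "t powr (p-1) = t * t powr (p-2)" using t0 powr_mult_base[of t "p - 2"] by simp
   have f: "(SUM i:I. c i * (if t < b i then d else 0)) = d * (SUM i:{i:I. t < b i}. c i)" for c :: "'a => real" and d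
    unfolding sum.inter_filter[OF fin] sum_distrib_left by (rule sum.cong) auto
   have "?f = p * (t powr (p-2) * (t * (SUM i:{i:I. t < b i}. 1)))"
    using f[of "%_. p"] by (simp add: e mult_ac)
   also have "... <= p * (t powr (p-2) * (SUM i:{i:I. t < b i}. a i))"
    using p weak[OF t0] by (intro mult_left_mono) auto
   also have "... = ?d"
    using f[of "%i. p * a i"] by (simp add: sum_distrib_left mult_ac)
   finally show ?thesis .
  qed
 qed
 thus ?thesis by (simp add: sum_distrib_left mult_ac)
qed auto

lemma weak_to_strong:
 fixes a b :: "'a => real"
 assumes fin: "finite I" and p: "1 < p" and nn: "!!i. i : I ==> 0 <= a i" "!!i. i : I ==> 0 <= b i"
  and weak: "!!t. 0 < t ==> t * (SUM i:{i:I. t < b i}. 1) <= (SUM i:{i:I. t < b i}. a i)"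
 shows "(SUM i:I. b i powr p) <= (p / (p - 1)) powr p * (SUM i:I. a i powr p)"
proof -
 define q where "q = p / (p - 1)"
 have pq: "1 < p" "1 < q" "1/p + 1/q = 1" "(p - 1) * q = p" using p by (auto simp: q_def field_simps)
 let ?a = "SUM i:I. b i powr p"
 let ?b = "SUM i:I. (b i powr (p-1)) powr q"
 let ?c = "SUM i:I. a i * b i powr (p - 1)"
 have "?a <= p / (p - 1) * ?c"
  by (rule weak_to_strong_aux[OF assms])
 also have "?c <= (SUM i:I. a i powr p) powr (1/p) * ?b powr (1/q)"
  by (rule Holder_sum[OF pq(1-3) fin]) (use nn in auto)
 also have "?b = ?a"
  by (simp add: powr_powr pq)
 finally have "?a <= p / (p - 1) * ((SUM i:I. a i powr p) powr (1/p) * ?a powr (1/q))"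
  using p by (smt (verit) divide_nonneg_pos mult_left_mono)
 thus ?thesis using p by (intro powr_absorb[OF pq(1-3)]) (auto intro: sum_nonneg)
qed

definition window_avg :: "(nat => real) => nat => nat => real" where
 "window_avg a i e = (SUM l=i..e. a l) / real (e + 1 - i)"

text \<open>The forward Hardy-Littlewood maximal function, truncated at \<open>h\<close>. Windows
  start at \<open>i\<close> because powers of the shift only look ahead; two-sided averages are
  handled by reflecting the index.\<close>

definition max_avg :: "nat => (nat => real) => nat => real" where
 "max_avg h a i = Max (window_avg a i ` {i..h})"

lemma window_avg_le_max: "i <= e ==> e <= h ==> window_avg a i e <= max_avg h a i"
 by (auto simp: max_avg_def)

lemma max_avg_nonneg:
 assumes "!!l. 0 <= a l" "i <= h"
 shows "0 <= max_avg h a i"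
 using window_avg_le_max[of i i h a] assms by (auto simp: window_avg_def intro: order_trans)

text \<open>Rising sun argument: a shortest window witnessing \<open>t < max_avg h a i\<close> is contained in the level set.\<close>

lemma max_avg_weak_from:
 fixes t :: real
 shows "t * (SUM l:{l:{i..h}. t < max_avg h a l}. 1) <= (SUM l:{l:{i..h}. t < max_avg h a l}. a l)"
proof (induction "Suc h - i" arbitrary: i rule: less_induct)
 case less
 let ?a = "%e. window_avg a i e"
 let ?b = "{l:{i..h}. t < max_avg h a l}"
 show ?case
 proof (cases "i <= h")
  case False
  thus ?thesis by simp
 next
  case ih: True
  show ?thesis
  proof (cases "t < max_avg h a i")
   case False
   have "?b = {l:{Suc i..h}. t < max_avg h a l}"
    using False by (auto simp: not_less_eq_eq le_Suc_eq) (metis le_antisym not_less_eq_eq)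
   thus ?thesis using less[of "Suc i"] ih by simp
  next
   case True
   hence "EX e. i <= e & e <= h & t < ?a e"
    using ih unfolding max_avg_def by (subst (asm) Max_gr_iff) auto
   define e where "e = (LEAST e. i <= e & e <= h & t < ?a e)"
   have e: "i <= e" "e <= h" "t < ?a e"
    using LeastI_ex[OF \<open>EX e. _ e\<close>] unfolding e_def by auto
   have min: "\<not> t < ?a d" if "i <= d" "d < e" for d
    using not_less_Least[of d "%e. i <= e & e <= h & t < ?a e"] that e unfolding e_def by auto
   have tot: "t * real (e + 1 - i) < (SUM l=i..e. a l)"
    using e by (simp add: window_avg_def field_simps)
   \<comment> \<open>By minimality of \<open>e\<close> the initial piece \<open>i..l-1\<close> has
     average at most \<open>t\<close>, so the rest \<open>l..e\<close> of the window averages more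
     than \<open>t\<close>.\<close>
   have lev: "t < max_avg h a l" if l: "i <= l" "l <= e" for l
   proof -
    have "t * real (e + 1 - l) < (SUM k=l..e. a k)"
    proof (cases "l = i")
     case True thus ?thesis using tot by simp
    next
     case False
     hence "(SUM k=i..l-1. a k) <= t * real (l - i)"
     proof -
      have *: "i <= l - 1" "l - 1 < e" "l - 1 + 1 - i = l - i" "0 < l - i" using l False by auto
      show ?thesis using min[OF *(1,2)] *(4) unfolding window_avg_def *(3) by (simp add: field_simps)
     qed
     moreover have "(SUM k=i..e. a k) = (SUM k=i..l-1. a k) + (SUM k=l..e. a k)"
     proof -
      have "{i..e} = {i..l-1} \<union> {l..e}" "{i..l-1} \<inter> {l..e} = {}" using l False by auto
      thus ?thesis by (simp add: sum.union_disjoint)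
     qed
     ultimately show ?thesis using tot l by (auto simp: of_nat_diff algebra_simps)
    qed
    hence "t < window_avg a l e" using l by (simp add: window_avg_def field_simps)
    thus ?thesis using window_avg_le_max[of l e h a] l e by linarith
   qed
   have split: "?b = {i..e} \<union> {l:{Suc e..h}. t < max_avg h a l}"
    using lev e by auto
   have IH: "t * (SUM l:{l:{Suc e..h}. t < max_avg h a l}. 1) <= (SUM l:{l:{Suc e..h}. t < max_avg h a l}. a l)"
    using e ih by (intro less) auto
   have "t * (SUM l:{i..e}. 1) <= (SUM l:{i..e}. a l)" using tot e by (simp add: of_nat_diff)
   thus ?thesis unfolding split using IH
    by (subst (1 2) sum.union_disjoint) (auto simp: distrib_left)
  qed
 qed
qed

lemma max_avg_strong:
 assumes p: "1 < p" and nn: "!!l. 0 <= a l"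
 shows "(SUM i<=h. max_avg h a i powr p) <= (p / (p - 1)) powr p * (SUM i<=h. a i powr p)"
proof (rule weak_to_strong[OF _ p])
 fix t :: real
 show "t * (SUM l:{l:{..h}. t < max_avg h a l}. 1) <= (SUM l:{l:{..h}. t < max_avg h a l}. a l)"
  using max_avg_weak_from[of t 0 h a] by (simp add: atMost_atLeast0)
qed (use nn max_avg_nonneg in auto)

definition dec_kernel :: "(nat => real) => bool" where
 "dec_kernel w \<longleftrightarrow> (ALL j. 0 <= w j & w (Suc j) <= w j) & (ALL J. (SUM j<J. w j) <= 1)"

text \<open>Such a kernel is a mixture of uniform windows starting at \<open>i\<close>. The
  induction is Abel summation: the partial sums of \<open>a - m\<close> are at most 0, so lowering
  the weight from \<open>w J\<close> to \<open>w (Suc J)\<close> can only increase the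
  bound.\<close>

lemma dec_kernel_le_max:
 assumes w: "dec_kernel w" and nn: "!!l. 0 <= a l" and zero: "!!l. h < l ==> a l = 0" and i: "i <= h"
 shows "(SUM j<J. w j * a (i + j)) <= max_avg h a i"
proof -
 define m where "m = max_avg h a i"
 have m0: "0 <= m" using max_avg_nonneg nn i by (simp add: m_def)
 have part: "(SUM j<n. a (i + j)) <= real n * m" for n
 proof (induction n)
  case (Suc n)
  show ?case
  proof (cases "i + n <= h")
   case True
   have "(SUM j<Suc n. a (i + j)) = (SUM l=i..i+n. a l)"
    by (rule sum.reindex_bij_witness[of _ "%l. l - i" "%j. i + j"]) auto
   thus ?thesis using window_avg_le_max[of i "i + n" h a] True
    by (simp add: window_avg_def m_def field_simps)
  next
   case False
   thus ?thesis using Suc zero[of "i + n"] m0 by (simp add: algebra_simps)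
  qed
 qed auto
 have "(SUM j<J. w j * (a (i + j) - m)) <= w J * (SUM j<J. a (i + j) - m)"
 proof (induction J)
  case (Suc J)
  let ?a = "SUM j<Suc J. a (i + j) - m"
  have "(SUM j<Suc J. w j * (a (i + j) - m)) <= w J * ?a"
   using Suc by (simp add: algebra_simps)
  also have "... <= w (Suc J) * ?a"
   using w part[of "Suc J"] by (intro mult_right_mono_neg) (auto simp: dec_kernel_def sum_subtractf)
  finally show ?case .
 qed auto
 also have "... <= 0"
  using w part[of J] by (intro mult_nonneg_nonpos) (auto simp: dec_kernel_def sum_subtractf)
 finally have "(SUM j<J. w j * a (i + j)) <= (SUM j<J. w j) * m"
  by (simp add: algebra_simps sum_subtractf sum_distrib_left)
 also have "... <= 1 * m" using w m0 by (intro mult_right_mono) (auto simp: dec_kernel_def)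
 finally show ?thesis by (simp add: m_def)
qed

definition conv :: "nat => (nat => real) => (nat => real) => nat => real" where
 "conv J w a i = (SUM j<J. w j * a (i + j))"

lemma conv_nonneg: "dec_kernel w ==> (!!l. 0 <= a l) ==> 0 <= conv J w a i"
 by (auto simp: conv_def dec_kernel_def intro!: sum_nonneg)

lemma dual_conv_sum:
 assumes zero: "!!l. h < l ==> a l = 0"
 shows "(SUM m<=h. y m * conv J w a m) = (SUM l<=h. a l * (SUM j<J. w j * (if j <= l then y (l - j) else 0)))"
proof -
 have "(SUM m<=h. y m * conv J w a m) = (SUM j<J. SUM m<=h. w j * (y m * a (m + j)))"
  unfolding conv_def sum_distrib_left by (subst sum.swap) (simp add: mult_ac)
 also have "... = (SUM j<J. SUM l<=h. w j * (a l * (if j <= l then y (l - j) else 0)))"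
 proof (rule sum.cong[OF refl])
  fix j
  let ?a = "SUM l<=h. w j * (a l * (if j <= l then y (l - j) else 0))"
  let ?b = "SUM m<=h. w j * (y m * a (m + j))"
  have "?a = (SUM l:{j..h}. w j * (a l * y (l - j)))"
   by (intro sum.mono_neutral_cong_right) auto
  also have "... = (SUM m:{m. m + j <= h}. w j * (y m * a (m + j)))"
   by (rule sum.reindex_bij_witness[of _ "%m. m + j" "%l. l - j"]) auto
  also have "... = ?b"
   by (rule sum.mono_neutral_cong_left) (auto simp: zero)
  finally show "?b = ?a" by simp
 qed
 also have "... = (SUM l<=h. a l * (SUM j<J. w j * (if j <= l then y (l - j) else 0)))"
  unfolding sum_distrib_left by (subst sum.swap) (simp add: mult_ac)
 finally show ?thesis .
qed

text \<open>By duality. Tested against \<open>y = W^(p-1)\<close>, the kernels move to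
  \<open>y\<close> and look backward; after reflection of the index by \<open>h\<close> they look
  forward again and are dominated by one maximal function \<open>Y\<close> that does not depend on
  \<open>k\<close>. Hence the sum over \<open>k\<close> stays inside. The constant \<open>p\<close>
  is \<open>q / (q - 1)\<close> for the conjugate exponent.\<close>

lemma conv_l1_bound:
 fixes A :: "'k => nat => real"
 assumes p: "1 < p" and fin: "finite S" and w: "!!k. k : S ==> dec_kernel (w k)"
  and nn: "!!k l. 0 <= A k l" and zero: "!!k l. h < l ==> A k l = 0"
 shows "(SUM m<=h. (SUM k:S. conv J (w k) (A k) m) powr p) <= p powr p * (SUM m<=h. (SUM k:S. A k m) powr p)"
proof -
 define q where "q = p / (p - 1)"
 have pq: "1 < p" "1 < q" "1/p + 1/q = 1" "(p - 1) * q = p" "q / (q - 1) = p" using p by (auto simp: q_def field_simps)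
 define W where "W m = (SUM k:S. conv J (w k) (A k) m)" for m
 have W0: "0 <= W m" for m unfolding W_def by (intro sum_nonneg conv_nonneg) (use w nn in auto)
 define y where "y m = W m powr (p - 1)" for m
 define y' where "y' i = (if i <= h then y (h - i) else 0)" for i
 have y0: "0 <= y m" "0 <= y' m" for m by (auto simp: y_def y'_def)
 define Y where "Y l = max_avg h y' (h - l)" for l
 have Y0: "0 <= Y l" for l unfolding Y_def by (intro max_avg_nonneg y0) auto
 let ?a = "SUM m<=h. W m powr p"
 let ?b = "SUM i<=h. max_avg h y' i powr q"
 let ?c = "SUM l<=h. (SUM k:S. A k l) powr p"
 let ?d = "%k l. SUM j<J. w k j * (if j <= l then y (l - j) else 0)"
 let ?e = "%i. h - i"
 let ?h = "SUM l<=h. Y l powr q"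
 have "?a = (SUM m<=h. y m * W m)"
  unfolding y_def using W0 by (intro sum.cong refl) (metis add.commute diff_add_cancel mult.commute powr_mult_base)
 also have "... = (SUM k:S. SUM m<=h. y m * conv J (w k) (A k) m)"
  unfolding W_def sum_distrib_left by (rule sum.swap)
 also have "... = (SUM k:S. SUM l<=h. A k l * (?d k l))"
  by (intro sum.cong refl dual_conv_sum zero)
 also have "... <= (SUM k:S. SUM l<=h. A k l * Y l)"
 proof (intro sum_mono mult_left_mono nn)
  fix k l assume k: "k : S" and l: "l : {..h}"
  have "(?d k l) = (SUM j<J. w k j * y' (h - l + j))"
   using l by (intro sum.cong refl) (auto simp: y'_def)
  also have "... <= Y l" unfolding Y_def
   by (rule dec_kernel_le_max) (use w k y0 in "auto simp: y'_def")
  finally show "(?d k l) <= Y l" .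
 qed
 also have "... = (SUM l<=h. (SUM k:S. A k l) * Y l)"
  by (subst sum.swap) (simp add: sum_distrib_right)
 also have "... <= ?c powr (1/p) * ?h powr (1/q)"
  by (rule Holder_sum[OF pq(1-3)]) (auto intro: sum_nonneg nn Y0)
 also have "?h = ?b"
  unfolding Y_def by (rule sum.reindex_bij_witness[of _ "?e" "?e"]) auto
 finally have 1: "?a <= ?c powr (1/p) * ?b powr (1/q)" .
 let ?f = "p * ?a powr (1/q)"
 let ?g = "SUM i<=h. y' i powr q"
 let ?i = "p powr q * ?a"
 have "?b powr (1/q) <= ?i powr (1/q)"
 proof (intro powr_mono2)
  have "?b <= p powr q * ?g"
   using max_avg_strong[OF pq(2), of y' h] y0 pq by simp
  also have "?g = (SUM m<=h. y m powr q)"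
   by (rule sum.reindex_bij_witness[of _ "?e" "?e"]) (auto simp: y'_def)
  also have "... = ?a" by (simp add: y_def powr_powr pq)
  finally show "?b <= ?i" .
 qed (use pq in "auto intro: sum_nonneg")
 also have "?i powr (1/q) = ?f"
  using pq by (simp add: powr_mult powr_powr sum_nonneg)
 finally have 2: "?b powr (1/q) <= ?f" .
 have "?a <= ?c powr (1/p) * ?f"
  using 1 2 by (meson mult_left_mono order_trans powr_ge_zero)
 hence "?a <= p * (?c powr (1/p) * ?a powr (1/q))"
  by (simp add: mult_ac)
 thus ?thesis unfolding W_def using p
  by (intro powr_absorb[OF pq(1-3)]) (auto intro: sum_nonneg)
qed

lemma conv_sup_bound:
 fixes A :: "'k => nat => real"
 assumes w: "dec_kernel w" and le: "!!l. a l <= b l" and nn: "!!l. 0 <= b l"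
  and zero: "!!l. h < l ==> b l = 0" and "m <= h"
 shows "conv J w a m <= max_avg h b m"
proof -
 have "conv J w a m <= conv J w b m" unfolding conv_def
  using w le by (intro sum_mono mult_left_mono) (auto simp: dec_kernel_def)
 also have "... <= max_avg h b m" unfolding conv_def by (intro dec_kernel_le_max assms)
 finally show ?thesis .
qed

text \<open>Explicit interpolation between \<open>l^1\<close> and \<open>l^infinity\<close>. With
  \<open>X\<close> the \<open>l^2\<close> norm over \<open>k\<close> and \<open>U = A^2 / X\<close>,
  Cauchy-Schwarz for each kernel bounds the square of the convolution of \<open>A\<close> by the
  product of those of \<open>U\<close> and \<open>X\<close>. The \<open>U\<close> sum to
  \<open>X\<close>, so the first factor is an \<open>l^1\<close> estimate and the second a maximal
  function. Where \<open>X\<close> vanishes so does \<open>A\<close>, and division by zero yields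
  \<open>U = 0\<close>.\<close>

lemma conv_l2_bound:
 fixes A :: "'k => nat => real"
 assumes p: "1 < p" and fin: "finite S" and w: "!!k. k : S ==> dec_kernel (w k)"
  and nn: "!!k l. 0 <= A k l" and zero: "!!k l. h < l ==> A k l = 0"
 shows "(SUM m<=h. (SUM k:S. (conv J (w k) (A k) m)\<^sup>2) powr (p/2)) <=
  (p * (p / (p - 1))) powr (p/2) * (SUM m<=h. (SUM k:S. (A k m)\<^sup>2) powr (p/2))"
proof -
 let ?d = "%l. SUM k:S. (A k l)\<^sup>2"
 define X where "X l = sqrt (?d l)" for l
 have X0: "0 <= X l" for l by (simp add: X_def sum_nonneg)
 have X2: "X l * X l = (?d l)" for l by (simp add: X_def sum_nonneg)
 have Xz: "X l = 0" if "h < l" for l by (simp add: X_def zero[OF that])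
 define U where "U k l = (if k : S then (A k l)\<^sup>2 / X l else 0)" for k l
 have U0: "0 <= U k l" for k l using X0 by (simp add: U_def)
 have UX: "U k l * X l = (A k l)^2" if "k : S" for k l
 proof (cases "X l = 0")
  case True
  hence "(SUM k:S. (A k l)\<^sup>2) = 0" using X2[of l] by simp
  hence "A k l = 0" using that fin by (simp add: sum_nonneg_eq_0_iff)
  thus ?thesis by (simp add: U_def)
 qed (use that in "simp add: U_def")
 have sumU: "(SUM k:S. U k l) = X l" for l
 proof (cases "X l = 0")
  case False
  thus ?thesis using X2[of l] by (simp add: U_def flip: sum_divide_distrib) (simp add: field_simps)
 qed (simp add: U_def)
 let ?e = "%k m. conv J (w k) (U k) m"
 define V1 V2 where "V1 m = (SUM k:S. ?e k m)" and "V2 m = max_avg h X m" for m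
 have V0: "0 <= V1 m" "m <= h ==> 0 <= V2 m" for m unfolding V1_def V2_def
  using w U0 X0 by (auto intro!: sum_nonneg conv_nonneg max_avg_nonneg)
 let ?f = "%k m. conv J (w k) (A k) m"
 have pt: "(SUM k:S. (?f k m)\<^sup>2) <= V1 m * V2 m" if m: "m <= h" for m
 proof -
  have "(?f k m)^2 <= ?e k m * V2 m" if k: "k : S" for k
  proof -
   have w0: "0 <= w k j" for j using w[OF k] by (simp add: dec_kernel_def)
   let ?b = "%j. sqrt (w k j * U k (m + j))"
   let ?c = "%j. sqrt (w k j * X (m + j))"
   have "?f k m = (SUM j<J. ?b j * ?c j)"
   proof (unfold conv_def, rule sum.cong[OF refl])
    fix j
    have "?b j * ?c j = sqrt ((w k j)^2 * (U k (m + j) * X (m + j)))"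
     by (simp add: power2_eq_square mult_ac flip: real_sqrt_mult)
    also have "... = w k j * A k (m + j)"
     using w0 nn by (simp add: UX[OF k] real_sqrt_mult)
    finally show "w k j * A k (m + j) = ?b j * ?c j" by simp
   qed
   hence "(?f k m)^2 <= (SUM j<J. (?b j)\<^sup>2) * (SUM j<J. (?c j)\<^sup>2)"
    by (simp add: Cauchy_Schwarz_ineq_sum)
   also have "... = ?e k m * conv J (w k) X m"
    using w0 U0 X0 by (simp add: conv_def)
   also have "... <= ?e k m * V2 m"
    unfolding V2_def using w[OF k] U0 X0 Xz m
    by (intro mult_left_mono conv_sup_bound conv_nonneg) auto
   finally show ?thesis .
  qed
  thus ?thesis unfolding V1_def sum_distrib_right by (rule sum_mono)
 qed
 let ?a = "SUM m<=h. X m powr p"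
 let ?g = "?a powr (1/2) * ?a powr (1/2)"
 let ?h = "SUM m<=h. V1 m powr p"
 let ?i = "SUM m<=h. V2 m powr p"
 have "(SUM m<=h. (SUM k:S. (?f k m)\<^sup>2) powr (p/2)) <= (SUM m<=h. V1 m powr (p/2) * V2 m powr (p/2))"
  using pt V0 p by (intro sum_mono) (auto simp flip: powr_mult intro!: powr_mono2 sum_nonneg)
 also have "... <= (SUM m<=h. (V1 m powr (p/2)) powr 2) powr (1/2) * (SUM m<=h. (V2 m powr (p/2)) powr 2) powr (1/2)"
  by (rule Holder_sum) auto
 also have "... = ?h powr (1/2) * ?i powr (1/2)"
  by (simp only: powr_powr) simp
 also have "... <= (p powr p * ?a) powr (1/2) * ((p/(p-1)) powr p * ?a) powr (1/2)"
 proof (intro mult_mono powr_mono2)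
  show "?h <= p powr p * ?a"
  proof -
   have Uz: "U k l = 0" if "h < l" for k l using zero[OF that] by (simp add: U_def)
   have "(SUM m<=h. (SUM k:S. ?e k m) powr p) <= p powr p * (SUM m<=h. (SUM k:S. U k m) powr p)"
    by (rule conv_l1_bound[OF p fin w U0 Uz])
   thus ?thesis unfolding V1_def sumU .
  qed
  show "?i <= (p/(p-1)) powr p * ?a"
   unfolding V2_def by (intro max_avg_strong p X0)
 qed (auto intro: sum_nonneg)
 also have "... = (p * (p / (p - 1))) powr (p/2) * ?g"
  using p by (simp add: powr_mult powr_powr sum_nonneg powr_divide mult_ac)
 also have "?g = ?a"
  by (simp flip: powr_add add: sum_nonneg)
 also have "... = (SUM m<=h. (?d m) powr (p/2))"
  by (intro sum.cong refl) (simp add: X_def powr_powr sum_nonneg flip: powr_half_sqrt)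
 finally show ?thesis .
qed

section \<open>Dyadic martingale square functions\<close>

text \<open>Conditional expectation onto the sequences constant on dyadic blocks of length
  \<open>2^k\<close>. Larger \<open>k\<close> is coarser, so in \<open>k\<close> this is a reversed
  martingale; \<open>block_const k\<close> is measurability at level \<open>k\<close>.\<close>

definition bavg :: "nat => (nat => real) => nat => real" where
 "bavg k f i = (SUM j<2^k. f (2^k * (i div 2^k) + j)) / 2^k"

definition block_const :: "nat => (nat => real) => bool" where
 "block_const k w \<longleftrightarrow> (ALL i j. i div 2^k = j div 2^k --> w i = w j)"

lemma block_const_avg: "block_const k (bavg k f)"
 by (simp add: block_const_def bavg_def)

lemma block_const_finer:
 assumes "block_const l w" "k <= l"
 shows "block_const k w"
proof -
 have "i div 2^l = j div 2^l" if "i div 2^k = j div 2^k" for i j :: nat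
 proof -
  have "(2::nat)^l = 2^k * 2^(l-k)" using assms by (simp flip: power_add)
  thus ?thesis using that by (simp add: div_mult2_eq)
 qed
 thus ?thesis using assms unfolding block_const_def by blast
qed

lemma block_const_combine:
 "block_const k u ==> block_const k v ==> block_const k (%i. F (u i) (v i))"
 unfolding block_const_def by metis

lemma block_const_comp: "block_const k u ==> block_const k (%i. F (u i))"
 unfolding block_const_def by metis

lemma block_const_sum: "(!!x. x : S ==> block_const k (u x)) ==> block_const k (%i. SUM x:S. u x i)"
 unfolding block_const_def by (intro allI impI sum.cong refl) blast

lemma sum_blocks:
 fixes g :: "nat => real"
 assumes "k <= H"
 shows "(SUM i<2^H. g i) = (SUM q<2^(H-k). SUM j<2^k. g (2^k * q + j))"
proof -
 have "(SUM i<2^H. g i) = (SUM i<2^(H-k) * 2^k. g i)" using assms by (simp flip: power_add)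
 also have "... = (SUM q<2^(H-k). sum g {q * 2^k..<q * 2^k + 2^k})" by (rule sum.nat_group[symmetric])
 also have "... = (SUM q<2^(H-k). SUM j<2^k. g (2^k * q + j))"
 proof (rule sum.cong[OF refl])
  fix q :: nat
  show "sum g {q * 2^k..<q * 2^k + 2^k} = (SUM j<2^k. g (2^k * q + j))"
   by (rule sum.reindex_bij_witness[of _ "%j. 2^k * q + j" "%i. i - 2^k * q"]) (auto simp: mult.commute[of q])
 qed
 finally show ?thesis .
qed

lemma sum_block_avg:
 assumes w: "block_const k w" and k: "k <= H"
 shows "(SUM i<2^H. w i * bavg k f i) = (SUM i<2^H. w i * f i)"
 unfolding sum_blocks[OF k]
proof (rule sum.cong[OF refl])
 fix q :: nat
 have dv: "(2^k * q + j) div 2^k = q" if "j < 2^k" for j :: nat using that by simp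
 have wc: "w (2^k * q + j) = w (2^k * q)" if "j < 2^k" for j
  using w dv[OF that] dv[of 0] unfolding block_const_def by auto
 let ?a = "SUM j<2^k. w (2^k * q + j) * bavg k f (2^k * q + j)"
 let ?b = "SUM j<2^k. w (2^k * q + j) * f (2^k * q + j)"
 have "?a = (SUM j<(2::nat)^k. w (2^k * q) * bavg k f (2^k * q))"
  using wc dv by (intro sum.cong refl) (simp add: bavg_def)
 also have "... = w (2^k * q) * (SUM j<2^k. f (2^k * q + j))" by (simp add: bavg_def)
 also have "... = ?b"
  unfolding sum_distrib_left using wc by (intro sum.cong) auto
 finally show "?a = ?b" .
qed

text \<open>Orthogonality of martingale differences under a weight from the coarser level: averaging
  replaces the cross term by the square of the coarser average. Both cases of the square function
  turn sums of squared differences into telescoping sums this way.\<close>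

lemma block_diff_orthogonal:
 assumes w: "block_const (Suc k) w" and k: "Suc k <= H"
 shows "(SUM i<2^H. w i * (bavg k f i - bavg (Suc k) f i)^2) =
  (SUM i<2^H. w i * ((bavg k f i)^2 - (bavg (Suc k) f i)^2))"
proof -
 let ?a = "%i. bavg (Suc k) f i"
 have c: "block_const (Suc k) (%i. w i * ?a i)"
  by (rule block_const_combine[OF w block_const_avg])
 have "(SUM i<2^H. (w i * ?a i) * bavg k f i) = (SUM i<2^H. (w i * ?a i) * f i)"
  by (rule sum_block_avg) (use block_const_finer[OF c, of k] k in auto)
 also have "... = (SUM i<2^H. (w i * ?a i) * ?a i)"
  by (rule sum_block_avg[symmetric]) (use c k in auto)
 finally have e: "(SUM i<2^H. w i * ?a i * bavg k f i) = (SUM i<2^H. w i * ?a i * ?a i)" .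
 have "(SUM i<2^H. w i * (bavg k f i - bavg (Suc k) f i)^2) =
  (SUM i<2^H. w i * ((bavg k f i)^2 - (bavg (Suc k) f i)^2))
   - 2 * (SUM i<2^H. w i * bavg (Suc k) f i * bavg k f i)
   + 2 * (SUM i<2^H. w i * bavg (Suc k) f i * bavg (Suc k) f i)"
  unfolding sum_distrib_left sum_subtractf[symmetric] sum.distrib[symmetric]
  by (intro sum.cong refl) (simp add: power2_eq_square algebra_simps)
 thus ?thesis using e by simp
qed

lemma block_avg_nonneg: "(!!l. 0 <= g l) ==> 0 <= bavg k g i"
 by (auto simp: bavg_def intro!: divide_nonneg_pos sum_nonneg)

text \<open>A block is one of the two halves of its parent, selected by \<open>r\<close>. This
  regularity makes the maximal functions of neighbouring levels comparable, which the case
  \<open>p <= 2\<close> needs.\<close>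

lemma block_avg_regular:
 assumes nn: "!!l. 0 <= g l"
 shows "bavg k g i <= 2 * bavg (Suc k) g i"
proof -
 define q r where "q = i div 2^k" and "r = q mod 2"
 let ?a = "i div 2^(Suc k)"
 have q: "q = 2 * ?a + r"
  unfolding r_def q_def by (simp add: power_Suc2 div_mult2_eq del: power_Suc)
 have r: "r < 2" by (simp add: r_def)
 have "(SUM j<2^k. g (2^k * q + j)) = (SUM j:{r * 2^k..<r * 2^k + 2^k}. g (2^(Suc k) * ?a + j))"
  by (rule sum.reindex_bij_witness[of _ "%j. j - r * 2^k" "%j. j + r * 2^k"]) (auto simp: q algebra_simps)
 also have "... <= (SUM j<2^(Suc k). g (2^(Suc k) * ?a + j))"
 proof (rule sum_mono2)
  have "r = 0 | r = 1" using r by auto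
  thus "{r * 2^k..<r * 2^k + 2^k} \<subseteq> {..<2 ^ Suc k}" by auto
 qed (use nn in auto)
 finally show ?thesis unfolding bavg_def q_def[symmetric] by (simp add: field_simps)
qed

lemma L2_set_sum_le: "L2_set (%n. SUM t:T. c t n) N <= (SUM t:T. L2_set (c t) N)"
proof (induction T rule: infinite_finite_induct)
 case (insert t T)
 have "L2_set (%n. c t n + (SUM t:T. c t n)) N <= L2_set (c t) N + L2_set (%n. SUM t:T. c t n) N"
  by (rule L2_set_triangle_ineq)
 thus ?case using insert by simp
qed (simp_all add: L2_set_def)

lemma block_avg_L2_le: "L2_set (%n. bavg k (f n) i) N <= bavg k (%l. L2_set (%n. f n l) N) i"
proof -
 have "L2_set (%n. bavg k (f n) i) N = L2_set (%n. inverse (2^k) * (SUM j<2^k. f n (2^k * (i div 2^k) + j))) N"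
  by (simp add: bavg_def field_simps)
 also have "... = inverse (2^k) * L2_set (%n. SUM j<2^k. f n (2^k * (i div 2^k) + j)) N"
  by (rule L2_set_right_distrib[symmetric]) simp
 also have "... <= inverse (2^k) * (SUM j<2^k. L2_set (%n. f n (2^k * (i div 2^k) + j)) N)"
  by (intro mult_left_mono L2_set_sum_le) simp
 finally show ?thesis by (simp add: bavg_def field_simps)
qed

text \<open>The block around \<open>i\<close> is covered by a window that starts at \<open>i\<close>
  and one that ends at \<open>i\<close>; the latter is a forward window of the reflected sequence.
  Neither is longer than \<open>2^k\<close>, which turns window averages back into block
  averages.\<close>

lemma block_avg_le_max:
 assumes nn: "!!l. 0 <= g l" and k: "k <= H" and i: "i < 2^H" and h: "h = 2^H - 1"
 shows "bavg k g i <= max_avg h g i + max_avg h (%l. g (h - l)) (h - i)"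
proof -
 define c where "c = 2^k * (i div 2^k)"
 have ci: "c <= i" "i < c + 2^k" unfolding c_def
  by (auto simp: algebra_simps) (metis add.commute dividend_less_times_div mult.commute zero_less_numeral zero_less_power)
 have "i div 2^k < 2^(H-k)" using i k
  by (metis div_less_iff_less_mult le_add_diff_inverse2 power_add zero_less_numeral zero_less_power)
 hence "c + 2^k <= 2^k * 2^(H-k)" unfolding c_def
  by (metis Suc_leI add.commute mult_Suc_right mult_le_mono2)
 also have "2^k * 2^(H-k) = (2::nat)^H" using k by (simp flip: power_add)
 finally have ch: "c + 2^k - 1 <= h" using h by simp
 have pos: "0 < (2::nat)^k" by simp
 let ?d = "SUM l=i..c+2^k-1. g l"
 let ?e = "max_avg h g i"
 have r: "?d <= 2^k * ?e"
 proof -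
  have "window_avg g i (c+2^k-1) <= ?e" using ci ch by (intro window_avg_le_max) auto
  moreover have "0 < c+2^k-1+1-i" using ci by auto
  hence "0 < real (c+2^k-1+1-i)" by (rule of_nat_0_less_iff[THEN iffD2])
  ultimately have "?d <= real (c+2^k-1+1-i) * ?e"
   unfolding window_avg_def by (metis mult.commute pos_divide_le_eq)
  also have "... <= 2^k * ?e"
   using ci max_avg_nonneg[of g i h] nn ch by (intro mult_right_mono) (auto simp: of_nat_diff)
  finally show ?thesis .
 qed
 let ?a = "max_avg h (%l. g (h - l)) (h - i)"
 let ?b = "h - c + 1 - (h - i)"
 let ?c = "SUM l=c..i. g l"
 have l: "?c <= 2^k * ?a"
 proof -
  have ih: "i <= h" using ci ch by auto
  have "window_avg (%l. g (h - l)) (h - i) (h - c) <= ?a" using ci ch by (intro window_avg_le_max) auto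
  moreover have "(SUM l=h-i..h-c. g (h-l)) = ?c"
   by (rule sum.reindex_bij_witness[of _ "%l. h - l" "%l. h - l"]) (use ci ih in auto)
  moreover have "0 < real ?b" using ci by auto
  ultimately have "?c <= real ?b * ?a"
   unfolding window_avg_def by (metis mult.commute pos_divide_le_eq)
  also have "... <= 2^k * ?a"
  proof (intro mult_right_mono max_avg_nonneg)
   have "?b <= 2^k" using ci ih by auto
   thus "real ?b <= 2^k" by (metis of_nat_le_iff of_nat_numeral of_nat_power)
  qed (use nn in auto)
  finally show ?thesis .
 qed
 let ?f = "SUM l:{c..<c+2^k}. g l"
 have "(SUM j<2^k. g (c + j)) = ?f"
  by (rule sum.reindex_bij_witness[of _ "%l. l - c" "%j. c + j"]) auto
 also have "{c..<c+2^k} \<subseteq> {c..i} \<union> {i..c+2^k-1}" by auto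
 hence "?f <= (SUM l:{c..i} \<union> {i..c+2^k-1}. g l)" using nn by (intro sum_mono2) auto
 also have "... <= ?c + ?d"
  using nn by (subst sum.union_inter[symmetric]) (auto intro!: sum_nonneg)
 finally have "(SUM j<2^k. g (c + j)) <= 2^k * (?e + ?a)"
  using r l by (simp add: distrib_left)
 thus ?thesis by (simp add: bavg_def c_def field_simps)
qed

lemma powr_add_le: "0 <= a ==> 0 <= b ==> 0 <= p ==> (a + b) powr p <= 2 powr p * (a powr p + b powr p)" for a b p :: real
proof -
 assume as: "0 <= a" "0 <= b" "0 <= p"
 have "(a + b) powr p <= (2 * max a b) powr p" using as by (intro powr_mono2) auto
 also have "... = 2 powr p * max a b powr p" using as by (simp add: powr_mult)
 also have "max a b powr p <= a powr p + b powr p" by (auto simp: max_def)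
 finally show ?thesis by simp
qed

definition block_max :: "nat => nat => (nat => real) => nat => real" where
 "block_max K k g i = Max ((%l. bavg l g i) ` {k..K})"

lemma block_max_Lp:
 assumes p: "1 < p" and nn: "!!l. 0 <= g l" and K: "K <= H"
 shows "(SUM i<2^H. block_max K 0 g i powr p) <= 2 powr (p + 1) * (p / (p - 1)) powr p * (SUM i<2^H. g i powr p)"
proof -
 define h :: nat where "h = 2^H - 1"
 have H: "2^H = Suc h" by (simp add: h_def)
 hence set: "{..<2^H} = {..h}" by (simp add: lessThan_Suc_atMost)
 define u v where "u i = max_avg h g i" and "v i = max_avg h (%l. g (h - l)) (h - i)" for i
 have uv: "0 <= u i" "0 <= v i" if "i <= h" for i unfolding u_def v_def using nn that by (auto intro!: max_avg_nonneg)
 let ?b = "%l. h - l"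
 let ?d = "SUM i<=h. g (h - i) powr p"
 let ?e = "SUM i<=h. u i powr p"
 let ?f = "SUM i<=h. v i powr p"
 let ?g = "SUM i<=h. g i powr p"
 have "(SUM i<=h. block_max K 0 g i powr p) <= (SUM i<=h. 2 powr p * (u i powr p + v i powr p))"
 proof (rule sum_mono)
  fix i assume i: "i : {..h}"
  have iH: "i < 2^H" using i H by simp
  let ?a = "block_max K 0 g i"
  let ?c = "2 powr p * (u i powr p + v i powr p)"
  have "bavg l g i <= u i + v i" if "l <= K" for l
   unfolding u_def v_def by (rule block_avg_le_max[OF nn _ iH h_def]) (use that K in simp)
  hence "?a <= u i + v i" unfolding block_max_def by (intro Max.boundedI) auto
  moreover have "bavg 0 g i <= ?a" unfolding block_max_def by (rule Max_ge) auto
  hence "0 <= ?a" using block_avg_nonneg[of g 0 i, OF nn] by linarith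
  ultimately have "?a powr p <= (u i + v i) powr p" using p by (intro powr_mono2) auto
  also have "... <= ?c" using uv i p by (intro powr_add_le) auto
  finally show "?a powr p <= ?c" .
 qed
 also have "... = 2 powr p * (?e + ?f)"
  by (simp add: sum_distrib_left sum.distrib distrib_left)
 also have "?f = (SUM i<=h. max_avg h (%l. g (h - l)) i powr p)"
  unfolding v_def by (rule sum.reindex_bij_witness[of _ "?b" "?b"]) auto
 also have "... <= (p / (p - 1)) powr p * ?d"
  by (rule max_avg_strong[OF p nn])
 also have "?d = ?g"
  by (rule sum.reindex_bij_witness[of _ "?b" "?b"]) auto
 also have "?e <= (p / (p - 1)) powr p * ?g"
  unfolding u_def by (rule max_avg_strong[OF p nn])
 finally show ?thesis unfolding set by (simp add: powr_add mult_ac)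
qed

text \<open>\<open>m k\<close> is the maximal function over the levels from \<open>k\<close> up,
  hence measurable at level \<open>k\<close>, and \<open>w k = m (Suc k)^(p-2)\<close> is an
  admissible weight for the difference \<open>D k\<close>. Either \<open>S <= (m 0)^2\<close> and
  \<open>S^(p/2) <= m 0^p\<close>, or, as \<open>p - 2 <= 0\<close>,
  \<open>S^(p/2) <= m 0^(p-2) * S\<close>, which is at most the weighted sum of the
  \<open>D k\<close>. Orthogonality and Abel summation bound the total of the latter by that of
  \<open>4 * m 0^p\<close>, whence 5.\<close>

lemma block_square_function_le2:
 fixes f :: "'n => nat => real"
 assumes p: "1 < p" "p <= 2" and KH: "K <= H" and fin: "finite N"
 defines "g \<equiv> %l. L2_set (%n. f n l) N"
 defines "S \<equiv> %i. SUM k<K. SUM n:N. (bavg k (f n) i - bavg (Suc k) (f n) i)\<^sup>2"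
 shows "(SUM i<2^H. S i powr (p/2)) <= 5 * (SUM i<2^H. block_max K 0 g i powr p)"
proof -
 define m where "m k = block_max K k g" for k
 define F where "F k i = (SUM n:N. (bavg k (f n) i)\<^sup>2)" for k i
 define D where "D k i = (SUM n:N. (bavg k (f n) i - bavg (Suc k) (f n) i)\<^sup>2)" for k i
 have g0: "0 <= g l" for l by (simp add: g_def)
 let ?d = "%k i. bavg k g i"
 have Fg: "sqrt (F k i) <= ?d k i" for k i
  using block_avg_L2_le[of k f i N] by (simp add: F_def g_def L2_set_def)
 have F0: "0 <= F k i" for k i by (simp add: F_def sum_nonneg)
 have D0: "0 <= D k i" for k i by (simp add: D_def sum_nonneg)
 have avg_le_m: "?d l i <= m k i" if "k <= l" "l <= K" for k l i
  using that by (auto simp: m_def block_max_def)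
 have m0: "0 <= m k i" if "k <= K" for k i using avg_le_m[of k K i] that block_avg_nonneg[of g K i] g0 by simp
 have Fm: "F k i <= (m k i)^2" if "k <= K" for k i
 proof -
  have "sqrt (F k i) <= m k i" using Fg[of k i] avg_le_m[of k k i] that by simp
  thus ?thesis using F0[of k i] m0[OF that, of i] real_sqrt_le_iff sqrt_le_D by blast
 qed
 have mdec: "m (Suc k) i <= m k i" if "k < K" for k i
  unfolding m_def block_max_def using that by (intro Max_mono) auto
 have mdec0: "m k i <= m 0 i" if "k <= K" for k i
  unfolding m_def block_max_def using that by (intro Max_mono) auto
 have mreg: "m k i <= 2 * m (Suc k) i" if "k < K" for k i
 proof -
  have "?d l i <= 2 * m (Suc k) i" if l: "k <= l" "l <= K" for l
  proof (cases "l = k")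
   case True
   thus ?thesis using block_avg_regular[of g k i] g0 avg_le_m[of "Suc k" "Suc k" i] \<open>k < K\<close> by simp
  next
   case False
   hence "?d l i <= m (Suc k) i" using l by (intro avg_le_m) auto
   thus ?thesis using m0[of "Suc k" i] \<open>k < K\<close> by simp
  qed
  thus ?thesis using that unfolding m_def[of k] block_max_def by (subst Max_le_iff) auto
 qed
 have mblk: "block_const k (m k)" for k
 proof -
  have "?d l i = ?d l j" if "i div 2^k = j div 2^k" "k <= l" for i j l
   using block_const_finer[OF block_const_avg that(2), of g] that unfolding block_const_def by blast
  thus ?thesis unfolding block_const_def m_def block_max_def by (metis (mono_tags, lifting) atLeastAtMost_iff image_cong)
 qed
 define w where "w k i = m (Suc k) i powr (p - 2)" for k i
 \<comment> \<open>Negative powers of \<open>m\<close> are only useful where it is positive. If the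
   coarsest average vanishes at \<open>i\<close>, regularity makes all finer averages vanish, and
   there is nothing to estimate.\<close>
 have pos_or: "(ALL k<=K. 0 < m k i) | (ALL k<K. D k i = 0)" if i: "i < 2^H" for i
 proof (cases "bavg K g i = 0")
  case False
  hence "0 < bavg K g i" using block_avg_nonneg[of g K i] g0 by simp
  thus ?thesis using avg_le_m[of _ K i] by (meson less_le_trans order_refl)
 next
  case True
  have *: "?d l i = 0" if "l <= K" for l
   using that
  proof (induction "K - l" arbitrary: l)
   case (Suc d)
   hence "bavg (Suc l) g i = 0" by (intro Suc(1)) auto
   thus ?case using block_avg_regular[of g l i] block_avg_nonneg[of g l i] g0 by simp
  qed (use True in auto)
  have "F l i = 0" if "l <= K" for l using Fg[of l i] *[OF that] F0[of l i] by simp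
  hence "bavg l (f n) i = 0" if "l <= K" "n : N" for l n
   using that fin unfolding F_def by (simp add: sum_nonneg_eq_0_iff)
  thus ?thesis by (simp add: D_def)
 qed
 let ?a = "%k i. F k i - F (Suc k) i"
 let ?b = "%i. (SUM k<K. w k i * (?a k i))"
 have key: "?b i <= 4 * m 0 i powr p" if i: "ALL k<=K. 0 < m k i" "0 < K" for i
 proof -
  have wF: "w k i * F k i <= 2 * m k i powr p" if "k < K" for k
  proof -
   have "w k i <= (m k i / 2) powr (p - 2)" unfolding w_def
    using mreg[OF that, of i] i that p by (intro powr_mono2') auto
   also have "... = m k i powr (p-2) * 2 powr (2 - p)" using i that
    by (simp add: powr_divide powr_diff field_simps)
   also have "... <= m k i powr (p-2) * 2 powr 1" using p by (intro mult_left_mono powr_mono) auto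
   finally have "w k i * F k i <= (m k i powr (p-2) * 2) * (m k i)^2" using Fm[of k i] F0 that
    by (intro mult_mono) auto
   also have "... = 2 * m k i powr p"
   proof -
    have "0 < m k i" using i that by simp
    thus ?thesis by (simp add: powr_diff powr_numeral)
   qed
   finally show ?thesis .
  qed
  let ?l = "%k. m (Suc (Suc k)) i"
  \<comment> \<open>One term of Abel summation. In terms of the ratio \<open>x = a / b\<close>,
    which regularity confines to \<open>[1, 2]\<close>, the claim is
    \<open>x^2 - x^p <= 2 * (x^p - 1)\<close>, and this follows from
    \<open>x <= x^p\<close>.\<close>
  have step: "(w (Suc k) i - w k i) * F (Suc k) i <= 2 * (m (Suc k) i powr p - ?l k powr p)" if "Suc k < K" for k
  proof -
   define a b where "a = m (Suc k) i" and "b = ?l k"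
   have ab: "0 < b" "b <= a" "a <= 2 * b" using i that mdec[of "Suc k" i] mreg[of "Suc k" i] by (auto simp: a_def b_def)
   define x where "x = a / b"
   have x: "1 <= x" "x <= 2" "a = x * b" using ab by (auto simp: x_def field_simps)
   have xp: "x <= x powr p" using powr_mono[of 1 p x] x p by simp
   let ?g = "2 * (x powr p - 1)"
   let ?i = "x * x - x powr p"
   have "?i <= x * x - x" using xp by simp
   also have "... = x * (x - 1)" by (simp add: algebra_simps)
   also have "... <= 2 * (x - 1)" using x by (intro mult_right_mono) auto
   also have "... <= ?g" using xp by simp
   finally have xx: "?i <= ?g" .
   let ?j = "b powr (p-2) - a powr (p-2)"
   have "?j * F (Suc k) i <= ?j * a^2"
    using Fm[of "Suc k" i] that ab p by (intro mult_left_mono) (auto simp: a_def intro: powr_mono2')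
   also have "... = b powr p * ?i"
    using ab x(1) unfolding x(3) by (simp add: powr_mult powr_diff power2_eq_square field_simps)
   also have "... <= b powr p * ?g" by (intro mult_left_mono xx) auto
   also have "... = 2 * (a powr p - b powr p)" using ab x(1) unfolding x(3) by (simp add: powr_mult algebra_simps)
   finally show ?thesis by (simp add: w_def a_def b_def)
  qed
  have "(SUM l=k..<K. w l i * (?a l i)) <= w k i * F k i + 2 * m (Suc k) i powr p" if "k < K" for k
   using that
  proof (induction "K - k" arbitrary: k)
   case (Suc d)
   show ?case
   proof (cases "Suc k = K")
    case True
    hence "{k..<K} = {k}" by auto
    moreover have "0 <= w k i * F (Suc k) i" by (simp add: w_def F0)
    ultimately show ?thesis by (simp add: algebra_simps)
   next
    case False
    hence sk: "Suc k < K" using Suc by auto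
    have "(SUM l=k..<K. w l i * (?a l i)) = w k i * (?a k i) + (SUM l=Suc k..<K. w l i * (?a l i))"
     using Suc by (simp add: sum.atLeast_Suc_lessThan)
    also have "... <= w k i * (?a k i) + (w (Suc k) i * F (Suc k) i + 2 * ?l k powr p)"
     using Suc(1)[of "Suc k"] Suc(2) sk by auto
    also have "... = w k i * F k i + (w (Suc k) i - w k i) * F (Suc k) i + 2 * ?l k powr p"
     by (simp add: algebra_simps)
    finally show ?thesis using step[OF sk] by simp
   qed
  qed auto
  from this[of 0] have "?b i <= w 0 i * F 0 i + 2 * m (Suc 0) i powr p"
   using i by (simp add: atLeast0LessThan)
  also have "... <= 2 * m 0 i powr p + 2 * m 0 i powr p"
   using i wF[of 0] mdec[of 0 i] p by (intro add_mono mult_left_mono powr_mono2) (auto simp: less_imp_le)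
  finally show ?thesis by simp
 qed
 let ?f = "SUM k<K. SUM i<2^H. w k i * D k i"
 have "(SUM i<2^H. S i powr (p/2)) <= (SUM i<2^H. m 0 i powr p + (SUM k<K. w k i * D k i))"
 proof (rule sum_mono)
  fix i :: nat assume i: "i : {..<2^H}"
  have SD: "S i = (SUM k<K. D k i)" by (simp add: S_def D_def)
  have S0: "0 <= S i" unfolding SD by (intro sum_nonneg D0)
  let ?c = "SUM k<K. w k i * D k i"
  have wD0: "0 <= ?c" by (intro sum_nonneg) (simp add: w_def D0)
  let ?e = "(m 0 i)^2"
  let ?m = "S i powr (p/2)"
  show "?m <= m 0 i powr p + ?c"
  proof (cases "S i <= ?e")
   case True
   hence "?m <= ?e powr (p/2)" using S0 p by (intro powr_mono2) auto
   also have "... = m 0 i powr p" using m0[of 0 i] by (simp add: powr_powr flip: powr_numeral)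
   finally show ?thesis using wD0 by simp
  next
   case False
   hence Spos: "0 < S i" by (smt (verit) zero_le_power2)
   hence mp: "ALL k<=K. 0 < m k i" using pos_or[of i] i SD by auto
   have e: "?e powr (p/2 - 1) = m 0 i powr (p - 2)"
    using mp m0[of 0 i] by (simp add: powr_powr diff_divide_distrib right_diff_distrib flip: powr_numeral)
   have "?m = S i powr (p/2 - 1) * S i" using Spos by (simp add: powr_diff)
   also have "... <= ?e powr (p/2 - 1) * S i"
    using False mp p Spos by (intro mult_right_mono powr_mono2') auto
   also have "... = (SUM k<K. m 0 i powr (p - 2) * D k i)" unfolding e SD by (rule sum_distrib_left)
   also have "... <= ?c" unfolding w_def
    using mp mdec0 p D0 by (intro sum_mono mult_right_mono powr_mono2') auto
   finally show ?thesis by (smt (verit) powr_ge_zero)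
  qed
 qed
 also have "... = (SUM i<2^H. m 0 i powr p) + ?f"
  by (simp add: sum.distrib) (rule sum.swap)
 also have "?f = (SUM k<K. SUM i<2^H. w k i * (?a k i))"
 proof (rule sum.cong[OF refl])
  fix k assume k: "k : {..<K}"
  have wb: "block_const (Suc k) (w k)" unfolding w_def by (rule block_const_comp[OF mblk])
  let ?h = "SUM i<2^H. w k i * (?a k i)"
  let ?k = "SUM i<2^H. w k i * D k i"
  have "?k = (SUM n:N. SUM i<2^H. w k i * (bavg k (f n) i - bavg (Suc k) (f n) i)^2)"
   unfolding D_def sum_distrib_left by (rule sum.swap)
  also have "... = (SUM n:N. SUM i<2^H. w k i * ((bavg k (f n) i)^2 - (bavg (Suc k) (f n) i)^2))"
   using k KH by (intro sum.cong refl block_diff_orthogonal wb) auto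
  also have "... = ?h"
   unfolding F_def sum_subtractf[symmetric] sum_distrib_left by (rule sum.swap)
  finally show "?k = ?h" .
 qed
 also have "... = (SUM i<2^H. SUM k<K. w k i * (?a k i))" by (rule sum.swap)
 also have "... <= (SUM i<2^H. 4 * m 0 i powr p)"
 proof (rule sum_mono)
  fix i :: nat assume i: "i : {..<2^H}"
  show "?b i <= 4 * m 0 i powr p"
  proof (cases "0 < K & (ALL k<=K. 0 < m k i)")
   case True thus ?thesis by (intro key) auto
  next
   case False
   have "EX k<=K. m k i = 0" if "0 < K" using False that m0 by (metis order_le_less)
   have "w k i * (?a k i) = 0" if k: "k < K" for k
   proof -
    obtain l where l: "l <= K" "m l i = 0" using False k m0 by (metis gr_implies_not0 neq0_conv order_le_less)
    have "bavg K g i = 0" using avg_le_m[of l K i] l block_avg_nonneg[of g K i] g0 by simp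
    have *: "?d l i = 0" if "l <= K" for l
     using that
    proof (induction "K - l" arbitrary: l)
     case (Suc d)
     hence "bavg (Suc l) g i = 0" by (intro Suc(1)) auto
     thus ?case using block_avg_regular[of g l i] block_avg_nonneg[of g l i] g0 by simp
    qed (use \<open>bavg K g i = 0\<close> in auto)
    have "F l i = 0" if "l <= K" for l using Fg[of l i] *[OF that] F0[of l i] by simp
    thus ?thesis using k by simp
   qed
   hence "?b i = 0" by (intro sum.neutral) auto
   thus ?thesis by simp
  qed
 qed
 finally show ?thesis by (simp add: m_def flip: sum_distrib_left)
qed

lemma powr_diff_le:
 fixes x y r :: real
 assumes "0 <= y" "y <= x" "1 <= r"
 shows "x powr r - y powr r <= r * x powr (r - 1) * (x - y)"
proof (cases "r = 1")
 case True
 thus ?thesis using assms by (cases "x = 0") auto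
next
 case False
 define q where "q = r / (r - 1)"
 have pq: "1 < q" "1 < r" "1/q + 1/r = 1" "(r - 1) * q = r" using False assms by (auto simp: q_def field_simps)
 let ?a = "x powr (r - 1) * y"
 have "?a <= (x powr (r - 1)) powr q / q + y powr r / r"
  by (rule Youngs_inequality[OF pq(1-3)]) (use assms in auto)
 also have "(x powr (r - 1)) powr q = x powr r" by (simp add: powr_powr pq)
 finally have "r * ?a <= r * (x powr r / q + y powr r / r)" using pq by (intro mult_left_mono) auto
 also have "... = (r - 1) * x powr r + y powr r" using pq by (simp add: q_def field_simps)
 finally have "r * ?a <= (r - 1) * x powr r + y powr r" .
 moreover have "x powr (r - 1) * x = x powr r" using powr_mult_base[of x "r - 1"] assms by (simp add: mult_ac)
 ultimately show ?thesis by (simp add: algebra_simps)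
qed

text \<open>With \<open>r = p/2 > 1\<close>, the tail sums \<open>A k\<close> over the levels from
  \<open>k\<close> up bound \<open>S^r\<close> by \<open>r\<close> times the sum of
  \<open>A k^(r-1) * D k\<close>. The powers are split into increments \<open>c l\<close>,
  measurable at level \<open>l\<close>. Against such a weight the differences below level
  \<open>l\<close> telescope to \<open>F 0 - F l\<close>, at most \<open>m^2\<close>, and the
  boundary term \<open>D l\<close> costs \<open>4 * m^2\<close> more. Hoelder for
  \<open>m^2 * S^(r-1)\<close> and absorption finish.\<close>

lemma block_square_function_gt2:
 fixes f :: "'n => nat => real"
 assumes p: "2 < p" and KH: "K <= H" and fin: "finite N"
 defines "g \<equiv> %l. L2_set (%n. f n l) N"
 defines "S \<equiv> %i. SUM k<K. SUM n:N. (bavg k (f n) i - bavg (Suc k) (f n) i)\<^sup>2"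
 shows "(SUM i<2^H. S i powr (p/2)) <= (5 * (p/2)) powr (p/2) * (SUM i<2^H. block_max K 0 g i powr p)"
proof -
 define r where "r = p / 2"
 have r: "1 < r" using p by (simp add: r_def)
 define m where "m = block_max K 0 g"
 define F where "F k i = (SUM n:N. (bavg k (f n) i)\<^sup>2)" for k i
 let ?i = "%k n i. bavg (Suc k) (f n) i"
 define D where "D k i = (SUM n:N. (bavg k (f n) i - ?i k n i)\<^sup>2)" for k i
 define A where "A k i = (SUM l:{k..<K}. D l i)" for k i
 define c where "c k i = A k i powr (r - 1) - A (Suc k) i powr (r - 1)" for k i
 have g0: "0 <= g l" for l by (simp add: g_def)
 have Fg: "sqrt (F k i) <= bavg k g i" for k i
  using block_avg_L2_le[of k f i N] by (simp add: F_def g_def L2_set_def)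
 have F0: "0 <= F k i" for k i by (simp add: F_def sum_nonneg)
 have D0: "0 <= D k i" for k i by (simp add: D_def sum_nonneg)
 have A0: "0 <= A k i" for k i by (simp add: A_def sum_nonneg D0)
 have AS: "A k i = D k i + A (Suc k) i" if "k < K" for k i
  using that by (simp add: A_def sum.atLeast_Suc_lessThan)
 have AK: "A K i = 0" for i by (simp add: A_def)
 have SA: "S i = A 0 i" for i by (simp add: S_def A_def D_def atLeast0LessThan)
 have avg_le_m: "bavg l g i <= m i" if "l <= K" for l i
  using that by (auto simp: m_def block_max_def)
 have m0: "0 <= m i" for i using avg_le_m[of 0 i] block_avg_nonneg[of g 0 i, OF g0] by simp
 have Fm: "F k i <= (m i)^2" if "k <= K" for k i
 proof -
  have "sqrt (F k i) <= m i" using Fg[of k i] avg_le_m[of k i] that by simp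
  thus ?thesis using F0[of k i] m0[of i] real_sqrt_le_iff sqrt_le_D by blast
 qed
 have Dm: "D k i <= 4 * (m i)^2" if "k < K" for k i
 proof -
  have "D k i <= (SUM n:N. 2 * (bavg k (f n) i)^2 + 2 * (?i k n i)^2)"
   unfolding D_def by (intro sum_mono) (smt (verit) sum_squares_bound power2_diff zero_le_power2 power2_sum)
  also have "... = 2 * F k i + 2 * F (Suc k) i" by (simp add: F_def sum.distrib sum_distrib_left)
  finally show ?thesis using Fm[of k i] Fm[of "Suc k" i] that by simp
 qed
 have Dblk: "block_const l (D l)" for l unfolding D_def
  by (intro block_const_sum block_const_combine[where F="%a b. (a - b)\<^sup>2"] block_const_avg)
   (rule block_const_finer[OF block_const_avg], simp)
 have Ablk: "block_const k (A k)" for k unfolding A_def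
  by (intro block_const_sum block_const_finer[OF Dblk]) auto
 have cblk: "block_const k (c k)" for k unfolding c_def
  by (rule block_const_combine[OF Ablk block_const_finer[OF Ablk]]) simp
 have c0: "0 <= c k i" if "k < K" for k i
  unfolding c_def using AS[OF that, of i] D0[of k i] A0[of "Suc k" i] r by (simp add: powr_mono2)
 have csum: "(SUM l:{k..<K}. c l i) = A k i powr (r - 1)" if "k <= K" for k i
  unfolding c_def using sum_Suc_diff'[OF that, of "%l. A l i powr (r-1)"] r AK[of i]
  by (simp add: sum_subtractf algebra_simps)
 let ?g = "%i. 5 * (m i)^2"
 let ?k = "%l. (SUM i<2^H. c l i * (SUM k<=l. D k i))"
 have cD: "?k l <= (SUM i<2^H. c l i * (?g i))" if l: "l < K" for l
 proof -
  have "(SUM i<2^H. c l i * (SUM k<l. D k i)) = (SUM k<l. SUM n:N. SUM i<2^H. c l i * (bavg k (f n) i - ?i k n i)^2)"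
   unfolding D_def sum_distrib_left by (subst sum.swap, rule sum.cong[OF refl], rule sum.swap)
  also have "... = (SUM k<l. SUM n:N. SUM i<2^H. c l i * ((bavg k (f n) i)^2 - (?i k n i)^2))"
   using l KH by (intro sum.cong refl block_diff_orthogonal block_const_finer[OF cblk]) auto
  also have "... = (SUM i<2^H. c l i * (SUM k<l. F k i - F (Suc k) i))"
   unfolding F_def sum_distrib_left sum_subtractf[symmetric] by (subst (2) sum.swap, rule sum.cong[OF refl], rule sum.swap)
  also have "... = (SUM i<2^H. c l i * (F 0 i - F l i))"
   using sum_lessThan_telescope'[of "%k. F k _" l] by simp
  finally have "?k l = (SUM i<2^H. c l i * (F 0 i - F l i + D l i))"
   by (simp add: lessThan_Suc_atMost[symmetric] distrib_left sum.distrib)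
  also have "... <= (SUM i<2^H. c l i * (?g i))"
  proof (intro sum_mono mult_left_mono c0 l)
   fix i show "F 0 i - F l i + D l i <= ?g i" using Fm[of 0 i] F0[of l i] Dm[OF l, of i] by simp
  qed
  finally show ?thesis .
 qed
 let ?a = "SUM i<2^H. S i powr r"
 let ?b = "SUM i<2^H. (m i)\<^sup>2 * S i powr (r - 1)"
 let ?d = "SUM i<2^H. SUM k<K. SUM l:{k..<K}. c l i * D k i"
 have "?a <= (SUM i<2^H. SUM k<K. r * (A k i powr (r - 1) * D k i))"
 proof (rule sum_mono)
  fix i :: nat
  let ?e = "SUM k<K. r * (A k i powr (r - 1) * D k i)"
  have "S i powr r = (SUM k<K. A k i powr r - A (Suc k) i powr r)"
   using AK[of i] r sum_lessThan_telescope'[of "%k. A k i powr r" K] by (simp add: SA)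
  also have "... <= ?e"
  proof (rule sum_mono)
   fix k assume k: "k : {..<K}"
   show "A k i powr r - A (Suc k) i powr r <= r * (A k i powr (r - 1) * D k i)"
    using powr_diff_le[of "A (Suc k) i" "A k i" r] AS[of k i] k A0 D0[of k i] r by (simp add: mult_ac)
  qed
  finally show "S i powr r <= ?e" .
 qed
 also have "... = r * ?d"
  unfolding sum_distrib_left by (intro sum.cong refl) (simp add: csum flip: sum_distrib_right sum_distrib_left)
 also have "?d = (SUM i<2^H. SUM l<K. SUM k<=l. c l i * D k i)"
 proof (rule sum.cong[OF refl])
  fix i :: nat
  show "(SUM k<K. SUM l:{k..<K}. c l i * D k i) = (SUM l<K. SUM k<=l. c l i * D k i)"
   unfolding sum.Sigma[OF finite_lessThan ballI[OF finite_atLeastLessThan]] sum.Sigma[OF finite_lessThan ballI[OF finite_atMost]]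
   by (rule sum.reindex_bij_witness[of _ "%(a,b). (b,a)" "%(a,b). (b,a)"]) auto
 qed
 also have "... = (SUM l<K. SUM i<2^H. c l i * (SUM k<=l. D k i))"
  unfolding sum_distrib_left by (rule sum.swap)
 also have "... <= (SUM l<K. SUM i<2^H. c l i * (?g i))" by (intro sum_mono cD) auto
 also have "... = (SUM i<2^H. SUM l<K. c l i * (?g i))" by (rule sum.swap)
 also have "... = (SUM i<2^H. 5 * ((m i)^2 * S i powr (r - 1)))"
  using csum[of 0] by (intro sum.cong refl) (simp add: SA atLeast0LessThan flip: sum_distrib_right)
 finally have 1: "?a <= 5 * r * ?b"
  using r by (simp add: sum_distrib_left mult_ac)
 define q where "q = r / (r - 1)"
 have pq: "1 < r" "1 < q" "1/r + 1/q = 1" "(r - 1) * q = r" using r by (auto simp: q_def field_simps)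
 have S0: "0 <= S i" for i by (simp add: SA A0)
 let ?c = "SUM i<2^H. m i powr p"
 let ?f = "SUM i<2^H. (S i powr (r - 1)) powr q"
 let ?h = "SUM i<2^H. (m i)\<^sup>2 powr r"
 let ?j = "?c powr (1/r) * ?a powr (1/q)"
 have "?b <= ?h powr (1/r) * ?f powr (1/q)"
  by (rule Holder_sum[OF pq(1-3)]) auto
 also have "?f = ?a" by (simp add: powr_powr pq)
 also have "?h = ?c"
  using m0 by (intro sum.cong refl) (simp add: r_def powr_powr flip: powr_numeral)
 finally have 2: "?b <= ?j" .
 have "?a <= (5 * r) * ?j"
  using 1 mult_left_mono[OF 2, of "5 * r"] r by linarith
 hence "?a <= (5 * r) powr r * ?c"
  using r by (intro powr_absorb[OF pq(1-3)]) (auto intro: sum_nonneg)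
 thus ?thesis by (simp add: r_def m_def)
qed

lemma block_square_function:
 assumes p: "1 < (p::real)"
 shows "EX C>=0. ALL K H N. ALL f :: 'n => nat => real. K <= H --> finite N -->
  (SUM i<2^H. (SUM k<K. SUM n:N. (bavg k (f n) i - bavg (Suc k) (f n) i)\<^sup>2) powr (p/2))
   <= C * (SUM i<2^H. (SUM n:N. (f n i)\<^sup>2) powr (p/2))"
proof -
 define c where "c = max 5 ((5 * (p/2)) powr (p/2))"
 define C where "C = c * (2 powr (p + 1) * (p / (p - 1)) powr p)"
 have C0: "0 <= C" "0 <= c" by (auto simp: C_def c_def)
 have "(SUM i<2^H. (SUM k<K. SUM n:N. (bavg k (f n) i - bavg (Suc k) (f n) i)\<^sup>2) powr (p/2))
   <= C * (SUM i<2^H. (SUM n:N. (f n i)\<^sup>2) powr (p/2))" if KH: "K <= H" and N: "finite N"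
  for K H :: nat and N :: "'n set" and f :: "'n => nat => real"
 proof -
  define g where "g l = L2_set (%n. f n l) N" for l
  let ?a = "SUM i<2^H. block_max K 0 g i powr p"
  have m: "0 <= ?a" by (intro sum_nonneg) auto
  have "(SUM i<2^H. (SUM k<K. SUM n:N. (bavg k (f n) i - bavg (Suc k) (f n) i)\<^sup>2) powr (p/2))
   <= c * (SUM i<2^H. block_max K 0 g i powr p)"
  proof (cases "p <= 2")
   case True
   have "5 * ?a <= c * ?a"
    by (intro mult_right_mono m) (simp add: c_def)
   thus ?thesis using block_square_function_le2[OF p True KH N, of f] unfolding g_def by linarith
  next
   case False
   have "(5 * (p/2)) powr (p/2) * ?a <= c * ?a"
    by (intro mult_right_mono m) (simp add: c_def)
   thus ?thesis using block_square_function_gt2[OF _ KH N, of p f] False unfolding g_def by linarith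
  qed
  also have "... <= c * (2 powr (p + 1) * (p / (p - 1)) powr p * (SUM i<2^H. g i powr p))"
   by (intro mult_left_mono block_max_Lp p KH) (auto simp: g_def C0)
  also have "(SUM i<2^H. g i powr p) = (SUM i<2^H. (SUM n:N. (f n i)\<^sup>2) powr (p/2))"
   by (intro sum.cong refl) (simp add: g_def L2_set_def powr_powr sum_nonneg flip: powr_half_sqrt)
  finally show ?thesis by (simp add: C_def mult_ac)
 qed
 thus ?thesis using C0 by blast
qed

lemma powr_mean:
 fixes u x :: "'a => real"
 assumes p: "1 < p" and fin: "finite S" and u: "!!s. s : S ==> 0 <= u s" "(SUM s:S. u s) <= 1"
  and x: "!!s. s : S ==> 0 <= x s"
 shows "(SUM s:S. u s * x s) powr p <= (SUM s:S. u s * x s powr p)"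
proof -
 define q where "q = p / (p - 1)"
 have pq: "1 < p" "1 < q" "1/p + 1/q = 1" using p by (auto simp: q_def field_simps)
 let ?a = "SUM s:S. u s * x s powr p"
 have R0: "0 <= ?a" using u by (intro sum_nonneg) auto
 let ?b = "SUM s:S. u s * x s"
 let ?c = "SUM s:S. (u s powr (1/p) * x s) powr p"
 let ?d = "SUM s:S. (u s powr (1/q)) powr q"
 have "?b = (SUM s:S. (u s powr (1/p) * x s) * u s powr (1/q))"
 proof (intro sum.cong refl)
  fix s assume s: "s : S"
  have "u s powr (1/p) * u s powr (1/q) = u s" using pq u(1)[OF s] by (cases "u s = 0") (simp_all flip: powr_add)
  thus "u s * x s = (u s powr (1/p) * x s) * u s powr (1/q)" by (simp add: mult_ac)
 qed
 also have "... <= ?c powr (1/p) * ?d powr (1/q)"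
  by (rule Holder_sum[OF pq fin]) (use u x in auto)
 also have "?d = (SUM s:S. u s)"
  using pq u by (intro sum.cong refl) (simp add: powr_powr)
 also have "?c = ?a"
  using pq u x by (intro sum.cong refl) (simp add: powr_mult powr_powr)
 also have "(SUM s:S. u s) powr (1/q) <= 1 powr (1/q)"
  using u pq by (intro powr_mono2 sum_nonneg) auto
 finally have "?b <= ?a powr (1/p)"
  by (simp add: mult_left_mono)
 hence "?b powr p <= (?a powr (1/p)) powr p"
  using u x p by (intro powr_mono2 sum_nonneg) auto
 thus ?thesis using p R0 by (simp add: powr_powr)
qed

section \<open>Littlewood-Paley polynomials in the shift\<close>

text \<open>The polynomial \<open>P\<close> evaluated at the left shift and applied to
  \<open>a\<close>; the lemmas up to \<open>pconv_sum\<close> make this a representation of the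
  polynomial ring.\<close>

definition pconv :: "real poly => (nat => real) => nat => real" where
 "pconv P = conv (Suc (degree P)) (coeff P)"

lemma conv_ext: "(!!j. J <= j ==> w j = 0) ==> J <= J' ==> conv J' w a m = conv J w a m"
 unfolding conv_def by (rule sum.mono_neutral_right) auto

lemma pconv_eq: "degree P < J ==> pconv P a m = conv J (coeff P) a m"
 unfolding pconv_def by (rule conv_ext[symmetric]) (auto intro: coeff_eq_0)

lemma pconv_add: "pconv (P + Q) a m = pconv P a m + pconv Q a m"
proof -
 define J where "J = Suc (max (degree (P+Q)) (max (degree P) (degree Q)))"
 show ?thesis by (subst (1 2 3) pconv_eq[where J=J]) (auto simp: J_def conv_def sum.distrib algebra_simps)
qed

lemma pconv_smult: "pconv (smult c P) a m = c * pconv P a m"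
 by (subst (1 2) pconv_eq[where J="Suc (degree P)"]) (auto simp: conv_def sum_distrib_left distrib_left mult_ac le_imp_less_Suc degree_smult_le)

lemma pconv_diff: "pconv (P - Q) a m = pconv P a m - pconv Q a m"
 using pconv_add[of P "smult (-1) Q"] pconv_smult[of "-1" Q] by simp

lemma pconv_pCons: "pconv (pCons c P) a m = c * a m + pconv P a (Suc m)"
proof -
 have "pconv (pCons c P) a m = conv (Suc (Suc (degree P))) (coeff (pCons c P)) a m"
  by (rule pconv_eq) (simp add: degree_pCons_le le_imp_less_Suc)
 thus ?thesis by (simp add: conv_def pconv_def sum.lessThan_Suc_shift del: sum.lessThan_Suc)
qed

lemma pconv_0: "pconv 0 a m = 0" by (simp add: pconv_def conv_def)

lemma pconv_mult: "pconv (P * Q) a m = pconv P (pconv Q a) m"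
proof (induction P arbitrary: m)
 case (pCons c P)
 have "pconv (pCons c P * Q) a m = pconv (smult c Q) a m + pconv (pCons 0 (P * Q)) a m"
  by (simp add: pconv_add)
 also have "... = c * pconv Q a m + pconv (P * Q) a (Suc m)"
  by (simp add: pconv_smult pconv_pCons)
 finally show ?case using pCons by (simp add: pconv_pCons)
qed (simp add: pconv_0)

lemma pconv_monom: "pconv (monom c n) a m = c * a (m + n)"
 by (induction n arbitrary: m) (simp_all add: monom_0 monom_Suc pconv_pCons pconv_0)

lemma pconv_sum: "finite S ==> pconv (SUM s:S. P s) a m = (SUM s:S. pconv (P s) a m)"
 by (induction S rule: finite_induct) (simp_all add: pconv_0 pconv_add)

definition avg_poly :: "nat => real poly" where
 "avg_poly n = (SUM j<n. monom (1 / real n) j)"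

lemma pconv_avg_poly: "pconv (avg_poly n) a m = (SUM j<n. a (m + j)) / real n"
 by (simp add: avg_poly_def pconv_sum pconv_monom sum_divide_distrib)

text \<open>\<open>avg_poly n\<close> squared is a triangular kernel, that is, a dyadic conditional
  expectation averaged over translations; the factor \<open>z^n\<close> centers the smaller triangle
  in the larger. The bracket is thus an averaged martingale difference, but read off at a place that
  depends on \<open>k\<close>. The leading factor \<open>avg_poly n\<close> smears it over a window,
  so that a maximal estimate can move it back to a common place.\<close>

definition lp_poly :: "nat => real poly" where
 "lp_poly k = avg_poly (2^k) * ((avg_poly (2^Suc k))^2 - monom 1 (2^k) * (avg_poly (2^k))^2)"

lemma pconv_avg_poly_sq:
 "pconv ((avg_poly n)^2) a m = (SUM j<n. SUM t<n. a (m + j + t)) / (real n)^2"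
 by (simp add: power2_eq_square pconv_mult pconv_avg_poly[abs_def] sum_divide_distrib)

lemma sum_mod_shift:
 fixes G :: "nat => real"
 assumes n: "0 < n"
 shows "(SUM s<n * M. G ((i + s) mod n)) = real M * (SUM t<n. G t)"
proof -
 have 1: "(SUM s<n. G ((i + s) mod n)) = (SUM t<n. G t)" for i
 proof (induction i)
  case (Suc i)
  have "(SUM s<Suc n. G ((i + s) mod n)) = G (i mod n) + (SUM s<n. G ((Suc i + s) mod n))"
   by (subst sum.lessThan_Suc_shift) simp
  thus ?case using Suc by simp
 qed simp
 have "(SUM s<M * n. G ((i + s) mod n)) = (SUM q<M. SUM s:{q*n..<q*n+n}. G ((i + s) mod n))"
  by (rule sum.nat_group[symmetric])
 also have "... = (SUM q<M. SUM s<n. G ((i + q * n + s) mod n))"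
 proof (rule sum.cong[OF refl])
  fix q
  show "(SUM s:{q*n..<q*n+n}. G ((i + s) mod n)) = (SUM s<n. G ((i + q * n + s) mod n))"
   by (rule sum.reindex_bij_witness[of _ "%s. q * n + s" "%s. s - q * n"]) (auto simp: add_ac)
 qed
 finally show ?thesis by (simp only: 1) (simp add: mult.commute)
qed

definition shift_seq :: "nat => (nat => real) => nat => real" where
 "shift_seq s a i = (if s <= i then a (i - s) else 0)"

text \<open>Averaging the dyadic conditional expectations over all translations gives convolution with a triangle.\<close>

lemma shift_average:
 assumes k: "k <= L" and i: "2^k <= Suc i"
 shows "(SUM s<2^L. bavg k (shift_seq s a) (i + s)) / 2^L = (SUM j<2^k. SUM t<2^k. a (i - t + j)) / (2^k)^2"
proof -
 define n :: nat where "n = 2^k"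
 have n: "0 < n" by (simp add: n_def)
 define G where "G t = (SUM j<n. a (i - t + j)) / n" for t
 let ?a = "SUM t<n. G t"
 have "bavg k (shift_seq s a) (i + s) = G ((i + s) mod n)" for s
 proof -
  have t: "(i + s) mod n <= i" using i n mod_less_divisor[OF n, of "i + s"] unfolding n_def[symmetric] by linarith
  have "n * ((i + s) div n) = i + s - (i + s) mod n" by (metis minus_mod_eq_mult_div)
  hence "n * ((i + s) div n) = s + (i - (i + s) mod n)" using t by simp
  thus ?thesis unfolding bavg_def n_def[symmetric] G_def
   by (simp add: shift_seq_def n_def)
 qed
 moreover have "(2::nat)^L = n * 2^(L-k)" using k by (simp add: n_def flip: power_add)
 ultimately have "(SUM s<2^L. bavg k (shift_seq s a) (i + s)) = 2^(L-k) * ?a"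
  using sum_mod_shift[OF n, of G i "2^(L-k)"] by simp
 also have "... / 2^L = ?a / 2^k"
  using k by (simp add: power_diff)
 also have "?a = (SUM j<n. SUM t<n. a (i - t + j)) / n"
  unfolding G_def by (subst sum.swap) (simp add: sum_divide_distrib)
 finally show ?thesis by (simp add: n_def power2_eq_square)
qed

lemma triangle_reindex: "(SUM j<n. SUM t<n. a (c + (n - 1) - t + j)) = (SUM j<n. SUM t<n. a (c + j + t))" for a :: "nat => real"
proof (rule sum.cong[OF refl])
 fix j
 show "(SUM t<n. a (c + (n - 1) - t + j)) = (SUM t<n. a (c + j + t))"
  by (rule sum.reindex_bij_witness[of _ "%t. n - 1 - t" "%t. n - 1 - t"]) (auto intro!: arg_cong[of _ _ a])
qed

lemma pconv_lp_poly:
 fixes a :: "nat => real"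
 assumes k: "Suc k <= L"
 defines "n \<equiv> (2::nat)^k"
 defines "b \<equiv> %i. (SUM s<2^L. bavg (Suc k) (shift_seq s a) (i + s) - bavg k (shift_seq s a) (i + s)) / 2^L"
 shows "pconv (lp_poly k) a m = (SUM s<n. b (m + s + (2 * n - 1))) / real n"
proof -
 have n: "0 < n" by (simp add: n_def)
 let ?a = "(avg_poly (2^Suc k))^2 - monom 1 n * (avg_poly n)^2"
 have "pconv ?a a i = b (i + (2 * n - 1))" for i
 proof -
  let ?b = "SUM j<2^k. SUM t<2^k. a (i + n + (n - 1) - t + j)"
  have "b (i + (2*n-1)) = (SUM j<2^Suc k. SUM t<2^Suc k. a (i + (2*n-1) - t + j)) / (2^Suc k)^2
    - (SUM j<2^k. SUM t<2^k. a (i + (2*n-1) - t + j)) / (2^k)^2"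
   unfolding b_def sum_subtractf diff_divide_distrib
   by (subst (1 2) shift_average) (use k n in "auto simp: n_def")
  also have "(SUM j<2^Suc k. SUM t<2^Suc k. a (i + (2*n-1) - t + j)) = (SUM j<2^Suc k. SUM t<2^Suc k. a (i + j + t))"
   using triangle_reindex[of a i "2^Suc k"] by (simp add: n_def)
  also have "(SUM j<2^k. SUM t<2^k. a (i + (2*n-1) - t + j)) = ?b"
   using n by (simp add: mult_2 add.assoc)
  also have "?b = (SUM j<n. SUM t<n. a (i + n + j + t))"
   using triangle_reindex[of a "i + n" n] by (simp add: n_def)
  finally have "b (i + (2*n-1)) = pconv ?a a i"
   by (simp add: pconv_diff pconv_mult pconv_monom pconv_avg_poly_sq n_def)
  thus ?thesis ..
 qed
 thus ?thesis unfolding lp_poly_def n_def[symmetric] by (simp add: pconv_mult pconv_avg_poly)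
qed

lemma L2_powr: "(L2_set f N) powr p = (SUM n:N. (f n)\<^sup>2) powr (p/2)"
 by (simp add: L2_set_def powr_powr sum_nonneg flip: powr_half_sqrt)

lemma lp_square_function:
 assumes p: "1 < (p::real)"
 shows "EX C>=0. ALL K h N. ALL a :: 'n => nat => real. finite N --> (ALL n l. h < l --> a n l = 0) -->
  (SUM m<=h. (SUM k<K. SUM n:N. (pconv (lp_poly k) (a n) m)\<^sup>2) powr (p/2))
   <= C * (SUM m<=h. (SUM n:N. (a n m)\<^sup>2) powr (p/2))"
proof -
 obtain C where C0: "0 <= C" and C: "!!K H N. !!f :: 'n => nat => real. K <= H ==> finite N ==>
  (SUM i<2^H. (SUM k<K. SUM n:N. (bavg k (f n) i - bavg (Suc k) (f n) i)\<^sup>2) powr (p/2))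
   <= C * (SUM i<2^H. (SUM n:N. (f n i)\<^sup>2) powr (p/2))"
  using block_square_function[OF p, where 'n='n] by blast
 define C2 where "C2 = (p * (p / (p - 1))) powr (p/2)"
 define C' where "C' = 9 powr (p/2) * (C2 * C)"
 have "(SUM m<=h. (SUM k<K. SUM n:N. (pconv (lp_poly k) (a n) m)\<^sup>2) powr (p/2))
   <= C' * (SUM m<=h. (SUM n:N. (a n m)\<^sup>2) powr (p/2))"
  if N: "finite N" and az: "!!n l. h < l ==> a n l = 0" for K h and N :: "'n set" and a :: "'n => nat => real"
 proof -
  \<comment> \<open>Translations run over \<open>2^L\<close>, a common multiple of all block
    lengths, large enough for \<open>h\<close> and for the window \<open>3 * 2^K\<close>. Two more
    levels in \<open>H\<close> leave room for all translated indices up to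
    \<open>h' + s\<close>.\<close>
  define L where "L = h + K + 2"
  have hL: "h < 2^L" unfolding L_def using less_exp[of "h + K + 2"] by linarith
  define H where "H = L + 2"
  define h' :: nat where "h' = 2 * 2^L - 1"
  have hh': "h <= h'" using hL by (simp add: h'_def)
  define d where "d s k n i = bavg k (shift_seq s (a n)) i - bavg (Suc k) (shift_seq s (a n)) i" for s k n i
  define b where "b k n i = (SUM s<2^L. bavg (Suc k) (shift_seq s (a n)) (i + s) - bavg k (shift_seq s (a n)) (i + s)) / 2^L" for k n i
  define S where "S = {..<K} \<times> N"
  have finS: "finite S" using N by (simp add: S_def)
  define B where "B x i = (if i <= h' then \<bar>b (fst x) (snd x) i\<bar> else 0)" for x i
  \<comment> \<open>With \<open>e = 2^k\<close>, the window of \<open>pconv_lp_poly\<close> is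
    \<open>2 * e - 1 ..< 3 * e - 1\<close>. The uniform kernel on \<open>{..<3 * e}\<close>
    dominates it up to the factor 3 and, starting at 0, is decreasing.\<close>
  define w where "w x j = (if j < 3 * 2^fst x then 1 / (3 * 2^fst x) else (0::real))" for x :: "nat \<times> 'n" and j :: nat
  define J :: nat where "J = 3 * 2^K"
  have wdec: "dec_kernel (w x)" for x
  proof -
   have "(SUM j<J. w x j) <= 1" for J
   proof -
    have "(SUM j<J. w x j) = (SUM j:{..<J} \<inter> {..<3 * 2^fst x}. 1 / (3 * 2^fst x))"
     unfolding w_def by (simp add: sum.If_cases lessThan_def)
    also have "... <= (SUM j:{..<3 * 2^fst x :: nat}. 1 / (3 * 2^fst x))" by (intro sum_mono2) auto
    finally show ?thesis by simp
   qed
   thus ?thesis unfolding dec_kernel_def by (auto simp: w_def)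
  qed
  let ?m = "%k n m. conv J (w (k,n)) (B (k,n)) m"
  have pc: "\<bar>pconv (lp_poly k) (a n) m\<bar> <= 3 * ?m k n m" if k: "k < K" and m: "m <= h" for k n m
  proof -
   define e :: nat where "e = 2^k"
   have e: "0 < e" by (simp add: e_def)
   have eJ: "3 * e <= J" using k by (simp add: e_def J_def power_increasing)
   have "3 * e <= 2^L"
   proof -
    have "3 * e <= 2^2 * 2^K" using eJ by (simp add: J_def)
    also have "... = 2^(K+2)" by (simp add: power_add)
    also have "... <= 2^L" by (rule power_increasing) (auto simp: L_def)
    finally show ?thesis .
   qed
   hence mh: "m + j <= h'" if "j < 3 * e" for j using m hL that by (simp add: h'_def)
   let ?i = "SUM s<e. \<bar>b k n (m + s + (2 * e - 1))\<bar>"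
   let ?j = "SUM j<3*e. w (k,n) j * B (k,n) (m + j)"
   have "pconv (lp_poly k) (a n) m = (SUM s<e. b k n (m + s + (2 * e - 1))) / real e"
    unfolding b_def e_def by (rule pconv_lp_poly) (use k in "simp add: L_def")
   also have "\<bar>...\<bar> <= ?i / real e"
    by (simp add: divide_right_mono)
   also have "?i = (SUM j:{2*e-1..<3*e-1}. \<bar>b k n (m + j)\<bar>)"
    by (rule sum.reindex_bij_witness[of _ "%j. j - (2*e-1)" "%s. s + (2*e-1)"]) (use e in "auto simp: add_ac")
   also have "... <= (SUM j<3*e. \<bar>b k n (m + j)\<bar>)" by (rule sum_mono2) auto
   also have "... = (SUM j<3*e. B (k,n) (m + j))" using mh by (simp add: B_def)
   also have "... / real e = 3 * ?j"
    by (simp add: w_def e_def sum_divide_distrib sum_distrib_left)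
   also have "?j = ?m k n m"
    unfolding conv_def using eJ by (intro sum.mono_neutral_left) (auto simp: w_def e_def)
   finally show ?thesis by (simp add: divide_right_mono)
  qed
  let ?c = "SUM m<=h'. (SUM x:S. (B x m)\<^sup>2) powr (p/2)"
  let ?d = "%m. SUM x:S. (conv J (w x) (B x) m)\<^sup>2"
  let ?o = "SUM m<=h. (?d m) powr (p/2)"
  have "(SUM m<=h. (SUM k<K. SUM n:N. (pconv (lp_poly k) (a n) m)\<^sup>2) powr (p/2)) <=
    (SUM m<=h. (9 * (SUM x:S. (conv J (w x) (B x) m)\<^sup>2)) powr (p/2))"
  proof (intro sum_mono powr_mono2)
   fix m assume m: "m : {..h}"
   let ?g = "SUM k<K. SUM n:N. (pconv (lp_poly k) (a n) m)\<^sup>2"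
   have "?g <= (SUM k<K. SUM n:N. (3 * ?m k n m)\<^sup>2)"
   proof (intro sum_mono)
    fix k n assume "k : {..<K}" "n : N"
    thus "(pconv (lp_poly k) (a n) m)^2 <= (3 * ?m k n m)^2"
     using pc[of k m n] m by (metis abs_ge_zero atMost_iff lessThan_iff power2_abs power_mono)
   qed
   thus "?g <= 9 * (?d m)"
    by (simp add: S_def sum.cartesian_product power_mult_distrib sum_distrib_left split_def)
  qed (use p in "auto intro!: sum_nonneg")
  also have "... = 9 powr (p/2) * ?o"
   by (simp add: powr_mult sum_nonneg flip: sum_distrib_left)
  also have "?o <= (SUM m<=h'. (?d m) powr (p/2))"
   using hh' by (intro sum_mono2) auto
  also have "... <= C2 * ?c"
   unfolding C2_def by (intro conv_l2_bound p finS wdec) (auto simp: B_def)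
  finally have T: "(SUM m<=h. (SUM k<K. SUM n:N. (pconv (lp_poly k) (a n) m)\<^sup>2) powr (p/2)) <=
   9 powr (p/2) * (C2 * (SUM m<=h'. (SUM x:S. (B x m)\<^sup>2) powr (p/2)))" by simp
  let ?a = "%s i. L2_set (%x. d s (fst x) (snd x) (i + s)) S"
  let ?b = "SUM m<=h. (SUM n:N. (a n m)\<^sup>2) powr (p/2)"
  let ?l = "%s. SUM i<=h'. (?a s i) powr p"
  \<comment> \<open>\<open>b\<close> is an average over \<open>s\<close> of martingale differences
    of translates. Minkowski in \<open>l^2\<close> and Jensen move the power \<open>p\<close> inside
    this average, and each translate obeys the dyadic estimate with the same constant.\<close>
  have "?c <= C * ?b"
  proof -
   have "?c <= (SUM i<=h'. SUM s<2^L. 1/2^L * (?a s i) powr p)"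
   proof (rule sum_mono)
    fix i assume i: "i : {..h'}"
    let ?e = "L2_set (%x. b (fst x) (snd x) i) S"
    let ?h = "SUM s<2^L. 1/2^L * ?a s i"
    have "?e = L2_set (%x. SUM s<2^L. (1/2^L) * (- d s (fst x) (snd x) (i + s))) S"
     by (simp add: b_def d_def sum_divide_distrib)
    also have "... <= (SUM s<2^L. L2_set (%x. (1/2^L) * (- d s (fst x) (snd x) (i + s))) S)" by (rule L2_set_sum_le)
    also have "... = ?h"
     by (intro sum.cong refl, subst L2_set_right_distrib[symmetric]) (simp_all add: L2_set_def)
    finally have le: "?e <= ?h" .
    let ?k = "(SUM x:S. (B x i)\<^sup>2) powr (p/2)"
    let ?n = "SUM s<2^L. 1/2^L * (?a s i) powr p"
    have "?k = ?e powr p"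
     using i by (simp add: L2_powr B_def)
    also have "... <= ?h powr p"
     using p le by (intro powr_mono2) auto
    also have "... <= ?n"
     by (rule powr_mean[OF p]) auto
    finally show "?k <= ?n" .
   qed
   also have "... = (SUM s<2^L. 1/2^L * (?l s))"
    unfolding sum_distrib_left by (rule sum.swap)
   also have "... <= (SUM s<(2::nat)^L. 1/2^L * (C * ?b))"
   proof (intro sum_mono mult_left_mono)
    fix s :: nat assume s: "s : {..<2^L}"
    let ?f = "SUM i<2^H. (SUM n:N. (shift_seq s (a n) i)\<^sup>2) powr (p/2)"
    have "(?l s) = (SUM i:{s..h'+s}. (L2_set (%x. d s (fst x) (snd x) i) S) powr p)"
     by (rule sum.reindex_bij_witness[of _ "%i. i - s" "%i. i + s"]) auto
    also have "... <= (SUM i<2^H. (L2_set (%x. d s (fst x) (snd x) i) S) powr p)"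
     using s by (intro sum_mono2) (auto simp: h'_def H_def)
    also have "... = (SUM i<2^H. (SUM k<K. SUM n:N. (d s k n i)\<^sup>2) powr (p/2))"
     unfolding L2_powr S_def by (simp add: sum.cartesian_product split_def)
    also have "... <= C * ?f"
     unfolding d_def by (rule C) (auto simp: H_def L_def N)
    also have "?f = (SUM i:{s..h+s}. (SUM n:N. (a n (i - s))\<^sup>2) powr (p/2))"
     using s hL az p by (intro sum.mono_neutral_cong_right) (auto simp: shift_seq_def H_def)
    also have "... = ?b"
     by (rule sum.reindex_bij_witness[of _ "%i. i + s" "%i. i - s"]) auto
    finally show "(?l s) <= C * ?b" .
   qed auto
   finally show ?thesis by simp
  qed
  hence "9 powr (p/2) * (C2 * ?c) <= 9 powr (p/2) * (C2 * (C * ?b))"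
   by (intro mult_left_mono) (auto simp: C2_def)
  thus ?thesis using T by (simp only: C'_def mult.assoc)
 qed
 moreover have "0 <= C'" using C0 by (simp add: C'_def C2_def)
 ultimately show ?thesis by blast
qed

text \<open>Dual to \<open>lp_square_function\<close> for the conjugate exponent. The adjoint of a
  polynomial in the left shift looks backward; reflecting the index by \<open>h\<close> makes it the
  same polynomial acting forward on \<open>y'\<close>.\<close>

lemma lp_dual_square_function:
 assumes p: "1 < (p::real)"
 shows "EX C>=0. ALL K h N. ALL a :: 'n => nat => nat => real. finite N --> (ALL n k l. h < l --> a n k l = 0) -->
  (SUM m<=h. (SUM n:N. (SUM k<K. pconv (lp_poly k) (a n k) m)\<^sup>2) powr (p/2))
   <= C * (SUM m<=h. (SUM k<K. SUM n:N. (a n k m)\<^sup>2) powr (p/2))"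
proof -
 define q where "q = p / (p - 1)"
 have pq: "1 < p" "1 < q" "1/p + 1/q = 1" "(p - 1) * q = p" using p by (auto simp: q_def field_simps)
 obtain C where C0: "0 <= C" and C: "!!K h N. !!a :: 'n => nat => real. finite N ==> (!!n l. h < l ==> a n l = 0) ==>
  (SUM m<=h. (SUM k<K. SUM n:N. (pconv (lp_poly k) (a n) m)\<^sup>2) powr (q/2))
   <= C * (SUM m<=h. (SUM n:N. (a n m)\<^sup>2) powr (q/2))"
  using lp_square_function[OF pq(2), where 'n='n] by blast
 define C' where "C' = (C powr (1/q)) powr p"
 let ?c = "%h X. SUM l<=h. X l powr p"
 let ?f = "%h N y'. SUM l<=h. (SUM n:N. (y' n l)\<^sup>2) powr (q/2)"
 have "(SUM m<=h. (SUM n:N. (SUM k<K. pconv (lp_poly k) (a n k) m)\<^sup>2) powr (p/2))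
   <= C' * (SUM m<=h. (SUM k<K. SUM n:N. (a n k m)\<^sup>2) powr (p/2))"
  if N: "finite N" and az: "!!n k l. h < l ==> a n k l = 0" for K h and N :: "'n set" and a :: "'n => nat => nat => real"
 proof -
  define G where "G n m = (SUM k<K. pconv (lp_poly k) (a n k) m)" for n m
  define W where "W m = L2_set (%n. G n m) N" for m
  define S where "S = {..<K} \<times> N"
  define X where "X m = L2_set (%x. a (snd x) (fst x) m) S" for m
  have W0: "0 <= W m" "0 <= X m" for m by (auto simp: W_def X_def)
  define y where "y n m = G n m * W m powr (p - 2)" for n m
  define y' where "y' n i = (if i <= h then y n (h - i) else 0)" for n i
  have Wp: "W m powr p = (SUM n:N. y n m * G n m)" for m
  proof -
   have "(SUM n:N. y n m * G n m) = (W m)^2 * W m powr (p - 2)"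
    by (simp add: y_def W_def L2_set_def sum_nonneg sum_distrib_right power2_eq_square mult_ac)
   also have "... = W m powr p" using W0[of m] by (cases "W m = 0") (auto simp: powr_diff powr_numeral)
   finally show ?thesis ..
  qed
  have yW: "L2_set (%n. y n m) N = W m powr (p - 1)" for m
  proof -
   have "L2_set (%n. y n m) N = W m powr (p - 2) * W m"
    unfolding W_def y_def by (subst mult.commute) (simp add: L2_set_right_distrib)
   also have "... = W m powr (p - 1)" using W0[of m] powr_mult_base[of "W m" "p - 2"] by (simp add: mult_ac)
   finally show ?thesis .
  qed
  let ?b = "%l. L2_set (%x. pconv (lp_poly (fst x)) (y' (snd x)) (h - l)) S"
  let ?d = "SUM m<=h. W m powr p"
  let ?g = "(?c h X) powr (1/p) * (SUM l<=h. (?b l) powr q) powr (1/q)"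
  have "?d = (SUM n:N. SUM k<K. SUM m<=h. y n m * pconv (lp_poly k) (a n k) m)"
   unfolding Wp G_def sum_distrib_left by (subst sum.swap, rule sum.cong[OF refl], rule sum.swap)
  also have "... = (SUM n:N. SUM k<K. SUM l<=h. a n k l * pconv (lp_poly k) (y' n) (h - l))"
  proof (rule sum.cong[OF refl], rule sum.cong[OF refl])
   fix n k
   let ?h = "SUM l<=h. a n k l * pconv (lp_poly k) (y' n) (h - l)"
   have "(SUM m<=h. y n m * pconv (lp_poly k) (a n k) m) =
    (SUM l<=h. a n k l * (SUM j<Suc (degree (lp_poly k)). coeff (lp_poly k) j * (if j <= l then y n (l - j) else 0)))"
    unfolding pconv_def by (rule dual_conv_sum) (use az in auto)
   also have "... = ?h"
    unfolding pconv_def conv_def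
   proof (intro sum.cong refl arg_cong2[where f="(*)"])
    fix l j assume "l : {..h}"
    thus "(if j <= l then y n (l - j) else 0) = y' n (h - l + j)" by (auto simp: y'_def)
   qed
   finally show "(SUM m<=h. y n m * pconv (lp_poly k) (a n k) m) = ?h" .
  qed
  also have "... = (SUM l<=h. SUM n:N. SUM k<K. a n k l * pconv (lp_poly k) (y' n) (h - l))"
   by (subst sum.swap[of _ "{..h}"]) (intro sum.cong refl sum.swap)
  also have "... = (SUM l<=h. SUM x:S. a (snd x) (fst x) l * pconv (lp_poly (fst x)) (y' (snd x)) (h - l))"
   unfolding S_def by (subst sum.swap) (simp add: sum.cartesian_product split_def)
  also have "... <= (SUM l<=h. X l * ?b l)"
  proof (rule sum_mono)
   fix l
   have "(SUM x:S. a (snd x) (fst x) l * pconv (lp_poly (fst x)) (y' (snd x)) (h - l)) <=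
    (SUM x:S. \<bar>a (snd x) (fst x) l\<bar> * \<bar>pconv (lp_poly (fst x)) (y' (snd x)) (h - l)\<bar>)"
    by (intro sum_mono) (metis abs_ge_self abs_mult)
   also have "... <= X l * ?b l"
    unfolding X_def by (rule L2_set_mult_ineq)
   finally show "(SUM x:S. a (snd x) (fst x) l * pconv (lp_poly (fst x)) (y' (snd x)) (h - l)) <=
    X l * L2_set (%x. pconv (lp_poly (fst x)) (y' (snd x)) (h - l)) S" .
  qed
  also have "... <= ?g"
   by (rule Holder_sum[OF pq(1-3)]) (auto simp: W0)
  finally have 0: "?d <= ?g" .
  let ?i = "%l. h - l"
  have e1: "(SUM l<=h. (L2_set (%x. pconv (lp_poly (fst x)) (y' (snd x)) (h - l)) S) powr q) =
   (SUM l<=h. (SUM k<K. SUM n:N. (pconv (lp_poly k) (y' n) l)\<^sup>2) powr (q/2))"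
   unfolding L2_powr S_def
   by (rule sum.reindex_bij_witness[of _ "?i" "?i"]) (auto simp: sum.cartesian_product split_def)
  let ?a = "SUM m<=h. (SUM k<K. SUM n:N. (a n k m)\<^sup>2) powr (p/2)"
  have e2: "(?c h X) = ?a"
   unfolding X_def L2_powr S_def by (simp add: sum.cartesian_product split_def)
  note 1 = 0[unfolded e1 e2]
  let ?e = "SUM l<=h. (SUM k<K. SUM n:N. (pconv (lp_poly k) (y' n) l)\<^sup>2) powr (q/2)"
  let ?j = "C powr (1/q) * (?c h W) powr (1/q)"
  have "?e <= C * (?f h N y')"
   by (rule C) (auto simp: N y'_def)
  also have "(?f h N y') = (?f h N y)"
   by (rule sum.reindex_bij_witness[of _ "?i" "?i"]) (auto simp: y'_def)
  also have "... = (?c h W)" by (simp add: yW powr_powr pq flip: L2_powr)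
  finally have "?e powr (1/q) <= (C * (?c h W)) powr (1/q)"
   using pq by (intro powr_mono2 sum_nonneg) auto
  also have "... = ?j" using C0 by (simp add: powr_mult sum_nonneg)
  finally have "?d <= ?a powr (1/p) * ?j"
   using 1 by (meson mult_left_mono order_trans powr_ge_zero)
  hence "?d <= C powr (1/q) * (?a powr (1/p) * (?c h W) powr (1/q))"
   by (simp add: mult_ac)
  hence "?d <= C' * ?a"
   unfolding C'_def by (intro powr_absorb[OF pq(1-3)]) (auto intro: sum_nonneg)
  thus ?thesis by (simp add: W_def G_def L2_powr)
 qed
 moreover have "0 <= C'" by (simp add: C'_def)
 ultimately show ?thesis by blast
qed

section \<open>Transference from the shift to matrices\<close>

text \<open>The weights \<open>u\<close> come from a positive solution of \<open>f = 1 + N f\<close>, where \<open>N f = (a\<^sup>T (a f)\<^bsup>p-1\<^esup>)\<^bsup>1/(p-1)\<^esup>\<close>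
 is a strict contraction in norm.\<close>

lemma stochastic_factor:
 fixes a :: "'i => 'i => real"
 assumes p: "1 < p" and fin: "finite I" and pos: "!!i j. i : I ==> j : I ==> 0 < a i j"
  and r: "0 < r" "r < 1"
  and contr: "!!x. (!!i. i : I ==> 0 <= x i) ==> (SUM i:I. (SUM j:I. a i j * x j) powr p) <= r powr p * (SUM j:I. x j powr p)"
 shows "EX u. (ALL i:I. ALL j:I. 0 < u i j) & (ALL i:I. (SUM j:I. u i j) = 1) &
  (ALL j:I. (SUM i:I. a i j powr p * u i j powr (1 - p)) <= 1)"
proof (cases "I = {}")
 case False
 define q where "q = p / (p - 1)"
 have pq: "1 < p" "1 < q" "1/p + 1/q = 1" "1/q + 1/p = 1" "(p - 1) * q = p" "(q - 1) * p = q" "(p - 1) * (q - 1) = 1"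
  using p by (auto simp: q_def field_simps)
 define TT where "TT x i = (SUM j:I. a i j * x j)" for x i
 define TS where "TS y j = (SUM i:I. a i j * y i)" for y j
 have TT0: "0 <= TT x i" if "i : I" "!!j. j : I ==> 0 <= x j" for x i
  unfolding TT_def using that pos by (intro sum_nonneg mult_nonneg_nonneg) (auto simp: less_imp_le)
 have TS0: "0 <= TS x i" if "i : I" "!!j. j : I ==> 0 <= x j" for x i
  unfolding TS_def using that pos by (intro sum_nonneg mult_nonneg_nonneg) (auto simp: less_imp_le)
 let ?c = "%z. r powr p * (SUM j:I. z j powr p)"
 let ?j = "%z. SUM i:I. TT z i powr p"
 have dual: "(SUM j:I. TS y j powr q) <= r powr q * (SUM i:I. y i powr q)" if y: "!!i. i : I ==> 0 <= y i" for y
 proof -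
  define z where "z j = TS y j powr (q - 1)" for j
  let ?d = "SUM j:I. TS y j powr q"
  let ?g = "SUM i:I. y i powr q"
  have "?d = (SUM j:I. TS y j * z j)"
   unfolding z_def using TS0[OF _ y] by (intro sum.cong refl) (simp add: powr_mult_base)
  also have "... = (SUM i:I. y i * TT z i)"
   unfolding TS_def TT_def sum_distrib_left sum_distrib_right by (subst sum.swap) (simp add: mult_ac)
  also have "... <= ?g powr (1/q) * (?j z) powr (1/p)"
   by (rule Holder_sum[OF pq(2,1,4) fin]) (use y TT0[of _ z] in "auto simp: z_def")
  also have "... <= ?g powr (1/q) * (?c z) powr (1/p)"
  proof (intro mult_left_mono powr_mono2 sum_nonneg)
   show "(?j z) <= ?c z"
    unfolding TT_def by (rule contr) (simp add: z_def)
  qed (use p in auto)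
  also have "(?c z) powr (1/p) = r * ?d powr (1/p)"
   using r pq(1) by (simp add: z_def powr_powr pq(6) powr_mult sum_nonneg)
  finally have "?d <= r * (?g powr (1/q) * ?d powr (1/p))"
   by (simp add: mult_ac)
  thus ?thesis using r by (intro powr_absorb[OF pq(2,1,4)]) (auto intro: sum_nonneg)
 qed
 let ?a = "%f j. TS (%i. TT f i powr (p - 1)) j"
 define NN where "NN f j = ?a f j powr (q - 1)" for f j
 define rh where "rh = r powr (q / p) * r"
 have rho: "0 < rh" "rh < 1" "rh powr p = r powr q * r powr p"
 proof -
  have "r powr (q/p) <= 1" using r pq by (intro powr_le1) auto
  hence "rh <= 1 * r" unfolding rh_def using r by (intro mult_right_mono) auto
  thus "rh < 1" using r by linarith
  show "0 < rh" using r by (simp add: rh_def)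
  show "rh powr p = r powr q * r powr p" using r p by (simp add: rh_def powr_mult powr_powr)
 qed
 have NNb: "(SUM j:I. NN f j powr p) <= rh powr p * (SUM j:I. f j powr p)" if f: "!!j. j : I ==> 0 <= f j" for f
 proof -
  have "(SUM j:I. NN f j powr p) = (SUM j:I. ?a f j powr q)"
   by (simp add: NN_def powr_powr pq)
  also have "... <= r powr q * (SUM i:I. (TT f i powr (p - 1)) powr q)" by (rule dual) simp
  also have "... = r powr q * (?j f)" by (simp add: powr_powr pq)
  also have "... <= r powr q * (?c f)"
   unfolding TT_def by (intro mult_left_mono contr f) auto
  finally show ?thesis by (simp add: rho)
 qed
 define F where "F n = ((%f j. 1 + NN f j) ^^ n) (%_. 1)" for n
 have FS: "F (Suc n) j = 1 + NN (F n) j" for n j by (simp add: F_def)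
 have F1: "1 <= F n j" for n j by (cases n) (auto simp: F_def NN_def)
 have F0: "0 <= F n j" for n j using F1[of n j] by simp
 have NNmono: "NN f j <= NN g j" if "j : I" "!!j. j : I ==> 0 <= f j" "!!j. j : I ==> f j <= g j" for f g j
  unfolding NN_def
 proof (intro powr_mono2)
  show "?a f j <= ?a g j"
   unfolding TS_def
  proof (intro sum_mono mult_left_mono powr_mono2)
   fix i assume i: "i : I"
   show "TT f i <= TT g i" unfolding TT_def using that pos[OF i] by (intro sum_mono mult_left_mono) (auto simp: less_imp_le)
   show "0 <= TT f i" using TT0[OF i] that by blast
   show "0 <= a i j" using pos[OF i that(1)] by simp
  qed (use p in auto)
  show "0 <= ?a f j" using TS0[OF that(1)] by simp
 qed (use pq in auto)
 have Finc: "F n j <= F (Suc n) j" if "j : I" for n j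
  using that
 proof (induction n arbitrary: j)
  case 0 thus ?case by (simp add: FS) (simp add: F_def NN_def)
 next
  case (Suc n)
  have "NN (F n) j <= NN (F (Suc n)) j" using Suc F0 by (intro NNmono) auto
  thus ?case by (simp add: FS[of "Suc n"] FS[of n])
 qed
 let ?e = "1 - rh"
 let ?i = "real (card I)"
 define c where "c = ?e powr (1 - p) * ?i"
 have c0: "0 <= c" by (simp add: c_def)
 let ?f = "%n. SUM j:I. F n j powr p"
 let ?h = "%n. (SUM j:I. F (Suc n) j powr p)"
 \<comment> \<open>Convexity with weights \<open>1 - rh\<close> and \<open>rh\<close> splits the
   power of \<open>1 + NN f\<close> without losing contraction: the factor \<open>rh^(1-p)\<close>
   meets \<open>rh^p\<close> from \<open>NNb\<close> and leaves \<open>rh < 1\<close>, so the norms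
   of the increasing iterates stay bounded.\<close>
 have step: "?h n <= c + rh * (?f n)" for n
 proof -
  have "(1 + NN (F n) j) powr p <= ?e powr (1 - p) + rh powr (1 - p) * NN (F n) j powr p" for j
  proof -
   have "(SUM b:{True,False}. (if b then 1 - rh else rh) * (if b then 1 / (1 - rh) else NN (F n) j / rh)) powr p <=
    (SUM b:{True,False}. (if b then 1 - rh else rh) * (if b then 1 / (1 - rh) else NN (F n) j / rh) powr p)"
    by (rule powr_mean[OF p]) (use rho in "auto simp: NN_def")
   moreover have "?e * (1 / ?e) powr p = ?e powr (1 - p)" using rho by (simp add: powr_divide powr_diff)
   moreover have "rh * (NN (F n) j / rh) powr p = rh powr (1 - p) * NN (F n) j powr p"
   proof -
    have "0 <= NN (F n) j" by (simp add: NN_def)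
    thus ?thesis using rho(1) by (simp add: powr_divide powr_diff)
   qed
   ultimately show ?thesis using rho(1,2) by simp
  qed
  hence "?h n <= (SUM j:I. ?e powr (1 - p) + rh powr (1 - p) * NN (F n) j powr p)"
   unfolding FS by (intro sum_mono)
  also have "... = c + rh powr (1 - p) * (SUM j:I. NN (F n) j powr p)"
   by (simp add: c_def sum.distrib sum_distrib_left mult.commute)
  also have "... <= c + rh powr (1 - p) * (rh powr p * (?f n))"
   by (intro add_left_mono mult_left_mono NNb F0) auto
  also have "rh powr (1 - p) * (rh powr p * (?f n)) = rh * (?f n)"
   using rho(1) by (simp add: powr_diff)
  finally show ?thesis .
 qed
 define B where "B = (c + ?i) / ?e"
 have cB: "c + rh * B <= B"
 proof -
  have "?e * B = c + ?i" using rho by (simp add: B_def)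
  thus ?thesis by (simp add: algebra_simps)
 qed
 have FB: "(?f n) <= B" for n
 proof (induction n)
  case 0
  have "?i * ?e <= ?i * 1" using rho by (intro mult_left_mono) auto
  thus ?case using rho c0 by (simp add: F_def B_def pos_le_divide_eq)
 next
  case (Suc n)
  have "?h n <= c + rh * B"
   using step[of n] mult_left_mono[OF Suc, of rh] rho by linarith
  thus ?case using cB by linarith
 qed
 have Fbd: "F n j <= B powr (1/p)" if "j : I" for n j
 proof -
  have "F n j powr p <= B" using FB[of n] member_le_sum[OF that, of "%j. F n j powr p"] fin by auto
  hence "(F n j powr p) powr (1/p) <= B powr (1/p)" using p by (intro powr_mono2) auto
  thus ?thesis using p F0[of n j] by (simp add: powr_powr)
 qed
 have "EX l. (%n. F n j) \<longlonglongrightarrow> l" if j: "j : I" for j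
  using incseq_convergent[of "%n. F n j" "B powr (1/p)"] Finc[OF j] Fbd[OF j] by (metis incseq_SucI)
 then obtain f where f: "!!j. j : I ==> (%n. F n j) \<longlonglongrightarrow> f j" by metis
 have f1: "1 <= f j" if "j : I" for j using f[OF that] F1 by (intro LIMSEQ_le_const) auto
 have TTpos: "0 < TT f i" if "i : I" for i
  unfolding TT_def using that False fin pos f1 by (intro sum_pos mult_pos_pos) (auto intro: less_le_trans[OF zero_less_one])
 let ?b = "%i. TT f i powr (p - 1)"
 have TSpos: "0 < TS ?b j" if "j : I" for j
  unfolding TS_def
 proof (intro sum_pos mult_pos_pos)
  show "0 < TT f i powr (p - 1)" if "i : I" for i using TTpos[OF that] by simp
 qed (use that False fin pos in auto)
 have lim: "(%n. NN (F n) j) \<longlonglongrightarrow> NN f j" if j: "j : I" for j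
 proof -
  have "(%n. TT (F n) i) \<longlonglongrightarrow> TT f i" for i unfolding TT_def by (intro tendsto_intros f)
  hence "(%n. TS (%i. TT (F n) i powr (p - 1)) j) \<longlonglongrightarrow> TS ?b j"
   unfolding TS_def using TTpos by (intro tendsto_intros) (auto simp: less_imp_neq[symmetric])
  thus ?thesis unfolding NN_def using TSpos[OF j] by (intro tendsto_intros) auto
 qed
 have fixpt: "f j = 1 + NN f j" if j: "j : I" for j
 proof (rule LIMSEQ_unique)
  show "(%n. F (Suc n) j) \<longlonglongrightarrow> f j" by (rule LIMSEQ_Suc[OF f[OF j]])
  show "(%n. F (Suc n) j) \<longlonglongrightarrow> 1 + NN f j" unfolding FS by (intro tendsto_intros lim j)
 qed
 \<comment> \<open>Rows sum to 1 by the definition of \<open>TT\<close>. The column condition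
   becomes \<open>NN f j <= f j\<close>, raised to the power \<open>p - 1\<close>, which the
   equation \<open>f = 1 + NN f\<close> provides.\<close>
 define u where "u i j = a i j * f j / TT f i" for i j
 have fpos: "0 < f j" if "j : I" for j using f1[OF that] by simp
 let ?l = "%j. (SUM i:I. a i j powr p * u i j powr (1 - p))"
 have "?l j <= 1" if j: "j : I" for j
 proof -
  have "?l j = (SUM i:I. a i j * TT f i powr (p - 1) * f j powr (1 - p))"
  proof (rule sum.cong[OF refl])
   fix i assume i: "i : I"
   let ?k = "a i j powr p * a i j powr (1 - p)"
   have "?k = a i j" using pos[OF i j] by (simp flip: powr_add)
   moreover have "1 / TT f i powr (1 - p) = TT f i powr (p - 1)" using TTpos[OF i] by (simp add: powr_diff)
   moreover have "u i j powr (1 - p) = a i j powr (1 - p) * f j powr (1 - p) * (1 / TT f i powr (1 - p))"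
    unfolding u_def using pos[OF i j] fpos[OF j] TTpos[OF i] by (simp add: powr_divide powr_mult)
   moreover have "a i j powr p * (a i j powr (1 - p) * f j powr (1 - p) * y) = ?k * y * f j powr (1 - p)" for y
    by (simp only: mult_ac)
   ultimately show "a i j powr p * u i j powr (1 - p) = a i j * TT f i powr (p - 1) * f j powr (1 - p)"
    by (simp only:)
  qed
  also have "... = TS ?b j * f j powr (1 - p)" by (simp add: TS_def sum_distrib_right)
  also have "TS ?b j = NN f j powr (p - 1)"
   using TSpos[OF j] pq by (simp add: NN_def powr_powr mult.commute)
  also have "NN f j powr (p - 1) * f j powr (1 - p) <= f j powr (p - 1) * f j powr (1 - p)"
   using fixpt[OF j] p by (intro mult_right_mono powr_mono2) (auto simp: NN_def)
  also have "... = 1" using fpos[OF j] by (simp flip: powr_add)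
  finally show ?thesis .
 qed
 moreover have "ALL i:I. ALL j:I. 0 < u i j" unfolding u_def using pos fpos TTpos by simp
 moreover have "(SUM j:I. u i j) = 1" if "i : I" for i
  using TTpos[OF that] unfolding u_def by (simp add: TT_def flip: sum_divide_distrib)
 ultimately show ?thesis by blast
qed auto

text \<open>One notion for the \<open>l^1\<close>, \<open>l^2\<close> and maximum norms, for all of
  which transference is needed.\<close>

definition csemi :: "(('k => complex) => real) => bool" where
 "csemi be \<longleftrightarrow> (ALL u v. be (%k. u k + v k) <= be u + be v) & (ALL c u. be (%k. c * u k) = cmod c * be u)"

lemma cseminorm_scale: "csemi be ==> be (%k. c * u k) = cmod c * be u"
 by (simp add: csemi_def)

lemma cseminorm_triangle: "csemi be ==> be (%k. u k + v k) <= be u + be v"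
 by (simp add: csemi_def)

lemma cseminorm_zero: "csemi be ==> be (%k. 0) = 0"
 using cseminorm_scale[of be 0] by simp

lemma cseminorm_nonneg: "csemi be ==> 0 <= be u"
proof -
 assume b: "csemi be"
 have "be (%k. u k + (- 1) * u k) <= be u + be (%k. (- 1) * u k)" by (rule cseminorm_triangle[OF b])
 thus ?thesis using cseminorm_scale[OF b, of "-1" u] cseminorm_zero[OF b] by simp
qed

lemma cseminorm_sum:
 assumes "csemi be" "finite S"
 shows "be (%k. SUM s:S. c s * u s k) <= (SUM s:S. cmod (c s) * be (u s))"
 using assms(2)
proof (induction S rule: finite_induct)
 case (insert s S)
 have "be (%k. c s * u s k + (SUM s:S. c s * u s k)) <= be (%k. c s * u s k) + be (%k. SUM s:S. c s * u s k)"
  by (rule cseminorm_triangle[OF assms(1)])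
 thus ?case using insert cseminorm_scale[OF assms(1)] by simp
qed (simp add: cseminorm_zero assms)

primrec mat_pow_app :: "'i set => ('i => 'i => complex) => ('i => 'k => complex) => nat => 'i => 'k => complex" where
 "mat_pow_app I t x 0 = x"
| "mat_pow_app I t x (Suc l) = (%i k. SUM j:I. t i j * mat_pow_app I t x l j k)"

text \<open>\<open>path_exp h i ph\<close> is the expectation of \<open>ph\<close> over the paths of length \<open>h\<close> that start at \<open>i\<close> of the Markov chain
 with transition matrix \<open>u\<close>; \<open>ph\<close> is evaluated at the sequence whose \<open>l\<close>-th entry is \<open>x\<close> at the \<open>l\<close>-th state,
 multiplied by the weights \<open>th\<close> of the first \<open>l\<close> steps. The expectation of that entry is \<open>(T\<^sup>l x) i\<close>.\<close>

locale weighted_chain =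
 fixes I :: "'i set" and u :: "'i => 'i => real" and th :: "'i => 'i => complex" and x :: "'i => 'k => complex" and p :: real
 assumes fin: "finite I" and u0: "!!i j. i : I ==> j : I ==> 0 <= u i j" and u1: "!!i. i : I ==> (SUM j:I. u i j) = 1"
  and p: "1 < p" and sub: "!!j. j : I ==> (SUM i:I. u i j * cmod (th i j) powr p) <= 1"
begin

primrec path_exp :: "nat => 'i => ((nat => 'k => complex) => real) => real" where
 "path_exp 0 i ph = ph (%l. if l = 0 then x i else (%_. 0))"
| "path_exp (Suc h) i ph = (SUM j:I. u i j * path_exp h j (%v. ph (%l. case l of 0 => x i | Suc l => (%k. th i j * v l k))))"

lemma path_exp_mono: "i : I ==> (!!v. ph v <= ps v) ==> path_exp h i ph <= path_exp h i ps"
 by (induction h arbitrary: i ph ps) (auto intro!: sum_mono mult_left_mono u0)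

lemma path_exp_add: "path_exp h i (%v. ph v + ps v) = path_exp h i ph + path_exp h i ps"
 by (induction h arbitrary: i ph ps) (auto simp: sum.distrib distrib_left)

lemma path_exp_cmult: "path_exp h i (%v. c * ph v) = c * path_exp h i ph"
 by (induction h arbitrary: i ph) (auto simp: sum_distrib_left mult_ac)

lemma path_exp_head: "i : I ==> path_exp h i (%v. ps (v 0)) = ps (x i)"
proof -
 have const: "path_exp h i (%v. c) = c" if "i : I" for h i c
  using that by (induction h arbitrary: i) (auto simp: u1 simp flip: sum_distrib_right)
 show "i : I ==> ?thesis" by (cases h) (auto simp: const u1 simp flip: sum_distrib_right)
qed

text \<open>Summed over the starting states, forgetting the first state turns the mass at
  \<open>j\<close> into the column sum of \<open>sub\<close>. It falls short of 1 by a deficit,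
  which is kept exactly because it has to be compared between the two sides of the transferred
  inequality.\<close>

lemma path_exp_tail:
 assumes hom: "!!c v. ph (%l k. c * v l k) = cmod c powr p * ph v"
 shows "(SUM i:I. path_exp (Suc h) i (%v. ph (%l. v (Suc l)))) =
  (SUM j:I. path_exp h j ph) - (SUM j:I. (1 - (SUM i:I. u i j * cmod (th i j) powr p)) * path_exp h j ph)"
proof -
 have "(SUM i:I. path_exp (Suc h) i (%v. ph (%l. v (Suc l)))) = (SUM i:I. SUM j:I. u i j * cmod (th i j) powr p * path_exp h j ph)"
  by (simp add: hom path_exp_cmult mult.assoc)
 also have "... = (SUM j:I. (SUM i:I. u i j * cmod (th i j) powr p) * path_exp h j ph)"
  by (subst sum.swap) (simp add: sum_distrib_right)
 finally show ?thesis by (simp add: sum_subtractf left_diff_distrib)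
qed

text \<open>The expected path from \<open>i\<close> is the orbit of \<open>x\<close> under the
  matrix, cut off after \<open>h\<close> steps. Jensen's inequality for the convex \<open>ph\<close>
  is applied to one transition of the chain at a time.\<close>

lemma path_exp_jensen:
 assumes t: "!!i j. i : I ==> j : I ==> t i j = u i j * th i j" and i: "i : I"
  and conv: "!!w v. (!!j. j : I ==> 0 <= w j) ==> (SUM j:I. w j) = 1 ==>
   ph (%l k. SUM j:I. of_real (w j) * v j l k) <= (SUM j:I. w j * ph (v j))"
 shows "ph (%l. if l <= h then mat_pow_app I t x l i else (%_. 0)) <= path_exp h i ph"
 using i conv
proof (induction h arbitrary: i ph)
 case 0
 have "(%l. if l <= 0 then mat_pow_app I t x l i else (%_. 0)) = (%l. if l = 0 then x i else (%_. 0))" by auto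
 thus ?case by simp
next
 case (Suc h)
 define cons where "cons j v = (%l. case l of 0 => x i | Suc l => (%k. th i j * v l k))" for j and v :: "nat => 'k => complex"
 have cons_sum: "cons j (%l k. SUM s:I. of_real (w s) * v s l k) = (%l k. SUM s:I. of_real (w s) * cons j (v s) l k)"
  if "(SUM s:I. w s) = 1" for j w v
  unfolding cons_def using that
  by (intro ext) (auto split: nat.split simp: sum_distrib_left mult_ac simp flip: sum_distrib_right of_real_sum)
 define V where "V j = (%l. if l <= h then mat_pow_app I t x l j else (%_. 0))" for j
 let ?a = "%l. if l <= Suc h then mat_pow_app I t x l i else (%_. 0)"
 let ?b = "%l k. SUM j:I. of_real (u i j) * cons j (V j) l k"
 have "?a = ?b"
 proof (intro ext)
  fix l k
  show "(if l <= Suc h then mat_pow_app I t x l i else (%_. 0)) k = (SUM j:I. of_real (u i j) * cons j (V j) l k)"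
  proof (cases l)
   case 0
   have "(SUM j:I. of_real (u i j) * x i k) = of_real (SUM j:I. u i j) * x i k" by (simp add: sum_distrib_right)
   thus ?thesis using u1[OF Suc.prems(1)] 0 by (simp add: cons_def)
  next
   case (Suc l')
   show ?thesis
   proof (cases "l' <= h")
    case True
    thus ?thesis using Suc t[OF Suc.prems(1)] by (simp add: cons_def V_def mult.assoc)
   qed (use Suc in "simp add: cons_def V_def")
  qed
 qed
 hence "ph ?a = ph ?b" by simp
 also have "... <= (SUM j:I. u i j * ph (cons j (V j)))"
  by (rule Suc.prems(2)) (use Suc.prems(1) u0 u1 in auto)
 also have "... <= (SUM j:I. u i j * path_exp h j (%v. ph (cons j v)))"
 proof (intro sum_mono mult_left_mono)
  fix j assume j: "j : I"
  show "ph (cons j (V j)) <= path_exp h j (%v. ph (cons j v))" unfolding V_def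
   by (rule Suc.IH[OF j]) (simp add: cons_sum Suc.prems(2))
 qed (use u0 Suc.prems in auto)
 finally show ?case by (simp add: cons_def)
qed

text \<open>The chain is only sub-invariant for the weights, so the mass entering at time \<open>m\<close> is made up for by paths born at time \<open>m\<close>;
 these are the terms with the factor \<open>1 - \<Sum>...\<close> below.\<close>

lemma transference_chain:
 fixes c :: "'l => 'k => nat => complex" and K :: "'k set"
 assumes t: "!!i j. i : I ==> j : I ==> t i j = u i j * th i j"
  and beta: "csemi be" and alpha: "csemi al" and C: "0 <= C"
  and H: "!!h v. (SUM m<h. be (%l. SUM k:K. SUM j<=J. c l k j * v (m + j) k) powr p) <= C * (SUM m<h + J. al (v m) powr p)"
 shows "(SUM i:I. be (%l. SUM k:K. SUM j<=J. c l k j * mat_pow_app I t x j i k) powr p) <= C * (SUM i:I. al (x i) powr p)"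
proof -
 define B where "B v = be (%l. SUM k:K. SUM j<=J. c l k j * v j k) powr p" for v :: "nat => 'k => complex"
 define ph where "ph h v = (SUM m<=h. B (%l. v (m + l)))" for h :: nat and v
 define ps where "ps L v = (SUM m<=L. al (v m) powr p)" for L :: nat and v :: "nat => 'k => complex"
 define b where "b j = 1 - (SUM i:I. u i j * cmod (th i j) powr p)" for j
 have b0: "0 <= b j" if "j : I" for j using sub[OF that] by (simp add: b_def)
 let ?f = "%i. B (%l. mat_pow_app I t x l i)"
 define w where "w = (SUM i:I. ?f i)"
 define N where "N = (SUM i:I. al (x i) powr p)"
 have Bhom: "B (%l k. c * v l k) = cmod c powr p * B v" for c v
 proof -
  have "(%l. SUM k:K. SUM j<=J. c' l k j * (c * v j k)) = (%l. c * (SUM k:K. SUM j<=J. c' l k j * v j k))" for c' :: "'l => 'k => nat => complex"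
   by (simp add: sum_distrib_left mult_ac)
  thus ?thesis unfolding B_def by (simp add: cseminorm_scale[OF beta] powr_mult cseminorm_nonneg[OF beta])
 qed
 have phihom: "ph h (%l k. c * v l k) = cmod c powr p * ph h v" for h c v
  by (simp add: ph_def Bhom sum_distrib_left)
 have psihom: "ps h (%l k. c * v l k) = cmod c powr p * ps h v" for h c v
  by (simp add: ps_def cseminorm_scale[OF alpha] powr_mult cseminorm_nonneg[OF alpha] sum_distrib_left)
 have phiS: "ph (Suc h) v = B v + ph h (%l. v (Suc l))" for h v
  unfolding ph_def by (subst sum.atMost_Suc_shift) simp
 have psiS: "ps (Suc h) v = al (v 0) powr p + ps h (%l. v (Suc l))" for h v
  unfolding ps_def by (subst sum.atMost_Suc_shift) simp
 let ?l = "%_. 0"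
 have wle: "w <= (SUM i:I. path_exp h i B)" if h: "J <= h" for h
  unfolding w_def
 proof (rule sum_mono)
  fix i assume i: "i : I"
  have "?f i = B (%l. if l <= h then mat_pow_app I t x l i else ?l)"
   unfolding B_def using h by (intro arg_cong[where f="%y. be y powr p"] ext sum.cong refl) auto
  also have "... <= path_exp h i B"
  proof (rule path_exp_jensen[OF t i])
   fix w :: "'i => real" and v :: "'i => nat => 'k => complex"
   assume w: "!!j. j : I ==> 0 <= w j" "(SUM j:I. w j) = 1"
   define V where "V s l = (SUM k:K. SUM j<=J. c l k j * v s j k)" for s l
   let ?c = "%s. of_real (w s)"
   let ?e = "%l. (SUM k:K. SUM j<=J. c l k j * (SUM s:I. ?c s * v s j k))"
   have e: "?e l = (SUM s:I. ?c s * V s l)" for l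
   proof -
    have "?e l = (SUM k:K. SUM j<=J. SUM s:I. ?c s * (c l k j * v s j k))"
     by (simp add: sum_distrib_left mult_ac)
    also have "... = (SUM k:K. SUM s:I. SUM j<=J. ?c s * (c l k j * v s j k))"
     by (intro sum.cong refl sum.swap)
    also have "... = (SUM s:I. ?c s * V s l)"
     by (subst sum.swap) (simp add: V_def sum_distrib_left)
    finally show ?thesis .
   qed
   let ?h = "be (%l. SUM s:I. ?c s * V s l)"
   let ?i = "B (%l k. SUM j:I. ?c j * v j l k)"
   let ?k = "SUM s:I. w s * be (V s)"
   have "?i = ?h powr p"
    unfolding B_def e ..
   also have "... <= ?k powr p"
   proof -
    have "?h <= (SUM s:I. cmod (?c s) * be (V s))"
     by (rule cseminorm_sum[OF beta fin])
    also have "... = ?k" using w by (intro sum.cong refl) simp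
    finally show ?thesis using p cseminorm_nonneg[OF beta] by (intro powr_mono2) auto
   qed
   also have "... <= (SUM s:I. w s * be (V s) powr p)"
    by (rule powr_mean[OF p fin]) (use w cseminorm_nonneg[OF beta] in auto)
   finally show "?i <= (SUM j:I. w j * B (v j))"
    by (simp add: B_def V_def[abs_def])
  qed
  finally show "?f i <= path_exp h i B" .
 qed
 let ?g = "%h i. path_exp (J + h) i (ph h)"
 \<comment> \<open>\<open>Q\<close> and \<open>R\<close> are the total expectations of the two sides
   of the sequence inequality, \<open>q\<close> and \<open>r\<close> what the deficits take from
   them in one step. Before this loss, \<open>Q\<close> gains at least \<open>w\<close> and
   \<open>R\<close> exactly \<open>N\<close> per step; as \<open>Q\<close>, \<open>q\<close> are
   bounded by \<open>C\<close> times \<open>R\<close>, \<open>r\<close>, the number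
   \<open>n * w\<close> is compared with \<open>C * n * N\<close> up to a bounded error.\<close>
 define Q q R r where "Q h = (SUM i:I. ?g h i)" and "q h = (SUM j:I. b j * ?g h j)"
  and "R L = (SUM i:I. path_exp L i (ps L))" and "r L = (SUM j:I. b j * path_exp L j (ps L))" for h L
 have pe: "path_exp h i (%v. ph1 v) = path_exp h i ph1" for h i and ph1 :: "(nat => 'k => complex) => real" by simp
 have QS: "w + Q h - q h <= Q (Suc h)" for h
 proof -
  let ?a = "SUM i:I. path_exp (Suc (J + h)) i (%v. ph h (%l. v (Suc l)))"
  have "Q (Suc h) = (SUM i:I. path_exp (Suc (J + h)) i B) + ?a"
   unfolding Q_def phiS[abs_def] path_exp_add by (simp only: sum.distrib add_Suc_right)
  also have "?a = Q h - q h"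
   unfolding Q_def q_def b_def by (rule path_exp_tail) (rule phihom)
  finally show ?thesis using wle[of "Suc (J + h)"] by simp
 qed
 have Q0: "w <= Q 0" using wle[of J] by (simp add: Q_def ph_def[abs_def])
 have RS: "R (Suc L) = N + R L - r L" for L
 proof -
  let ?b = "SUM i:I. path_exp (Suc L) i (%v. ps L (%l. v (Suc l)))"
  let ?d = "SUM i:I. path_exp (Suc L) i (%v. al (v 0) powr p)"
  have "R (Suc L) = ?d + ?b"
   unfolding R_def psiS[abs_def] path_exp_add by (simp only: sum.distrib)
  also have "?d = N"
   unfolding N_def by (intro sum.cong refl path_exp_head[where ps="%y. al y powr p"])
  also have "?b = R L - r L"
   unfolding R_def r_def b_def by (rule path_exp_tail) (rule psihom)
  finally show ?thesis by simp
 qed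
 have R0: "R 0 = N" by (simp add: R_def N_def ps_def)
 have psi0: "0 <= ps L v" for L v by (simp add: ps_def sum_nonneg)
 have r0: "0 <= r L" for L
 proof -
  have "0 <= path_exp L j (ps L)" if "j : I" for j
   using path_exp_mono[OF that, of "?l" "ps L" L] psi0 path_exp_cmult[of L j 0 "?l"] by simp
  thus ?thesis unfolding r_def using b0 by (intro sum_nonneg) auto
 qed
 have RJ: "R L <= real (Suc L) * N" for L
  by (induction L) (use RS R0 r0 in "auto simp: algebra_simps intro: order_trans", smt (verit))
 have Qsum: "real (Suc n) * w <= Q n + (SUM h<n. q h)" for n
 proof (induction n)
  case (Suc n) thus ?case using QS[of n] by (simp add: algebra_simps)
 qed (use Q0 in simp)
 have Rsum: "R (J + n) + (SUM h<n. r (J + h)) = R J + real n * N" for n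
 proof (induction n)
  case (Suc n) thus ?case using RS[of "J + n"] by (simp add: algebra_simps)
 qed simp
 have phipsi: "ph h v <= C * ps (J + h) v" for h v
  using H[where h="Suc h" and v=v] by (simp add: ph_def ps_def B_def lessThan_Suc_atMost add.commute)
 have pp: "?g h i <= C * path_exp (J + h) i (ps (J + h))" if "i : I" for h i
  using path_exp_mono[OF that, of "ph h" "%v. C * ps (J + h) v" "J + h"] phipsi by (simp add: path_exp_cmult)
 have QR: "Q h <= C * R (J + h)" for h
  unfolding Q_def R_def sum_distrib_left by (intro sum_mono pp)
 have qr: "q h <= C * r (J + h)" for h
  unfolding q_def r_def sum_distrib_left
 proof (rule sum_mono)
  fix j assume j: "j : I"
  show "b j * ?g h j <= C * (b j * path_exp (J + h) j (ps (J + h)))"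
   using mult_left_mono[OF pp[OF j, of h] b0[OF j]] by (simp add: mult_ac)
 qed
 have fin_le: "real (Suc n) * w <= C * (real (Suc J) * N + real n * N)" for n
 proof -
  have "real (Suc n) * w <= C * R (J + n) + (SUM h<n. C * r (J + h))"
   using Qsum[of n] QR[of n] sum_mono[of "{..<n}" q "%h. C * r (J + h)"] qr by simp
  also have "... = C * (R J + real n * N)" unfolding Rsum[of n, symmetric] by (simp add: sum_distrib_left distrib_left)
  also have "... <= C * (real (Suc J) * N + real n * N)" using RJ[of J] C by (intro mult_left_mono) auto
  finally show ?thesis .
 qed
 \<comment> \<open>Dividing by \<open>n + 1\<close> removes the boundary effect of the
   \<open>J\<close> extra terms.\<close>
 let ?j = "%n. (C * N * J) / real (Suc n)"
 have "w - C * N <= (C * N * J) / real (Suc n)" for n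
  using fin_le[of n] by (simp add: field_simps)
 moreover have "?j \<longlonglongrightarrow> 0"
  by (rule LIMSEQ_Suc) (rule lim_const_over_n)
 ultimately have "w - C * N <= 0" by (intro LIMSEQ_le_const[where X="?j"]) auto
 thus ?thesis by (simp add: w_def B_def N_def)
qed

end

text \<open>The matrix factors into transition probabilities \<open>u\<close> and weights
  \<open>th = t / u\<close>. Because \<open>|t| <= a\<close>, the column condition of
  \<open>stochastic_factor\<close> is the sub-invariance that the chain needs.\<close>

lemma transference_finite:
 fixes t :: "'i => 'i => complex" and c :: "'l => 'k => nat => complex" and K :: "'k set"
 assumes p: "1 < p" and fin: "finite I" and pos: "!!i j. i : I ==> j : I ==> 0 < a i j"
  and ta: "!!i j. i : I ==> j : I ==> cmod (t i j) <= a i j" and r: "0 < r" "r < 1"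
  and contr: "!!x. (!!i. i : I ==> 0 <= x i) ==> (SUM i:I. (SUM j:I. a i j * x j) powr p) <= r powr p * (SUM j:I. x j powr p)"
  and beta: "csemi be" and alpha: "csemi al" and C: "0 <= C"
  and H: "!!h v. (SUM m<h. be (%l. SUM k:K. SUM j<=J. c l k j * v (m + j) k) powr p) <= C * (SUM m<h + J. al (v m) powr p)"
 shows "(SUM i:I. be (%l. SUM k:K. SUM j<=J. c l k j * mat_pow_app I t x j i k) powr p) <= C * (SUM i:I. al (x i) powr p)"
proof -
 obtain u where u: "!!i j. i : I ==> j : I ==> 0 < u i j" "!!i. i : I ==> (SUM j:I. u i j) = 1"
  "!!j. j : I ==> (SUM i:I. a i j powr p * u i j powr (1 - p)) <= 1"
  using stochastic_factor[OF p fin pos r contr] by blast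
 define th where "th i j = t i j / of_real (u i j)" for i j
 let ?a = "%j. (SUM i:I. u i j * cmod (th i j) powr p)"
 have "?a j <= 1" if j: "j : I" for j
 proof -
  have "?a j <= (SUM i:I. a i j powr p * u i j powr (1 - p))"
  proof (rule sum_mono)
   fix i assume i: "i : I"
   let ?b = "u i j * cmod (th i j) powr p"
   let ?c = "a i j powr p * u i j powr (1 - p)"
   have "?b <= u i j * (a i j / u i j) powr p"
    unfolding th_def using u(1)[OF i j] ta[OF i j] p
    by (intro mult_left_mono powr_mono2) (auto simp: norm_divide divide_right_mono)
   also have "... = ?c"
    using u(1)[OF i j] pos[OF i j] by (simp add: powr_divide powr_diff)
   finally show "?b <= ?c" .
  qed
  thus ?thesis using u(3)[OF j] by simp
 qed
 then interpret weighted_chain I u th x p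
  by unfold_locales (use fin u p in "auto simp: less_imp_le")
 have "t i j = u i j * th i j" if "i : I" "j : I" for i j
  using u(1)[OF that] by (simp add: th_def)
 thus ?thesis by (intro transference_chain beta alpha C H) auto
qed

section \<open>Functional calculus of a scalar moment sequence\<close>

text \<open>The power series that converge absolutely on the closed disc of radius \<open>s\<close>,
  with the submultiplicative norm \<open>wnorm s\<close>: those that can be evaluated at
  \<open>s * T\<close> for a power bounded \<open>T\<close>.\<close>

definition wsum :: "real => complex fps => bool" where
 "wsum s A \<longleftrightarrow> summable (%n. norm (fps_nth A n) * s ^ n)"

definition wnorm :: "real => complex fps => real" where
 "wnorm s A = (\<Sum>n. norm (fps_nth A n) * s ^ n)"

lemma wnorm_nonneg: "0 <= s ==> wsum s A ==> 0 <= wnorm s A"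
 unfolding wnorm_def wsum_def by (intro suminf_nonneg) auto

lemma w_mult:
 assumes s: "0 <= s" and A: "wsum s A" and B: "wsum s B"
 shows "wsum s (A * B)" "wnorm s (A * B) <= wnorm s A * wnorm s B"
proof -
 let ?a = "%n. norm (fps_nth A n) * s ^ n" and ?b = "%n. norm (fps_nth B n) * s ^ n"
 have ab: "summable (%k. norm (?a k))" "summable (%k. norm (?b k))" using A B s by (auto simp: wsum_def)
 have le: "norm (fps_nth (A * B) n) * s ^ n <= (SUM i<=n. ?a i * ?b (n - i))" for n
 proof -
  have "norm (fps_nth (A * B) n) * s ^ n <= (SUM i<=n. norm (fps_nth A i * fps_nth B (n - i))) * s ^ n"
   unfolding fps_mult_nth atMost_atLeast0 using s by (intro mult_right_mono norm_sum) auto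
  also have "... = (SUM i<=n. ?a i * ?b (n - i))"
   unfolding sum_distrib_right
  proof (rule sum.cong[OF refl])
   fix i assume "i : {..n}"
   hence "s ^ n = s ^ i * s ^ (n - i)" by (simp flip: power_add)
   thus "norm (fps_nth A i * fps_nth B (n - i)) * s ^ n = ?a i * ?b (n - i)"
    by (simp add: norm_mult mult_ac)
  qed
  finally show ?thesis .
 qed
 have sm: "summable (%n. SUM i<=n. ?a i * ?b (n - i))" by (rule summable_Cauchy_product[OF ab])
 show 1: "wsum s (A * B)" unfolding wsum_def
  by (rule summable_comparison_test'[OF sm]) (use le s in auto)
 have "wnorm s (A * B) <= (\<Sum>n. SUM i<=n. ?a i * ?b (n - i))"
  unfolding wnorm_def using 1 sm le by (intro suminf_le) (auto simp: wsum_def)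
 also have "... = wnorm s A * wnorm s B" unfolding wnorm_def by (rule Cauchy_product[OF ab, symmetric])
 finally show "wnorm s (A * B) <= wnorm s A * wnorm s B" .
qed

lemma w_one: "wsum s 1" "wnorm s 1 = 1"
proof -
 have "(%n. norm (fps_nth (1 :: complex fps) n) * s ^ n) sums (SUM n:{0}. norm (fps_nth (1 :: complex fps) n) * s ^ n)"
  by (rule sums_finite) auto
 thus "wsum s 1" "wnorm s 1 = 1" by (auto simp: wsum_def wnorm_def sums_iff)
qed

lemma w_power:
 assumes s: "0 <= s" and A: "wsum s A"
 shows "wsum s (A ^ j)" "wnorm s (A ^ j) <= wnorm s A ^ j"
proof -
 have "wsum s (A ^ j) & wnorm s (A ^ j) <= wnorm s A ^ j"
 proof (induction j)
  case (Suc j)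
  hence "wsum s (A * A ^ j)" "wnorm s (A * A ^ j) <= wnorm s A * wnorm s (A ^ j)"
   using w_mult[OF s A, of "A ^ j"] by auto
  moreover have "wnorm s A * wnorm s (A ^ j) <= wnorm s A * wnorm s A ^ j"
   using Suc wnorm_nonneg[OF s A] by (intro mult_left_mono) auto
  ultimately show ?case by auto
 qed (auto simp: w_one)
 thus "wsum s (A ^ j)" "wnorm s (A ^ j) <= wnorm s A ^ j" by auto
qed

lemma w_diff:
 assumes s: "0 <= s" and A: "wsum s A" and B: "wsum s B"
 shows "wsum s (A - B)" "wnorm s (A - B) <= wnorm s A + wnorm s B"
proof -
 have sm: "summable (%n. norm (fps_nth A n) * s ^ n + norm (fps_nth B n) * s ^ n)"
  using A B by (auto simp: wsum_def intro: summable_add)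
 have le: "norm (fps_nth (A - B) n) * s ^ n <= norm (fps_nth A n) * s ^ n + norm (fps_nth B n) * s ^ n" for n
  using s norm_triangle_ineq4[of "fps_nth A n" "fps_nth B n"] by (simp add: mult_right_mono flip: distrib_right)
 show 1: "wsum s (A - B)" unfolding wsum_def
  by (rule summable_comparison_test'[OF sm]) (use le s in auto)
 have "wnorm s (A - B) <= (\<Sum>n. norm (fps_nth A n) * s ^ n + norm (fps_nth B n) * s ^ n)"
  unfolding wnorm_def using 1 sm le by (intro suminf_le) (auto simp: wsum_def)
 also have "... = wnorm s A + wnorm s B" unfolding wnorm_def
  using A B by (intro suminf_add[symmetric]) (auto simp: wsum_def)
 finally show "wnorm s (A - B) <= wnorm s A + wnorm s B" .
qed

lemma wnorm_add_le:
 assumes s: "0 <= s" and A: "wsum s A" and B: "wsum s B"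
 shows "wsum s (A + B)" "wnorm s (A + B) <= wnorm s A + wnorm s B"
proof -
 have mB: "wsum s (- B)" "wnorm s (- B) = wnorm s B" using B by (auto simp: wsum_def wnorm_def)
 show "wsum s (A + B)" "wnorm s (A + B) <= wnorm s A + wnorm s B"
  using w_diff[OF s A mB(1)] mB(2) by auto
qed

text \<open>\<open>gfps c\<close> is the expansion of \<open>1 / (c - z)\<close>, and \<open>rpoly c N\<close> is its truncation.\<close>

definition gfps :: "complex => complex fps" where
 "gfps c = Abs_fps (%n. inverse c ^ Suc n)"

definition rpoly :: "complex => nat => complex poly" where
 "rpoly c N = (SUM n<N. monom (inverse c ^ Suc n) n)"

lemma coeff_res_poly: "coeff (rpoly c N) n = (if n < N then inverse c ^ Suc n else 0)"
 by (auto simp: rpoly_def coeff_sum)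

lemma w_geom:
 assumes s: "0 <= s" "s < norm c"
 shows "wsum s (gfps c)" "wnorm s (gfps c) = 1 / (norm c - s)"
proof -
 have c: "norm c > 0" using s by linarith
 let ?a = "inverse (norm c)"
 have "(%n. ?a * (s / norm c) ^ n) sums (?a * (1 / (1 - s / norm c)))"
  using s c by (intro sums_mult geometric_sums) auto
 moreover have "?a * (s / norm c) ^ n = norm (fps_nth (gfps c) n) * s ^ n" for n
  by (simp add: gfps_def norm_power norm_mult norm_inverse divide_inverse power_mult_distrib mult_ac)
 moreover have "?a * (1 / (1 - s / norm c)) = 1 / (norm c - s)" using c by (simp add: field_simps)
 ultimately show "wsum s (gfps c)" "wnorm s (gfps c) = 1 / (norm c - s)"
  by (auto simp: wsum_def wnorm_def sums_iff)
qed

lemma geom_fps_inverse: "c ~= 0 ==> (fps_const c - fps_X) * gfps c = 1"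
proof (rule fps_ext)
 fix n assume "c ~= 0"
 thus "fps_nth ((fps_const c - fps_X) * gfps c) n = fps_nth 1 n"
  by (cases n) (simp_all add: gfps_def left_diff_distrib)
qed

lemma geom_fps_diff:
 assumes "c ~= 0" "l ~= 0"
 shows "gfps l - gfps c = fps_const (c - l) * gfps c * gfps l"
proof -
 have "gfps l - gfps c = ((fps_const c - fps_X) * gfps c) * gfps l - gfps c * ((fps_const l - fps_X) * gfps l)"
  using assms by (simp add: geom_fps_inverse)
 also have "... = (fps_const c - fps_const l) * gfps c * gfps l" by (simp add: algebra_simps del: fps_const_sub)
 finally show ?thesis unfolding fps_const_sub .
qed

text \<open>For \<open>m n = <(s T)^n x, y>\<close> this is \<open><A(s T) x, y>\<close>;
  \<open>pmoment\<close> is the same for polynomials.\<close>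

definition moment :: "(nat => complex) => complex fps => complex" where
 "moment m A = (\<Sum>n. fps_nth A n * m n)"

definition pmoment :: "(nat => complex) => complex poly => complex" where
 "pmoment m P = (SUM n<=degree P. coeff P n * m n)"

locale moment_seq =
 fixes m :: "nat => complex" and s Cm :: real
 assumes s: "0 < s" "s < 1" and m: "!!n. norm (m n) <= Cm * s ^ n"
begin

lemma Cm0: "0 <= Cm"
 using order_trans[OF norm_ge_zero m[of 0]] by simp

lemma moment_summable:
 assumes "wsum s A"
 shows "summable (%n. norm (fps_nth A n * m n))"
proof (rule summable_comparison_test')
 show "summable (%n. Cm * (norm (fps_nth A n) * s ^ n))" using assms by (intro summable_mult) (simp add: wsum_def)
 show "norm (norm (fps_nth A n * m n)) <= Cm * (norm (fps_nth A n) * s ^ n)" if "n >= 0" for n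
  using mult_left_mono[OF m[of n], of "norm (fps_nth A n)"] by (simp add: norm_mult mult_ac)
qed

lemma moment_bound:
 assumes "wsum s A"
 shows "norm (moment m A) <= Cm * wnorm s A"
proof -
 let ?a = "%n. norm (fps_nth A n) * s ^ n"
 have "norm (moment m A) <= (\<Sum>n. norm (fps_nth A n * m n))"
  unfolding moment_def by (rule summable_norm[OF moment_summable[OF assms]])
 also have "... <= (\<Sum>n. Cm * (?a n))"
 proof (rule suminf_le)
  show "norm (fps_nth A n * m n) <= Cm * (?a n)" for n
   using mult_left_mono[OF m[of n], of "norm (fps_nth A n)"] by (simp add: norm_mult mult_ac)
  show "summable (%n. Cm * (?a n))" using assms by (intro summable_mult) (simp add: wsum_def)
 qed (rule moment_summable[OF assms])
 also have "... = Cm * wnorm s A" unfolding wnorm_def using assms by (intro suminf_mult) (simp add: wsum_def)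
 finally show ?thesis .
qed

lemma moment_diff:
 assumes "wsum s A" "wsum s B"
 shows "moment m (A - B) = moment m A - moment m B"
 unfolding moment_def using moment_summable[OF assms(1)] moment_summable[OF assms(2)]
 by (subst suminf_diff) (auto intro: summable_norm_cancel simp: left_diff_distrib)

lemma moment_scale:
 assumes "wsum s A"
 shows "moment m (fps_const c * A) = c * moment m A"
 unfolding moment_def using moment_summable[OF assms]
 by (subst suminf_mult[symmetric]) (auto intro: summable_norm_cancel simp: mult_ac)

lemma w_poly: "wsum s (fps_of_poly P)"
 unfolding wsum_def by (rule summable_finite[of "{..degree P}"]) (auto simp: coeff_eq_0)

lemma moment_poly: "moment m (fps_of_poly P) = pmoment m P"
 unfolding moment_def pmoment_def by (subst suminf_finite[of "{..degree P}"]) (auto simp: coeff_eq_0)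

lemma res_poly_tendsto:
 assumes c: "s < norm c"
 shows "(%N. wnorm s (gfps c - fps_of_poly (rpoly c N))) \<longlonglongrightarrow> 0"
proof -
 define f where "f n = norm (fps_nth (gfps c) n) * s ^ n" for n
 have sf: "summable f" using w_geom(1)[of s c] s c by (simp add: wsum_def f_def[abs_def])
 have "wnorm s (gfps c - fps_of_poly (rpoly c N)) = (\<Sum>n. f (n + N))" for N
 proof -
  have e: "norm (fps_nth (gfps c - fps_of_poly (rpoly c N)) n) * s ^ n = (if n < N then 0 else f n)" for n
   by (auto simp: f_def gfps_def coeff_res_poly)
  have "summable (%n. if n < N then 0 else f n)"
   by (rule summable_comparison_test'[OF sf]) (use s in "auto simp: f_def")
  hence "(\<Sum>n. if n < N then 0 else f n) = (\<Sum>n. f (n + N))"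
   by (subst suminf_split_initial_segment[where k=N]) auto
  thus ?thesis unfolding wnorm_def e .
 qed
 thus ?thesis using suminf_exist_split2[OF sf] by simp
qed

lemma res_poly_power_tendsto:
 assumes c: "s < norm c"
 shows "(%N. pmoment m (rpoly c N ^ j)) \<longlonglongrightarrow> moment m (gfps c ^ j)"
proof -
 define E where "E = gfps c"
 define P where "P N = fps_of_poly (rpoly c N)" for N
 have E: "wsum s E" using w_geom(1)[of s c] s c by (simp add: E_def)
 have P: "wsum s (P N)" for N by (simp add: P_def w_poly)
 have s0: "0 <= s" using s by simp
 let ?d = "%N. wnorm s (E - P N)"
 have d0: "(%N. ?d N) \<longlonglongrightarrow> 0" using res_poly_tendsto[OF c] by (simp add: E_def P_def)
 have dj: "(%N. wnorm s (E ^ j - P N ^ j)) \<longlonglongrightarrow> 0"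
 proof (induction j)
  case 0
  have "wnorm s 0 = 0" by (simp add: wnorm_def)
  thus ?case by simp
 next
  case (Suc j)
  let ?a = "%N. wnorm s (E ^ j - P N ^ j)"
  let ?c = "wnorm s (E ^ j)"
  have PjE: "wnorm s (P N ^ j) <= ?c + ?a N" for N
   using w_diff(2)[OF s0 w_power(1)[OF s0 E, of j] w_diff(1)[OF s0 w_power(1)[OF s0 E, of j] w_power(1)[OF s0 P[of N], of j]]] by simp
  have b: "wnorm s (E ^ Suc j - P N ^ Suc j) <= wnorm s E * ?a N + ?d N * (?c + ?a N)" for N
  proof -
   let ?e = "E ^ j - P N ^ j"
   have w1: "wsum s ?e" by (intro w_diff w_power E P s0)
   have w2: "wsum s (E - P N)" by (intro w_diff E P s0)
   have "E ^ Suc j - P N ^ Suc j = E * ?e + (E - P N) * P N ^ j" by (simp add: algebra_simps)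
   hence "wnorm s (E ^ Suc j - P N ^ Suc j) <= wnorm s (E * ?e) + wnorm s ((E - P N) * P N ^ j)"
    using wnorm_add_le(2)[OF s0 w_mult(1)[OF s0 E w1] w_mult(1)[OF s0 w2 w_power(1)[OF s0 P]]] by simp
   also have "... <= wnorm s E * ?a N + ?d N * wnorm s (P N ^ j)"
    by (intro add_mono w_mult E w1 w2 w_power P s0)
   also have "?d N * wnorm s (P N ^ j) <= ?d N * (?c + ?a N)"
    by (intro mult_left_mono PjE wnorm_nonneg w2 s0)
   finally show ?thesis by simp
  qed
  have lim: "(%N. wnorm s E * ?a N + ?d N * (?c + ?a N)) \<longlonglongrightarrow> wnorm s E * 0 + 0 * (?c + 0)"
   by (intro tendsto_intros Suc d0)
  show ?case
   by (rule tendsto_sandwich[OF _ _ tendsto_const lim[simplified]])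
    (auto intro!: always_eventually wnorm_nonneg w_diff w_mult w_power E P s0 b simp del: power_Suc)
 qed
 let ?b = "moment m (E ^ j)"
 have "(%N. ?b - moment m (P N ^ j)) \<longlonglongrightarrow> 0"
 proof (rule Lim_null_comparison)
  show "\<forall>\<^sub>F N in sequentially. norm (?b - moment m (P N ^ j)) <= Cm * wnorm s (E ^ j - P N ^ j)"
   using moment_bound moment_diff w_diff(1) w_power(1) E P s0 by (intro always_eventually) metis
  show "(%N. Cm * wnorm s (E ^ j - P N ^ j)) \<longlonglongrightarrow> 0" using tendsto_mult_left[OF dj, of Cm] by simp
 qed
 hence "(%N. ?b - (?b - moment m (P N ^ j))) \<longlonglongrightarrow> ?b - 0"
  by (intro tendsto_intros)
 thus ?thesis by (simp add: P_def E_def fps_of_poly_power[symmetric] moment_poly del: fps_of_poly_power)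
qed

text \<open>Neumann series around \<open>c\<close> of the resolvent at \<open>l\<close>, in the disc
  of radius \<open>1 - s\<close> where the crude bound
  \<open>wnorm s (gfps c) <= 1 / (1 - s)\<close> suffices. After \<open>J\<close> terms the
  remainder is \<open>(c - l)^J\<close> times the moment of
  \<open>gfps c ^ J * gfps l\<close>.\<close>

lemma geom_expand:
 assumes c: "1 <= norm c" and l: "norm (c - l) < 1 - s"
 shows "(%j. moment m (gfps c ^ Suc j) * (c - l) ^ j) sums moment m (gfps l)"
proof -
 have s0: "0 <= s" using s by simp
 let ?d = "norm (c - l)"
 have "norm c <= norm l + ?d" by (metis add.commute diff_add_cancel norm_triangle_ineq)
 hence ls: "s < norm l" using c l by linarith
 have cs: "s < norm c" using c s by linarith
 have nz: "c ~= 0" "l ~= 0" using ls cs s by auto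
 define E where "E = gfps c"
 have E: "wsum s E" "wnorm s E <= 1 / (1 - s)" using w_geom[of s c] s cs c by (auto simp: E_def frac_le)
 let ?b = "gfps l"
 have L: "wsum s ?b" using w_geom[of s l] s ls by auto
 let ?a = "%J. moment m (E ^ J * gfps l)"
 let ?f = "Cm * wnorm s ?b"
 have "(SUM j<J. moment m (E ^ Suc j) * (c - l) ^ j) = moment m ?b - (c - l) ^ J * ?a J" for J
 proof (induction J)
  case (Suc J)
  let ?c = "E ^ Suc J * gfps l"
  have w: "wsum s (E ^ J * gfps l)" "wsum s (E ^ Suc J)" "wsum s ?c"
   by (intro w_mult w_power E L s0)+
  have "E ^ J * gfps l - E ^ Suc J = E ^ J * (gfps l - E)" by (simp add: algebra_simps)
  also have "... = fps_const (c - l) * ?c"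
   unfolding E_def geom_fps_diff[OF nz] by (simp add: algebra_simps)
  finally have "?a J - moment m (E ^ Suc J) = (c - l) * moment m ?c"
   using moment_diff[OF w(1,2)] moment_scale[OF w(3)] by simp
  hence "(c - l) ^ J * (?a J - moment m (E ^ Suc J)) = (c - l) ^ Suc J * moment m ?c"
   by simp
  thus ?case using Suc by (simp add: algebra_simps del: power_Suc)
 qed simp
 moreover have "(%J. (c - l) ^ J * ?a J) \<longlonglongrightarrow> 0"
 proof (rule Lim_null_comparison)
  show "\<forall>\<^sub>F J in sequentially. norm ((c - l) ^ J * ?a J) <= ?f * (?d / (1 - s)) ^ J"
  proof (intro always_eventually allI)
   fix J
   let ?e = "Cm * ((1 / (1 - s)) ^ J * wnorm s ?b)"
   have "norm (?a J) <= Cm * wnorm s (E ^ J * gfps l)"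
    by (intro moment_bound w_mult w_power E L s0)
   also have "... <= Cm * (wnorm s E ^ J * wnorm s ?b)"
    using w_mult(2)[OF s0 w_power(1)[OF s0 E(1), of J] L] w_power(2)[OF s0 E(1), of J] wnorm_nonneg[OF s0 L] Cm0
    by (intro mult_left_mono) (auto intro: order_trans mult_right_mono)
   also have "... <= ?e"
    using wnorm_nonneg[OF s0 L] wnorm_nonneg[OF s0 E(1)] Cm0 E(2) by (intro mult_left_mono mult_right_mono power_mono)
   finally have "?d ^ J * norm (?a J) <= ?d ^ J * ?e"
    by (intro mult_left_mono) auto
   thus "norm ((c - l) ^ J * ?a J) <= ?f * (?d / (1 - s)) ^ J"
    by (simp add: norm_mult norm_power power_divide mult_ac)
  qed
  show "(%J. ?f * (?d / (1 - s)) ^ J) \<longlonglongrightarrow> 0"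
   by (intro tendsto_mult_right_zero LIMSEQ_power_zero) (use l s in auto)
 qed
 hence "(%J. moment m ?b - (c - l) ^ J * ?a J) \<longlonglongrightarrow> moment m ?b - 0"
  by (intro tendsto_intros)
 ultimately show ?thesis unfolding sums_def E_def by simp
qed

end

section \<open>Continuation of the resolvent across the unit circle\<close>

text \<open>From \<open>z\<close>, rotate about 0 until the ray of \<open>c\<close> is reached, then
  move along the ray to \<open>c\<close>. Rotation towards the ray does not increase the distance to
  \<open>c\<close>, by the law of cosines, and both motions stay outside radius
  \<open>s\<close>.\<close>

lemma connected_ball_exterior:
 fixes c :: complex
 assumes s: "0 <= s" and c: "s < norm c"
 shows "connected (ball c r \<inter> {z. s < norm z})"
proof -
 have c0: "norm c > 0" "c ~= 0" using s c by auto
 let ?b = "%z. ball c r \<inter> {z. s < norm z}"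
 have main: "connected_component (?b z) z c" if z: "z : ball c r" "s < norm z" for z
 proof -
  define rh where "rh = norm z"
  define al where "al = Arg (z / c)"
  let ?a = "rh / norm c"
  define f where "f t = c * ?a * cis (t * al)" for t :: real
  have z0: "z ~= 0" using z s by auto
  have al: "- pi < al" "al <= pi" using Arg_bounded by (auto simp: al_def)
  have "z / c = norm (z / c) * cis al" using rcis_cmod_Arg[of "z / c"] by (simp add: rcis_def al_def)
  hence f1: "f 1 = z" using c0 by (simp add: f_def rh_def norm_divide field_simps)
  have nf: "norm (f t) = rh" for t using c0 by (simp add: f_def norm_mult norm_divide rh_def)
  let ?f = "%t. (norm (f t - c))\<^sup>2"
  have df: "?f t = rh\<^sup>2 + (norm c)^2 - 2 * rh * norm c * cos (t * al)" for t
  proof -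
   let ?c = "t * al"
   have "f t - c = c * (of_real ?a * cis ?c - 1)" by (simp add: f_def algebra_simps)
   hence "?f t = (norm c)^2 * (norm (of_real ?a * cis ?c - 1))^2"
    by (simp add: norm_mult power_mult_distrib)
   also have "(norm (of_real ?a * cis ?c - 1))^2 = (rh / norm c * cos ?c - 1)^2 + (rh / norm c * sin ?c)^2"
    by (simp add: cmod_power2)
   also have "... = ?a^2 * ((cos ?c)^2 + (sin ?c)^2) + 1 - 2 * ?a * cos ?c"
   proof -
    have "(x * C - 1)^2 + (x * S)^2 = x^2 * (C^2 + S^2) + 1 - 2 * x * C" for x C S :: real
     by (simp add: power2_eq_square algebra_simps)
    thus ?thesis .
   qed
   also have "... = ?a^2 + 1 - 2 * ?a * cos ?c" by simp
   finally have "?f t = (norm c)^2 * (?a^2 + 1 - 2 * ?a * cos ?c)" .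
   also have "... = (norm c * ?a)^2 + (norm c)^2 - 2 * (norm c * ?a) * norm c * cos ?c"
    by (simp add: power2_eq_square algebra_simps)
   finally show ?thesis using c0 by simp
  qed
  have mono: "norm (f t - c) <= norm (z - c)" if t: "0 <= t" "t <= 1" for t
  proof -
   have "cos \<bar>al\<bar> <= cos \<bar>t * al\<bar>"
    using al t by (intro cos_monotone_0_pi_le) (auto simp: abs_mult mult_left_le_one_le)
   hence "rh * norm c * cos al <= rh * norm c * cos (t * al)"
    by (intro mult_left_mono) (auto simp: rh_def)
   hence "?f t <= (norm (f 1 - c))^2" unfolding df by simp
   thus ?thesis using f1 by simp
  qed
  have contf: "continuous_on {0..1} f" unfolding f_def by (intro continuous_intros)
  have "connected (f ` {0..1})" by (rule connected_continuous_image[OF contf]) simp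
  moreover have "f ` {0..1} \<subseteq> ?b z"
   using mono nf z by (auto simp: dist_norm norm_minus_commute rh_def) (smt (verit) norm_minus_commute)
  ultimately have A: "connected_component (?b z) z (f 0)"
   unfolding connected_component_def using f1 by (metis atLeastAtMost_iff image_eqI order_refl zero_le_one)
  have "closed_segment (f 0) c \<subseteq> ?b z"
  proof
   fix y assume y: "y : closed_segment (f 0) c"
   have "f 0 : ball c r" using mono[of 0] z by (auto simp: dist_norm norm_minus_commute)
   moreover have "c : ball c r" using z by (auto intro: le_less_trans[OF zero_le_dist])
   ultimately have yb: "y : ball c r" using y convex_ball[of c r] by (meson closed_segment_subset subsetD)
   obtain t where t: "0 <= t" "t <= 1" "y = (1 - t) *\<^sub>R f 0 + t *\<^sub>R c" using y by (auto simp: closed_segment_def)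
   let ?e = "(1 - t) * rh + t * norm c"
   have "y = of_real ((1 - t) * ?a + t) * c" unfolding t(3) f_def by (simp add: scaleR_conv_of_real algebra_simps)
   hence "norm y = \<bar>(1 - t) * ?a + t\<bar> * norm c" by (metis norm_mult norm_of_real)
   also have "... = ((1 - t) * ?a + t) * norm c" using t by (simp add: rh_def)
   also have "... = ?e" using c0 by (simp add: field_simps)
   finally have ny: "norm y = ?e" .
   have "s < ?e"
   proof (cases "t = 1")
    case False
    hence "(1 - t) * s < (1 - t) * rh" using t z by (simp add: rh_def)
    moreover have "t * s <= t * norm c" using t c by (intro mult_left_mono) auto
    ultimately show ?thesis by (simp add: algebra_simps)
   qed (use c in simp)
   thus "y : ?b z" using yb ny by simp
  qed
  hence B: "connected_component (?b z) (f 0) c"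
   unfolding connected_component_def by (meson connected_segment ends_in_segment)
  show ?thesis using connected_component_trans[OF A B] .
 qed
 let ?d = "ball c r \<inter> {z. s < norm z}"
 show ?thesis unfolding connected_iff_connected_component
 proof (intro ballI)
  fix x y assume "x : ?d" "y : ?d"
  thus "connected_component ?d x y"
   using connected_component_trans[OF main[of x] connected_component_sym[OF main[of y]]] by blast
 qed
qed

text \<open>The bound of an analytic operator on powers of the resolvent, in scalar form. It is
  uniform in the truncation \<open>N\<close>, so it passes to the limit, and it does not involve
  \<open>s\<close>: the local series converge in discs of radius \<open>|c - 1| / K\<close>, which
  can cross the circle even when \<open>s\<close> is close to 1.\<close>

locale resolvent_moment = moment_seq +
 fixes K C' :: real
 assumes K: "1 <= K" and C': "0 <= C'"
  and bound: "!!c N j. 1 <= norm c ==> norm c <= 3 ==> c ~= 1 ==> norm (pmoment m (rpoly c N ^ Suc j)) <= C' * (K / norm (c - 1)) ^ Suc j"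
begin

definition tcoeff :: "complex => nat => complex" where
 "tcoeff c j = moment m (gfps c ^ Suc j)"

definition centers :: "complex set" where
 "centers = {c. 1 <= norm c & norm c <= 3 & c ~= 1}"

definition local_ext :: "complex => complex => complex" where
 "local_ext c l = (\<Sum>j. tcoeff c j * (c - l) ^ j)"

text \<open>A quarter of the radius of convergence \<open>|c - 1| / K\<close>. If two discs of
  radius \<open>rad\<close> meet, the larger one, enlarged four times, contains the smaller one
  together with its center; consistency rests on this.\<close>

definition rad :: "complex => real" where
 "rad c = norm (c - 1) / (4 * K)"

lemma tcoeff_bound: "c : centers ==> norm (tcoeff c j) <= C' * (K / norm (c - 1)) ^ Suc j"
 unfolding tcoeff_def centers_def using s
 by (intro LIMSEQ_le_const2[OF tendsto_norm[OF res_poly_power_tendsto]]) (auto simp del: power_Suc intro!: exI[of _ 0] bound)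

lemma rad_pos: "c : centers ==> 0 < rad c"
 using K by (auto simp: rad_def centers_def)

lemma local_ext_sums:
 assumes c: "c : centers" and l: "norm (c - l) < 4 * rad c"
 shows "(%j. tcoeff c j * (c - l) ^ j) sums local_ext c l"
proof -
 let ?a = "norm (c - 1)"
 define q where "q = K * norm (c - l) / ?a"
 have d: "?a > 0" using c by (simp add: centers_def)
 have q: "0 <= q" "q < 1" using l K d by (auto simp: q_def rad_def field_simps)
 have "summable (%j. norm (tcoeff c j * (c - l) ^ j))"
 proof (rule summable_comparison_test')
  show "summable (%j. C' * (K / ?a) * q ^ j)" using q by (intro summable_mult summable_geometric) auto
  show "norm (norm (tcoeff c j * (c - l) ^ j)) <= C' * (K / ?a) * q ^ j" if "j >= 0" for j
  proof -
   have "norm (tcoeff c j) * norm (c - l) ^ j <= C' * (K / ?a) ^ Suc j * norm (c - l) ^ j"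
    by (intro mult_right_mono tcoeff_bound c) auto
   also have "... = C' * (K / ?a) * q ^ j" by (simp add: q_def power_divide power_mult_distrib)
   finally show ?thesis by (simp add: norm_mult norm_power)
  qed
 qed
 thus ?thesis unfolding local_ext_def by (rule summable_sums[OF summable_norm_cancel])
qed

lemma local_ext_holomorphic:
 assumes c: "c : centers"
 shows "local_ext c holomorphic_on ball c (4 * rad c)"
proof (rule power_series_holomorphic)
 fix w assume w: "w : ball c (4 * rad c)"
 let ?a = "%n. (tcoeff c n * (- 1) ^ n) * (w - c) ^ n"
 have eq: "?a = (%n. tcoeff c n * (c - w) ^ n)"
  by (rule ext) (metis minus_diff_eq mult.assoc power_minus)
 thus "?a sums local_ext c w"
  unfolding eq using local_ext_sums[OF c, of w] w by (simp add: dist_norm)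
qed

definition outer :: "complex => complex" where
 "outer l = moment m (gfps l)"

lemma outer_sums:
 assumes l: "s < norm l"
 shows "(%n. m n * inverse l ^ Suc n) sums outer l"
proof -
 have w: "wsum s (gfps l)" using w_geom(1)[of s l] s l by auto
 have "summable (%n. fps_nth (gfps l) n * m n)" by (rule summable_norm_cancel[OF moment_summable[OF w]])
 thus ?thesis unfolding outer_def moment_def by (simp add: gfps_def summable_sums mult.commute)
qed

lemma moment_power_abs_summable:
 assumes "norm w < 1 / s"
 shows "summable (%n. norm (m (k + n) * w ^ n))"
proof (rule summable_comparison_test')
 have "s * norm w < 1" using assms s by (simp add: field_simps)
 thus "summable (%n. Cm * s ^ k * (s * norm w) ^ n)" using s by (intro summable_mult summable_geometric) auto
 show "norm (norm (m (k + n) * w ^ n)) <= Cm * s ^ k * (s * norm w) ^ n" if "n >= 0" for n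
  using mult_right_mono[OF m[of "k + n"], of "norm w ^ n"] by (simp add: norm_mult norm_power power_add power_mult_distrib mult_ac)
qed

lemmas moment_power_sums = summable_norm_cancel[OF moment_power_abs_summable]

lemma outer_holomorphic: "outer holomorphic_on {z. s < norm z}"
proof -
 define g where "g w = (\<Sum>n. m n * w ^ n)" for w
 let ?a = "%z. g (inverse z) * inverse z"
 have "g holomorphic_on ball 0 (1/s)"
 proof (rule power_series_holomorphic)
  fix w :: complex assume "w : ball 0 (1/s)"
  thus "(%n. m n * (w - 0) ^ n) sums g w"
   using moment_power_sums[of w 0] by (simp add: g_def summable_sums)
 qed
 moreover have inv: "inverse z : ball 0 (1/s)" if "s < norm z" for z :: complex
 proof -
  have "0 < norm z" using that s by linarith
  thus ?thesis using that s by (simp add: norm_divide inverse_eq_divide field_simps)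
 qed
 ultimately have "?a holomorphic_on {z. s < norm z}"
  using s by (intro holomorphic_intros holomorphic_on_compose_gen[of inverse _ g "ball 0 (1/s)", unfolded o_def]) auto
 moreover have "g (inverse z) * inverse z = outer z" if z: "s < norm z" for z
 proof -
  have "(%n. m n * inverse z ^ n) sums g (inverse z)" unfolding g_def
   using moment_power_sums[of "inverse z" 0] inv[OF z] by (intro summable_sums) auto
  from sums_mult2[OF this, of "inverse z"] have "(%n. m n * inverse z ^ Suc n) sums (g (inverse z) * inverse z)"
   by (simp add: mult_ac)
  thus ?thesis using outer_sums[OF z] sums_unique2 by blast
 qed
 ultimately show ?thesis by (subst holomorphic_cong[OF refl, of _ _ "?a"]) auto
qed

lemma local_ext_eq_outer:
 assumes c: "c : centers" and l: "l : ball c (4 * rad c)" "s < norm l"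
 shows "local_ext c l = outer l"
proof -
 define A where "A = ball c (4 * rad c) \<inter> {z. s < norm z}"
 have c1: "1 <= norm c" using c by (simp add: centers_def)
 have "open A" unfolding A_def by (intro open_Int open_ball open_Collect_less continuous_intros)
 have "connected A" unfolding A_def using s c1 by (intro connected_ball_exterior) auto
 define B where "B = ball c (min (4 * rad c) (1 - s))"
 let ?b = "%z. local_ext c z - outer z"
 have "local_ext c l - outer l = 0"
 proof (rule analytic_continuation[of "?b" A B c])
  show "?b holomorphic_on A"
   using local_ext_holomorphic[OF c] outer_holomorphic unfolding A_def
   by (intro holomorphic_intros) (auto elim: holomorphic_on_subset)
  show "B \<subseteq> A"
  proof
   fix z assume z: "z : B"
   have "norm c <= norm z + norm (c - z)" by (metis add.commute diff_add_cancel norm_triangle_ineq)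
   thus "z : A" using z c1 by (auto simp: A_def B_def dist_norm)
  qed
  show "c : A" using c1 s rad_pos[OF c] by (auto simp: A_def)
  show "c islimpt B" unfolding B_def using rad_pos[OF c] s by (intro interior_limit_point) (auto simp: interior_open)
  show "local_ext c z - outer z = 0" if "z : B" for z
  proof -
   let ?a = "%j. tcoeff c j * (c - z) ^ j"
   have "?a sums outer z"
    using geom_expand[OF c1, of z] that by (simp add: tcoeff_def outer_def B_def dist_norm)
   moreover have "?a sums local_ext c z"
    using that by (intro local_ext_sums c) (auto simp: B_def dist_norm)
   ultimately show ?thesis using sums_unique2 by fastforce
  qed
  show "l : A" using l by (simp add: A_def)
 qed fact+
 thus ?thesis by simp
qed

text \<open>Two discs may meet only inside radius \<open>s\<close>, where \<open>outer\<close> says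
  nothing. The comparison is therefore made on the intersection of the enlarged bigger disc with the
  smaller one: it is convex and contains the center \<open>c'\<close>, which is not inside the unit
  circle and near which both series equal \<open>outer\<close>.\<close>

lemma local_ext_consistent:
 assumes c: "c : centers" and c': "c' : centers" and l: "l : ball c (rad c)" "l : ball c' (rad c')"
 shows "local_ext c l = local_ext c' l"
proof -
 let ?a = "%c. ball c (4 * rad c)"
 have main: "local_ext c l = local_ext c' l"
  if c: "c : centers" and c': "c' : centers" and l: "l : ball c (rad c)" "l : ball c' (rad c')" and r: "rad c' <= rad c" for c c'
 proof -
  define A where "A = ?a c \<inter> ball c' (rad c')"
  have rp: "0 < rad c" "0 < rad c'" using rad_pos c c' by auto
  have c1: "1 <= norm c'" using c' by (simp add: centers_def)
  have "dist c c' <= dist c l + dist l c'" by (rule dist_triangle)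
  hence cc: "dist c c' < 2 * rad c" using l r by (simp add: dist_commute)
  define B where "B = ball c' (min (rad c') (min (1 - s) (2 * rad c)))"
  let ?b = "%z. local_ext c z - local_ext c' z"
  have "local_ext c l - local_ext c' l = 0"
  proof (rule analytic_continuation[of "?b" A B c'])
   show "?b holomorphic_on A"
    
   proof (intro holomorphic_on_diff)
    have "A \<subseteq> ?a c" "A \<subseteq> ?a c'" using rp by (auto simp: A_def)
    thus "local_ext c holomorphic_on A" "local_ext c' holomorphic_on A"
     using local_ext_holomorphic c c' holomorphic_on_subset by blast+
   qed
   show "open A" "connected A" by (auto simp: A_def intro!: convex_connected convex_Int)
   have BA: "z : A & s < norm z" if z: "z : B" for z
   proof -
    have "dist c z <= dist c c' + dist c' z" by (rule dist_triangle)
    moreover have "norm c' <= norm z + norm (c' - z)" by (metis add.commute diff_add_cancel norm_triangle_ineq)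
    ultimately show ?thesis using z cc c1 by (auto simp: A_def B_def dist_norm)
   qed
   show "B \<subseteq> A" using BA by auto
   show "c' : A" using cc rp by (auto simp: A_def)
   show "c' islimpt B" unfolding B_def using rp s by (intro interior_limit_point) (auto simp: interior_open)
   show "local_ext c z - local_ext c' z = 0" if "z : B" for z
   proof -
    have "z : ?a c" "s < norm z" "z : ?a c'" using BA[OF that] rp by (auto simp: A_def)
    thus ?thesis using local_ext_eq_outer c c' by simp
   qed
   show "l : A" using l rp by (auto simp: A_def)
  qed
  thus ?thesis by simp
 qed
 show ?thesis
 proof (cases "rad c' <= rad c")
  case True thus ?thesis using main[OF c c' l] by simp
 next
  case False thus ?thesis using main[OF c' c l(2,1)] by simp
 qed
qed

definition ext_dom :: "complex set" where
 "ext_dom = {z. s < norm z} \<union> (\<Union>c\<in>centers. ball c (rad c))"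

definition ext :: "complex => complex" where
 "ext l = (if s < norm l then outer l else local_ext (SOME c. c : centers & l : ball c (rad c)) l)"

lemma ext_eq_local:
 assumes c: "c : centers" and l: "l : ball c (rad c)"
 shows "ext l = local_ext c l"
proof (cases "s < norm l")
 case True
 thus ?thesis using local_ext_eq_outer[OF c, of l] l rad_pos[OF c] by (auto simp: ext_def)
next
 case False
 define d where "d = (SOME c. c : centers & l : ball c (rad c))"
 have "d : centers & l : ball d (rad d)" unfolding d_def by (rule someI[of _ c]) (use c l in auto)
 thus ?thesis using False local_ext_consistent[of d c l] c l by (simp add: ext_def d_def)
qed

lemma open_ext_dom: "open ext_dom"
 unfolding ext_dom_def by (intro open_Un open_UN ballI open_ball open_Collect_less continuous_intros)

lemma ext_holomorphic: "ext holomorphic_on ext_dom"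
 unfolding holomorphic_on_open[OF open_ext_dom]
proof
 fix z assume z: "z : ext_dom"
 show "EX f'. (ext has_field_derivative f') (at z)"
 proof (cases "s < norm z")
  case True
  have op: "open {z :: complex. s < norm z}" by (intro open_Collect_less continuous_intros)
  then obtain f' where "(outer has_field_derivative f') (at z)"
   using outer_holomorphic True holomorphic_on_open by blast
  hence "(ext has_field_derivative f') (at z)"
   by (rule has_field_derivative_transform_within_open[OF _ op]) (use True in "auto simp: ext_def")
  thus ?thesis ..
 next
  case False
  then obtain c where c: "c : centers" "z : ball c (rad c)" using z by (auto simp: ext_dom_def)
  have "z : ball c (4 * rad c)" using c rad_pos[of c] by auto
  then obtain f' where "(local_ext c has_field_derivative f') (at z)"
   using local_ext_holomorphic[OF c(1)] holomorphic_on_open[OF open_ball] by blast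
  hence "(ext has_field_derivative f') (at z)"
   by (rule has_field_derivative_transform_within_open[OF _ open_ball c(2)]) (simp add: ext_eq_local[OF c(1)])
  thus ?thesis ..
 qed
qed

end

context resolvent_moment
begin

text \<open>Expanded in powers of \<open>1 / z\<close>, the function \<open>z^k * outer z\<close> is
  a polynomial, plus \<open>m k / z\<close>, plus a series starting with \<open>1 / z^2\<close>. The
  first and the last part have primitives, \<open>- V (inverse z)\<close> for the last, so only the
  middle term contributes.\<close>

lemma outer_power_contour:
 assumes h: "valid_path h" "pathfinish h = pathstart h" "!!z. z : path_image h ==> s < norm z"
  and one: "((%z. 1 / z) has_contour_integral w) h"
 shows "((%z. z ^ k * outer z) has_contour_integral (w * m k)) h"
proof -
 have lowint: "((%z. m n * z ^ (k - Suc n)) has_contour_integral 0) h" if "n < k" for n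
 proof (rule Cauchy_theorem_primitive[of UNIV "%z. m n * z ^ (k - n) / of_nat (k - n)"])
  fix z :: complex
  have "k - n ~= 0" "k - n - 1 = k - Suc n" using that by auto
  thus "((%z. m n * z ^ (k - n) / of_nat (k - n)) has_field_derivative m n * z ^ (k - Suc n)) (at z within UNIV)"
   by (auto intro!: derivative_eq_intros)
 qed (use h in auto)
 define c where "c n = (case n of 0 => 0 | Suc j => m (Suc k + j) / of_nat (Suc j))" for n
 define V where "V z = (\<Sum>n. c n * z ^ n)" for z
 define v where "v z = (\<Sum>j. m (Suc k + j) * z ^ j)" for z
 have dV: "(V has_field_derivative v z) (at z)" if z: "norm z < 1 / s" for z
 proof -
  have "(V has_field_derivative (\<Sum>n. diffs c n * z ^ n)) (at z)"
   unfolding V_def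
  proof (rule termdiffs_strong'[OF _ z])
   fix z :: complex assume z: "norm z < 1 / s"
   have "summable (%j. c (Suc j) * z ^ Suc j)"
   proof (rule summable_comparison_test')
    show "summable (%j. norm (m (Suc k + j) * z ^ j) * norm z)" by (intro summable_mult2 moment_power_abs_summable z)
    show "norm (c (Suc j) * z ^ Suc j) <= norm (m (Suc k + j) * z ^ j) * norm z" if "j >= 0" for j
    proof -
     let ?e = "norm (m (Suc k + j))"
     have "norm (c (Suc j)) <= ?e / 1"
     proof -
      have "?e / real (Suc j) <= ?e / 1" by (rule divide_left_mono) auto
      thus ?thesis unfolding c_def nat.case norm_divide norm_of_nat .
     qed
     hence "norm (c (Suc j)) * (norm z ^ j * norm z) <= ?e * (norm z ^ j * norm z)"
      by (intro mult_right_mono) auto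
     thus ?thesis by (simp add: norm_mult norm_power mult_ac)
    qed
   qed
   thus "summable (%n. c n * z ^ n)" by (subst summable_Suc_iff[symmetric])
  qed
  moreover have "diffs c n = m (Suc k + n)" for n
   unfolding diffs_def c_def by (simp del: of_nat_Suc)
  ultimately show ?thesis by (simp add: v_def)
 qed
 have inv: "norm (inverse z) < 1 / s" if "s < norm z" for z :: complex
 proof -
  have "0 < norm z" using that s by linarith
  thus ?thesis using that s by (simp add: norm_divide inverse_eq_divide field_simps)
 qed
 have tail: "((%z. v (inverse z) * inverse z ^ 2) has_contour_integral 0) h"
 proof (rule Cauchy_theorem_primitive[of "{z. s < norm z}" "%z. - V (inverse z)"])
  fix z :: complex assume z: "z : {z. s < norm z}"
  hence z0: "z ~= 0" using s by auto
  let ?b = "(%z. - V (inverse z)) has_field_derivative v (inverse z) * inverse z ^ 2"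
  have "((%z. V (inverse z)) has_field_derivative v (inverse z) * (- (inverse z ^ 2))) (at z)"
   by (rule DERIV_chain2[OF dV]) (use z z0 inv in "auto intro!: derivative_eq_intros simp: power2_eq_square")
  hence "?b (at z)"
   by (auto intro!: derivative_eq_intros)
  thus "?b (at z within {z. s < norm z})"
   by (rule has_field_derivative_at_within)
 qed (use h in auto)
 let ?a = "%z. SUM n<k. m n * z ^ (k - Suc n)"
 let ?d = "%z. (?a z) + m k * (1 / z) + v (inverse z) * inverse z ^ 2"
 have "(?d has_contour_integral ((SUM n<k. 0) + m k * w + 0)) h"
  by (intro has_contour_integral_add has_contour_integral_sum has_contour_integral_lmul lowint one tail) auto
 hence 1: "(?d has_contour_integral (w * m k)) h"
  by (simp add: mult.commute)
 show ?thesis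
 proof (rule has_contour_integral_eq[OF 1])
  fix z assume "z : path_image h"
  hence z: "s < norm z" by (rule h)
  hence z0: "z ~= 0" using s by auto
  have sm: "summable (%n. m n * inverse z ^ Suc n)" and so: "outer z = (\<Sum>n. m n * inverse z ^ Suc n)"
   using outer_sums[OF z] by (auto simp: sums_iff)
  let ?c = "v (inverse z) * inverse z ^ Suc (Suc k)"
  let ?f = "\<Sum>n. m (n + Suc k) * inverse z ^ Suc (n + Suc k)"
  let ?g = "SUM n<Suc k. z ^ k * (m n * inverse z ^ Suc n)"
  have "outer z = ?f + (SUM n<Suc k. m n * inverse z ^ Suc n)"
   unfolding so by (rule suminf_split_initial_segment[OF sm])
  also have "?f = ?c"
   unfolding v_def using moment_power_sums[OF inv[OF z], of "Suc k"]
   by (subst suminf_mult2) (auto simp: power_add mult_ac add_ac)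
  finally have "z ^ k * outer z = z ^ k * ?c + ?g"
   by (simp add: distrib_left sum_distrib_left del: power_Suc sum.lessThan_Suc)
  also have "z ^ k * ?c = v (inverse z) * inverse z ^ 2"
   using z0 by (simp add: power2_eq_square field_simps)
  also have "?g = (?a z) + m k * (1 / z)"
  proof -
   have "z ^ k * inverse z ^ Suc n = z ^ (k - Suc n)" if "n < k" for n
    using z0 that by (simp add: power_diff power_inverse divide_inverse del: power_Suc)
   hence "(SUM n<k. z ^ k * (m n * inverse z ^ Suc n)) = (?a z)"
    by (intro sum.cong refl) (simp add: mult_ac del: power_Suc)
   moreover have "z ^ k * (m k * inverse z ^ Suc k) = m k * (1 / z)" using z0 by (simp add: field_simps)
   ultimately show ?thesis by simp
  qed
  finally show "(?a z) + m k * (1 / z) + v (inverse z) * inverse z ^ 2 = z ^ k * outer z" by simp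
 qed
qed

end

section \<open>The boundary of a Stolz domain and the contour formula\<close>

text \<open>Boundary of the Stolz domain of angle \<open>pi / 2 - e\<close>, whose disc has radius
  \<open>cos e\<close>. The segments from 1 are the tangents to this disc; they touch it at
  \<open>cos e * cis e\<close> and its conjugate.\<close>

definition stolz_path :: "real => real => complex" where
 "stolz_path e = linepath 1 (of_real (cos e) * cis e) +++ (part_circlepath 0 (cos e) e (2 * pi - e) +++ linepath (of_real (cos e) * cis (- e)) 1)"

definition ray :: "real => real => complex" where
 "ray e t = 1 + of_real (t * sin e) * (\<i> * cis e)"

lemma ray_conv: "linepath 1 (of_real (cos e) * cis e) t = ray e t"
proof -
 have "cos e * cos e - 1 = - (sin e * sin e)" using sin_cos_squared_add[of e] by (simp add: power2_eq_square)
 hence "of_real (cos e) * cis e - 1 = of_real (sin e) * (\<i> * cis e)"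
  by (simp add: complex_eq_iff)
 moreover have "linepath 1 (of_real (cos e) * cis e) t = 1 + of_real t * (of_real (cos e) * cis e - 1)"
  by (simp add: linepath_def scaleR_conv_of_real algebra_simps)
 ultimately show ?thesis by (simp add: ray_def mult.assoc)
qed

lemma stolz_path_props:
 shows "valid_path (stolz_path e)" "pathfinish (stolz_path e) = pathstart (stolz_path e)"
 by (auto simp: stolz_path_def cis_conv_exp exp_diff exp_minus inverse_eq_divide ring_distribs exp_two_pi_i' mult_ac
  intro!: valid_path_join)

lemma stolz_path_winding:
 assumes "0 < e" "e < pi / 2"
 shows "((%z. 1 / z) has_contour_integral (2 * pi * \<i>)) (stolz_path e)"
proof -
 have ce: "0 < cos e" using assms by (intro cos_gt_zero_pi) auto
 define P :: "complex set" where "P = {z. 0 < Re z}"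
 have cv: "convex P" unfolding P_def by (rule convex_halfspace_Re_gt)
 let ?c = "%z. 1 / z"
 have LnP: "(?c has_contour_integral (Ln b - Ln a)) (linepath a b)" if ab: "a : P" "b : P" for a b
 proof -
  let ?e = "linepath a b"
  have "(?c has_contour_integral (Ln (pathfinish ?e) - Ln (pathstart ?e))) ?e"
  proof (rule contour_integral_primitive[of P])
   fix z assume "z : P"
   hence "z ~: \<real>\<^sub>\<le>\<^sub>0" by (auto simp: P_def complex_nonpos_Reals_iff)
   thus "(Ln has_field_derivative 1 / z) (at z within P)"
    by (auto intro!: derivative_eq_intros simp: inverse_eq_divide)
  qed (use ab cv in "auto simp: closed_segment_subset")
  thus ?thesis by simp
 qed
 let ?a = "of_real (cos e)"
 have Lnc: "Ln (?a * cis x) = of_real (ln (cos e)) + \<i> * of_real x" if "\<bar>x\<bar> < pi" for x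
 proof -
  have "?a * cis x = exp (of_real (ln (cos e)) + \<i> * of_real x)"
   using ce by (simp add: exp_add cis_conv_exp exp_of_real)
  thus ?thesis using that by (simp add: Ln_exp)
 qed
 have aP: "?a * cis e : P" "?a * cis (- e) : P" "1 : P"
  using ce by (auto simp: P_def)
 let ?d = "of_real (2 * pi - 2 * e)"
 have arc: "(?c has_contour_integral (\<i> * ?d)) (part_circlepath 0 (cos e) e (2 * pi - e))"
 proof (subst has_contour_integral_part_circlepath_iff)
  show "e < 2 * pi - e" using assms by simp
  have "((%t. \<i>) has_integral \<i> * ?d) {e..2 * pi - e}"
   using has_integral_const_real[of "\<i>" e "2 * pi - e"] assms by (simp add: scaleR_conv_of_real mult.commute algebra_simps)
  thus "((%t. 1 / (0 + ?a * cis t) * ?a * \<i> * cis t) has_integral (\<i> * ?d)) {e..2 * pi - e}"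
   using ce by (simp add: cis_neq_zero)
 qed
 let ?b = "(Ln (?a * cis e) - Ln 1) + (\<i> * of_real (2 * pi - 2 * e) + (Ln 1 - Ln (?a * cis (- e))))"
 have "(?c has_contour_integral ?b) (stolz_path e)"
  unfolding stolz_path_def
  by (intro has_contour_integral_join LnP arc aP valid_path_join valid_path_part_circlepath valid_path_linepath)
   (auto simp: cis_conv_exp exp_diff exp_minus ring_distribs mult_ac divide_inverse)
 also have "?b = 2 * pi * \<i>"
 proof -
  have b: "\<bar>e\<bar> < pi" "\<bar>- e\<bar> < pi" using assms by auto
  show ?thesis unfolding Lnc[OF b(1)] Lnc[OF b(2)] by (simp add: algebra_simps)
 qed
 finally show ?thesis .
qed

text \<open>The mirror image \<open>c\<close> of \<open>ray e t\<close> in the line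
  \<open>Re z = 1\<close>. Then \<open>|c - 1| = t * sin e\<close>, the step to the ray has length
  \<open>2 * t * (sin e)^2\<close>, that is \<open>2 * sin e * |c - 1|\<close>, and
  \<open>|c| - 1\<close> is at least \<open>|c - 1| * sin e / 2\<close>: the center keeps a
  nontangential distance from the circle, as the maximal estimates require.\<close>

definition ray_center :: "real => real => complex" where
 "ray_center e t = 1 + of_real (t * sin e) * (\<i> * cis (- e))"

lemma sum_sq_shift: "(a + r * S)^2 + (r * C)^2 = a^2 + 2 * (a * r * S) + r^2 * (S^2 + C^2)" for a r S C :: real
 by (simp add: power2_eq_square algebra_simps)

lemma ray_facts:
 assumes e: "0 < e" "e < 1/16" and t: "0 < t" "t <= 1"
 shows "norm (ray e t - 1) = t * sin e" "0 < norm (ray e t)" "norm (ray e t) < 1"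
  "1 - norm (ray e t) <= 2 * sin e * (t * sin e)" "norm (ray e t) <= 1 - sin e / 2 * (t * sin e)"
  "norm (ray_center e t - 1) = t * sin e" "1 <= norm (ray_center e t)" "norm (ray_center e t) <= 2"
  "ray_center e t - ray e t = of_real (2 * t * (sin e)^2)"
  "norm (ray_center e t) >= 1 + (t * sin e) * sin e / 2"
proof -
 define rh where "rh = t * sin e"
 have se: "0 < sin e" "sin e <= 1/16" using e sin_x_le_x[of e] pi_gt3 by (auto intro: sin_gt_zero)
 have r: "0 < rh" "rh <= sin e" using se t by (auto simp: rh_def mult_left_le_one_le)
 show 1: "norm (ray e t - 1) = t * sin e" "norm (ray_center e t - 1) = t * sin e"
  using se t by (auto simp: ray_def ray_center_def norm_mult abs_mult)
 let ?a = "norm (ray e t)"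
 let ?e = "(sin e)^2 + (cos e)^2"
 have n2: "?a^2 = 1 - 2 * rh * sin e + rh\<^sup>2"
 proof -
  have "?a^2 = (1 + rh * (- sin e))^2 + (rh * cos e)^2" by (simp add: cmod_power2 ray_def rh_def)
  also have "... = 1 - 2 * rh * sin e + rh\<^sup>2 * ?e" unfolding sum_sq_shift by simp
  finally show ?thesis by simp
 qed
 let ?b = "norm (ray_center e t)"
 have c2: "?b^2 = 1 + 2 * rh * sin e + rh\<^sup>2"
 proof -
  have "?b^2 = (1 + rh * sin e)^2 + (rh * cos e)^2" by (simp add: cmod_power2 ray_center_def rh_def)
  also have "... = 1 + 2 * rh * sin e + rh\<^sup>2 * ?e" unfolding sum_sq_shift by simp
  finally show ?thesis by simp
 qed
 let ?c = "rh * sin e"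
 have rr: "rh\<^sup>2 <= ?c" using r by (simp add: power2_eq_square mult_left_mono)
 have rs: "?c <= 1/256" using r se mult_mono[of rh "1/16" "sin e" "1/16"] by simp
 have rs0: "0 < ?c" using r se by simp
 have n_le: "?a^2 <= 1 - rh * sin e" using n2 rr by simp
 show "0 < ?a"
 proof -
  have "0 < ?a^2" using n2 rs zero_le_power2[of rh] by linarith
  thus ?thesis by (metis norm_ge_zero order_le_less zero_less_power2)
 qed
 have "?a^2 <= (1 - rh * sin e / 2)^2"
 proof -
  have "1 - x <= (1 - x / 2)^2" for x :: real using zero_le_power2[of "x / 2"] by (simp add: power2_eq_square algebra_simps)
  thus ?thesis using n_le order_trans by blast
 qed
 hence nle: "?a <= 1 - rh * sin e / 2" by (rule power2_le_imp_le) (use rs in auto)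
 thus "?a <= 1 - sin e / 2 * (t * sin e)" by (simp add: rh_def mult_ac)
 show lt1: "?a < 1" using nle rs0 by linarith
 have "?a^2 <= ?a" using lt1 by (simp add: power2_eq_square mult_left_le_one_le)
 hence "1 - ?a <= 2 * rh * sin e" using n2 zero_le_power2[of rh] by linarith
 thus "1 - ?a <= 2 * sin e * (t * sin e)" by (simp add: rh_def mult_ac)
 let ?d = "1 + rh * sin e / 2"
 have "?d^2 <= ?b^2"
 proof -
  have "?c * ?c <= ?c * 1" using rs rs0 by (intro mult_left_mono) auto
  hence "(rh * sin e / 2)^2 <= ?c" using rs0 by (simp add: power2_eq_square)
  moreover have "?d^2 = 1 + rh * sin e + (rh * sin e / 2)^2" by (simp add: power2_eq_square algebra_simps)
  moreover have "2 * rh * sin e = rh * sin e + rh * sin e" by simp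
  ultimately show ?thesis using c2 zero_le_power2[of rh] by linarith
 qed
 hence "?d <= ?b" by (rule power2_le_imp_le) simp
 thus "?b >= 1 + (t * sin e) * sin e / 2" "1 <= ?b" using rs0 by (auto simp: rh_def)
 have "?b^2 <= 2^2" using c2 rs rr by simp
 thus "?b <= 2" by (rule power2_le_imp_le) simp
 show "ray_center e t - ray e t = of_real (2 * t * (sin e)^2)"
  by (simp add: ray_center_def ray_def complex_eq_iff power2_eq_square)
qed

context resolvent_moment
begin

lemma centers_cnj: "c : centers ==> cnj c : centers" "rad (cnj c) = rad c"
proof -
 have "norm (cnj c - 1) = norm (c - 1)" by (metis complex_cnj_diff complex_cnj_one complex_mod_cnj)
 thus "rad (cnj c) = rad c" by (simp add: rad_def)
qed (auto simp: centers_def)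

text \<open>A boundary point \<open>l\<close> is reached from its radial projection
  \<open>l / norm l\<close>: it is within \<open>2 * sin e * rh\<close> of the circle, while
  \<open>|l - 1|\<close> is at least \<open>rh\<close> and \<open>16 * K * e < 1\<close>. A multiple
  \<open>ta * l\<close> with \<open>ta >= 1\<close> either lies outside radius \<open>s\<close> or
  is still between \<open>l\<close> and the projection, so it stays in the domain; these multiples
  carry the homotopy.\<close>

lemma radial:
 fixes l :: complex
 assumes e: "0 < e" "16 * K * e < 1" and l: "0 < norm l" "norm l < 1" and r: "0 < rh" "rh <= norm (l - 1)" "1 - norm l <= 2 * sin e * rh"
 shows "l / norm l : centers" "l : ball (l / norm l) (rad (l / norm l))" "1 <= ta ==> of_real ta * l : ext_dom"
proof -
 define c where "c = l / norm l"
 have nc: "norm c = 1" using l by (simp add: c_def norm_divide)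
 have e16: "e < 1/16" using e K mult_right_mono[of 1 K e] by linarith
 have se: "0 < sin e" "sin e <= e" using e e16 sin_x_le_x[of e] pi_gt3 by (auto intro: sin_gt_zero)
 have dist: "norm (of_real ta * l - c) = \<bar>1 - ta * norm l\<bar>" for ta :: real
 proof -
  let ?b = "of_real (ta * norm l - 1) * c"
  have "of_real ta * l - c = ?b" using l by (simp add: c_def algebra_simps)
  moreover have "norm ?b = \<bar>ta * norm l - 1\<bar>" unfolding norm_mult norm_of_real nc by simp
  ultimately show ?thesis by (simp add: abs_minus_commute)
 qed
 let ?c = "norm (c - 1)"
 have "norm (l - 1) <= ?c + norm (l - c)" using norm_triangle_ineq[of "c - 1" "l - c"] by simp
 hence c1: "rh - (1 - norm l) <= ?c" using dist[of 1] l r by simp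
 have K16: "16 * (K * sin e) < 1" using e se K mult_left_mono[of "sin e" e K] by linarith
 have "2 * sin e <= 1/8" using e16 se by linarith
 hence "2 * sin e * rh <= 1/8 * rh" using r by (intro mult_right_mono) auto
 hence c2: "7/8 * rh <= ?c" using c1 r by linarith
 show cc: "l / norm l : centers" using c2 r nc unfolding c_def[symmetric] centers_def by auto
 have "2 * sin e * rh * (4 * K) = (8 * (K * sin e)) * rh" by simp
 also have "... < 7/8 * rh" using K16 r by (intro mult_strict_right_mono) auto
 also have "... <= ?c" by (rule c2)
 finally have "2 * sin e * rh < rad c" using K by (simp add: rad_def pos_less_divide_eq)
 hence lr: "1 - norm l < rad c" using r by simp
 thus "l : ball (l / norm l) (rad (l / norm l))"
  unfolding c_def[symmetric] using dist[of 1] l by (simp add: dist_norm norm_minus_commute)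
 let ?a = "of_real ta"
 show "?a * l : ext_dom" if "1 <= ta"
 proof (cases "s < norm (?a * l)")
  case True thus ?thesis by (simp add: ext_dom_def)
 next
  case False
  hence "ta * norm l <= s" using that by (simp add: norm_mult)
  moreover have "norm l <= ta * norm l" using that l by (simp add: mult_le_cancel_right1)
  ultimately have "norm (?a * l - c) < rad c" using dist[of ta] lr s by simp
  hence "?a * l : ball c (rad c)" by (simp add: dist_norm norm_minus_commute)
  thus ?thesis unfolding ext_dom_def using cc c_def by blast
 qed
qed

context
 fixes e :: real
 assumes e: "0 < e" "16 * K * e < 1"
begin

lemma e16: "e < 1/16" using e K mult_right_mono[of 1 K e] by linarith

lemma ray_dom:
 assumes t: "0 <= t" "t <= 1" and tau: "1 <= ta"
 shows "of_real ta * ray e t : ext_dom" "of_real ta * cnj (ray e t) : ext_dom"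
proof -
 have "of_real ta * ray e t : ext_dom & of_real ta * cnj (ray e t) : ext_dom"
 proof (cases "t = 0")
  case True
  thus ?thesis using tau s by (simp add: ray_def ext_dom_def)
 next
  case False
  hence t0: "0 < t" using t by simp
  note f = ray_facts[OF e(1) e16 t0 t(2)]
  have "0 < sin e" using e e16 pi_gt3 by (intro sin_gt_zero) auto
  hence se: "0 < t * sin e" using t0 by simp
  have "norm (cnj (ray e t) - 1) = norm (ray e t - 1)" by (metis complex_cnj_diff complex_cnj_one complex_mod_cnj)
  thus ?thesis
   using radial(3)[OF e, of "ray e t" "t * sin e" ta] radial(3)[OF e, of "cnj (ray e t)" "t * sin e" ta] f se tau by auto
 qed
 thus "of_real ta * ray e t : ext_dom" "of_real ta * cnj (ray e t) : ext_dom" by auto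
qed

lemma arc_radial:
 assumes th: "e <= th" "th <= 2 * pi - e"
 shows "cis th : centers" "of_real (cos e) * cis th : ball (cis th) (rad (cis th))" "1 <= ta ==> of_real ta * (of_real (cos e) * cis th) : ext_dom"
  "sin e <= norm (cis th - 1)"
proof -
 have ce: "0 < cos e" "cos e < 1" using e e16 pi_gt3 cos_monotone_0_pi[of 0 e] by (auto intro!: cos_gt_zero_pi)
 have se: "0 < sin e" using e e16 pi_gt3 by (auto intro: sin_gt_zero)
 let ?b = "cos th"
 have ct: "?b <= cos e"
 proof (cases "th <= pi")
  case True thus ?thesis using th e by (intro cos_monotone_0_pi_le) auto
 next
  case False
  have "cos (2 * pi - th) <= cos e" using False th e by (intro cos_monotone_0_pi_le) auto
  thus ?thesis by (simp add: cos_diff)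
 qed
 let ?a = "cis th"
 let ?c = "of_real (cos e)"
 define l where "l = ?c * ?a"
 have nl: "norm l = cos e" using ce by (simp add: l_def norm_mult)
 have cl: "l / ?c = ?a" using ce by (simp add: l_def)
 let ?d = "?b^2 + (sin th)^2"
 let ?f = "norm (l - 1)"
 have "(sin e)^2 <= ?f^2"
 proof -
  have "?f^2 = (- 1 + cos e * ?b)^2 + (cos e * sin th)^2" by (simp add: cmod_power2 l_def)
  also have "... = (cos e)^2 * ?d + 1 - 2 * (cos e * ?b)" unfolding sum_sq_shift by simp
  also have "... = (cos e)^2 + 1 - 2 * (cos e * ?b)" by simp
  also have "... >= (cos e)\<^sup>2 + 1 - 2 * (cos e * cos e)" using ct ce by (simp add: mult_left_mono)
  finally show ?thesis using sin_cos_squared_add[of e] by (simp add: power2_eq_square)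
 qed
 hence l1: "sin e <= ?f" by (rule power2_le_imp_le) simp
 have "(cos e)^2 <= cos e" using ce by (simp add: power2_eq_square mult_left_le_one_le)
 moreover have "2 * sin e * sin e = 2 * (sin e)^2" by (simp add: power2_eq_square)
 ultimately have l2: "1 - cos e <= 2 * sin e * sin e" using sin_cos_squared_add[of e] zero_le_power2[of "sin e"] by linarith
 note R = radial[OF e, of l "sin e", unfolded nl cl, OF ce(1,2) se l1 l2]
 let ?e = "norm (?a - 1)"
 have "(sin e)^2 <= ?e^2"
 proof -
  have "?e^2 = (- 1 + 1 * ?b)^2 + (1 * sin th)^2" by (simp add: cmod_power2)
  also have "... = ?d + 1 - 2 * ?b" unfolding sum_sq_shift by simp
  also have "... = 2 - 2 * ?b" by simp
  also have "... >= 2 - 2 * cos e" using ct by simp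
  also have "2 - 2 * cos e = (sin e)^2 + (1 - cos e)^2" using sin_cos_squared_add[of e] by (simp add: power2_eq_square algebra_simps)
  finally show ?thesis using zero_le_power2[of "1 - cos e"] by linarith
 qed
 thus "sin e <= ?e" by (rule power2_le_imp_le) simp
 show "?a : centers" "?c * ?a : ball ?a (rad ?a)" using R(1,2) by (auto simp: l_def)
 show "1 <= ta ==> of_real ta * (?c * ?a) : ext_dom" using R(3) by (simp add: l_def)
qed

text \<open>Radial projections are enough for the domain, but they lie on the circle, where the
  coefficients of the resolvent are not summable. The value on the ray is therefore expanded around
  \<open>ray_center\<close>, whose disc contains the same point.\<close>

lemma ray_value:
 assumes t: "0 < t" "t <= 1"
 shows "ext (ray e t) = (\<Sum>j. tcoeff (ray_center e t) j * of_real (2 * t * (sin e)^2) ^ j)"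
  "ext (cnj (ray e t)) = (\<Sum>j. tcoeff (cnj (ray_center e t)) j * of_real (2 * t * (sin e)^2) ^ j)"
proof -
 note f = ray_facts[OF e(1) e16 t]
 define c where "c = ray_center e t"
 have se: "0 < sin e" "sin e <= e" using e e16 sin_x_le_x[of e] pi_gt3 by (auto intro: sin_gt_zero)
 have cc: "c : centers" unfolding centers_def c_def using f t se by auto
 have "norm (c - ray e t) = \<bar>2 * t * (sin e)^2\<bar>" unfolding c_def f(9) norm_of_real ..
 also have "... = 2 * t * sin e * sin e" using t by (simp add: power2_eq_square abs_mult)
 also have "... < t * sin e / (4 * K)"
 proof -
  have "8 * (K * sin e) < 1" using e se K mult_left_mono[of "sin e" e K] by linarith
  hence "(t * sin e) * (8 * (K * sin e)) < (t * sin e) * 1" using t se by (intro mult_strict_left_mono) auto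
  thus ?thesis using K by (simp add: pos_less_divide_eq mult_ac)
 qed
 finally have d: "norm (c - ray e t) < rad c" by (simp add: rad_def f c_def)
 hence d': "norm (cnj c - cnj (ray e t)) < rad (cnj c)" by (metis centers_cnj(2) complex_cnj_diff complex_mod_cnj)
 have "ext (ray e t) = local_ext c (ray e t)" using d by (intro ext_eq_local cc) (simp add: dist_norm)
 thus "ext (ray e t) = (\<Sum>j. tcoeff (ray_center e t) j * of_real (2 * t * (sin e)^2) ^ j)"
  unfolding local_ext_def c_def f(9) .
 have "ext (cnj (ray e t)) = local_ext (cnj c) (cnj (ray e t))" using d' by (intro ext_eq_local centers_cnj cc) (simp add: dist_norm)
 moreover have "cnj c - cnj (ray e t) = of_real (2 * t * (sin e)^2)"
  by (metis c_def f(9) complex_cnj_diff complex_cnj_complex_of_real)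
 ultimately show "ext (cnj (ray e t)) = (\<Sum>j. tcoeff (cnj (ray_center e t)) j * of_real (2 * t * (sin e)^2) ^ j)"
  unfolding local_ext_def c_def by simp
qed

lemma arc_value:
 assumes th: "e <= th" "th <= 2 * pi - e"
 shows "ext (of_real (cos e) * cis th) = (\<Sum>j. tcoeff (cis th) j * (of_real (1 - cos e) * cis th) ^ j)"
proof -
 have "ext (of_real (cos e) * cis th) = local_ext (cis th) (of_real (cos e) * cis th)"
  by (intro ext_eq_local arc_radial th)
 moreover have "cis th - of_real (cos e) * cis th = of_real (1 - cos e) * cis th" by (simp add: algebra_simps)
 ultimately show ?thesis unfolding local_ext_def by simp
qed

lemma cnj_ray: "linepath 1 (of_real (cos e) * cis (- e)) t = cnj (ray e t)"
proof -
 have "linepath 1 (of_real (cos e) * cis (- e)) t = cnj (linepath 1 (of_real (cos e) * cis e) t)"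
  by (simp add: linepath_def complex_eq_iff)
 thus ?thesis by (simp add: ray_conv)
qed

text \<open>The dilation from the path to its double stays in the domain of \<open>ext\<close>, so
  the integral of the holomorphic \<open>poly G * ext\<close> does not change. The doubled path lies
  outside the unit circle, where \<open>ext\<close> is \<open>outer\<close> and
  \<open>outer_power_contour\<close> gives the moments.\<close>

theorem contour_representation:
 "2 * pi * \<i> * pmoment m G =
  integral {0..1} (%t. poly G (ray e t) * ext (ray e t) * (of_real (sin e) * (\<i> * cis e)))
 + integral {0..1} (%t. poly G (cnj (ray e t)) * ext (cnj (ray e t)) * (of_real (sin e) * (\<i> * cis (- e))))
 + integral {e..2*pi-e} (%th. poly G (of_real (cos e) * cis th) * ext (of_real (cos e) * cis th) * (of_real (cos e) * \<i> * cis th))"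
 (is "_ = ?I1 + ?I2 + ?I3")
 "continuous_on {0..1} (%t. ext (ray e t))" "continuous_on {0..1} (%t. ext (cnj (ray e t)))"
 "continuous_on {e..2*pi-e} (%th. ext (of_real (cos e) * cis th))"
proof -
 define g where "g = stolz_path e"
 define h where "h = (%z. 2 * z) \<circ> g"
 define f where "f z = poly G z * ext z" for z
 have epi: "e < pi / 2" "e < 2 * pi - e" using e16 pi_gt3 by auto
 have vg: "valid_path g" "pathfinish g = pathstart g" using stolz_path_props by (auto simp: g_def)
 have vh: "valid_path h" unfolding h_def
  by (rule valid_path_compose_holomorphic[OF vg(1), of _ UNIV]) (auto intro!: holomorphic_intros)
 have ph: "pathfinish h = pathstart h" using vg(2) by (simp add: h_def pathfinish_def pathstart_def)
 let ?a = "of_real (cos e)"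
 let ?c = "part_circlepath 0 (cos e) e (2 * pi - e)"
 let ?d = "%t. cnj (ray e t)"
 let ?h = "?a * cis (- e)"
 let ?j = "%th. ?a * cis th"
 let ?q = "path_image g"
 have pi: "?q = ray e ` {0..1} \<union> (?j ` {e..2*pi-e} \<union> ?d ` {0..1})"
 proof -
  have p1: "path_image (linepath 1 (?a * cis e)) = ray e ` {0..1}"
   unfolding path_image_def ray_conv ..
  have "closed_segment ?h 1 = path_image (linepath 1 ?h)" by (simp add: closed_segment_commute)
  also have "... = ?d ` {0..1}" unfolding path_image_def cnj_ray ..
  finally have p3: "path_image (linepath ?h 1) = ?d ` {0..1}" by simp
  have p2: "path_image ?c = ?j ` {e..2*pi-e}"
   unfolding path_image_part_circlepath' using epi by (simp add: closed_segment_eq_real_ivl)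
  show ?thesis unfolding g_def stolz_path_def
   by (subst path_image_join, simp add: cis_conv_exp, subst path_image_join, simp add: cis_conv_exp exp_diff exp_minus ring_distribs mult_ac divide_inverse)
    (simp only: p1 p2 p3)
 qed
 have dom: "of_real ta * z : ext_dom" if "z : ?q" "1 <= ta" for z ta
  using that ray_dom arc_radial(3) unfolding pi by auto
 have dom1: "z : ext_dom" if "z : ?q" for z using dom[OF that, of 1] by simp
 have fh: "f holomorphic_on ext_dom" unfolding f_def by (intro holomorphic_intros ext_holomorphic)
 let ?f = "%t. closed_segment (g t) (h t)"
 have hom: "homotopic_loops ext_dom g h"
 proof (rule homotopic_loops_linear)
  show "path g" "path h" using vg vh by (auto simp: valid_path_imp_path)
  fix t :: real assume t: "t : {0..1}"
  show "?f t \<subseteq> ext_dom"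
  proof
   fix z assume "z : ?f t"
   then obtain u where u: "0 <= u" "u <= 1" "z = (1 - u) *\<^sub>R g t + u *\<^sub>R h t" by (auto simp: closed_segment_def)
   have "z = of_real (1 + u) * g t" unfolding u(3) h_def by (simp add: scaleR_conv_of_real algebra_simps)
   thus "z : ext_dom" using dom[of "g t" "1 + u"] t u by (auto simp: path_image_def)
  qed
 qed (use vg ph in auto)
 have hs: "1 < norm z" if z: "z : path_image h" for z
 proof -
  obtain y where y: "y : ?q" "z = 2 * y" using z by (auto simp: h_def path_image_compose)
  have "1/2 < norm y"
  proof -
   have "1/2 < norm (ray e t)" if "0 <= t" "t <= 1" for t
   proof (cases "t = 0")
    case False
    note f = ray_facts[OF e(1) e16, of t]
    have se: "0 < sin e" "sin e <= 1/16" using e e16 sin_x_le_x[of e] pi_gt3 by (auto intro: sin_gt_zero)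
    have "2 * sin e * (t * sin e) <= 2 * (1/16) * (1 * (1/16))" using se that by (intro mult_mono) auto
    thus ?thesis using f False that by simp
   qed (simp add: ray_def)
   moreover have "1/2 < cos e" using cos_monotone_0_pi[of e "pi/3"] e e16 pi_gt3 by (simp add: cos_60)
   ultimately show ?thesis using y(1) unfolding pi by (auto simp: norm_mult)
  qed
  thus ?thesis using y(2) by (simp add: norm_mult)
 qed
 let ?b = "%z. 1 / z"
 let ?i = "?b has_contour_integral (2 * pi * \<i>)"
 \<comment> \<open>The winding number is transported by the same dilation, now in the plane without
   0.\<close>
 have one: "?i h"
 proof -
  have i: "?i g" unfolding g_def by (rule stolz_path_winding) (use e epi in auto)
  have hol: "?b holomorphic_on (- {0 :: complex})" by (intro holomorphic_intros) auto
  have hom0: "homotopic_loops (- {0}) g h"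
  proof (rule homotopic_loops_linear)
   show "path g" "path h" using vg vh by (auto simp: valid_path_imp_path)
   fix t :: real assume t: "t : {0..1}"
   have "h t : path_image h" using t by (auto simp: path_image_def)
   hence g0: "g t ~= 0" using hs[of "h t"] by (auto simp: h_def)
   show "?f t \<subseteq> - {0}"
   proof
    fix z assume "z : ?f t"
    then obtain u where u: "0 <= u" "u <= 1" "z = (1 - u) *\<^sub>R g t + u *\<^sub>R h t" by (auto simp: closed_segment_def)
    have "z = of_real (1 + u) * g t" unfolding u(3) h_def by (simp add: scaleR_conv_of_real algebra_simps)
    moreover have "of_real (1 + u) ~= (0 :: complex)" using u by (simp only: of_real_eq_0_iff)
    ultimately show "z : - {0}" using g0 by simp
   qed
  qed (use vg ph in auto)
  have "contour_integral g ?b = contour_integral h ?b"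
   by (rule Cauchy_theorem_homotopic_loops[OF hom0 _ hol vg(1) vh]) auto
  moreover have "?b contour_integrable_on h"
   by (rule contour_integrable_holomorphic_simple[OF hol _ vh]) (use hs in force)+
  ultimately show ?thesis using contour_integral_unique[OF i] by (metis has_contour_integral_integral)
 qed
 let ?e = "SUM k<=degree G. coeff G k * (2 * pi * \<i> * m k)"
 let ?g = "2 * pi * \<i> * pmoment m G"
 let ?k = "contour_integral g f"
 have "((%z. SUM k<=degree G. coeff G k * (z ^ k * outer z)) has_contour_integral ?e) h"
  by (intro has_contour_integral_sum has_contour_integral_lmul outer_power_contour vh ph one) (use hs s in "force+")
 hence "(f has_contour_integral ?e) h"
 proof (rule has_contour_integral_eq)
  fix z assume "z : path_image h"
  hence "s < norm z" using hs s by force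
  thus "(SUM k<=degree G. coeff G k * (z ^ k * outer z)) = f z"
   by (simp add: f_def ext_def poly_altdef sum_distrib_right mult.assoc)
 qed
 hence "contour_integral h f = ?g"
  by (simp add: contour_integral_unique pmoment_def sum_distrib_left mult_ac)
 moreover have "?k = contour_integral h f"
  by (rule Cauchy_theorem_homotopic_loops[OF hom open_ext_dom fh vg(1) vh])
 ultimately have tot: "?g = ?k" by simp
 have contf: "continuous_on ext_dom f" using fh by (rule holomorphic_on_imp_continuous_on)
 define a where "a = ?a * cis e"
 define b where "b = ?h"
 let ?m = "closed_segment 1 a"
 let ?n = "closed_segment 1 b"
 have seg: "?m \<subseteq> ext_dom" "?n \<subseteq> ext_dom"
 proof -
  have "?m = ray e ` {0..1}" unfolding a_def path_image_linepath[symmetric] path_image_def ray_conv ..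
  thus "?m \<subseteq> ext_dom" using ray_dom(1)[of _ 1] by auto
  have "?n = ?d ` {0..1}" unfolding b_def path_image_linepath[symmetric] path_image_def cnj_ray ..
  thus "?n \<subseteq> ext_dom" using ray_dom(2)[of _ 1] by auto
 qed
 have i1: "f contour_integrable_on linepath 1 a" "f contour_integrable_on linepath b 1"
  using seg by (auto intro!: contour_integrable_continuous_linepath continuous_on_subset[OF contf] simp: closed_segment_commute)
 have i2: "f contour_integrable_on part_circlepath 0 (cos e) e (2 * pi - e)"
  by (rule contour_integrable_holomorphic_simple[OF fh open_ext_dom]) (use epi arc_radial(3)[of _ 1] in "auto simp: path_image_part_circlepath' closed_segment_eq_real_ivl")
 let ?l = "- contour_integral (linepath 1 b) f"
 let ?o = "contour_integral (linepath 1 a) f"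
 let ?p = "contour_integral (linepath b 1) f"
 have "?k = ?o + (contour_integral ?c f + ?p)"
  unfolding g_def stolz_path_def a_def[symmetric] b_def[symmetric]
  by (subst contour_integral_join, rule i1, rule contour_integrable_joinI)
   (use i1 i2 in "auto simp: a_def b_def cis_conv_exp exp_diff exp_minus ring_distribs mult_ac divide_inverse intro!: valid_path_join")
 also have "?o = ?I1"
 proof -
  have "a - 1 = of_real (sin e) * (\<i> * cis e)" using ray_conv[of e 1] by (simp add: a_def ray_def linepath_def)
  thus ?thesis unfolding contour_integral_integral by (simp add: a_def ray_conv f_def)
 qed
 also have "contour_integral ?c f = ?I3"
  using epi by (subst contour_integral_part_circlepath_eq) (auto simp: f_def mult.assoc)
 also have "?p = ?l"
  by (rule contour_integral_reverse_linepath, rule continuous_on_subset[OF contf]) (use seg in "simp add: closed_segment_commute")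
 also have "?l = ?I2"
 proof -
  have "b - 1 = - (of_real (sin e) * (\<i> * cis (- e)))" using cnj_ray[of 1] by (simp add: b_def ray_def linepath_def cis_cnj)
  thus ?thesis unfolding contour_integral_integral integral_neg[symmetric] by (simp add: b_def cnj_ray f_def)
 qed
 finally show "?g = ?I1 + ?I2 + ?I3" using tot by simp
 have conte: "continuous_on ext_dom ext" by (rule holomorphic_on_imp_continuous_on[OF ext_holomorphic])
 show "continuous_on {0..1} (%t. ext (ray e t))" "continuous_on {0..1} (%t. ext (cnj (ray e t)))"
  by (rule continuous_on_compose2[OF conte]; use ray_dom[of _ 1] in "auto simp: ray_def intro!: continuous_intros")+
 show "continuous_on {e..2*pi-e} (%th. ext (?a * cis th))"
  by (rule continuous_on_compose2[OF conte]) (use arc_radial(3)[of _ 1] in "auto intro!: continuous_intros")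
qed

end

end

section \<open>The spaces L^p of representatives\<close>

text \<open>Real-valued norm, equal to \<open>lp_norm\<close> on \<open>Lp M p\<close>. For a
  non-integrable power the integral is 0 and the value is meaningless, so membership in
  \<open>Lp M p\<close> accompanies every estimate. From here on \<open>Ln\<close> no longer denotes
  the complex logarithm.\<close>

definition Ln :: "'a measure => real => ('a => complex) => real" where
 "Ln M p f = (\<integral>w. cmod (f w) powr p \<partial>M) powr (1 / p)"

lemma enn_powr_ennreal: "0 <= x ==> enn_powr (ennreal x) r = ennreal (x powr r)"
 by (simp add: enn_powr_def)

lemma lp_norm_nn:
 assumes p: "0 < p"
 shows "lp_norm M p f = enn_powr (\<integral>\<^sup>+w. ennreal (cmod (f w) powr p) \<partial>M) (1 / p)"
 by (simp add: lp_norm_def lpn_def enn_powr_ennreal)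

lemma Lp_iff:
 assumes p: "0 < p"
 shows "f : Lp M p \<longleftrightarrow> f : borel_measurable M & integrable M (%w. cmod (f w) powr p)"
proof -
 have "lp_norm M p f < \<infinity> \<longleftrightarrow> (\<integral>\<^sup>+w. ennreal (cmod (f w) powr p) \<partial>M) < \<infinity>"
  unfolding lp_norm_nn[OF p] by (auto simp: enn_powr_def top.not_eq_extremum)
 thus ?thesis by (auto simp: Lp_def integrable_iff_bounded)
qed

lemma LpD [measurable_dest]: "f : Lp M p ==> f : borel_measurable M"
 by (simp add: Lp_def)

lemma Ln_nonneg: "0 <= Ln M p f" by (simp add: Ln_def)

lemma Ln_powr:
 assumes "0 < p"
 shows "Ln M p f powr p = (\<integral>w. cmod (f w) powr p \<partial>M)"
 using assms by (simp add: Ln_def powr_powr integral_nonneg_AE)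

lemma lp_norm_Ln:
 assumes p: "0 < p" and f: "f : Lp M p"
 shows "lp_norm M p f = ennreal (Ln M p f)"
proof -
 have "(\<integral>\<^sup>+w. ennreal (cmod (f w) powr p) \<partial>M) = ennreal (\<integral>w. cmod (f w) powr p \<partial>M)"
  using f unfolding Lp_iff[OF p] by (intro nn_integral_eq_integral) auto
 thus ?thesis unfolding lp_norm_nn[OF p]
  by (simp add: enn_powr_ennreal Ln_def integral_nonneg_AE)
qed

lemma Lp_mono:
 assumes p: "0 < p" and g: "g : Lp M p" and f: "f : borel_measurable M"
  and le: "!!w. w : space M ==> cmod (f w) <= cmod (g w)"
 shows "f : Lp M p" "Ln M p f <= Ln M p g"
proof -
 have gi: "integrable M (%w. cmod (g w) powr p)" using g p by (simp add: Lp_iff)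
 have fi: "integrable M (%w. cmod (f w) powr p)"
  using f p le by (intro Bochner_Integration.integrable_bound[OF gi]) (auto intro!: powr_mono2)
 thus "f : Lp M p" using f p by (simp add: Lp_iff)
 show "Ln M p f <= Ln M p g" unfolding Ln_def
  using fi gi p le by (intro powr_mono2 integral_mono integral_nonneg_AE) (auto intro!: powr_mono2)
qed

lemma Lp_scale:
 assumes p: "0 < p" and f: "f : Lp M p"
 shows "(%w. c * f w) : Lp M p" "Ln M p (%w. c * f w) = cmod c * Ln M p f"
proof -
 let ?a = "%w. c * f w"
 show "?a : Lp M p"
  using f p by (auto simp: Lp_iff norm_mult powr_mult)
 show "Ln M p ?a = cmod c * Ln M p f"
  unfolding Ln_def using p
  by (simp add: norm_mult powr_mult powr_powr integral_nonneg_AE)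
qed

lemma Lp_zero: "0 < p ==> (%w. 0) : Lp M p" "0 < p ==> Ln M p (%w. 0) = 0"
 by (simp_all add: Lp_iff Ln_def)

lemma Lp_cong_AE:
 assumes p: "0 < p" and f: "f : Lp M p" and g: "g : borel_measurable M" and eq: "AE w in M. g w = f w"
 shows "g : Lp M p" "Ln M p g = Ln M p f"
proof -
 have fi: "integrable M (%w. cmod (f w) powr p)" using f p by (simp add: Lp_iff)
 have e: "AE w in M. cmod (f w) powr p = cmod (g w) powr p" using eq by eventually_elim simp
 have [measurable]: "f : borel_measurable M" using f by measurable
 note [measurable] = g
 show "g : Lp M p" using g p integrable_cong_AE_imp[OF fi _ e] by (simp add: Lp_iff)
 have "(\<integral>w. cmod (g w) powr p \<partial>M) = (\<integral>w. cmod (f w) powr p \<partial>M)"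
  using e by (intro integral_cong_AE) auto
 thus "Ln M p g = Ln M p f" by (simp add: Ln_def)
qed

lemma powr_le_cancel:
 fixes x y :: real
 assumes "0 < p" "0 <= y" "x powr p <= y powr p"
 shows "x <= y"
 using assms powr_less_mono2[of p y x] by (meson not_le)

lemma powr_convex2:
 fixes x y :: real
 assumes p: "1 < p" and "0 <= x" "0 <= y" "0 <= u" "0 <= v" "u + v <= 1"
 shows "(u * x + v * y) powr p <= u * x powr p + v * y powr p"
 using powr_mean[OF p, of "UNIV :: bool set" "%b. if b then u else v" "%b. if b then x else y"] assms
 by (simp add: UNIV_bool add.commute)

text \<open>Minkowski from convexity: with \<open>a\<close> and \<open>b\<close> slightly above the
  two norms, \<open>|f + g|\<close> is at most \<open>a + b\<close> times a convex combination of
  \<open>|f| / a\<close> and \<open>|g| / b\<close>. Strict upper bounds avoid dividing by a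
  vanishing norm.\<close>

lemma Lp_add:
 assumes p: "1 < p" and f: "f : Lp M p" and g: "g : Lp M p"
 shows "(%w. f w + g w) : Lp M p" "Ln M p (%w. f w + g w) <= Ln M p f + Ln M p g"
proof -
 have p0: "0 < p" using p by simp
 have fi: "integrable M (%w. cmod (f w) powr p)" "integrable M (%w. cmod (g w) powr p)" using f g p by (simp_all add: Lp_iff)
 have [measurable]: "f : borel_measurable M" "g : borel_measurable M" using f g by measurable
 let ?f = "%w. cmod (f w + g w)"
 have gen: "?f w powr p <= (a + b) powr p * (a / (a + b) * (cmod (f w) / a) powr p + b / (a + b) * (cmod (g w) / b) powr p)"
  if "0 < a" "0 < b" for a b w
 proof -
  let ?b = "cmod (f w)"
  let ?c = "cmod (g w)"
  let ?e = "a / (a + b) * (?b / a) + b / (a + b) * (?c / b)"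
  have "?f w powr p <= (?b + ?c) powr p"
   using p by (intro powr_mono2 norm_triangle_ineq) auto
  also have "?b + ?c = (a + b) * ?e"
  proof -
   have "(a + b) * (a / (a + b) * (?b / a)) = ?b" "(a + b) * (b / (a + b) * (?c / b)) = ?c"
    using that by simp_all
   thus ?thesis by (simp only: distrib_left)
  qed
  also have "... powr p = (a + b) powr p * ?e powr p"
   by (rule powr_mult)
  also have "... <= (a + b) powr p * (a / (a + b) * (?b / a) powr p + b / (a + b) * (?c / b) powr p)"
   using that p by (intro mult_left_mono powr_convex2) (auto simp: field_simps)
  finally show ?thesis .
 qed
 let ?d = "%a b w. a / (a + b) * (cmod (f w) powr p / a powr p) + b / (a + b) * (cmod (g w) powr p / b powr p)"
 have gen2: "?f w powr p <= (a + b) powr p * (?d a b w)"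
  if "0 < a" "0 < b" for a b w
  using gen[OF that] that by (simp add: powr_divide)
 let ?a = "%w. f w + g w"
 have int: "integrable M (%w. ?f w powr p)"
  by (rule Bochner_Integration.integrable_bound[of _ "%w. (1 + 1) powr p * (1 / (1 + 1) * (cmod (f w) powr p / 1 powr p) + 1 / (1 + 1) * (cmod (g w) powr p / 1 powr p))"])
   (use fi gen2[of 1 1] in "auto simp: abs_of_nonneg")
 thus "?a : Lp M p" using p0 by (simp add: Lp_iff)
 have ab: "Ln M p ?a <= a + b" if ab: "Ln M p f < a" "Ln M p g < b" for a b
 proof -
  have a: "0 < a" "0 < b" using ab Ln_nonneg[of M p f] Ln_nonneg[of M p g] by linarith+
  have le: "Ln M p f powr p <= a powr p" "Ln M p g powr p <= b powr p"
   using ab p by (auto intro!: powr_mono2 simp: Ln_nonneg)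
  have "(\<integral>w. ?f w powr p \<partial>M) <= (\<integral>w. (a + b) powr p * (?d a b w) \<partial>M)"
   using int fi gen2[OF a] by (intro integral_mono) auto
  also have "... = (a + b) powr p * (a / (a + b) * (Ln M p f powr p / a powr p) + b / (a + b) * (Ln M p g powr p / b powr p))"
   using fi by (simp add: Ln_powr[OF p0])
  also have "... <= (a + b) powr p * (a / (a + b) * 1 + b / (a + b) * 1)"
   using le a by (intro mult_left_mono add_mono) (auto simp: field_simps)
  also have "... = (a + b) powr p" using a by (simp flip: add_divide_distrib)
  finally have "Ln M p ?a powr p <= (a + b) powr p" by (simp add: Ln_powr[OF p0])
  from powr_le_cancel[OF p0 _ this] show ?thesis using a by simp
 qed
 show "Ln M p ?a <= Ln M p f + Ln M p g"
 proof (rule field_le_epsilon)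
  fix e :: real assume "0 < e"
  thus "Ln M p ?a <= Ln M p f + Ln M p g + e"
   using ab[of "Ln M p f + e / 2" "Ln M p g + e / 2"] by simp
 qed
qed

lemma Lp_diff:
 assumes p: "1 < p" and f: "f : Lp M p" and g: "g : Lp M p"
 shows "(%w. f w - g w) : Lp M p" "Ln M p (%w. f w - g w) <= Ln M p f + Ln M p g"
proof -
 have "0 < p" using p by simp
 note s = Lp_scale[OF this g, of "-1"]
 from Lp_add[OF p f s(1)] s(2) show "(%w. f w - g w) : Lp M p" "Ln M p (%w. f w - g w) <= Ln M p f + Ln M p g"
  by simp_all
qed

lemma Lp_sum:
 assumes p: "1 < p" and "finite S" and "!!i. i : S ==> f i : Lp M p"
 shows "(%w. SUM i:S. f i w) : Lp M p & Ln M p (%w. SUM i:S. f i w) <= (SUM i:S. Ln M p (f i))"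
 using assms(2,3)
proof (induction S rule: finite_induct)
 case empty
 thus ?case using p by (simp add: Lp_zero)
next
 case (insert x S)
 hence "f x : Lp M p" "(%w. SUM i:S. f i w) : Lp M p" "Ln M p (%w. SUM i:S. f i w) <= (SUM i:S. Ln M p (f i))"
  by auto
 with Lp_add[OF p this(1,2)] insert(1,2) show ?case by simp
qed

lemma Lp_Holder:
 assumes pq: "1 < p" "1 < q" "1/p + 1/q = 1" and f: "f : Lp M p" and g: "g : Lp M q"
 shows "integrable M (%w. f w * g w)" "cmod (\<integral>w. f w * g w \<partial>M) <= Ln M p f * Ln M q g"
  "(\<integral>w. cmod (f w * g w) \<partial>M) <= Ln M p f * Ln M q g"
proof -
 have p0: "0 < p" "0 < q" using pq by auto
 have [measurable]: "f : borel_measurable M" "g : borel_measurable M" using f g by measurable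
 let ?a = "\<integral>w. cmod (f w * g w) \<partial>M"
 let ?b = "Ln M p f * Ln M q g"
 have "(\<integral>\<^sup>+w. ennreal (cmod (f w) * cmod (g w)) \<partial>M) <= ennreal ((\<integral>w. cmod (f w) powr p \<partial>M) powr (1/p) * (\<integral>w. cmod (g w) powr q \<partial>M) powr (1/q))"
  using f g p0 by (intro Holder_nn_integral[OF pq]) (auto simp: Lp_iff nn_integral_eq_integral integral_nonneg_AE)
 hence le: "(\<integral>\<^sup>+w. ennreal (cmod (f w * g w)) \<partial>M) <= ennreal ?b"
  by (simp add: Ln_def norm_mult)
 thus int: "integrable M (%w. f w * g w)"
  by (auto simp: integrable_iff_bounded intro: le_less_trans)
 from le have "ennreal ?a <= ennreal ?b"
  by (subst (asm) nn_integral_eq_integral) (use int in auto)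
 thus 3: "?a <= ?b"
  by (simp add: Ln_nonneg ennreal_le_iff)
 show "cmod (\<integral>w. f w * g w \<partial>M) <= ?b"
  by (rule order_trans[OF integral_norm_bound 3])
qed

lemma Lp_seminorm:
 fixes \<gamma> :: "('m => complex) => real"
 assumes p: "1 < p" and "csemi \<gamma>" "(%w. \<gamma> (%l. f l w)) : borel_measurable M" "finite S" "!!v. \<gamma> v <= (SUM l:S. cmod (v l))" "!!l. l : S ==> f l : Lp M p"
 shows "(%w. of_real (\<gamma> (%l. f l w))) : Lp M p" "Ln M p (%w. of_real (\<gamma> (%l. f l w))) <= (SUM l:S. Ln M p (f l))"
proof -
 have p0: "0 < p" using p by simp
 let ?a = "%l. %w. complex_of_real (cmod (f l w))"
 have a: "(?a l) : Lp M p & Ln M p (?a l) <= Ln M p (f l)" if "l : S" for l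
  using Lp_mono[OF p0 assms(6)[OF that], of "?a l"] LpD[OF assms(6)[OF that]] by simp
 let ?c = "%w. SUM l:S. complex_of_real (cmod (f l w))"
 let ?d = "SUM l:S. Ln M p (?a l)"
 have b: "?c : Lp M p"
  "Ln M p ?c <= ?d"
  using Lp_sum[OF p assms(4), of "%l w. complex_of_real (cmod (f l w))" M] a by auto
 let ?b = "%w. complex_of_real (\<gamma> (%l. f l w))"
 have cm: "?b : borel_measurable M" using assms(3) by measurable
 have le: "cmod (complex_of_real (\<gamma> (%l. f l w))) <= cmod (SUM l:S. complex_of_real (cmod (f l w)))" for w
  using assms(5)[of "%l. f l w"] cseminorm_nonneg[OF assms(2), of "%l. f l w"]
  by (simp flip: of_real_sum)
 note c = Lp_mono[OF p0 b(1) cm le]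
 show "?b : Lp M p" by (rule c(1))
 have "?d <= (SUM l:S. Ln M p (f l))" using a by (intro sum_mono) auto
 with b(2) c(2) show "Ln M p (%w. of_real (\<gamma> (%l. f l w))) <= (SUM l:S. Ln M p (f l))" by linarith
qed

lemma Ln_le_add:
 assumes p: "1 < p" and "(%w. complex_of_real (g w)) : Lp M p" "(%w. complex_of_real (h w)) : Lp M p"
  "!!w. 0 <= f w" "!!w. f w <= g w + h w" "f : borel_measurable M"
 shows "Ln M p (%w. complex_of_real (f w)) <= Ln M p (%w. complex_of_real (g w)) + Ln M p (%w. complex_of_real (h w))"
proof -
 note a = Lp_add[OF p assms(2,3)]
 let ?a = "%w. complex_of_real (f w)"
 have "Ln M p ?a <= Ln M p (%w. complex_of_real (g w) + complex_of_real (h w))"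
 proof (rule Lp_mono(2)[OF _ a(1)])
  show "0 < p" using p by simp
  show "?a : borel_measurable M" using assms(6) by measurable
  show "cmod (complex_of_real (f w)) <= cmod (complex_of_real (g w) + complex_of_real (h w))" for w
   using assms(4)[of w] assms(5)[of w] by (simp flip: of_real_add)
 qed
 with a(2) show ?thesis by simp
qed

section \<open>Step functions on finite partitions\<close>

locale step_partition =
 fixes M :: "'a measure" and p :: real and I :: "'i set" and A :: "'i => 'a set"
 assumes p: "1 < p" and fin: "finite I" and meas: "!!i. i : I ==> A i : sets M"
  and disj: "disjoint_family_on A I" and mpos: "!!i. i : I ==> 0 < measure M (A i)"
  and mfin: "!!i. i : I ==> emeasure M (A i) < \<infinity>"
begin

abbreviation "mu i \<equiv> measure M (A i)"

text \<open>Normalised so that \<open>step\<close> is an isometry from \<open>l^p(I)\<close> into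
  \<open>L^p\<close>, and by \<open>step_seminorm\<close> also for vector values under any seminorm.
  \<open>cf\<close> is its contractive left inverse, and on the sets of the partition
  \<open>step (cf f)\<close> is the average of \<open>f\<close>.\<close>

definition step :: "('i => complex) => 'a => complex" where
 "step a w = (SUM i:I. a i * of_real (mu i powr (- 1 / p)) * indicator (A i) w)"

definition cf :: "('a => complex) => 'i => complex" where
 "cf f i = of_real (mu i powr (1 / p - 1)) * (\<integral>w. indicator (A i) w * f w \<partial>M)"

lemma p0: "0 < p" using p by simp

lemma ind_eq: "i : I ==> j : I ==> w : A i ==> indicator (A j) w = (if j = i then 1 else (0::'b::zero_neq_one))"
 using disj by (auto simp: disjoint_family_on_def indicator_def)

lemma sum_ind:
 fixes f :: "'i => 'b::comm_semiring_1"
 assumes "i : I" "w : A i" shows "(SUM j:I. f j * indicator (A j) w) = f i"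
proof -
 have "(SUM j:I. f j * indicator (A j) w) = (SUM j:I. if j = i then f j else 0)"
  by (rule sum.cong[OF refl]) (simp add: ind_eq[OF assms(1) _ assms(2)])
 thus ?thesis using assms fin by simp
qed

lemma sum_ind_out:
 fixes f :: "'i => 'b::comm_semiring_1"
 assumes "!!i. i : I ==> w ~: A i" shows "(SUM j:I. f j * indicator (A j) w) = 0"
 using assms by (intro sum.neutral) (auto simp: indicator_def)

lemma step_in: "i : I ==> w : A i ==> step a w = a i * of_real (mu i powr (- 1 / p))"
 unfolding step_def by (rule sum_ind)

lemma step_out: "(!!i. i : I ==> w ~: A i) ==> step a w = 0"
 unfolding step_def by (rule sum_ind_out)

lemma step_measurable [measurable]: "step a : borel_measurable M"
 unfolding step_def[abs_def] using meas by (intro borel_measurable_sum borel_measurable_times) auto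

lemma mu_powr: "i : I ==> (mu i powr (- 1 / p)) powr p = 1 / mu i"
 using p mpos[of i] powr_neg_one[of "mu i"] by (simp add: powr_powr)

lemma mu_powr2: "i : I ==> mu i powr (1 / p - 1) * mu i powr (- 1 / p) * mu i = 1"
proof -
 assume i: "i : I"
 have "mu i powr (1 / p - 1) * mu i powr (- 1 / p) * mu i = mu i powr (1 / p - 1) * mu i powr (- 1 / p) * mu i powr 1"
  using mpos[OF i] by simp
 also have "... = mu i powr (1 / p - 1 + - 1 / p + 1)" by (simp only: powr_add)
 also have "... = 1" using mpos[OF i] by simp
 finally show ?thesis .
qed

lemma ind_integral:
 assumes "i : I"
 shows "integrable M (%w. indicator (A i) w :: real)" "(\<integral>w. indicator (A i) w \<partial>M) = (mu i :: real)"
 using meas[OF assms] mfin[OF assms] sets.sets_into_space[OF meas[OF assms]] by (auto simp: Int_absorb2)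

lemma step_seminorm:
 fixes be :: "('l => complex) => real"
 assumes b: "csemi be"
 shows "integrable M (%w. be (%l. step (a l) w) powr p)"
  "(\<integral>w. be (%l. step (a l) w) powr p \<partial>M) = (SUM i:I. be (%l. a l i) powr p)"
proof -
 let ?a = "%i. be (%l. a l i)"
 let ?b = "%w. be (%l. step (a l) w)"
 have eq: "?b w powr p = (SUM i:I. ?a i powr p / mu i * indicator (A i) w)" for w
 proof (cases "EX i:I. w : A i")
  case True
  then obtain i where i: "i : I" "w : A i" by blast
  have "?b w = be (%l. of_real (mu i powr (- 1 / p)) * a l i)"
   by (simp add: step_in[OF i] mult.commute)
  also have "... = mu i powr (- 1 / p) * ?a i" by (simp add: cseminorm_scale[OF b])
  finally show ?thesis using i cseminorm_nonneg[OF b, of "%l. a l i"]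
   using sum_ind[OF i, of "%i. ?a i powr p / mu i"] mu_powr[OF i(1)] by (simp add: powr_mult)
 next
  case False
  hence o: "!!i. i : I ==> w ~: A i" by blast
  show ?thesis using sum_ind_out[OF o, of "%i. ?a i powr p / mu i"] by (simp add: step_out[OF o] cseminorm_zero[OF b])
 qed
 show "integrable M (%w. ?b w powr p)"
  unfolding eq using ind_integral(1) by auto
 let ?d = "\<integral>w. ?b w powr p \<partial>M"
 have "?d = (SUM i:I. \<integral>w. ?a i powr p / mu i * indicator (A i) w \<partial>M)"
  unfolding eq using ind_integral(1) by (intro Bochner_Integration.integral_sum) auto
 also have "... = (SUM i:I. ?a i powr p)"
 proof (rule sum.cong[OF refl])
  fix i assume i: "i : I"
  let ?c = "\<integral>w. ?a i powr p / mu i * indicator (A i) w \<partial>M"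
  have "?c = ?a i powr p / mu i * mu i"
   using ind_integral[OF i] by (subst integral_mult_right_zero) simp
  thus "?c = ?a i powr p" using mpos[OF i] by simp
 qed
 finally show "?d = (SUM i:I. ?a i powr p)" .
qed

lemma step_Lp: "step a : Lp M p" "Ln M p (step a) = (SUM i:I. cmod (a i) powr p) powr (1 / p)"
proof -
 have "csemi (%v :: unit => complex. cmod (v ()))"
  by (auto simp: csemi_def norm_triangle_ineq norm_mult)
 note s = step_seminorm[OF this, of "%_. a"]
 show "step a : Lp M p" using s(1) p0 by (simp add: Lp_iff)
 show "Ln M p (step a) = (SUM i:I. cmod (a i) powr p) powr (1 / p)" using s(2) by (simp add: Ln_def)
qed

lemma ind_Lp:
 assumes i: "i : I" and q: "0 < q"
 shows "(indicator (A i) :: 'a => complex) : Lp M q" "Ln M q (indicator (A i)) = mu i powr (1 / q)"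
proof -
 have e: "cmod (indicator (A i) w) powr q = indicator (A i) w" for w using q by (simp add: indicator_def)
 show "(indicator (A i) :: 'a => complex) : Lp M q" unfolding Lp_iff[OF q] e using ind_integral(1)[OF i] meas[OF i] by auto
 show "Ln M q (indicator (A i)) = mu i powr (1 / q)" unfolding Ln_def e using ind_integral(2)[OF i] by simp
qed

lemma cf_bound:
 assumes f: "f : Lp M p" and i: "i : I"
 shows "integrable M (%w. indicator (A i) w * f w)"
  "cmod (cf f i) powr p <= (\<integral>w. indicator (A i) w * cmod (f w) powr p \<partial>M)"
proof -
 define q where "q = p / (p - 1)"
 have pq: "1 < p" "1 < q" "1/p + 1/q = 1" "0 < q" using p by (auto simp: q_def field_simps)
 define g where "g w = f w * indicator (A i) w" for w
 have [measurable]: "f : borel_measurable M" "A i : sets M" using f meas[OF i] by auto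
 have "g : borel_measurable M" unfolding g_def[abs_def] by measurable
 hence g: "g : Lp M p" by (rule Lp_mono(1)[OF p0 f]) (simp add: g_def indicator_def)
 note H = Lp_Holder[OF pq(1-3) g ind_Lp(1)[OF i pq(4)]]
 have e: "g w * indicator (A i) w = indicator (A i) w * f w" for w by (simp add: g_def indicator_def)
 show "integrable M (%w. indicator (A i) w * f w)" using H(1) by (simp add: e)
 let ?a = "\<integral>w. indicator (A i) w * cmod (f w) powr p \<partial>M"
 let ?b = "mu i powr (1 / p - 1) * mu i powr (1 / q)"
 let ?c = "cmod (cf f i)"
 have "?c = mu i powr (1 / p - 1) * cmod (\<integral>w. indicator (A i) w * f w \<partial>M)"
  by (simp add: cf_def norm_mult)
 also have "... <= mu i powr (1 / p - 1) * (Ln M p g * mu i powr (1 / q))"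
  using H(2) by (intro mult_left_mono) (simp_all add: e ind_Lp(2)[OF i pq(4)])
 also have "... = Ln M p g * ?b" by simp
 also have "?b = mu i powr (1 / p - 1 + 1 / q)" by (simp only: powr_add)
 also have "1 / p - 1 + 1 / q = 0" using pq by simp
 finally have "?c <= Ln M p g" using mpos[OF i] by simp
 hence "?c powr p <= Ln M p g powr p" using p0 by (intro powr_mono2) auto
 also have "... = ?a"
  unfolding Ln_powr[OF p0] by (rule Bochner_Integration.integral_cong) (auto simp: g_def indicator_def)
 finally show "?c powr p <= ?a" .
qed

lemma cf_contr:
 assumes f: "f : Lp M p"
 shows "(SUM i:I. cmod (cf f i) powr p) <= Ln M p f powr p"
proof -
 have int: "integrable M (%w. cmod (f w) powr p)" using f by (simp add: Lp_iff p0)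
 have int2: "integrable M (%w. indicator (A i) w * cmod (f w) powr p)" if "i : I" for i
  using int meas[OF that] by (intro integrable_real_mult_indicator[OF _ int, THEN Bochner_Integration.integrable_cong[THEN iffD1, rotated -1]]) (auto simp: mult.commute)
 let ?a = "%w. SUM i:I. indicator (A i) w * cmod (f w) powr p"
 have "(SUM i:I. cmod (cf f i) powr p) <= (SUM i:I. \<integral>w. indicator (A i) w * cmod (f w) powr p \<partial>M)"
  using f by (intro sum_mono cf_bound)
 also have "... = (\<integral>w. (?a w) \<partial>M)"
  using int2 by (subst Bochner_Integration.integral_sum) auto
 also have "... <= (\<integral>w. cmod (f w) powr p \<partial>M)"
 proof (rule integral_mono)
  show "(?a w) <= cmod (f w) powr p" for w
  proof (cases "EX i:I. w : A i")
   case True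
   then obtain i where i: "i : I" "w : A i" by blast
   show ?thesis using sum_ind[OF i, of "%_. cmod (f w) powr p"] by (simp add: mult.commute)
  next
   case False
   hence "(?a w) = 0" by (intro sum.neutral) (auto simp: indicator_def)
   thus ?thesis by simp
  qed
 qed (use int int2 in auto)
 finally show ?thesis by (simp add: Ln_powr p0)
qed

lemma step_cf_contr: "f : Lp M p ==> Ln M p (step (cf f)) <= Ln M p f"
 using powr_mono2[OF _ _ cf_contr, of "1/p" f] p0
 by (simp add: step_Lp powr_powr sum_nonneg Ln_nonneg)

lemma cf_step: "i : I ==> cf (step a) i = a i"
proof -
 assume i: "i : I"
 let ?a = "a i * of_real (mu i powr (- 1 / p))"
 have "(\<integral>w. indicator (A i) w * step a w \<partial>M) = (\<integral>w. complex_of_real (indicator (A i) w) * ?a \<partial>M)"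
  by (rule Bochner_Integration.integral_cong) (auto simp: indicator_def step_in[OF i])
 also have "... = of_real (mu i) * ?a"
  using ind_integral[OF i] by (subst integral_mult_left_zero) (simp only: integral_complex_of_real)
 finally have "cf (step a) i = of_real (mu i powr (1 / p - 1) * mu i powr (- 1 / p) * mu i) * a i"
  by (simp add: cf_def)
 thus ?thesis unfolding mu_powr2[OF i] by simp
qed

lemma cf_AE: "AE w in M. f w = g w ==> f : Lp M p ==> g : Lp M p ==> i : I ==> cf f i = cf g i"
proof -
 assume a: "AE w in M. f w = g w" "f : Lp M p" "g : Lp M p" "i : I"
 have [measurable]: "f : borel_measurable M" "g : borel_measurable M" "A i : sets M" using a meas by auto
 have "(\<integral>w. indicator (A i) w * f w \<partial>M) = (\<integral>w. indicator (A i) w * g w \<partial>M)"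
  using a(1) by (intro integral_cong_AE) auto
 thus ?thesis by (simp add: cf_def)
qed

lemma cf_scale: "cf (%w. c * f w) i = c * cf f i"
 by (simp add: cf_def mult.left_commute)

lemma cf_sum:
 assumes "finite S" and "!!n. n : S ==> f n : Lp M p" and i: "i : I"
 shows "cf (%w. SUM n:S. f n w) i = (SUM n:S. cf (f n) i)"
proof -
 have "(\<integral>w. indicator (A i) w * (SUM n:S. f n w) \<partial>M) = (SUM n:S. \<integral>w. indicator (A i) w * f n w \<partial>M)"
  unfolding sum_distrib_left using assms cf_bound(1) by (intro Bochner_Integration.integral_sum) auto
 thus ?thesis by (simp add: cf_def sum_distrib_left)
qed

lemma cf_diff:
 assumes "f : Lp M p" "g : Lp M p" and i: "i : I"
 shows "cf (%w. f w - g w) i = cf f i - cf g i"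
 using cf_bound(1)[OF assms(1) i] cf_bound(1)[OF assms(2) i] by (simp add: cf_def right_diff_distrib)

lemma cf_mono:
 assumes f: "f : Lp M p" and g: "(%w. of_real (g w)) : Lp M p" and i: "i : I" and le: "!!w. w : space M ==> cmod (f w) <= g w"
 shows "cmod (cf f i) <= cmod (cf (%w. of_real (g w)) i)"
proof -
 let ?a = "%w. indicator (A i) w"
 have e: "(%w. ?a w * complex_of_real (g w)) = (%w. complex_of_real (?a w * g w))"
  by (auto simp: indicator_def fun_eq_iff)
 have gi: "integrable M (%w. ?a w * g w)" using cf_bound(1)[OF g i] unfolding e by (simp only: complex_of_real_integrable_eq)
 have "cmod (\<integral>w. ?a w * f w \<partial>M) <= (\<integral>w. cmod (?a w * f w) \<partial>M)"
  by (rule integral_norm_bound)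
 also have "... <= (\<integral>w. ?a w * g w \<partial>M)"
  by (rule integral_mono[OF integrable_norm[OF cf_bound(1)[OF f i]] gi]) (use le in "auto simp: norm_mult indicator_def")
 also have "... <= cmod (\<integral>w. ?a w * complex_of_real (g w) \<partial>M)"
  unfolding e by (simp only: integral_complex_of_real norm_of_real abs_ge_self)
 finally show ?thesis by (simp add: cf_def norm_mult mult_left_mono)
qed

lemma step_diff: "step (%i. a i - b i) w = step a w - step b w"
 by (simp add: step_def left_diff_distrib sum_subtractf)

lemma step_sum: "step (%i. SUM n:S. a n i) w = (SUM n:S. step (a n) w)"
 unfolding step_def sum_distrib_right by (rule sum.swap)

lemma step_scale: "step (%i. c * a i) w = c * step a w"
 by (simp add: step_def sum_distrib_left mult.assoc)

lemma step_cong: "(!!i. i : I ==> a i = b i) ==> step a = step b"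
 by (auto simp: step_def fun_eq_iff intro!: sum.cong)

lemma step_unit: "step a w = (SUM j:I. a j * step (%i. if i = j then 1 else 0) w)"
proof -
 let ?a = "%j. step (%i. if i = j then 1 else 0) w"
 have "?a j = of_real (mu j powr (- 1 / p)) * indicator (A j) w" if "j : I" for j
 proof -
  have "?a j = (SUM i:I. if i = j then of_real (mu i powr (- 1 / p)) * indicator (A i) w else 0)"
   unfolding step_def by (rule sum.cong) auto
  thus ?thesis using that fin by simp
 qed
 thus ?thesis unfolding step_def[of a] by (intro sum.cong) (auto simp: mult.assoc)
qed

end

lemma simple_functionD_level: "simple_function M f ==> {w : space M. f w = c} : sets M"
 using simple_functionD(2)[of M f "{c}"] by (simp add: vimage_def Int_def conj_commute)

lemma integrable_finite_superlevel:
 fixes f :: "'a => real"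
 assumes f: "integrable M f" and c: "0 < c"
 shows "emeasure M {w : space M. c <= f w} < \<infinity>"
proof -
 let ?a = "{w : space M. 1 <= ennreal (1/c) * ennreal (norm (f w))}"
 let ?b = "%w. ennreal (norm (f w))"
 have "{w : space M. c <= f w} \<subseteq> ?a"
  using c by (auto simp: field_simps simp flip: ennreal_mult ennreal_1)
 moreover have "?a : sets M" using f by measurable
 ultimately have "emeasure M {w : space M. c <= f w} <= emeasure M {w : space M. 1 <= ennreal (1/c) * ennreal (norm (f w))}"
  by (rule emeasure_mono)
 also have "... <= ennreal (1/c) * (\<integral>\<^sup>+w. ennreal (norm (f w)) * indicator (space M) w \<partial>M)"
  by (rule order_trans[OF _ nn_integral_Markov_inequality[of "?b" "space M" M "ennreal (1/c)"]]) (use f in auto)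
 also have "... < \<infinity>" using f c by (auto simp: integrable_iff_bounded ennreal_mult_less_top nn_integral_cong[of M "%w. ennreal (norm (f w)) * indicator (space M) w" "?b"])
 finally show ?thesis .
qed

text \<open>One partition for finitely many functions: approximate each by a simple function and
  take the common level sets, indexed by the vector of values. The zero vector is left out because
  its set may have infinite measure. The projection reproduces the simple functions and is a
  contraction, so the error at most doubles; hence \<open>de / 2\<close>.\<close>

lemma step_approximation:
 fixes g :: "'n => 'a => complex"
 assumes p: "1 < p" and fin: "finite S" and g: "!!n. n : S ==> g n : Lp M p" and d: "0 < de"
 shows "EX (I :: ('n => complex) set) A. step_partition M p I A &
  (ALL n:S. Ln M p (%w. g n w - step_partition.step M p I A (step_partition.cf M p A (g n)) w) <= de)"
proof -
 have p0: "0 < p" using p by simp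
 let ?g = "de / 2"
 have "EX s. simple_function M s & s : Lp M p & Ln M p (%w. g n w - s w) <= de / 2" if n: "n : S" for n
 proof -
  have gm [measurable]: "g n : borel_measurable M" and gi: "integrable M (%w. cmod (g n w) powr p)" using g[OF n] by (simp_all add: Lp_iff p0)
  obtain F where F: "!!i. simple_function M (F i)" "!!x. x : space M ==> (%i. F i x) \<longlonglongrightarrow> g n x"
   "!!i x. x : space M ==> cmod (F i x) <= 2 * cmod (g n x)"
   using borel_measurable_implies_sequence_metric[OF gm, of 0] by (auto simp del: norm_mult) blast
  have [measurable]: "F i : borel_measurable M" for i using F(1) by (rule borel_measurable_simple_function)
  have FL: "F i : Lp M p" for i
   using Lp_mono(1)[OF p0 Lp_scale(1)[OF p0 g[OF n], of 2], of "F i"] F(3) by (simp add: norm_mult)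
  let ?b = "%w i. cmod (g n w - F i w)"
  have "(%i. \<integral>w. ?b w i powr p \<partial>M) \<longlonglongrightarrow> (\<integral>w. 0 \<partial>M)"
  proof (rule integral_dominated_convergence[where w = "%w. 3 powr p * cmod (g n w) powr p"])
   show "AE w in M. (%i. ?b w i powr p) \<longlonglongrightarrow> 0"
   proof (rule AE_I2)
    fix w assume "w : space M"
    hence "(%i. ?b w i powr p) \<longlonglongrightarrow> cmod (g n w - g n w) powr p"
     using p0 F(2) by (intro tendsto_powr2 tendsto_intros) auto
    thus "(%i. ?b w i powr p) \<longlonglongrightarrow> 0" using p0 by simp
   qed
   show "AE w in M. norm (?b w i powr p) <= 3 powr p * cmod (g n w) powr p" for i
   proof (rule AE_I2)
    fix w assume w: "w : space M"
    let ?f = "g n w"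
    have "?b w i <= 3 * cmod ?f" using F(3)[OF w, of i] norm_triangle_ineq4[of "?f" "F i w"] by simp
    hence "?b w i powr p <= (3 * cmod ?f) powr p" using p0 by (intro powr_mono2) auto
    thus "norm (?b w i powr p) <= 3 powr p * cmod ?f powr p" by (simp add: powr_mult)
   qed
  qed (use gi in auto)
  hence "eventually (%i. (\<integral>w. ?b w i powr p \<partial>M) < ?g powr p) sequentially"
   by (rule order_tendstoD) (use d in simp)
  then obtain i where i: "(\<integral>w. cmod (g n w - F i w) powr p \<partial>M) < ?g powr p"
   by (auto simp: eventually_sequentially)
  hence "Ln M p (%w. g n w - F i w) powr p <= ?g powr p" by (simp add: Ln_powr p0)
  hence "Ln M p (%w. g n w - F i w) <= ?g" by (rule powr_le_cancel[OF p0, rotated]) (use d in simp)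
  with F(1) FL show ?thesis by blast
 qed
 hence "ALL n:S. EX s. simple_function M s & s : Lp M p & Ln M p (%w. g n w - s w) <= de / 2" by blast
 from bchoice[OF this] obtain s where s: "!!n. n : S ==> simple_function M (s n)" "!!n. n : S ==> s n : Lp M p"
  "!!n. n : S ==> Ln M p (%w. g n w - s n w) <= de / 2" by blast
 define G where "G w = (%n. if n : S then s n w else 0)" for w
 define A where "A v = {w : space M. ALL n:S. s n w = v n}" for v
 have Am: "A v : sets M" for v
 proof -
  have "{w : space M. s n w = v n} : sets M" if "n : S" for n
   using s(1)[OF that] by (rule simple_functionD_level)
  thus ?thesis unfolding A_def using fin by (auto intro: sets.sets_Collect_finite_All)
 qed
 have Gimg: "finite (G ` space M)"
 proof (rule finite_subset)
  show "G ` space M \<subseteq> {v. (ALL n:S. v n : s n ` space M) & (ALL n. n ~: S --> v n = 0)}" by (auto simp: G_def)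
  show "finite {v. (ALL n:S. v n : s n ` space M) & (ALL n. n ~: S --> v n = 0)}"
  proof -
   have "finite {f. ALL n. (n : S --> f n : (\<Union>n\<in>S. s n ` space M)) & (n ~: S --> f n = 0)}"
    using fin s(1) by (intro finite_set_of_finite_funs) (auto simp: simple_function_def)
   thus ?thesis by (rule rev_finite_subset) blast
  qed
 qed
 define I where "I = {v : G ` space M. (EX n:S. v n ~= 0) & emeasure M (A v) ~= 0}"
 have Afin: "emeasure M (A v) < \<infinity>" if "v : I" for v
 proof -
  from that obtain n where n: "n : S" "v n ~= 0" by (auto simp: I_def)
  have int: "integrable M (%w. cmod (s n w) powr p)" using s(2)[OF n(1)] by (simp add: Lp_iff p0)
  let ?d = "{w : space M. cmod (v n) powr p <= cmod (s n w) powr p}"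
  have "?d : sets M" using s(2)[OF n(1)] by measurable
  moreover have "A v \<subseteq> ?d" using n by (auto simp: A_def)
  moreover have "emeasure M {w : space M. cmod (v n) powr p <= cmod (s n w) powr p} < \<infinity>"
   using integrable_finite_superlevel[OF int, of "cmod (v n) powr p"] n by simp
  ultimately show ?thesis by (meson emeasure_mono le_less_trans)
 qed
 have P: "step_partition M p I A"
 proof
  show "disjoint_family_on A I"
   unfolding disjoint_family_on_def
  proof (intro ballI impI)
   fix u v assume uv: "u : I" "v : I" "u ~= v"
   show "A u \<inter> A v = {}"
   proof (rule ccontr)
    assume "A u \<inter> A v ~= {}"
    hence "ALL n:S. u n = v n" by (auto simp: A_def)
    moreover have "ALL n. n ~: S --> u n = 0 & v n = 0" using uv by (auto simp: I_def G_def)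
    ultimately have "u n = v n" for n by (cases "n : S") simp_all
    hence "u = v" by (rule ext)
    with uv show False by simp
   qed
  qed
  show "0 < measure M (A i)" if "i : I" for i
  proof -
   have "emeasure M (A i) = ennreal (measure M (A i))" using Afin[OF that] by (intro emeasure_eq_ennreal_measure) auto
   moreover have "emeasure M (A i) ~= 0" using that by (simp add: I_def)
   ultimately have "measure M (A i) ~= 0" by auto
   thus ?thesis by (simp add: less_le)
  qed
  show "finite I" unfolding I_def using Gimg by simp
 qed (rule p Am Afin, assumption?)+
 interpret step_partition M p I A by (rule P)
 let ?e = "%n. Ln M p (%w. g n w - step (cf (g n)) w)"
 have "?e n <= de" if n: "n : S" for n
 proof -
  define a where "a v = v n * of_real (mu v powr (1 / p))" for v
  have sa: "AE w in M. s n w = step a w"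
  proof -
   have "AE w in M. ALL v:{v:G ` space M. emeasure M (A v) = 0}. w ~: A v"
    using Gimg Am by (intro AE_finite_allI) (auto intro!: AE_not_in simp: null_sets_def)
   thus ?thesis
   proof (rule AE_mp, intro AE_I2 impI)
    fix w assume w: "w : space M" and nul: "ALL v:{v:G ` space M. emeasure M (A v) = 0}. w ~: A v"
    have wA: "w : A (G w)" using w by (simp add: A_def G_def)
    show "s n w = step a w"
    proof (cases "EX n:S. G w n ~= 0")
     case True
     hence GI: "G w : I" using w wA nul by (auto simp: I_def)
     show ?thesis using n mpos[OF GI]
      by (simp add: step_in[OF GI wA] a_def G_def mult.assoc flip: of_real_mult powr_add)
    next
     case False
     have "w ~: A v" if vI: "v : I" for v
     proof
      assume "w : A v"
      moreover obtain m where "m : S" "v m ~= 0" using vI unfolding I_def by blast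
      ultimately have "s m w ~= 0" by (auto simp: A_def)
      with False \<open>m : S\<close> show False by (auto simp: G_def)
     qed
     thus ?thesis using False n by (subst step_out) (auto simp: G_def)
    qed
   qed
  qed
  have "step (cf (s n)) = step a"
   using cf_AE[OF sa s(2)[OF n] step_Lp(1)] by (intro step_cong) (simp add: cf_step)
  note gs = Lp_diff(1)[OF p g[OF n] s(2)[OF n]]
  let ?c = "%w. cf (%w. g n w - s n w)"
  have "AE w in M. g n w - step (cf (g n)) w = (g n w - s n w) - step (?c w) w"
  proof -
   have "step (?c w) w = step (cf (g n)) w - step a w" for w
   proof -
    have "step (?c w) = step (%i. cf (g n) i - cf (s n) i)"
     using g s n by (intro step_cong cf_diff) auto
    thus ?thesis by (simp add: step_diff \<open>step (cf (s n)) = step a\<close>)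
   qed
   thus ?thesis using sa by auto
  qed
  note e = Lp_cong_AE(2)[OF p0 Lp_diff(1)[OF p gs step_Lp(1)] _ this]
  let ?a = "%w. g n w - s n w"
  have "?e n = Ln M p (%w. (g n w - s n w) - step (?c w) w)"
   by (intro e borel_measurable_diff LpD[OF g[OF n]] step_measurable)
  also have "... <= Ln M p ?a + Ln M p (step (cf ?a))"
   by (rule Lp_diff(2)[OF p gs step_Lp(1)])
  also have "... <= Ln M p ?a + Ln M p ?a"
   using step_cf_contr[OF gs] by simp
  also have "... <= de" using s(3)[OF n] by simp
  finally show ?thesis .
 qed
 with P show ?thesis by blast
qed

lemma AE_linear_sum:
 assumes p: "1 < p" and V: "!!f. f : Lp M p ==> V f : Lp M p"
  and lin: "!!f g a b. f : Lp M p ==> g : Lp M p ==> AE w in M. V (%w. a * f w + b * g w) w = a * V f w + b * V g w"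
  and "finite S" "!!n. n : S ==> f n : Lp M p"
 shows "AE w in M. V (%w. SUM n:S. a n * f n w) w = (SUM n:S. a n * V (f n) w)"
 using assms(4,5)
proof (induction S rule: finite_induct)
 case empty
 show ?case using lin[of "%_. 0" "%_. 0" 0 0] Lp_zero(1)[of p M] p by simp
next
 case (insert m S)
 have s: "(%w. SUM n:S. a n * f n w) : Lp M p"
  using insert p by (intro conjunct1[OF Lp_sum[OF p]] Lp_scale(1)) auto
 have "AE w in M. V (%w. SUM n:S. a n * f n w) w = (SUM n:S. a n * V (f n) w)"
  using insert by auto
 moreover have "AE w in M. V (%w. a m * f m w + 1 * (SUM n:S. a n * f n w)) w = a m * V (f m) w + 1 * V (%w. SUM n:S. a n * f n w) w"
  using insert s by (intro lin) auto
 ultimately show ?case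
  by eventually_elim (use insert(1,2) in simp)
qed

section \<open>Transference from sequences to the operator\<close>

locale contr_regular =
 fixes M :: "'a measure" and p :: real and T :: "('a => complex) => 'a => complex"
 assumes p: "1 < p" and cr: "contractively_regular M p T"
begin

lemma p0: "0 < p" using p by simp

lemma T_Lp: "f : Lp M p ==> T f : Lp M p"
 using cr by (simp add: contractively_regular_def lp_operator_def)

lemma T_AE: "AE w in M. f w = g w ==> f : Lp M p ==> g : Lp M p ==> AE w in M. T f w = T g w"
 using cr by (simp add: contractively_regular_def lp_operator_def)

lemma T_lin: "f : Lp M p ==> g : Lp M p ==> AE w in M. T (%w'. a * f w' + b * g w') w = a * T f w + b * T g w"
 using cr unfolding contractively_regular_def lp_operator_def by blast

lemma T_scale: "f : Lp M p ==> AE w in M. T (%w'. a * f w') w = a * T f w"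
 using T_lin[of f f a 0] by simp

lemma T_diff: "f : Lp M p ==> g : Lp M p ==> AE w in M. T (%w'. f w' - g w') w = T f w - T g w"
 using T_lin[of f g 1 "-1"] by simp

lemma T_sum:
 assumes "finite S" "!!n. n : S ==> f n : Lp M p"
 shows "AE w in M. T (%w'. SUM n:S. a n * f n w') w = (SUM n:S. a n * T (f n) w)"
 by (rule AE_linear_sum[OF p T_Lp T_lin assms])

lemma regular_max:
 assumes N: "0 < (N::nat)" and xs: "!!k. k < N ==> xs k : Lp M p" and G: "G : Lp M p"
  and le: "!!k w. k < N ==> w : space M ==> cmod (xs k w) <= cmod (G w)"
 shows "EX W. (%w. of_real (W w)) : Lp M p & Ln M p (%w. of_real (W w)) <= Ln M p G & (ALL k<N. ALL w. cmod (T (xs k) w) <= W w)"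
proof -
 define W where "W w = Max ((%k. cmod (T (xs k) w)) ` {..<N})" for w
 have W: "cmod (T (xs k) w) <= W w" if "k < N" for k w using that by (auto simp: W_def)
 have W0: "0 <= W w" for w using W[OF N, of w] norm_ge_zero order_trans by blast
 have [measurable]: "T (xs k) : borel_measurable M" if "k < N" for k using LpD[OF T_Lp[OF xs[OF that]]] .
 have Wm [measurable]: "W : borel_measurable M" unfolding W_def[abs_def]
  by (rule borel_measurable_Max) auto
 have WS: "ennreal (W w) = (SUP k\<in>{..<N}. ennreal (cmod (T (xs k) w)))" for w
 proof (rule antisym)
  have "W w : (%k. cmod (T (xs k) w)) ` {..<N}" unfolding W_def using N by (intro Max_in) auto
  thus "ennreal (W w) <= (SUP k\<in>{..<N}. ennreal (cmod (T (xs k) w)))" by (auto intro: SUP_upper)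
 qed (auto intro!: SUP_least ennreal_leI W)
 let ?a = "%w. of_real (W w)"
 have "lp_norm M p ?a = lpn M p (%w. SUP k\<in>{..<N}. ennreal (cmod (T (xs k) w)))"
  using W0 by (simp add: lp_norm_def flip: WS)
 also have "... <= ennreal 1 * lpn M p (%w. SUP k\<in>{..<N}. ennreal (cmod (xs k w)))"
  using cr xs unfolding contractively_regular_def regular_with_def by blast
 also have "... <= lp_norm M p G"
 proof -
  have sup: "(SUP k\<in>{..<N}. ennreal (cmod (xs k w))) <= ennreal (cmod (G w))" if "w : space M" for w
   using le that by (auto intro!: SUP_least ennreal_leI)
  have mono: "enn_powr a r <= enn_powr b r" if "a <= b" "0 < r" for a b r
   using that by (auto simp: enn_powr_def top_unique less_top intro!: ennreal_leI powr_mono2 enn2real_mono)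
  show ?thesis unfolding lp_norm_def lpn_def using p0 sup
   by (simp, intro mono nn_integral_mono) auto
 qed
 also have "... = ennreal (Ln M p G)" by (rule lp_norm_Ln[OF p0 G])
 finally have le: "lp_norm M p ?a <= ennreal (Ln M p G)" .
 hence WL: "(%w. complex_of_real (W w)) : Lp M p" by (auto simp: Lp_def intro: le_less_trans)
 from le have "Ln M p ?a <= Ln M p G"
  unfolding lp_norm_Ln[OF p0 WL] by (simp add: Ln_nonneg)
 with WL W show ?thesis by blast
qed

lemma T_contr: "f : Lp M p ==> Ln M p (T f) <= Ln M p f"
proof -
 assume f: "f : Lp M p"
 from regular_max[of 1 "%_. f" f] f obtain W where
  W: "(%w. complex_of_real (W w)) : Lp M p" "Ln M p (%w. of_real (W w)) <= Ln M p f" "ALL w. cmod (T f w) <= W w" by auto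
 have "Ln M p (T f) <= Ln M p (%w. of_real (W w))"
  by (rule Lp_mono(2)[OF p0 W(1) LpD[OF T_Lp[OF f]]]) (use W(3) in "auto intro: order_trans")
 with W(2) show ?thesis by simp
qed

lemma Tn_Lp: "f : Lp M p ==> (T ^^ n) f : Lp M p"
 by (induction n) (auto intro: T_Lp)

lemma Tn_contr: "f : Lp M p ==> Ln M p ((T ^^ n) f) <= Ln M p f"
 by (induction n) (auto intro: order_trans[OF T_contr] Tn_Lp)

lemma Tn_AE:
 assumes "AE w in M. f w = g w" "f : Lp M p" "g : Lp M p"
 shows "AE w in M. (T ^^ n) f w = (T ^^ n) g w"
proof (induction n)
 case (Suc n)
 show ?case using T_AE[OF Suc Tn_Lp[OF assms(2)] Tn_Lp[OF assms(3)]] by simp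
qed (use assms in simp)

lemma Tn_sum:
 assumes S: "finite S" "!!n. n : S ==> f n : Lp M p"
 shows "AE w in M. (T ^^ m) (%w'. SUM n:S. a n * f n w') w = (SUM n:S. a n * (T ^^ m) (f n) w)"
proof (induction m)
 case (Suc m)
 have s: "(%w. SUM n:S. a n * f n w) : Lp M p" "(%w. SUM n:S. a n * (T ^^ m) (f n) w) : Lp M p"
  using S by (intro conjunct1[OF Lp_sum[OF p]] Lp_scale(1)[OF p0] Tn_Lp; auto)+
 let ?a = "%w. T (%w'. SUM n:S. a n * (T ^^ m) (f n) w') w"
 have "AE w in M. T ((T ^^ m) (%w'. SUM n:S. a n * f n w')) w = ?a w"
  by (intro T_AE Suc Tn_Lp s)
 moreover have "AE w in M. ?a w = (SUM n:S. a n * T ((T ^^ m) (f n)) w)"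
  using S by (intro T_sum Tn_Lp) auto
 ultimately show ?case by eventually_elim simp
qed simp

end

locale contr_partition = contr_regular M p T + step_partition M p I A
 for M :: "'a measure" and p :: real and T and I :: "'i set" and A
begin

definition tmat :: "'i => 'i => complex" where
 "tmat i j = cf (T (step (%i. if i = j then 1 else 0))) i"

lemma cf_T_step:
 assumes i: "i : I"
 shows "cf (T (step a)) i = (SUM j:I. tmat i j * a j)"
proof -
 let ?a = "%j. step (%i. if i = j then 1 else 0)"
 have "AE w in M. T (step a) w = (SUM j:I. a j * T (?a j) w)"
  using T_sum[OF fin, of "%j. ?a j" a] step_Lp(1) by (simp flip: step_unit)
 hence "cf (T (step a)) i = cf (%w. SUM j:I. a j * T (?a j) w) i"
  using fin i by (intro cf_AE T_Lp step_Lp(1) conjunct1[OF Lp_sum[OF p]] Lp_scale(1)[OF p0]) auto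
 also have "... = (SUM j:I. cf (%w. a j * T (?a j) w) i)"
  using fin i by (intro cf_sum T_Lp step_Lp(1) Lp_scale(1)[OF p0]) auto
 finally show ?thesis by (simp add: cf_scale tmat_def mult.commute)
qed

text \<open>Here regularity is used in full: it makes even the matrix of absolute values
  contractive. For each row the step function with the phases conjugate to that row is fed into
  \<open>T\<close>; all of them are dominated by the same \<open>G\<close>, so a single majorant
  \<open>W\<close> bounds every row at once.\<close>

lemma tmat_contr:
 assumes x: "!!i. i : I ==> 0 <= x i"
 shows "(SUM i:I. (SUM j:I. cmod (tmat i j) * x j) powr p) <= (SUM j:I. x j powr p)"
proof (cases "I = {}")
 case False
 define N where "N = card I"
 have N: "0 < N" using False fin by (simp add: N_def card_gt_0_iff)
 obtain e where e: "bij_betw e {0..<N} I" using ex_bij_betw_nat_finite[OF fin] unfolding N_def by blast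
 define u where "u i j = cnj (sgn (tmat i j))" for i j
 have u: "tmat i j * u i j = of_real (cmod (tmat i j))" "cmod (u i j) <= 1" for i j
  by (auto simp: u_def sgn_eq norm_divide complex_norm_square[symmetric] power2_eq_square)
 define xs where "xs k = step (%j. u (e k) j * of_real (x j))" for k
 define G where "G = step (%j. of_real (x j))"
 have xsG: "cmod (xs k w) <= cmod (G w)" for k w
 proof (cases "EX i:I. w : A i")
  case True
  then obtain i where i: "i : I" "w : A i" by blast
  show ?thesis using x[OF i(1)] u(2)[of "e k" i]
   by (simp add: xs_def G_def step_in[OF i] norm_mult mult_right_mono mult_left_le_one_le)
 next
  case False
  thus ?thesis by (auto simp: xs_def G_def step_out)
 qed
 obtain W where W: "(%w. complex_of_real (W w)) : Lp M p" "Ln M p (%w. of_real (W w)) <= Ln M p G" "!!k w. k < N ==> cmod (T (xs k) w) <= W w"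
  using regular_max[OF N, of xs G] xsG step_Lp(1) unfolding xs_def G_def by blast
 let ?a = "%i. cmod (cf (%w. of_real (W w)) i)"
 let ?b = "%i. SUM j:I. cmod (tmat i j) * x j"
 have row: "(?b i) <= ?a i" if i: "i : I" for i
 proof -
  obtain k where k: "k < N" "e k = i" using e i by (auto simp: bij_betw_def)
  have "cf (T (xs k)) i = (SUM j:I. (tmat i j * u i j) * of_real (x j))"
   unfolding xs_def cf_T_step[OF i] k by (simp add: mult.assoc)
  also have "... = of_real (?b i)" by (simp add: u(1))
  finally have "(?b i) <= cmod (cf (T (xs k)) i)"
   by (simp only: norm_of_real abs_ge_self)
  also have "... <= ?a i"
   by (rule cf_mono[OF _ W(1) i W(3)[OF k(1)]]) (auto simp: xs_def intro: T_Lp step_Lp(1))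
  finally show ?thesis .
 qed
 have "(SUM i:I. (?b i) powr p) <= (SUM i:I. ?a i powr p)"
  using row x p0 by (intro sum_mono powr_mono2 sum_nonneg mult_nonneg_nonneg) auto
 also have "... <= Ln M p (%w. of_real (W w)) powr p" by (rule cf_contr[OF W(1)])
 also have "... <= Ln M p G powr p" using W(2) p0 by (intro powr_mono2) (auto simp: Ln_nonneg)
 also have "... = (SUM j:I. x j powr p)"
  using p0 x by (simp add: G_def step_Lp powr_powr sum_nonneg)
 finally show ?thesis .
qed simp

text \<open>\<open>stochastic_factor\<close> needs strictly positive entries and a strict
  contraction. The factor \<open>s < 1\<close> creates room and \<open>et\<close> is added to all
  entries; convexity with weights \<open>s\<close> and \<open>1 - s\<close> separates the two, and
  \<open>et\<close> is so small that its share is at most \<open>(1 - s) / 2\<close>.\<close>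

lemma perturbed_contraction:
 assumes s: "0 < s" "s < 1"
 shows "EX et>0. ALL x. (ALL i:I. 0 <= x i) --> (SUM i:I. (SUM j:I. (s * cmod (tmat i j) + et) * x j) powr p) <= (1 + s) / 2 * (SUM j:I. x j powr p)"
proof -
 define n where "n = real (card I)"
 define D where "D = (1 - s) powr (1 - p) * n * n powr p"
 have D0: "0 <= D" by (simp add: D_def n_def)
 define et where "et = ((1 - s) / 2 / (D + 1)) powr (1 / p)"
 have eta: "0 < et" using s D0 by (simp add: et_def)
 let ?e = "D * et powr p"
 have etap: "?e <= (1 - s) / 2"
 proof -
  have "?e = (D / (D + 1)) * ((1 - s) / 2)" using s D0 p0 by (simp add: et_def powr_powr)
  also have "... <= 1 * ((1 - s) / 2)" using s D0 by (intro mult_right_mono) auto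
  finally show ?thesis by simp
 qed
 let ?b = "%i x. SUM j:I. (s * cmod (tmat i j) + et) * x j"
 have "(SUM i:I. (?b i x) powr p) <= (1 + s) / 2 * (SUM j:I. x j powr p)"
  if x: "!!i. i : I ==> 0 <= x i" for x
 proof -
  define S where "S = (SUM j:I. x j powr p)"
  have S0: "0 <= S" by (simp add: S_def sum_nonneg)
  let ?a = "SUM j:I. x j"
  have sx: "?a powr p <= n powr p * S"
  proof -
   have "x j <= S powr (1 / p)" if "j : I" for j
   proof -
    have "x j powr p <= S" unfolding S_def using that fin by (intro member_le_sum) auto
    hence "(x j powr p) powr (1 / p) <= S powr (1 / p)" using p0 by (intro powr_mono2) auto
    thus ?thesis using x[OF that] p0 by (simp add: powr_powr)
   qed
   hence "?a <= n * S powr (1 / p)" unfolding n_def by (rule sum_bounded_above)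
   hence "?a powr p <= (n * S powr (1 / p)) powr p" using x p0 by (intro powr_mono2 sum_nonneg) auto
   thus ?thesis using p0 S0 by (simp add: powr_mult powr_powr n_def)
  qed
  let ?c = "%i. SUM j:I. cmod (tmat i j) * x j"
  have row: "(?b i x) powr p <= s * (?c i) powr p + (1 - s) powr (1 - p) * et powr p * ?a powr p" for i
  proof -
   let ?d = "s * (?c i) + (1 - s) * (et * ?a / (1 - s))"
   have "(?b i x) = s * (?c i) + et * ?a"
    by (simp add: distrib_right sum.distrib sum_distrib_left mult.assoc)
   also have "... = ?d" using s by simp
   finally have e: "(?b i x) = ?d" .
   have X0: "0 <= ?a" using x by (intro sum_nonneg) auto
   have "(?b i x) powr p <= s * (?c i) powr p + (1 - s) * (et * ?a / (1 - s)) powr p"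
    unfolding e using s eta X0 x by (intro powr_convex2[OF p] divide_nonneg_nonneg mult_nonneg_nonneg sum_nonneg) auto
   also have "(1 - s) * (et * ?a / (1 - s)) powr p = (1 - s) powr (1 - p) * et powr p * ?a powr p"
    using s eta X0 by (simp add: powr_divide powr_mult powr_diff)
   finally show ?thesis .
  qed
  have "(SUM i:I. (?b i x) powr p) <= (SUM i:I. s * (?c i) powr p + (1 - s) powr (1 - p) * et powr p * ?a powr p)"
   by (intro sum_mono row)
  also have "... = s * (SUM i:I. (?c i) powr p) + n * ((1 - s) powr (1 - p) * et powr p * ?a powr p)"
   by (simp add: sum.distrib sum_distrib_left n_def)
  also have "... <= s * S + n * ((1 - s) powr (1 - p) * et powr p * (n powr p * S))"
   unfolding S_def using tmat_contr[OF x] sx s by (intro add_mono mult_left_mono) (auto simp: S_def n_def)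
  also have "... = s * S + ?e * S" by (simp add: D_def)
  also have "... <= s * S + (1 - s) / 2 * S" using etap S0 by (intro add_left_mono mult_right_mono)
  also have "... = (1 + s) / 2 * S" by (simp add: field_simps)
  finally show ?thesis by (simp add: S_def)
 qed
 with eta show ?thesis by blast
qed

lemma transference_step:
 fixes c :: "'l => 'k => nat => complex"
 assumes s: "0 < s" "s < 1"
  and beta: "csemi be" and alpha: "csemi al" and C: "0 <= C"
  and H: "!!h v. (SUM m<h. be (%l. SUM k:K. SUM j<=J. c l k j * v (m + j) k) powr p) <= C * (SUM m<h + J. al (v m) powr p)"
 shows "(SUM i:I. be (%l. SUM k:K. SUM j<=J. c l k j * mat_pow_app I (%i j. of_real s * tmat i j) x j i k) powr p) <= C * (SUM i:I. al (x i) powr p)"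
proof -
 obtain et where eta: "0 < et" "!!x. (ALL i:I. 0 <= x i) ==> (SUM i:I. (SUM j:I. (s * cmod (tmat i j) + et) * x j) powr p) <= (1 + s) / 2 * (SUM j:I. x j powr p)"
  using perturbed_contraction[OF s] by blast
 define r where "r = ((1 + s) / 2) powr (1 / p)"
 have r: "0 < r" "r powr p = (1 + s) / 2" using s p0 by (auto simp: r_def powr_powr)
 have r1: "r < 1"
 proof (rule ccontr)
  assume "\<not> r < 1"
  hence "1 <= r powr p" using p0 by (intro ge_one_powr_ge_zero) auto
  with r s show False by simp
 qed
 show ?thesis
 proof (rule transference_finite[where a = "%i j. s * cmod (tmat i j) + et" and r = r])
  show "0 < s * cmod (tmat i j) + et" for i j using s eta by (simp add: add_nonneg_pos)
  show "cmod (of_real s * tmat i j) <= s * cmod (tmat i j) + et" for i j using s eta by (simp add: norm_mult)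
  show "(SUM i:I. (SUM j:I. (s * cmod (tmat i j) + et) * x j) powr p) <= r powr p * (SUM j:I. x j powr p)"
   if "!!i. i : I ==> 0 <= x i" for x using eta(2)[of x] that by (simp add: r)
 qed (rule p fin r(1) r1 beta alpha C H)+
qed

text \<open>Each step adds one projection error \<open>de\<close>; since \<open>T\<close>,
  multiplication by \<open>s\<close> and the projection do not expand, the errors only add
  up.\<close>

lemma step_iterates:
 assumes s: "0 <= s" "s <= 1" and x: "!!k. k : K ==> x k : Lp M p" and k: "k : K" and d: "0 <= de"
  and app: "!!j. j <= J ==> Ln M p (%w. of_real (s ^ j) * (T ^^ j) (x k) w - step (cf (%w. of_real (s ^ j) * (T ^^ j) (x k) w)) w) <= de"
  and j: "j <= J"
 shows "Ln M p (%w. of_real (s ^ j) * (T ^^ j) (x k) w - step (%i. mat_pow_app I (%i j. of_real s * tmat i j) (%i k. cf (x k) i) j i k) w) <= (real j + 1) * de"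
 using j
proof (induction j)
 case 0
 show ?case using app[of 0] by simp
next
 case (Suc j)
 define y where "y j = (%w. of_real (s ^ j) * (T ^^ j) (x k) w)" for j
 define X where "X j = step (%i. mat_pow_app I (%i j. of_real s * tmat i j) (%i k. cf (x k) i) j i k)" for j
 have yL: "y j : Lp M p" for j unfolding y_def by (intro Lp_scale(1)[OF p0] Tn_Lp x k)
 have XL: "X j : Lp M p" for j unfolding X_def by (rule step_Lp)
 define z where "z = (%w. of_real s * T (X j) w)"
 have zL: "z : Lp M p" unfolding z_def by (intro Lp_scale(1)[OF p0] T_Lp XL)
 have XS: "X (Suc j) = step (cf z)"
  unfolding X_def by (rule step_cong) (simp add: z_def cf_scale X_def cf_T_step sum_distrib_left mult.assoc)
 let ?b = "%w. y j w - X j w"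
 have IH: "Ln M p ?b <= (real j + 1) * de" using Suc by (simp add: y_def X_def)
 note dL = Lp_diff(1)[OF p yL XL]
 let ?c = "%w. T (%w. y j w - X j w) w"
 have yz: "AE w in M. y (Suc j) w - z w = of_real s * ?c w"
 proof -
  have "AE w in M. T (y j) w = of_real (s ^ j) * T ((T ^^ j) (x k)) w"
   unfolding y_def by (intro T_scale Tn_Lp x k)
  moreover have "AE w in M. ?c w = T (y j) w - T (X j) w" by (intro T_diff yL XL)
  ultimately show ?thesis
  proof eventually_elim
   case (elim w)
   show ?case unfolding elim(2) elim(1) z_def by (simp add: y_def right_diff_distrib)
  qed
 qed
 let ?a = "%w. y (Suc j) w - z w"
 have yzL: "Ln M p ?a <= (real j + 1) * de"
 proof -
  have "Ln M p ?a = Ln M p (%w. of_real s * ?c w)"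
   by (rule Lp_cong_AE(2)[OF p0 Lp_scale(1)[OF p0 T_Lp[OF dL]] _ yz]) (intro borel_measurable_diff LpD[OF yL] LpD[OF zL])
  also have "... = s * Ln M p (T ?b)" using s by (simp add: Lp_scale(2)[OF p0 T_Lp[OF dL]])
  also have "... <= 1 * Ln M p ?b" using s T_contr[OF dL] by (intro mult_mono) (auto simp: Ln_nonneg)
  finally show ?thesis using IH by simp
 qed
 let ?d = "%w. y (Suc j) w - X (Suc j) w"
 have eq: "?d = (%w. (y (Suc j) w - step (cf (y (Suc j))) w) + step (cf (%w. y (Suc j) w - z w)) w)"
 proof -
  have "step (cf ?a) = step (%i. cf (y (Suc j)) i - cf z i)"
   by (intro step_cong cf_diff yL zL)
  thus ?thesis by (simp add: XS step_diff)
 qed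
 have "Ln M p ?d <= Ln M p (%w. y (Suc j) w - step (cf (y (Suc j))) w) + Ln M p (step (cf ?a))"
  unfolding eq by (intro Lp_add(2)[OF p] Lp_diff(1)[OF p] yL step_Lp(1))
 also have "... <= de + (real j + 1) * de"
  by (intro add_mono order_trans[OF step_cf_contr[OF Lp_diff(1)[OF p yL zL]] yzL]) (use app[OF Suc.prems] in "simp only: y_def")
 finally show ?case by (simp add: y_def X_def algebra_simps)
qed

end

context contr_regular
begin

text \<open>On a partition adapted to the vectors \<open>s^j T^j x_k\<close> the claim is the matrix
  statement \<open>transference_step\<close>. The approximation error is \<open>E * de\<close> with
  \<open>E\<close> independent of the partition: the bounds of the seminorms by finite sums turn
  errors of single entries into errors of the norms.\<close>

theorem transference:
 fixes c :: "'l => 'k => nat => complex" and x :: "'k => 'a => complex"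
 assumes s: "0 < s" "s < 1" and finK: "finite K" and finL: "finite L"
  and x: "!!k. k : K ==> x k : Lp M p"
  and beta: "csemi be" and betam: "!!f. (!!l. f l : borel_measurable M) ==> (%w. be (%l. f l w)) : borel_measurable M"
  and betab: "!!v. be v <= (SUM l:L. cmod (v l))"
  and alpha: "csemi al" and alpham: "!!f. (!!k. f k : borel_measurable M) ==> (%w. al (%k. f k w)) : borel_measurable M"
  and alphab: "!!v. al v <= (SUM k:K. cmod (v k))"
  and C: "0 <= C"
  and H: "!!h v. (SUM m<h. be (%l. SUM k:K. SUM j<=J. c l k j * v (m + j) k) powr p) <= C * (SUM m<h + J. al (v m) powr p)"
 shows "Ln M p (%w. of_real (be (%l. SUM k:K. SUM j<=J. c l k j * (of_real (s ^ j) * (T ^^ j) (x k) w))))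
  <= C powr (1 / p) * Ln M p (%w. of_real (al (%k. if k : K then x k w else 0)))"
  (is "?lhs <= C powr (1 / p) * ?R")
proof -
 let ?e = "SUM l:L. SUM k:K. SUM j<=J. cmod (c l k j) * (real j + 1)"
 define E where "E = ?e + C powr (1 / p) * real (card K)"
 have E0: "0 <= E" unfolding E_def by (intro add_nonneg_nonneg sum_nonneg mult_nonneg_nonneg) auto
 define x' where "x' k = (if k : K then x k else (%_. 0))" for k
 have x': "x' k : Lp M p" for k using x Lp_zero(1)[OF p0, of M] by (simp add: x'_def)
 let ?a = "%bD. %w. complex_of_real (bD w)"
 let ?b = "%bY. \<integral>w. cmod (complex_of_real (bY w)) powr p \<partial>M"
 let ?c = "%l f. %w. SUM k:K. SUM j<=J. c l k j * f k j w"
 let ?h = "%bD. Ln M p (?a bD)"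
 let ?m = "%l f. (SUM k:K. SUM j<=J. cmod (c l k j) * Ln M p (f k j))"
 have main: "?lhs <= C powr (1 / p) * ?R + E * de" if d: "0 < de" for de
 proof -
  define y where "y k j = (%w. of_real (s ^ j) * (T ^^ j) (x' k) w)" for k j
  have yL: "y k j : Lp M p" for k j unfolding y_def by (intro Lp_scale(1)[OF p0] Tn_Lp x')
  obtain I :: "('k \<times> nat => complex) set" and A where P: "step_partition M p I A" and
   app: "!!k j. k : K ==> j <= J ==> Ln M p (%w. y k j w - step_partition.step M p I A (step_partition.cf M p A (y k j)) w) <= de"
   using step_approximation[OF p, of "K \<times> {..J}" "%(k, j). y k j" M de] finK d yL by fastforce
  interpret step_partition M p I A by (rule P)
  interpret contr_partition M p T I A ..
  define X where "X j i k = mat_pow_app I (%i j. of_real s * tmat i j) (%i k. cf (x' k) i) j i k" for j i k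
  let ?k = "%k j. Ln M p (%w. y k j w - step (%i. X j i k) w)"
  have X: "?k k j <= (real j + 1) * de" if "k : K" "j <= J" for k j
   unfolding y_def X_def
   by (rule step_iterates[where K = UNIV and J = J]) (use s x' d app[OF that(1)] that(2) in "auto simp: y_def")
  define Z where "Z l w = (SUM k:K. SUM j<=J. c l k j * y k j w)" for l w
  define Y where "Y l w = (SUM k:K. SUM j<=J. c l k j * step (%i. X j i k) w)" for l w
  have lin: "(?c l f) : Lp M p & Ln M p (?c l f) <= ?m l f"
   if f: "!!k j. f k j : Lp M p" for f l
  proof -
   let ?f = "%k. %w. SUM j<=J. c l k j * f k j w"
   have 1: "(?f k) : Lp M p & Ln M p (?f k) <= (SUM j<=J. cmod (c l k j) * Ln M p (f k j))" for k
    using Lp_sum[OF p, of "{..J}" "%j w. c l k j * f k j w" M] Lp_scale[OF p0 f] by simp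
   have 2: "Ln M p (?c l f) <= (SUM k:K. Ln M p (?f k))" "(?c l f) : Lp M p"
    using Lp_sum[OF p finK, of "%k w. SUM j<=J. c l k j * f k j w" M] 1 by simp_all
   have "(SUM k:K. Ln M p (?f k)) <= ?m l f" using 1 by (intro sum_mono) auto
   with 2 show ?thesis by (meson order_trans)
  qed
  have ZL: "Z l : Lp M p" and YL: "Y l : Lp M p" for l
   unfolding Z_def Y_def using lin[of y l] lin[of "%k j. step (%i. X j i k)" l] yL step_Lp(1) by auto
  let ?d = "%l. %w. Z l w - Y l w"
  let ?l = "%l. (SUM k:K. SUM j<=J. cmod (c l k j) * ((real j + 1) * de))"
  have ZY: "Ln M p (?d l) <= ?l l" for l
  proof -
   have "(?d l) = (%w. SUM k:K. SUM j<=J. c l k j * (y k j w - step (%i. X j i k) w))"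
    by (simp add: Z_def Y_def right_diff_distrib sum_subtractf)
   hence "Ln M p (?d l) <= (SUM k:K. SUM j<=J. cmod (c l k j) * ?k k j)"
    using lin[of "%k j w. y k j w - step (%i. X j i k) w" l] Lp_diff(1)[OF p yL step_Lp(1)] by simp
   also have "... <= ?l l"
    using X by (intro sum_mono mult_left_mono) auto
   finally show ?thesis .
  qed
  define bD where "bD w = be (%l. Z l w - Y l w)" for w
  define bY where "bY w = be (%l. Y l w)" for w
  have bD: "(?a bD) : Lp M p & ?h bD <= (SUM l:L. Ln M p (?d l))"
   unfolding bD_def using Lp_diff(1)[OF p ZL YL]
   by (intro conjI Lp_seminorm[OF p beta _ finL betab] betam LpD) auto
  have bY: "(?a bY) : Lp M p"
   unfolding bY_def using YL
   by (intro Lp_seminorm(1)[OF p beta _ finL betab] betam LpD) auto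
  define aD where "aD w = al (%k. step (cf (x' k)) w - x' k w)" for w
  define aX where "aX w = al (%k. x' k w)" for w
  define aS where "aS w = al (%k. step (cf (x' k)) w)" for w
  have aD: "(?a aD) : Lp M p & ?h aD <= (SUM k:K. Ln M p (%w. step (cf (x' k)) w - x' k w))"
   unfolding aD_def using Lp_diff(1)[OF p step_Lp(1) x']
   by (intro conjI Lp_seminorm[OF p alpha _ finK alphab] alpham LpD) auto
  have aX: "(?a aX) : Lp M p"
   unfolding aX_def using x' by (intro Lp_seminorm(1)[OF p alpha _ finK alphab] alpham LpD) auto
  have aS: "(?a aS) : Lp M p"
   unfolding aS_def using step_Lp(1) by (intro Lp_seminorm(1)[OF p alpha _ finK alphab] alpham LpD) auto
  have lhs: "?lhs <= ?h bY + ?h bD"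
  proof -
   have e: "(%l. SUM k:K. SUM j<=J. c l k j * (of_real (s ^ j) * (T ^^ j) (x k) w)) = (%l. Z l w)" for w
    by (simp add: Z_def y_def x'_def)
   have "be (%l. Z l w) <= bY w + bD w" for w
    using cseminorm_triangle[OF beta, of "%l. Y l w" "%l. Z l w - Y l w"] by (simp add: bY_def bD_def)
   thus ?thesis unfolding e
    using bY bD betam[OF LpD[OF ZL]] cseminorm_nonneg[OF beta] by (intro Ln_le_add[OF p]) auto
  qed
  let ?g = "SUM i:I. be (%l. SUM k:K. SUM j<=J. c l k j * X j i k) powr p"
  let ?i = "SUM i:I. al (%k. cf (x' k) i) powr p"
  have tr: "?h bY <= C powr (1 / p) * ?h aS"
  proof -
   have Ye: "Y l w = step (%i. SUM k:K. SUM j<=J. c l k j * X j i k) w" for l w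
    unfolding Y_def by (simp add: step_sum step_scale)
   have 1: "(?b bY) = ?g"
    unfolding bY_def Ye using step_seminorm(2)[OF beta] cseminorm_nonneg[OF beta] by simp
   have 2: "(?b aS) = ?i"
    unfolding aS_def using step_seminorm(2)[OF alpha] cseminorm_nonneg[OF alpha] by simp
   have "?g <= C * ?i"
    unfolding X_def by (rule transference_step[OF s beta alpha C H])
   hence "(?b bY) powr (1 / p) <= (C * (?b aS)) powr (1 / p)"
    unfolding 1 2 using p0 by (intro powr_mono2 sum_nonneg) auto
   thus ?thesis unfolding Ln_def using C by (simp add: powr_mult integral_nonneg_AE)
  qed
  have aSle: "?h aS <= ?R + ?h aD"
  proof -
   have e: "(%w. of_real (al (%k. if k : K then x k w else 0))) = (?a aX)"
    unfolding aX_def x'_def by (intro ext arg_cong[where f = of_real] arg_cong[where f = al]) auto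
   have "aS w <= aX w + aD w" for w
    using cseminorm_triangle[OF alpha, of "%k. x' k w" "%k. step (cf (x' k)) w - x' k w"] by (simp add: aS_def aX_def aD_def)
   thus ?thesis unfolding e
    using aX aD alpham[OF LpD[OF step_Lp(1)], of "%k. cf (x' k)"] cseminorm_nonneg[OF alpha] by (intro Ln_le_add[OF p]) (auto simp: aS_def[abs_def])
  qed
  have "(SUM l:L. Ln M p (?d l)) <= (SUM l:L. SUM k:K. SUM j<=J. cmod (c l k j) * ((real j + 1) * de))"
   by (intro sum_mono ZY)
  hence D1: "?h bD <= ?e * de"
   using conjunct2[OF bD] by (simp add: sum_distrib_right mult.assoc)
  have "(SUM k:K. Ln M p (%w. step (cf (x' k)) w - x' k w)) <= (SUM k:K. de)"
  proof (rule sum_mono)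
   fix k assume k: "k : K"
   have "y k 0 = x' k" by (simp add: y_def)
   hence "Ln M p (%w. x' k w - step (cf (x' k)) w) <= de" using app[OF k, of 0] by simp
   thus "Ln M p (%w. step (cf (x' k)) w - x' k w) <= de" by (simp add: Ln_def norm_minus_commute)
  qed
  hence D2: "?h aD <= real (card K) * de" using conjunct2[OF aD] by simp
  let ?j = "?R + real (card K) * de"
  have "?lhs <= C powr (1 / p) * ?j + ?e * de"
  proof -
   have "?h aS <= ?j" using aSle D2 by linarith
   hence "C powr (1 / p) * ?h aS <= C powr (1 / p) * ?j" by (rule mult_left_mono) simp
   with lhs tr D1 show ?thesis by linarith
  qed
  thus ?thesis unfolding E_def by (simp add: algebra_simps)
 qed
 show ?thesis
 proof (rule field_le_epsilon)
  fix e :: real assume e: "0 < e"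
  have "E * (e / (E + 1)) <= e" using E0 e by (simp add: field_simps)
  with main[of "e / (E + 1)"] e E0 show "?lhs <= C powr (1 / p) * ?R + e" by (smt (verit) divide_pos_pos)
 qed
qed

end

section \<open>Seminorms in the values and the norm of L^p(l^2)\<close>

lemma sqrt_sum_cseminorm:
 "csemi (%v. L2_set (%l. cmod (v l)) S)"
proof -
 have "L2_set (%k. cmod (u k + v k)) S <= L2_set (%k. cmod (u k)) S + L2_set (%k. cmod (v k)) S" for u v
  by (rule order_trans[OF L2_set_mono L2_set_triangle_ineq]) (auto intro: norm_triangle_ineq)
 thus ?thesis unfolding csemi_def by (simp add: norm_mult L2_set_right_distrib)
qed

lemma L2_set_measurable:
 assumes "!!l. l : S ==> f l : borel_measurable M"
 shows "(%w. L2_set (%l. cmod (f l w)) S) : borel_measurable M"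
proof -
 note [measurable] = assms
 show ?thesis unfolding L2_set_def by measurable
qed

lemma sum_cseminorm: "csemi (%v. SUM l:S. cmod (v l))"
 unfolding csemi_def by (auto simp: norm_mult sum_distrib_left sum.distrib[symmetric] intro!: sum_mono norm_triangle_ineq)

text \<open>The inserted 0 gives the empty set the supremum 0.\<close>

definition sup_set :: "'l set => ('l => complex) => real" where
 "sup_set S v = Max (insert 0 ((%l. cmod (v l)) ` S))"

lemma sup_set_le: "finite S ==> sup_set S v <= c \<longleftrightarrow> 0 <= c & (ALL l:S. cmod (v l) <= c)"
 by (simp add: sup_set_def)

lemma sup_set_ge: "finite S ==> l : S ==> cmod (v l) <= sup_set S v"
 and sup_set_nonneg: "finite S ==> 0 <= sup_set S v"
 by (simp_all add: sup_set_def)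

lemma sup_set_le_sum: "finite S ==> sup_set S v <= (SUM l:S. cmod (v l))"
 by (auto simp: sup_set_le sum_nonneg intro: member_le_sum)

lemma sup_set_cseminorm:
 assumes S: "finite S"
 shows "csemi (sup_set S)"
proof -
 have tri: "sup_set S (%k. u k + v k) <= sup_set S u + sup_set S v" for u v
  using S sup_set_ge[OF S, of _ u] sup_set_ge[OF S, of _ v] sup_set_nonneg[OF S, of u] sup_set_nonneg[OF S, of v]
  by (auto simp: sup_set_le intro: order_trans[OF norm_triangle_ineq add_mono])
 let ?a = "%c u. sup_set S (%k. c * u k)"
 have le: "?a c u <= cmod c * sup_set S u" for c u
  using S sup_set_ge[OF S, of _ u] sup_set_nonneg[OF S, of u] by (auto simp: sup_set_le norm_mult mult_left_mono)
 have "?a c u = cmod c * sup_set S u" for c u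
 proof (cases "c = 0")
  case False
  have "cmod c * sup_set S u = cmod c * sup_set S (%k. inverse c * (c * u k))" using False by (simp flip: mult.assoc)
  also have "... <= cmod c * (cmod (inverse c) * ?a c u)" by (intro mult_left_mono le) auto
  also have "... = ?a c u" using False by (simp add: norm_inverse)
  finally show ?thesis using le[of c u] by simp
 next
  case True
  thus ?thesis using le[of 0 u] sup_set_nonneg[OF S, of "%k. 0"] by simp
 qed
 with tri show ?thesis by (simp add: csemi_def)
qed

lemma sup_set_measurable:
 assumes S: "finite S" and "!!l. l : S ==> f l : borel_measurable M"
 shows "(%w. sup_set S (%l. f l w)) : borel_measurable M"
proof -
 have "(%w. Max ((%l. case l of None => 0 | Some l => cmod (f l w)) ` insert None (Some ` S))) : borel_measurable M"
 proof (rule borel_measurable_Max)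
  show "finite (insert None (Some ` S))" using S by simp
  show "(%w. case l of None => 0 | Some l => cmod (f l w)) : borel_measurable M" if "l : insert None (Some ` S)" for l
   using assms(2) that by (cases l) auto
 qed
 thus ?thesis by (simp add: sup_set_def image_image)
qed

definition L2n :: "'a measure => real => 'k set => ('k => 'a => complex) => real" where
 "L2n M p S u = Ln M p (%w. of_real (L2_set (%k. cmod (u k w)) S))"

lemma L2n_nonneg: "0 <= L2n M p S u" by (simp add: L2n_def Ln_nonneg)

lemma L2n_single: "L2n M p {k} u = Ln M p (u k)"
 by (simp add: L2n_def L2_set_def Ln_def)

lemma L2n_Lp:
 assumes p: "1 < p" and S: "finite S" and u: "!!k. k : S ==> u k : Lp M p"
 shows "(%w. of_real (L2_set (%k. cmod (u k w)) S)) : Lp M p"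
proof (rule Lp_seminorm(1)[OF p sqrt_sum_cseminorm L2_set_measurable S L2_set_le_sum u])
 show "u l : borel_measurable M" if "l : S" for l by (rule LpD[OF u[OF that]])
qed auto

lemma L2n_le_sum: "1 < p ==> finite S ==> (!!k. k : S ==> u k : Lp M p) ==> L2n M p S u <= (SUM k:S. Ln M p (u k))"
 unfolding L2n_def by (rule Lp_seminorm(2)[OF _ sqrt_sum_cseminorm L2_set_measurable _ L2_set_le_sum]) (auto intro: LpD)

lemma L2n_triangle:
 assumes p: "1 < p" and S: "finite S" and u: "!!k. k : S ==> u k : Lp M p" and v: "!!k. k : S ==> v k : Lp M p"
 shows "L2n M p S (%k w. u k w + v k w) <= L2n M p S u + L2n M p S v"
 unfolding L2n_def
proof (rule Ln_le_add[OF p L2n_Lp[OF p S u] L2n_Lp[OF p S v]])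
 show "L2_set (%k. cmod (u k w + v k w)) S <= L2_set (%k. cmod (u k w)) S + L2_set (%k. cmod (v k w)) S" for w
  by (rule order_trans[OF L2_set_mono L2_set_triangle_ineq]) (auto intro: norm_triangle_ineq)
 show "(%w. L2_set (%k. cmod (u k w + v k w)) S) : borel_measurable M"
  by (rule L2_set_measurable) (use LpD[OF Lp_add(1)[OF p u v]] in auto)
qed (simp_all add: L2_set_nonneg)

lemma L2n_mono:
 assumes p: "1 < p" and S: "finite S" "finite S'" and u: "!!k. k : S ==> u k : Lp M p" and v: "!!k. k : S' ==> v k : Lp M p" and B: "0 <= B"
  and le: "!!w. (SUM k:S. (cmod (u k w))\<^sup>2) <= B^2 * (SUM k:S'. (cmod (v k w))\<^sup>2)"
 shows "L2n M p S u <= B * L2n M p S' v"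
proof -
 have p0: "0 < p" using p by simp
 have "L2_set (%k. cmod (u k w)) S <= B * L2_set (%k. cmod (v k w)) S'" for w
  using real_sqrt_le_mono[OF le[of w]] B by (simp add: L2_set_def real_sqrt_mult)
 hence "Ln M p (%w. of_real (L2_set (%k. cmod (u k w)) S)) <= Ln M p (%w. of_real B * of_real (L2_set (%k. cmod (v k w)) S'))"
  using B by (intro Lp_mono(2)[OF p0 Lp_scale(1)[OF p0 L2n_Lp[OF p S(2) v]] LpD[OF L2n_Lp[OF p S(1) u]]]) (auto simp: L2_set_nonneg norm_mult)
 also have "... = B * L2n M p S' v" using B unfolding L2n_def by (subst Lp_scale(2)[OF p0 L2n_Lp[OF p S(2) v]]) auto
 finally show ?thesis by (simp add: L2n_def)
qed

lemma L2n_subset: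
 assumes "1 < p" "finite S'" "S \<subseteq> S'" "!!k. k : S' ==> u k : Lp M p"
 shows "L2n M p S u <= L2n M p S' u"
proof -
 have "L2n M p S u <= 1 * L2n M p S' u" using assms by (intro L2n_mono) (auto intro: finite_subset intro!: sum_mono2)
 thus ?thesis by simp
qed

lemma L2n_cong_AE:
 assumes p: "1 < p" and S: "finite S" and u: "!!k. k : S ==> u k : Lp M p" "!!k. k : S ==> v k : Lp M p"
  and eq: "!!k. k : S ==> AE w in M. u k w = v k w"
 shows "L2n M p S u = L2n M p S v"
 unfolding L2n_def
proof (rule Lp_cong_AE(2)[OF _ L2n_Lp[OF p S u(2)] LpD[OF L2n_Lp[OF p S u(1)]]])
 have "AE w in M. ALL k:S. u k w = v k w" by (rule AE_finite_allI[OF S eq])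
 thus "AE w in M. complex_of_real (L2_set (%k. cmod (u k w)) S) = of_real (L2_set (%k. cmod (v k w)) S)"
  by eventually_elim (auto intro: L2_set_cong)
qed (use p in auto)

lemma L2n_pairing:
 assumes pq: "1 < p" "1 < q" "1/p + 1/q = 1" and S: "finite S" and f: "!!k. k : S ==> f k : Lp M p" and g: "!!k. k : S ==> g k : Lp M q"
 shows "cmod (SUM k:S. \<integral>w. f k w * g k w \<partial>M) <= L2n M p S f * L2n M q S g"
proof -
 note H = Lp_Holder[OF pq L2n_Lp[OF pq(1) S f] L2n_Lp[OF pq(2) S g]]
 note I = Lp_Holder(1)[OF pq f g]
 let ?a = "%w. cmod (complex_of_real (L2_set (%k. cmod (f k w)) S) * complex_of_real (L2_set (%k. cmod (g k w)) S))"
 let ?b = "%w. SUM k:S. f k w * g k w"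
 have "(SUM k:S. \<integral>w. f k w * g k w \<partial>M) = (\<integral>w. (?b w) \<partial>M)"
  by (rule Bochner_Integration.integral_sum[symmetric]) (rule I)
 also have "cmod ... <= (\<integral>w. ?a w \<partial>M)"
 proof (rule order_trans[OF integral_norm_bound integral_mono])
  show "integrable M (%w. cmod (?b w))" by (intro integrable_norm Bochner_Integration.integrable_sum I)
  show "integrable M (%w. ?a w)"
   by (rule integrable_norm[OF H(1)])
  fix w
  have "cmod (?b w) <= (SUM k:S. \<bar>cmod (f k w)\<bar> * \<bar>cmod (g k w)\<bar>)"
   by (rule sum_norm_le) (simp add: norm_mult)
  also have "... <= L2_set (%k. cmod (f k w)) S * L2_set (%k. cmod (g k w)) S" by (rule L2_set_mult_ineq)
  finally show "cmod (?b w) <= ?a w"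
   by (simp add: norm_mult L2_set_nonneg)
 qed
 also have "... <= L2n M p S f * L2n M q S g" using H(3) by (simp add: L2n_def)
 finally show ?thesis .
qed

section \<open>Square functions of the operator\<close>

text \<open>\<open>Q(s T) x\<close>. The hard estimates are made for \<open>0 < s < 1\<close>,
  uniformly in \<open>s\<close>; \<open>s = 1\<close> gives \<open>poly_op\<close>.\<close>

definition op :: "real => (('a => complex) => 'a => complex) => complex poly => ('a => complex) => 'a => complex" where
 "op s T Q x w = (SUM j<=degree Q. coeff Q j * (of_real (s ^ j) * (T ^^ j) x w))"

lemma sum_coeff_extend:
 fixes g :: "nat => 'b::comm_semiring_1"
 assumes "degree Q <= J"
 shows "(SUM j<=J. coeff Q j * g j) = (SUM j<=degree Q. coeff Q j * g j)"
 using assms by (intro sum.mono_neutral_right) (auto simp: coeff_eq_0)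

lemma op_eq: "degree Q <= J ==> op s T Q x w = (SUM j<=J. coeff Q j * (of_real (s ^ j) * (T ^^ j) x w))"
 unfolding op_def by (rule sum_coeff_extend[symmetric])

definition cpoly :: "real poly => complex poly" where "cpoly P = map_poly of_real P"

lemma coeff_cpoly [simp]: "coeff (cpoly P) j = of_real (coeff P j)" by (simp add: cpoly_def coeff_map_poly)

lemma degree_cpoly [simp]: "degree (cpoly P) = degree P" by (simp add: cpoly_def degree_map_poly)

lemma pconv_cpoly:
 fixes v :: "nat => complex"
 assumes d: "degree P <= J" and m: "m < h"
 shows "(SUM j<=J. coeff (cpoly P) j * v (m + j)) =
  Complex (pconv P (%l. if l < h + J then Re (v l) else 0) m) (pconv P (%l. if l < h + J then Im (v l) else 0) m)"
proof -
 have "pconv P (%l. if l < h + J then g l else 0) m = (SUM j<=J. coeff P j * g (m + j))" for g :: "nat => real"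
  using m by (subst pconv_eq[of _ "Suc J"]) (auto simp: d conv_def le_imp_less_Suc lessThan_Suc_atMost intro!: sum.cong)
 thus ?thesis by (simp add: complex_eq_iff)
qed

lemma sum_pairs: "(SUM nk:A \<times> B. F nk) = (SUM n:A. SUM k:B. F (n, k))"
 by (simp add: sum.cartesian_product split_def)

lemma sum_select:
 assumes "finite V" "n : V" "!!k. F 0 k = 0"
 shows "(SUM k:V \<times> B. F (if n = fst k then f (snd k) else 0) k) = (SUM k:B. F (f k) (n, k))"
proof -
 have "(SUM k:V \<times> B. F (if n = fst k then f (snd k) else 0) k) = (SUM n':V. if n' = n then SUM k:B. F (f k) (n, k) else 0)"
  unfolding sum_pairs by (intro sum.cong refl) (auto simp: assms)
 thus ?thesis using assms by simp
qed

context contr_regular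
begin

lemma op_Lp: "x : Lp M p ==> op s T Q x : Lp M p"
 unfolding op_def[abs_def] using p
 by (intro conjunct1[OF Lp_sum] Lp_scale(1) Tn_Lp) auto

text \<open>Transference for a matrix of real polynomials in \<open>l^2\<close> norms. The index
  \<open>b\<close> runs over real and imaginary part, so that estimates for real sequences serve
  complex ones.\<close>

lemma poly_transference:
 fixes q :: "'l => 'k => real poly"
 assumes s: "0 < s" "s < 1" and fin: "finite S" "finite L" and x: "!!k. k : S ==> x k : Lp M p" and C: "0 <= C"
  and H: "!!h a. (!!k b l. h < l ==> a k b l = 0) ==> (SUM m<=h. (SUM l:L. SUM b:UNIV. (SUM k:S. pconv (q l k) (a k b) m)\<^sup>2) powr (p/2))
   <= C * (SUM m<=h. (SUM k:S. SUM b:(UNIV :: bool set). (a k b m)\<^sup>2) powr (p/2))"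
 shows "L2n M p L (%l w. SUM k:S. op s T (cpoly (q l k)) (x k) w) <= C powr (1 / p) * L2n M p S x"
proof -
 define J where "J = (SUM l:L. SUM k:S. degree (q l k))"
 have J: "degree (q l k) <= J" if "l : L" "k : S" for l k
  unfolding J_def using that fin member_le_sum[of k S "%k. degree (q l k)"] member_le_sum[of l L "%l. SUM k:S. degree (q l k)"] by fastforce
 let ?c = "%l k j. coeff (cpoly (q l k)) j"
 let ?d = "%v. %l. cmod (v l)"
 have "Ln M p (%w. of_real (L2_set (%l. cmod (SUM k:S. SUM j<=J. ?c l k j * (of_real (s ^ j) * (T ^^ j) (x k) w))) L))
  <= C powr (1 / p) * Ln M p (%w. of_real (L2_set (%k. cmod (if k : S then x k w else 0)) S))"
 proof (rule transference[where al = "%v. L2_set (?d v) S" and be = "%v. L2_set (?d v) L" and L = L])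
  show "L2_set (?d v) L <= (SUM l:L. cmod (v l))" for v by (rule L2_set_le_sum) auto
  show "L2_set (?d v) S <= (SUM l:S. cmod (v l))" for v by (rule L2_set_le_sum) auto
  fix h and v :: "nat => 'k => complex"
  define a where "a k b l = (if l < h + J then (if b then Re else Im) (v l k) else 0)" for k b and l :: nat
  let ?e = "%l m. cmod (SUM k:S. SUM j<=J. ?c l k j * v (m + j) k)"
  have "pconv (q l k) (a k b) m = (if b then Re else Im) (SUM j<=J. ?c l k j * v (m + j) k)" if "l : L" "k : S" "m < h" for l k b m
   unfolding pconv_cpoly[OF J[OF that(1,2)] that(3), of "%l. v l k"] a_def by (cases b) (simp_all cong: if_cong)
  hence a: "(SUM b:UNIV. (SUM k:S. pconv (q l k) (a k b) m)\<^sup>2) = (?e l m)^2" if "l : L" "m < h" for l m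
   using that by (simp add: UNIV_bool cmod_power2)
  let ?a = "SUM m<=h + J. (SUM k:S. SUM b:UNIV. (a k b m)\<^sup>2) powr (p/2)"
  let ?b = "SUM m<h + J. L2_set (%l. cmod (v m l)) S powr p"
  have "(SUM m<h. L2_set (%l. cmod (SUM k:S. SUM j<=J. ?c l k j * v (m + j) k)) L powr p)
   = (SUM m<h. (SUM l:L. SUM b:UNIV. (SUM k:S. pconv (q l k) (a k b) m)\<^sup>2) powr (p/2))"
   unfolding L2_powr by (intro sum.cong refl arg_cong2[where f = "(powr)"]) (simp add: a)
  also have "... <= (SUM m<=h + J. (SUM l:L. SUM b:UNIV. (SUM k:S. pconv (q l k) (a k b) m)\<^sup>2) powr (p/2))" by (intro sum_mono2) auto
  also have "... <= C * ?a" by (rule H) (simp add: a_def)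
  also have "?a = ?b"
   unfolding L2_powr by (intro sum.mono_neutral_cong_right) (auto simp: a_def UNIV_bool cmod_power2 add.commute)
  finally show "(SUM m<h. L2_set (%l. ?e l m) L powr p) <= C * ?b" .
 qed (use s x C fin in "auto intro: sqrt_sum_cseminorm L2_set_measurable")
 moreover have "L2_set (%l. cmod (SUM k:S. SUM j<=J. ?c l k j * (of_real (s ^ j) * (T ^^ j) (x k) w))) L = L2_set (%l. cmod (SUM k:S. op s T (cpoly (q l k)) (x k) w)) L" for w
  using J by (intro L2_set_cong refl) (simp add: op_eq[of _ J])
 moreover have "L2_set (%k. cmod (if k : S then x k w else 0)) S = L2_set (%k. cmod (x k w)) S" for w by (intro L2_set_cong) auto
 ultimately show ?thesis by (simp add: L2n_def)
qed

lemma square_function: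
 "EX C>=0. ALL s K x. 0 < s --> s < 1 --> x : Lp M p --> L2n M p {..<K} (%k. op s T (cpoly (lp_poly k)) x) <= C * Ln M p x"
proof -
 obtain C where C: "0 <= C" "!!K h N. !!a :: bool => nat => real. finite N ==> (ALL n l. h < l --> a n l = 0) ==>
  (SUM m<=h. (SUM k<K. SUM n:N. (pconv (lp_poly k) (a n) m)\<^sup>2) powr (p/2))
   <= C * (SUM m<=h. (SUM n:N. (a n m)\<^sup>2) powr (p/2))" using lp_square_function[OF p, where 'n = bool] by blast
 have "L2n M p {..<K} (%k w. SUM u:{()}. op s T (cpoly (lp_poly k)) x w) <= C powr (1 / p) * L2n M p {()} (%_. x)"
  if "0 < s" "s < 1" "x : Lp M p" for s K x
  using that C by (intro poly_transference) auto
 thus ?thesis by (intro exI[of _ "C powr (1 / p)"]) (auto simp: L2n_single)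
qed

lemma dual_square_function:
 "EX C>=0. ALL s K (V :: nat set) x. 0 < s --> s < 1 --> finite V --> (ALL n k. x n k : Lp M p) -->
  L2n M p V (%n w. SUM k<K. op s T (cpoly (lp_poly k)) (x n k) w) <= C * L2n M p (V \<times> {..<K}) (%(n, k). x n k)"
proof -
 obtain C where C: "0 <= C" "!!K h N. !!a :: nat \<times> bool => nat => nat => real. finite N ==> (ALL n k l. h < l --> a n k l = 0) ==>
  (SUM m<=h. (SUM n:N. (SUM k<K. pconv (lp_poly k) (a n k) m)\<^sup>2) powr (p/2))
   <= C * (SUM m<=h. (SUM k<K. SUM n:N. (a n k m)\<^sup>2) powr (p/2))" using lp_dual_square_function[OF p, where 'n = "nat \<times> bool"] by blast
 have "L2n M p V (%n w. SUM k<K. op s T (cpoly (lp_poly k)) (x n k) w) <= C powr (1 / p) * L2n M p (V \<times> {..<K}) (%(n, k). x n k)"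
  if s: "0 < s" "s < 1" and V: "finite V" and x: "!!n k. x n k : Lp M p" for s K and V :: "nat set" and x
 proof -
  \<comment> \<open>Diagonal in \<open>n\<close>: row \<open>n\<close> only involves the vectors
    with first index \<open>n\<close>.\<close>
  let ?q = "%n nk. if n = fst nk then lp_poly (snd nk) else 0"
  note d = sum_select[OF V]
  have "L2n M p V (%n w. SUM nk:V \<times> {..<K}. op s T (cpoly (?q n nk)) ((%(n, k). x n k) nk) w) <= C powr (1 / p) * L2n M p (V \<times> {..<K}) (%(n, k). x n k)"
  proof (rule poly_transference)
   fix h and a :: "nat \<times> nat => bool => nat => real" assume a: "!!k b l. h < l ==> a k b l = 0"
   have P: "(SUM nk:V \<times> {..<K}. pconv (?q n nk) (a nk b) m) = (SUM k<K. pconv (lp_poly k) (a (n, k) b) m)" if "n : V" for n b m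
    by (rule d[where F = "%q nk. pconv q (a nk b) m", OF that pconv_0])
   have e: "(SUM k<K. SUM nb:V \<times> UNIV. (a (fst nb, k) (snd nb) m)\<^sup>2) = (SUM nk:V \<times> {..<K}. SUM b:UNIV. (a nk b m)\<^sup>2)" for m
    by (simp add: sum_pairs sum.swap[of _ "{..<K}"])
   have "(SUM m<=h. (SUM n:V. SUM b:UNIV. (SUM nk:V \<times> {..<K}. pconv (?q n nk) (a nk b) m)\<^sup>2) powr (p/2))
    = (SUM m<=h. (SUM n:V. SUM b:UNIV. (SUM k<K. pconv (lp_poly k) (a (n, k) b) m)\<^sup>2) powr (p/2))" by (simp only: P cong: sum.cong)
   also have "... <= C * (SUM m<=h. (SUM k<K. SUM nb:V \<times> UNIV. (a (fst nb, k) (snd nb) m)\<^sup>2) powr (p/2))"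
    using C(2)[of "V \<times> UNIV" h "%nb k. a (fst nb, k) (snd nb)" K] V a by (simp add: sum_pairs)
   finally show "(SUM m<=h. (SUM n:V. SUM b:UNIV. (SUM nk:V \<times> {..<K}. pconv (?q n nk) (a nk b) m)\<^sup>2) powr (p/2)) <= C * (SUM m<=h. (SUM nk:V \<times> {..<K}. SUM b:UNIV. (a nk b m)\<^sup>2) powr (p/2))"
    unfolding e .
  qed (use s V x C(1) in auto)
  moreover have "(SUM nk:V \<times> {..<K}. op s T (cpoly (?q n nk)) ((%(n, k). x n k) nk) w) = (SUM k<K. op s T (cpoly (lp_poly k)) (x n k) w)" if "n : V" for n w
   using d[where F = "%q nk. op s T (cpoly q) ((%(n, k). x n k) nk) w", OF that] by (simp add: op_def)
  ultimately show ?thesis by (simp add: L2n_def cong: L2_set_cong)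
 qed
 thus ?thesis by (intro exI[of _ "C powr (1 / p)"]) auto
qed

end

section \<open>Complex interpolation\<close>

text \<open>Division by \<open>M0^(1-z) * M1^z\<close> reduces to the bound 1 on both lines. The
  factor \<open>exp (ep * (z^2 - 1))\<close> makes the function small on the horizontal sides of a
  tall rectangle, the maximum principle applies there, and \<open>ep\<close> tends to 0.\<close>

lemma three_lines:
 fixes f :: "complex => complex"
 assumes hol: "f holomorphic_on UNIV"
  and bdd: "!!z. 0 <= Re z ==> Re z <= 1 ==> norm (f z) <= Bd"
  and M: "0 < M0" "0 < M1" and b0: "!!z. Re z = 0 ==> norm (f z) <= M0" and b1: "!!z. Re z = 1 ==> norm (f z) <= M1"
  and t: "0 <= t" "t <= 1"
 shows "norm (f (of_real t)) <= M0 powr (1 - t) * M1 powr t"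
proof -
 let ?e = "%z. exp (- ((1 - z) * of_real (ln M0) + z * of_real (ln M1)))"
 define g where "g z = f z * ?e z" for z
 define D where "D = exp (\<bar>ln M0\<bar> + \<bar>ln M1\<bar>)"
 have Bd0: "0 <= Bd" using order_trans[OF norm_ge_zero bdd[of 0]] by simp
 have ng: "norm (g z) = norm (f z) / (M0 powr (1 - Re z) * M1 powr Re z)" for z
  using M by (simp add: g_def norm_mult powr_def exp_minus exp_add mult_exp_exp field_simps)
 have g0: "norm (g z) <= 1" if "Re z = 0 | Re z = 1" for z
  using that b0[of z] b1[of z] M unfolding ng by (auto simp: field_simps)
 have gb: "norm (g z) <= Bd * D" if z: "0 <= Re z" "Re z <= 1" for z
 proof -
  have uv: "u * v <= \<bar>v\<bar>" if "0 <= u" "u <= 1" for u v :: real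
  proof -
   have "u * v <= u * \<bar>v\<bar>" using that by (intro mult_left_mono) auto
   also have "... <= 1 * \<bar>v\<bar>" using that by (intro mult_right_mono) auto
   finally show ?thesis by simp
  qed
  have e: "(1 - Re z) * (- ln M0) <= \<bar>ln M0\<bar>" "Re z * (- ln M1) <= \<bar>ln M1\<bar>"
   using uv[of "1 - Re z" "- ln M0"] uv[of "Re z" "- ln M1"] z by simp_all
  have "norm (?e z) <= D"
   unfolding D_def norm_exp_eq_Re using e by simp
  thus ?thesis unfolding g_def norm_mult using bdd[OF z] Bd0 by (intro mult_mono) auto
 qed
 let ?b = "norm (g (of_real t))"
 have main: "?b * exp (- ep) <= 1" if eps: "0 < ep" for ep
 proof -
  define h where "h z = g z * exp (of_real ep * (z^2 - 1))" for z
  have hh: "norm (h z) = norm (g z) * exp (ep * ((Re z)^2 - (Im z)^2 - 1))" for z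
   by (simp add: h_def norm_mult Re_power2)
  let ?d = "sqrt ((Bd * D) / ep)"
  \<comment> \<open>The height is chosen so that the damping \<open>exp (- ep * R^2)\<close> beats
    the bound \<open>x = Bd * D\<close>, by \<open>x * exp (- x) <= 1\<close>.\<close>
  define R where "R = ?d + 1"
  let ?c = "ep * R^2"
  have R: "0 < R" "Bd * D <= ?c"
  proof -
   have D0: "0 <= Bd * D" using Bd0 by (simp add: D_def)
   hence "0 <= ?d" using eps by simp
   thus "0 < R" unfolding R_def by linarith
   have "Bd * D / ep = ?d^2" using D0 eps by simp
   also have "... <= R^2" unfolding R_def using D0 eps by (intro power_mono) auto
   finally show "Bd * D <= ?c" using eps by (simp add: field_simps)
  qed
  define S where "S = cbox (Complex 0 (- R)) (Complex 1 R)"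
  have S: "z : S \<longleftrightarrow> 0 <= Re z & Re z <= 1 & \<bar>Im z\<bar> <= R" for z
   by (auto simp: S_def in_cbox_complex_iff)
  have hbound: "norm (h z) <= 1" if z: "z : frontier S" for z
  proof -
   have zS: "z : S" using z frontier_subset_eq[of S] by (auto simp: S_def)
   let ?a = "(Re z)^2 - (Im z)^2 - 1"
   have "z ~: box (Complex 0 (- R)) (Complex 1 R)" using z by (simp add: S_def frontier_def interior_cbox)
   then consider "Re z = 0 | Re z = 1" | "\<bar>Im z\<bar> = R" using zS unfolding S by (auto simp: in_box_complex_iff)
   thus ?thesis
   proof cases
    case 1
    hence "(Re z)^2 <= 1" by auto
    hence "?a <= 0" using zero_le_power2[of "Im z"] by linarith
    hence "exp (ep * ?a) <= 1" using mult_nonneg_nonpos[of ep] eps by simp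
    thus ?thesis unfolding hh using g0[OF 1] by (intro mult_le_one) auto
   next
    case 2
    have "(Re z)^2 <= 1" using zS unfolding S by (simp add: power_le_one)
    moreover have "(Im z)^2 = R^2" using 2 by (metis power2_abs)
    ultimately have "?a <= - R\<^sup>2" by linarith
    hence "ep * ?a <= ep * (- R\<^sup>2)"
     by (rule mult_left_mono) (use eps in simp)
    hence "ep * ?a <= - ?c" by simp
    hence "exp (ep * ?a) <= exp (- ?c)" by simp
    also have "... <= exp (- (Bd * D))" using R by simp
    finally have "norm (h z) <= (Bd * D) * exp (- (Bd * D))"
     unfolding hh using gb[of z] zS Bd0 unfolding S by (intro mult_mono) (auto simp: D_def)
    also have "... <= 1" using exp_ge_add_one_self[of "Bd * D"] by (simp add: exp_minus field_simps del: exp_ge_add_one_self)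
    finally show ?thesis .
   qed
  qed
  have hh': "h holomorphic_on UNIV"
   unfolding h_def g_def by (intro holomorphic_intros hol)
  have "norm (h (of_real t)) <= 1"
  proof (rule maximum_modulus_frontier[of h S])
   show "h holomorphic_on interior S" "continuous_on (closure S) h"
    using hh' holomorphic_on_subset holomorphic_on_imp_continuous_on by blast+
   show "bounded S" by (simp add: S_def)
   show "of_real t : S" using t R by (simp add: S)
  qed (rule hbound)
  moreover have "?b * exp (- ep) <= norm (h (of_real t))"
   unfolding hh using eps by (intro mult_left_mono) (auto simp: right_diff_distrib)
  ultimately show ?thesis by simp
 qed
 have "((%ep. ?b * exp (- ep)) \<longlongrightarrow> ?b * exp (- 0)) (at_right 0)"
  by (intro tendsto_intros)
 moreover have "\<forall>\<^sub>F ep in at_right 0. ?b * exp (- ep) <= 1"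
  using main by (auto simp: eventually_at_right_less intro: eventually_at_rightI[of 0 1])
 ultimately have "?b * exp (- 0) <= 1"
  by (rule tendsto_upperbound) simp
 thus ?thesis using M by (simp add: ng field_simps)
qed

text \<open>\<open>x\<close> and \<open>y\<close> are embedded in analytic families with moduli
  \<open>|x|^al * X^(1 - al)\<close> and \<open>|y|^(2 - al) * Y^(al - 1)\<close>. Here
  \<open>al\<close> moves affinely from \<open>al'\<close> on the line \<open>Re z = 0\<close> to
  \<open>al''\<close> on \<open>Re z = 1\<close> and is 1 at \<open>t\<close>, where
  \<open>x\<close> and \<open>y\<close> themselves reappear. With \<open>l^2\<close> norms as
  \<open>X\<close> and \<open>Y\<close>, \<open>al = 2 / r\<close> turns \<open>l^2\<close> control
  into \<open>l^r\<close> control of the first family.\<close>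

lemma bilinear_interpolation:
 fixes x y :: "'k => 'i => complex" and b :: "'k => 'i => 'i => complex"
 assumes fin: "finite S" "finite I" and t: "0 <= t" "t <= 1" "(1 - t) * al' + t * al'' = 1"
  and M: "0 < M0" "0 < M1"
  and X: "!!k j. k : S ==> j : I ==> x k j ~= 0 ==> 0 < X j"
  and Y: "!!k j. k : S ==> j : I ==> y k j ~= 0 ==> 0 < Y j"
  and H: "!!xx et al M. (al, M) : {(al', M0), (al'', M1)} ==>
   (!!k j. k : S ==> j : I ==> norm (xx k j) <= norm (x k j) powr al * X j powr (1 - al)) ==>
   (!!k i. k : S ==> i : I ==> norm (et k i) <= norm (y k i) powr (2 - al) * Y i powr (al - 1)) ==>
   norm (SUM k:S. SUM i:I. SUM j:I. b k i j * xx k j * et k i) <= M"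
 shows "norm (SUM k:S. SUM i:I. SUM j:I. b k i j * x k j * y k i) <= M0 powr (1 - t) * M1 powr t"
proof -
 define A where "A z = of_real al' + z * of_real (al'' - al')" for z :: complex
 define xx where "xx z k j = (if x k j = 0 then 0 else sgn (x k j) * exp (A z * of_real (ln (norm (x k j))) + (1 - A z) * of_real (ln (X j))))" for z k j
 define et where "et z k i = (if y k i = 0 then 0 else sgn (y k i) * exp ((2 - A z) * of_real (ln (norm (y k i))) + (A z - 1) * of_real (ln (Y i))))" for z k i
 define f where "f z = (SUM k:S. SUM i:I. SUM j:I. b k i j * xx z k j * et z k i)" for z
 have nx: "norm (xx z k j) = norm (x k j) powr (Re (A z)) * X j powr (1 - Re (A z))" if "k : S" "j : I" for z k j
  using X[OF that] by (auto simp: xx_def norm_mult norm_sgn powr_def exp_add)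
 have ny: "norm (et z k j) = norm (y k j) powr (2 - Re (A z)) * Y j powr (Re (A z) - 1)" if "k : S" "j : I" for z k j
  using Y[OF that] by (auto simp: et_def norm_mult norm_sgn powr_def exp_add)
 have A0: "Re (A z) = al'" if "Re z = 0" for z using that by (simp add: A_def)
 have A1: "Re (A z) = al''" if "Re z = 1" for z using that by (simp add: A_def)
 have hol: "f holomorphic_on UNIV"
 proof -
  have "(%z. xx z k j) holomorphic_on UNIV" "(%z. et z k j) holomorphic_on UNIV" for k j
   unfolding xx_def et_def A_def by (cases "x k j = 0"; cases "y k j = 0"; auto intro!: holomorphic_intros)+
  thus ?thesis unfolding f_def by (intro holomorphic_intros)
 qed
 let ?a = "\<bar>al'\<bar> + \<bar>al''\<bar> + 2"
 define L where "L k j = ?a * (\<bar>ln (norm (x k j))\<bar> + \<bar>ln (X j)\<bar> + \<bar>ln (norm (y k j))\<bar> + \<bar>ln (Y j)\<bar>)" for k j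
 have Ab: "\<bar>Re (A z)\<bar> <= \<bar>al'\<bar> + \<bar>al''\<bar>" if "0 <= Re z" "Re z <= 1" for z
 proof -
  have "Re (A z) = (1 - Re z) * al' + Re z * al''" by (simp add: A_def algebra_simps)
  hence "\<bar>Re (A z)\<bar> <= (1 - Re z) * \<bar>al'\<bar> + Re z * \<bar>al''\<bar>" using that
   by (simp add: abs_mult order_trans[OF abs_triangle_ineq])
  also have "... <= 1 * \<bar>al'\<bar> + 1 * \<bar>al''\<bar>" using that by (intro add_mono mult_right_mono) auto
  finally show ?thesis by simp
 qed
 have xb: "norm (xx z k j) <= exp (L k j)" "norm (et z k j) <= exp (L k j)" if z: "0 <= Re z" "Re z <= 1" for z k j
 proof -
  have m: "u * v <= ?a * \<bar>v\<bar>" if "\<bar>u\<bar> <= ?a" for u v :: real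
  proof -
   have "u * v <= \<bar>u\<bar> * \<bar>v\<bar>" by (metis abs_ge_self abs_mult)
   also have "... <= ?a * \<bar>v\<bar>" by (intro mult_right_mono that) auto
   finally show ?thesis .
  qed
  have n0: "0 <= ?a * \<bar>v\<bar>" for v :: real by simp
  have us: "\<bar>Re (A z)\<bar> <= ?a" "\<bar>1 - Re (A z)\<bar> <= ?a"
   "\<bar>2 - Re (A z)\<bar> <= ?a" "\<bar>Re (A z) - 1\<bar> <= ?a"
   using Ab[OF z] by linarith+
  have Le: "L k j = (\<bar>al'\<bar> + \<bar>al''\<bar> + 2) * \<bar>ln (norm (x k j))\<bar> + (\<bar>al'\<bar> + \<bar>al''\<bar> + 2) * \<bar>ln (X j)\<bar>
   + (\<bar>al'\<bar> + \<bar>al''\<bar> + 2) * \<bar>ln (norm (y k j))\<bar> + (\<bar>al'\<bar> + \<bar>al''\<bar> + 2) * \<bar>ln (Y j)\<bar>"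
   unfolding L_def by (simp only: distrib_left)
  let ?d = "ln (norm (x k j))"
  let ?e = "ln (norm (y k j))"
  have "Re (A z) * ?d + (1 - Re (A z)) * ln (X j) <= L k j"
   unfolding Le using m[OF us(1), of "?d"] m[OF us(2), of "ln (X j)"] n0[of "?e"] n0[of "ln (Y j)"] by linarith
  thus "norm (xx z k j) <= exp (L k j)" by (simp add: xx_def norm_mult norm_sgn)
  have "(2 - Re (A z)) * ?e + (Re (A z) - 1) * ln (Y j) <= L k j"
   unfolding Le using m[OF us(3), of "?e"] m[OF us(4), of "ln (Y j)"] n0[of "?d"] n0[of "ln (X j)"] by linarith
  thus "norm (et z k j) <= exp (L k j)" by (simp add: et_def norm_mult norm_sgn)
 qed
 have bdd: "norm (f z) <= (SUM k:S. SUM i:I. SUM j:I. norm (b k i j) * exp (L k j) * exp (L k i))" if "0 <= Re z" "Re z <= 1" for z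
 proof -
  have "norm (b k i j * xx z k j * et z k i) <= norm (b k i j) * exp (L k j) * exp (L k i)" for k i j
   unfolding norm_mult by (intro mult_mono mult_left_mono xb that) auto
  thus ?thesis unfolding f_def by (intro sum_norm_le)
 qed
 let ?b = "of_real ((1 - t) * al' + t * al'')"
 let ?c = "A (of_real t)"
 have xt: "xx (of_real t) k j = x k j" if kj: "k : S" "j : I" for k j
 proof -
  have "?c = ?b" by (simp add: A_def algebra_simps)
  hence "?c = 1" by (simp only: t) simp
  thus ?thesis using X[OF kj] by (auto simp: xx_def exp_of_real sgn_eq)
 qed
 have yt: "et (of_real t) k j = y k j" if kj: "k : S" "j : I" for k j
 proof -
  have "?c = ?b" by (simp add: A_def algebra_simps)
  hence "?c = 1" by (simp only: t) simp
  thus ?thesis using Y[OF kj] by (auto simp: et_def exp_of_real sgn_eq)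
 qed
 have "norm (f (of_real t)) <= M0 powr (1 - t) * M1 powr t"
 proof (rule three_lines[OF hol bdd M _ _ t(1,2)])
  fix z :: complex assume z: "Re z = 0"
  show "norm (f z) <= M0" unfolding f_def
   by (rule H[of al']) (use nx ny A0[OF z] in auto)
 next
  fix z :: complex assume z: "Re z = 1"
  show "norm (f z) <= M1" unfolding f_def
   by (rule H[of al'']) (use nx ny A1[OF z] in auto)
 qed
 also have "f (of_real t) = (SUM k:S. SUM i:I. SUM j:I. b k i j * x k j * y k i)"
  unfolding f_def by (intro sum.cong refl) (simp add: xt yt)
 finally show ?thesis .
qed

lemma L2_set_sq: "(L2_set f S)^2 = (SUM k:S. (f k)\<^sup>2)"
 by (simp add: L2_set_def sum_nonneg)

lemma L2_set_ge: "finite S ==> k : S ==> \<bar>f k\<bar> <= L2_set f S"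
 using member_le_L2_set[of S k "%k. \<bar>f k\<bar>"] by (simp add: L2_set_def)

lemma weighted_power_sum:
 fixes x :: "'k => complex"
 assumes S: "finite S" and a: "0 < a" and xx: "!!k. k : S ==> cmod (xx k) <= cmod (x k) powr (2 / a) * L2_set (%k. cmod (x k)) S powr (1 - 2 / a)"
 shows "(SUM k:S. cmod (xx k) powr a) <= L2_set (%k. cmod (x k)) S powr a"
proof -
 define X where "X = L2_set (%k. cmod (x k)) S"
 show ?thesis
 proof (cases "X = 0")
  case True
  hence "cmod (xx k) = 0" if "k : S" for k using xx[OF that] by (simp add: X_def)
  thus ?thesis by simp
 next
  case False
  hence X: "0 < X" by (simp add: X_def less_le L2_set_nonneg)
  have "(SUM k:S. cmod (xx k) powr a) <= (SUM k:S. (cmod (x k))\<^sup>2 * X powr (a - 2))"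
  proof (rule sum_mono)
   fix k assume k: "k : S"
   have "cmod (xx k) powr a <= (cmod (x k) powr (2 / a) * X powr (1 - 2 / a)) powr a"
    using xx[OF k] a by (intro powr_mono2) (auto simp: X_def)
   also have "... = cmod (x k) powr 2 * X powr (a - 2)"
    using a by (simp add: powr_mult powr_powr left_diff_distrib)
   finally show "cmod (xx k) powr a <= (cmod (x k))^2 * X powr (a - 2)" by simp
  qed
  also have "... = X^2 * X powr (a - 2)" by (simp add: X_def L2_set_sq sum_distrib_right)
  also have "... = X powr 2 * X powr (a - 2)" using X by simp
  also have "... = X powr (2 + (a - 2))" by (simp only: powr_add)
  finally show ?thesis by (simp add: X_def)
 qed
qed

context step_partition
begin

lemma cf_sum_abs:
 assumes S: "finite S" and f: "!!k. k : S ==> f k : Lp M p" and i: "i : I"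
 shows "(SUM k:S. cmod (cf (f k) i)) <= cmod (cf (%w. of_real (SUM k:S. cmod (f k w))) i)"
proof -
 define u where "u k = cnj (sgn (cf (f k) i))" for k
 have u: "u k * cf (f k) i = of_real (cmod (cf (f k) i))" "cmod (u k) <= 1" for k
  by (auto simp: u_def sgn_eq norm_divide complex_norm_square[symmetric] power2_eq_square mult.commute)
 let ?a = "%w. SUM k:S. u k * f k w"
 let ?b = "SUM k:S. cmod (cf (f k) i)"
 have "complex_of_real ?b = (SUM k:S. cf (%w. u k * f k w) i)"
  by (simp add: cf_scale u)
 also have "... = cf ?a i"
  using S f i by (intro cf_sum[symmetric] Lp_scale(1)[OF p0]) auto
 finally have "cmod (cf ?a i) = \<bar>SUM k:S. cmod (cf (f k) i)\<bar>"
  by (metis norm_of_real)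
 hence "?b <= cmod (cf ?a i)" by simp
 also have "... <= cmod (cf (%w. of_real (SUM k:S. cmod (f k w))) i)"
 proof (rule cf_mono[OF _ _ i])
  show "?a : Lp M p" using S f by (intro conjunct1[OF Lp_sum[OF p]] Lp_scale(1)[OF p0]) auto
  show "(%w. complex_of_real (SUM k:S. cmod (f k w))) : Lp M p"
  proof (rule Lp_seminorm(1)[OF p sum_cseminorm _ S order_refl f])
   have [measurable]: "f k : borel_measurable M" if "k : S" for k using LpD[OF f[OF that]] .
   show "(%w. SUM l:S. cmod (f l w)) : borel_measurable M" by measurable
  qed
  show "cmod (SUM k:S. u k * f k w) <= (SUM k:S. cmod (f k w))" for w
   by (rule sum_norm_le) (simp add: norm_mult u mult_left_le_one_le)
 qed
 finally show ?thesis .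
qed

text \<open>The endpoint \<open>al = 2 / p\<close> is \<open>L^p(l^p)\<close>, where the
  \<open>V k\<close> act separately. The other endpoint is \<open>L^p(l^infinity)\<close> with
  \<open>al = 0\<close> if \<open>p <= 2\<close>, and \<open>L^p(l^1)\<close> with
  \<open>al = 2\<close> otherwise. Solving \<open>1/2 = t/p\<close>, respectively
  \<open>1/2 = (1 - t) + t/p\<close>, places \<open>l^2\<close> between them and gives
  \<open>t\<close>. \<open>y\<close> is the extremal functional of the output, so the pairing is
  \<open>SW\<close> and absorption concludes.\<close>

lemma matrix_interpolation:
 fixes V :: "'k => ('a => complex) => 'a => complex" and x :: "'k => 'i => complex"
 assumes S: "finite S" and VLp: "!!k f. k : S ==> f : Lp M p ==> V k f : Lp M p"
  and VL: "!!k a. k : S ==> AE w in M. V k (step a) w = (SUM j:I. a j * V k (step (%i. if i = j then 1 else 0)) w)"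
  and A': "0 < A'" "!!k f. k : S ==> f : Lp M p ==> Ln M p (V k f) <= A' * Ln M p f" and B: "0 < B"
  and small: "!!f. p <= 2 ==> (!!k. k : S ==> f k : Lp M p) ==>
   Ln M p (%w. of_real (sup_set S (%k. V k (f k) w))) <= B * Ln M p (%w. of_real (sup_set S (%k. f k w)))"
  and large: "!!f. 2 < p ==> (!!k. k : S ==> f k : Lp M p) ==>
   Ln M p (%w. of_real (SUM k:S. cmod (V k (f k) w))) <= B * Ln M p (%w. of_real (SUM k:S. cmod (f k w)))"
 defines "t \<equiv> (if p <= 2 then p / 2 else p / (p - 1) / 2)"
 shows "(SUM i:I. L2_set (%k. cmod (cf (V k (step (x k))) i)) S powr p) <= (B powr (1 - t) * A' powr t) powr p * (SUM i:I. L2_set (%k. cmod (x k i)) S powr p)"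
proof -
 define q where "q = p / (p - 1)"
 have pq: "1 < p" "1 < q" "1/p + 1/q = 1" "0 < q" using p by (auto simp: q_def field_simps)
 define X where "X i = L2_set (%k. cmod (x k i)) S" for i
 define z where "z k i = cf (V k (step (x k))) i" for k i
 define W where "W i = L2_set (%k. cmod (z k i)) S" for i
 define y where "y k i = cnj (z k i) * of_real (W i powr (p - 2))" for k i
 define Y where "Y i = L2_set (%k. cmod (y k i)) S" for i
 let ?o = "%i j. step (%i. if i = j then 1 else 0)"
 define b where "b k i j = cf (V k (?o i j)) i" for k i j
 have X0: "0 <= X i" and W0: "0 <= W i" and Y0: "0 <= Y i" for i by (simp_all add: X_def W_def Y_def L2_set_nonneg)
 have bz: "cf (V k (step a)) i = (SUM j:I. b k i j * a j)" if k: "k : S" and i: "i : I" for k i a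
 proof -
  have "cf (V k (step a)) i = cf (%w. SUM j:I. a j * V k (?o i j) w) i"
   using fin i VL[OF k] k by (intro cf_AE VLp step_Lp(1) conjunct1[OF Lp_sum[OF p]] Lp_scale(1)[OF p0]) auto
  also have "... = (SUM j:I. cf (%w. a j * V k (?o i j) w) i)"
   using fin i k by (intro cf_sum VLp step_Lp(1) Lp_scale(1)[OF p0]) auto
  finally show ?thesis by (simp add: cf_scale b_def mult.commute)
 qed
 define SX where "SX = (SUM i:I. X i powr p)"
 define SW where "SW = (SUM i:I. W i powr p)"
 have S0: "0 <= SX" "0 <= SW" by (simp_all add: SX_def SW_def sum_nonneg)
 have Wpow: "W i powr (p - 2) * W i = W i powr (p - 1)" for i
 proof (cases "W i = 0")
  case False
  hence "W i powr (p - 2) * W i powr 1 = W i powr (p - 2 + 1)" by (simp only: powr_add)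
  thus ?thesis using W0[of i] by simp
 qed simp
 have YW: "Y i = W i powr (p - 1)" for i
 proof -
  have "Y i = L2_set (%k. W i powr (p - 2) * cmod (z k i)) S" by (simp add: Y_def y_def norm_mult mult.commute)
  also have "... = W i powr (p - 2) * W i" by (simp add: W_def L2_set_right_distrib)
  finally show ?thesis by (simp add: Wpow)
 qed
 have SY: "(SUM i:I. Y i powr q) = SW"
 proof -
  have "(p - 1) * q = p" using p by (simp add: q_def)
  thus ?thesis unfolding YW SW_def by (simp add: powr_powr)
 qed
 let ?e = "SUM k:S. SUM i:I. SUM j:I. b k i j * x k j * y k i"
 have pair: "?e = of_real SW"
 proof -
  have "?e = (SUM k:S. SUM i:I. z k i * y k i)"
   by (intro sum.cong refl) (simp add: z_def bz sum_distrib_right)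
  also have "... = (SUM i:I. SUM k:S. of_real ((cmod (z k i))^2) * of_real (W i powr (p - 2)))"
   by (subst sum.swap) (simp add: y_def mult.assoc[symmetric] complex_norm_square[symmetric])
  also have "... = (SUM i:I. of_real ((W i)^2 * W i powr (p - 2)))"
   by (simp add: W_def L2_set_sq sum_distrib_right)
  also have "... = (SUM i:I. of_real (W i powr p))"
  proof (intro sum.cong refl arg_cong[where f = of_real])
   fix i
   show "(W i)^2 * W i powr (p - 2) = W i powr p"
   proof (cases "W i = 0")
    case False
    hence "W i powr 2 * W i powr (p - 2) = W i powr (2 + (p - 2))" by (simp only: powr_add)
    thus ?thesis using W0[of i] False by simp
   qed simp
  qed
  finally show ?thesis by (simp add: SW_def)
 qed
 let ?c = "%et i. SUM k:S. cmod (et k i)"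
 let ?g = "B * SX powr (1 / p)"
 let ?n = "B powr (1 - t) * A' powr t"
 let ?s = "SX powr (1 / p) * SW powr (1 / q)"
 show ?thesis
 proof (cases "SX = 0 | SW = 0")
  case True
  have "SW = 0"
  proof (cases "SW = 0")
   case False
   hence "X j powr p = 0" if "j : I" for j using True that fin by (simp add: SX_def sum_nonneg_eq_0_iff)
   hence "x k j = 0" if "j : I" "k : S" for j k
    using that S L2_set_ge[OF S, of k "%k. cmod (x k j)"] by (auto simp: X_def)
   hence "z k i = 0" if "i : I" "k : S" for i k using that by (simp add: z_def bz)
   thus ?thesis using p0 by (simp add: SW_def W_def L2_set_def)
  qed
  thus ?thesis using S0 by (simp add: SX_def[symmetric] SW_def[symmetric] W_def[symmetric] z_def[symmetric] X_def[symmetric])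
 next
  case False
  hence pos: "0 < SX" "0 < SW" using S0 by auto
  define Q where "Q = ?s"
  have Q: "0 < Q" using pos by (simp add: Q_def)
  define al' where "al' = (if p <= 2 then 0 else 2 :: real)"
  let ?r = "(B * Q) powr (1 - t) * (A' * Q) powr t"
  have "norm ?e <= ?r"
  proof (rule bilinear_interpolation[where al' = al' and al'' = "2 / p" and X = X and Y = Y])
   show "0 <= t" "t <= 1" "(1 - t) * al' + t * (2 / p) = 1" using p by (auto simp: t_def al'_def field_simps)
   show "0 < X j" if "k : S" "j : I" "x k j ~= 0" for k j
   proof -
    have "cmod (x k j) <= X j" using L2_set_ge[OF S that(1), of "%k. cmod (x k j)"] by (simp add: X_def)
    moreover have "0 < cmod (x k j)" using that(3) by simp
    ultimately show ?thesis by linarith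
   qed
   show "0 < Y j" if "k : S" "j : I" "y k j ~= 0" for k j
   proof -
    have "cmod (y k j) <= Y j" using L2_set_ge[OF S that(1), of "%k. cmod (y k j)"] by (simp add: Y_def)
    moreover have "0 < cmod (y k j)" using that(3) by simp
    ultimately show ?thesis by linarith
   qed
   fix xx et :: "'k => 'i => complex" and al M'
   assume am: "(al, M') : {(al', B * Q), (2 / p, A' * Q)}"
    and xx: "!!k j. k : S ==> j : I ==> norm (xx k j) <= norm (x k j) powr al * X j powr (1 - al)"
    and et: "!!k i. k : S ==> i : I ==> norm (et k i) <= norm (y k i) powr (2 - al) * Y i powr (al - 1)"
   define f where "f k = step (xx k)" for k
   have fL: "f k : Lp M p" for k by (simp add: f_def step_Lp)
   let ?i = "SUM k:S. SUM i:I. SUM j:I. b k i j * xx k j * et k i"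
   let ?l = "SUM k:S. SUM i:I. cf (V k (f k)) i * et k i"
   have e: "?i = ?l"
    by (intro sum.cong refl) (simp add: f_def bz sum_distrib_right)
   let ?b = "SUM k:S. SUM i:I. cmod (cf (V k (f k)) i) * cmod (et k i)"
   have n: "norm ?l <= ?b"
    by (intro sum_norm_le) (simp add: norm_mult)
   let ?a = "SUM ki:S \<times> I. cmod (cf (V (fst ki) (f (fst ki))) (snd ki)) powr p"
   let ?d = "%G. SUM i:I. cmod (cf G i) powr p"
   let ?f = "SUM ki:S \<times> I. cmod (et (fst ki) (snd ki)) powr q"
   let ?h = "%k i. cmod (cf (V k (f k)) i)"
   let ?j = "Ln M p (%w. of_real (sup_set S (%k. f k w)))"
   let ?k = "SUM i:I. (?c et i) powr q"
   let ?m = "%k. SUM i:I. cmod (xx k i) powr p"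
   let ?p = "Ln M p (%w. of_real (?c f w))"
   let ?q = "%k i. cmod (et k i)"
   consider "al = al'" "M' = B * Q" "p <= 2" | "al = al'" "M' = B * Q" "2 < p" | "al = 2 / p" "M' = A' * Q" using am by force
   thus "norm ?i <= M'"
   proof cases
    case 1
    hence al: "al = 0" by (simp add: al'_def)
    define G where "G w = complex_of_real (sup_set S (%k. V k (f k) w))" for w
    have G: "G : Lp M p" unfolding G_def[abs_def]
     by (rule Lp_seminorm(1)[OF p sup_set_cseminorm[OF S] sup_set_measurable[OF S] S sup_set_le_sum[OF S]])
      (simp_all add: LpD[OF VLp[OF _ fL]] VLp[OF _ fL])
    have "Ln M p G <= B * ?j"
     unfolding G_def using 1(3) fL by (rule small)
    also have "?j <= SX powr (1 / p)"
    proof -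
     have "(\<integral>w. sup_set S (%k. f k w) powr p \<partial>M) = (SUM i:I. sup_set S (%k. xx k i) powr p)"
      unfolding f_def by (rule step_seminorm(2)[OF sup_set_cseminorm[OF S]])
     also have "... <= SX" unfolding SX_def
     proof (intro sum_mono powr_mono2)
      fix i assume i: "i : I"
      have "cmod (xx k i) <= X i" if k: "k : S" for k
      proof -
       have "cmod (xx k i) <= cmod (x k i) powr 0 * X i powr 1" using xx[OF k i] al by simp
       also have "... <= 1 * X i" using X0[of i] by (intro mult_mono) (auto simp: powr_def)
       finally show ?thesis by simp
      qed
      thus "sup_set S (%k. xx k i) <= X i" using X0 by (simp add: sup_set_le[OF S])
     qed (use p0 sup_set_nonneg[OF S] in auto)
     finally show ?thesis using p0 unfolding Ln_def by (intro powr_mono2) (auto simp: integral_nonneg_AE abs_of_nonneg sup_set_nonneg[OF S])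
    qed
    finally have Gn: "Ln M p G <= ?g" using B by simp
    have "?b <= (SUM k:S. SUM i:I. cmod (cf G i) * ?q k i)"
    proof (intro sum_mono mult_right_mono)
     fix k i assume "k : S" "i : I"
     thus "?h k i <= cmod (cf G i)" unfolding G_def
      by (intro cf_mono VLp fL G[unfolded G_def]) (auto intro: sup_set_ge[OF S, of k "%k. V k (f k) _"])
    qed simp
    also have "... = (SUM i:I. cmod (cf G i) * (?c et i))"
     by (subst sum.swap) (simp add: sum_distrib_left)
    also have "... <= (?d G) powr (1/p) * ?k powr (1/q)"
     by (intro Holder_sum[OF pq(1-3) fin]) (auto intro: sum_nonneg)
    also have "... <= ?g * SW powr (1 / q)"
    proof (intro mult_mono)
     have "(?d G) powr (1/p) <= (Ln M p G powr p) powr (1 / p)"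
      using cf_contr[OF G] p0 by (intro powr_mono2) (auto intro: sum_nonneg)
     thus "(?d G) powr (1/p) <= ?g" using Gn p0 by (simp add: powr_powr Ln_nonneg)
     have "?k <= (SUM i:I. Y i powr q)"
     proof (intro sum_mono powr_mono2)
      fix i assume i: "i : I"
      have "(SUM k:S. ?q k i powr 1) <= L2_set (%k. cmod (y k i)) S powr 1"
       by (rule weighted_power_sum[OF S]) (use et i al in "auto simp: Y_def")
      thus "(?c et i) <= Y i" by (simp add: Y_def L2_set_nonneg)
     qed (use pq in "auto intro: sum_nonneg")
     thus "?k powr (1/q) <= SW powr (1 / q)"
      using pq unfolding SY by (intro powr_mono2) (auto intro: sum_nonneg)
    qed (use B in auto)
    finally show ?thesis using n 1(2) unfolding e Q_def by (simp add: mult.assoc)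
   next
    case 2
    hence al: "al = 2" by (simp add: al'_def)
    define G where "G w = complex_of_real (SUM k:S. cmod (V k (f k) w))" for w
    have G: "G : Lp M p" unfolding G_def[abs_def]
    proof (rule Lp_seminorm(1)[OF p sum_cseminorm _ S order_refl])
     have [measurable]: "V k (f k) : borel_measurable M" if "k : S" for k using LpD[OF VLp[OF that fL]] .
     show "(%w. SUM l:S. cmod (V l (f l) w)) : borel_measurable M" by measurable
    qed (intro VLp fL)
    have "Ln M p G <= B * ?p"
     unfolding G_def using 2(3) fL by (rule large)
    also have "?p <= SX powr (1 / p)"
    proof -
     have "(\<integral>w. (?c f w) powr p \<partial>M) = (SUM i:I. (?c xx i) powr p)"
      unfolding f_def by (rule step_seminorm(2)[OF sum_cseminorm])
     also have "... <= SX" unfolding SX_def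
     proof (intro sum_mono powr_mono2)
      fix i assume i: "i : I"
      have "(SUM k:S. cmod (xx k i) powr 1) <= L2_set (%k. cmod (x k i)) S powr 1"
       by (rule weighted_power_sum[OF S]) (use xx i al in "auto simp: X_def")
      thus "(?c xx i) <= X i" by (simp add: X_def L2_set_nonneg)
     qed (use p0 in "auto intro: sum_nonneg")
     finally show ?thesis using p0 unfolding Ln_def by (intro powr_mono2) (auto simp: integral_nonneg_AE abs_of_nonneg sum_nonneg simp flip: of_real_sum)
    qed
    finally have Gn: "Ln M p G <= ?g" using B by simp
    have "?b <= (SUM k:S. SUM i:I. ?h k i * Y i)"
    proof (intro sum_mono mult_left_mono)
     fix k i assume k: "k : S" "i : I"
     have "?q k i <= cmod (y k i) powr 0 * Y i powr 1" using et[OF k] al by simp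
     also have "... <= 1 * Y i" using Y0[of i] by (intro mult_mono) (auto simp: powr_def)
     finally show "?q k i <= Y i" by simp
    qed simp
    also have "... = (SUM i:I. (SUM k:S. ?h k i) * Y i)"
     by (subst sum.swap) (simp add: sum_distrib_right)
    also have "... <= (SUM i:I. cmod (cf G i) * Y i)"
     unfolding G_def by (intro sum_mono mult_right_mono cf_sum_abs[OF S] VLp fL Y0)
    also have "... <= (?d G) powr (1/p) * (SUM i:I. Y i powr q) powr (1/q)"
     by (intro Holder_sum[OF pq(1-3) fin]) (auto simp: Y0)
    also have "... <= ?g * SW powr (1 / q)"
    proof (intro mult_mono)
     have "(?d G) powr (1/p) <= (Ln M p G powr p) powr (1 / p)"
      using cf_contr[OF G] p0 by (intro powr_mono2) (auto intro: sum_nonneg)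
     thus "(?d G) powr (1/p) <= ?g" using Gn p0 by (simp add: powr_powr Ln_nonneg)
    qed (use B SY in auto)
    finally show ?thesis using n 2(2) unfolding e Q_def by (simp add: mult.assoc)
   next
    case 3
    have xxx: "(SUM k:S. cmod (xx k i) powr p) <= X i powr p" if "i : I" for i
     unfolding X_def by (rule weighted_power_sum[OF S p0]) (use xx that 3 in "auto simp: X_def")
    have yet: "(SUM k:S. ?q k i powr q) <= Y i powr q" if "i : I" for i
    proof -
     have "2 - 2 / p = 2 / q" "2 / p - 1 = 1 - 2 / q" using pq(3) by (auto simp: field_simps)
     thus ?thesis
      unfolding Y_def by (intro weighted_power_sum[OF S pq(4)]) (use et that 3 in "auto simp: Y_def")
    qed
    have "?b = (SUM (k, i):S \<times> I. ?h k i * ?q k i)"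
     by (simp add: sum.cartesian_product)
    also have "... = (SUM ki:S \<times> I. cmod (cf (V (fst ki) (f (fst ki))) (snd ki)) * cmod (et (fst ki) (snd ki)))"
     by (simp add: split_def)
    also have "... <= ?a powr (1/p) * ?f powr (1/q)"
     using S fin by (intro Holder_sum[OF pq(1-3)]) auto
    also have "... <= (A' * SX powr (1 / p)) * SW powr (1 / q)"
    proof (intro mult_mono)
     have "?a = (SUM k:S. SUM i:I. ?h k i powr p)"
      by (simp add: sum_pairs)
     also have "... <= (SUM k:S. A' powr p * (?m k))"
     proof (rule sum_mono)
      fix k assume k: "k : S"
      let ?t = "SUM i:I. ?h k i powr p"
      have "?t <= Ln M p (V k (f k)) powr p" by (rule cf_contr[OF VLp[OF k fL]])
      also have "... <= (A' * Ln M p (f k)) powr p" using A'(2)[OF k fL] p0 by (intro powr_mono2) (auto simp: Ln_nonneg)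
      also have "... = A' powr p * (?m k)"
       using A'(1) p0 by (simp add: f_def step_Lp powr_mult powr_powr sum_nonneg)
      finally show "?t <= A' powr p * (?m k)" .
     qed
     also have "... = A' powr p * (SUM i:I. SUM k:S. cmod (xx k i) powr p)"
      by (subst sum.swap) (simp add: sum_distrib_left)
     also have "... <= A' powr p * SX" unfolding SX_def using xxx by (intro mult_left_mono sum_mono) auto
     finally have "?a powr (1/p) <= (A' powr p * SX) powr (1/p)"
      using p0 by (intro powr_mono2) (auto intro: sum_nonneg)
     thus "?a powr (1/p) <= A' * SX powr (1 / p)"
      using A'(1) S0 p0 by (simp add: powr_mult powr_powr)
     have "?f = (SUM i:I. SUM k:S. ?q k i powr q)"
      by (subst sum.swap) (simp add: sum_pairs)
     also have "... <= SW" unfolding SY[symmetric] using yet by (intro sum_mono) auto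
     finally show "?f powr (1/q) <= SW powr (1 / q)"
      using pq by (intro powr_mono2) (auto intro: sum_nonneg)
    qed (use A' in auto)
    finally show ?thesis using n 3(2) unfolding e Q_def by (simp add: mult.assoc)
   qed
  qed (use S fin A' B Q in auto)
  hence "SW <= ?r" unfolding pair using S0 by simp
  also have "... = ?n * (Q powr (1 - t) * Q powr t)" using A' B Q by (simp add: powr_mult)
  also have "Q powr (1 - t) * Q powr t = Q powr (1 - t + t)" by (simp only: powr_add)
  finally have "SW <= ?n * ?s" using Q by (simp add: Q_def)
  hence "SW <= ?n powr p * SX"
   using S0 by (intro powr_absorb[OF pq(1-3)]) auto
  thus ?thesis by (simp add: SW_def SX_def W_def X_def z_def)
 qed
qed

end

text \<open>From matrices to functions: one partition approximates the inputs \<open>x k\<close>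
  (index \<open>False\<close>) and the outputs \<open>V k (x k)\<close> (index \<open>True\<close>)
  at once, and the total error is a fixed multiple of \<open>de\<close>.\<close>

lemma Lp_interpolation:
 fixes V :: "'k => ('a => complex) => 'a => complex" and x :: "'k => 'a => complex"
 assumes p: "1 < p" and S: "finite S" and VLp: "!!k f. k : S ==> f : Lp M p ==> V k f : Lp M p"
  and VL: "!!k f g a b. k : S ==> f : Lp M p ==> g : Lp M p ==> AE w in M. V k (%w. a * f w + b * g w) w = a * V k f w + b * V k g w"
  and A: "0 < A" "!!k f. k : S ==> f : Lp M p ==> Ln M p (V k f) <= A * Ln M p f" and B: "0 < B"
  and small: "!!f. p <= 2 ==> (!!k. k : S ==> f k : Lp M p) ==>
   Ln M p (%w. of_real (sup_set S (%k. V k (f k) w))) <= B * Ln M p (%w. of_real (sup_set S (%k. f k w)))"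
  and large: "!!f. 2 < p ==> (!!k. k : S ==> f k : Lp M p) ==>
   Ln M p (%w. of_real (SUM k:S. cmod (V k (f k) w))) <= B * Ln M p (%w. of_real (SUM k:S. cmod (f k w)))"
  and x: "!!k. k : S ==> x k : Lp M p"
 defines "t \<equiv> (if p <= 2 then p / 2 else p / (p - 1) / 2)"
 shows "L2n M p S (%k. V k (x k)) <= (B powr (1 - t) * A powr t) * L2n M p S x"
  (is "?lhs <= ?D * ?R")
proof -
 have p0: "0 < p" using p by simp
 let ?g = "real (card S)"
 define E where "E = ?D * ?g + ?g * (1 + A)"
 have E0: "0 <= E" using A(1) by (simp add: E_def)
 let ?b = "%z w. L2_set (%k. cmod (z k w)) S"
 let ?c = "%z. \<integral>w. ?b z w powr p \<partial>M"
 let ?h = "%j. %i. if i = j then 1 else 0"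
 have main: "?lhs <= ?D * ?R + E * de" if d: "0 < de" for de
 proof -
  define g where "g kb = (if snd kb then V (fst kb) (x (fst kb)) else x (fst kb))" for kb
  have gL: "g kb : Lp M p" if "kb : S \<times> UNIV" for kb using that x VLp by (auto simp: g_def)
  note ap = step_approximation[where S = "S \<times> UNIV" and g = g and M = M and p = p and de = de, OF p finite_cartesian_product[OF S finite[of "UNIV :: bool set"]] gL d]
  obtain I :: "('k \<times> bool => complex) set" and A0 where P: "step_partition M p I A0" and
   app: "!!kb. kb : S \<times> UNIV ==> Ln M p (%w. g kb w - step_partition.step M p I A0 (step_partition.cf M p A0 (g kb)) w) <= de"
   using ap by blast
  interpret step_partition M p I A0 by (rule P)
  define x' where "x' k = step (cf (x k))" for k
  have x'L: "x' k : Lp M p" for k by (simp add: x'_def step_Lp)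
  have dx: "Ln M p (%w. x k w - x' k w) <= de" if "k : S" for k using app[of "(k, False)"] that by (simp add: g_def x'_def)
  have dV: "Ln M p (%w. V k (x k) w - step (cf (V k (x k))) w) <= de" if "k : S" for k using app[of "(k, True)"] that by (simp add: g_def)
  define z where "z k = step (cf (V k (x' k)))" for k
  have zL: "z k : Lp M p" for k by (simp add: z_def step_Lp)
  let ?d = "%k. %w. V k (x k) w - z k w"
  have dz: "Ln M p (?d k) <= (1 + A) * de" if k: "k : S" for k
  proof -
   note L = VLp[OF k x[OF k]] VLp[OF k x'L] and xd = Lp_diff(1)[OF p x[OF k] x'L]
   have "AE w in M. V k (x k) w - V k (x' k) w = V k (%w. x k w - x' k w) w"
    using VL[OF k x[OF k] x'L, of 1 "-1" k] by eventually_elim simp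
   note e = Lp_cong_AE(2)[OF p0 VLp[OF k xd] borel_measurable_diff[OF LpD[OF L(1)] LpD[OF L(2)]] this]
   let ?e = "cf (%w. V k (x k) w - V k (x' k) w)"
   have "step ?e = step (%i. cf (V k (x k)) i - cf (V k (x' k)) i)"
    by (intro step_cong cf_diff L)
   hence eq: "(?d k) = (%w. (V k (x k) w - step (cf (V k (x k))) w) + step (cf (%w. V k (x k) w - V k (x' k) w)) w)"
    by (simp add: z_def step_diff)
   have "Ln M p (?d k) <= Ln M p (%w. V k (x k) w - step (cf (V k (x k))) w) + Ln M p (step ?e)"
    unfolding eq by (intro Lp_add(2)[OF p] Lp_diff(1)[OF p] L step_Lp(1))
   also have "Ln M p (step ?e) <= Ln M p (%w. V k (x k) w - V k (x' k) w)"
    by (rule step_cf_contr[OF Lp_diff(1)[OF p L]])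
   also have "... <= A * Ln M p (%w. x k w - x' k w)" unfolding e by (rule A(2)[OF k xd])
   also have "... <= A * de" using dx[OF k] A(1) by simp
   finally show ?thesis using dV[OF k] by (simp add: distrib_right)
  qed
  have dzL: "(?d k) : Lp M p" if "k : S" for k by (rule Lp_diff(1)[OF p VLp[OF that x[OF that]] zL])
  have dxL: "(%w. x' k w - x k w) : Lp M p" if "k : S" for k by (rule Lp_diff(1)[OF p x'L x[OF that]])
  let ?a = "%k w. V k (x k) w - z k w"
  have lhs: "?lhs <= L2n M p S z + L2n M p S ?a"
   using L2n_triangle[OF p S, of z M "?a"] zL dzL by simp
  have "L2n M p S ?a <= (SUM k:S. Ln M p (?d k))" by (intro L2n_le_sum p S dzL)
  also have "... <= (SUM k:S. (1 + A) * de)" by (intro sum_mono dz)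
  finally have l1: "L2n M p S ?a <= ?g * ((1 + A) * de)" by simp
  have l2: "L2n M p S z <= ?D * L2n M p S x'"
  proof -
   have VLs: "AE w in M. V k (step a) w = (SUM j:I. a j * V k (step (?h j)) w)" if k: "k : S" for k a
   proof -
    have "(%w. SUM j:I. a j * step (?h j) w) = step a" by (rule ext) (rule step_unit[symmetric])
    note e = this
    note ls = AE_linear_sum[where V = "V k" and M = M and p = p and S = I and f = "%j. step (?h j)" and a = a, OF p VLp[OF k] VL[OF k] fin step_Lp(1)]
    show ?thesis by (rule ls[unfolded e])
   qed
   have "(SUM i:I. L2_set (%k. cmod (cf (V k (step (cf (x k)))) i)) S powr p) <= ?D powr p * (SUM i:I. L2_set (%k. cmod (cf (x k) i)) S powr p)"
    unfolding t_def by (rule matrix_interpolation[where V = V and x = "%k. cf (x k)" and A' = A and B = B, OF S VLp VLs A B small large])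
   hence "(?c z) <= ?D powr p * (?c x')"
    unfolding z_def x'_def step_seminorm(2)[OF sqrt_sum_cseminorm] .
   hence "(?c z) powr (1 / p) <= (?D powr p * (?c x')) powr (1 / p)"
    using p0 by (intro powr_mono2) (auto intro!: integral_nonneg_AE)
   also have "... = ?D * (?c x') powr (1 / p)"
    using p0 A(1) B by (subst powr_mult) (auto simp: powr_powr)
   finally show ?thesis by (simp add: L2n_def Ln_def L2_set_nonneg)
  qed
  let ?f = "%k w. x' k w - x k w"
  have l3: "L2n M p S x' <= ?R + L2n M p S ?f" using L2n_triangle[OF p S, of x M "?f"] x dxL by simp
  have "L2n M p S ?f <= (SUM k:S. Ln M p (%w. x' k w - x k w))" by (intro L2n_le_sum p S dxL)
  also have "... <= (SUM k:S. de)" using dx by (intro sum_mono) (simp add: Ln_def norm_minus_commute)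
  finally have "?D * L2n M p S x' <= ?D * (?R + ?g * de)" using l3 by (intro mult_left_mono) auto
  with lhs l1 l2 have "?lhs <= ?D * (?R + ?g * de) + ?g * ((1 + A) * de)" by linarith
  thus ?thesis unfolding E_def by (simp add: algebra_simps)
 qed
 show ?thesis
 proof (rule field_le_epsilon)
  fix e :: real assume e: "0 < e"
  have "E * (e / (E + 1)) <= e" using E0 e by (simp add: field_simps)
  moreover have "0 < e / (E + 1)" using e E0 by simp
  hence "?lhs <= ?D * ?R + E * (e / (E + 1))" by (rule main)
  ultimately show "?lhs <= ?D * ?R + e" by linarith
 qed
qed

section \<open>Resolvents on L^p(l^2)\<close>

text \<open>The coefficients of the resolvent at \<open>c\<close> are bounded by a geometric
  sequence with sum \<open>1 / (|c| - 1)\<close>, so \<open>rh / B\<close> times it is a decreasing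
  kernel of mass at most 1 as soon as \<open>rh <= B * (|c| - 1)\<close>. This is where the distance
  of the center from the circle is needed.\<close>

lemma cseminorm_res:
 fixes v :: "nat => 'k => complex"
 assumes c: "1 < cmod c" and rh: "0 <= rh" "rh <= B * (cmod c - 1)" and B: "0 < B"
 defines "w \<equiv> %j. rh / B * inverse (cmod c) ^ Suc j"
 shows "dec_kernel w"
  "m < h ==> cmod (SUM j<=N. of_real rh * coeff (rpoly c N) j * v (m + j) k) <= B * conv (Suc N) w (%l. if l < h + N then cmod (v l k) else 0) m"
proof -
 let ?a = "inverse (cmod c)"
 have ic: "?a <= 1" "c ~= 0" "?a < 1" using c by (auto simp: inverse_le_1_iff inverse_less_1_iff)
 have w0: "0 <= w j" for j using rh B by (simp add: w_def)
 have wdec: "w (Suc j) <= w j" for j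
 proof -
  have "?a ^ Suc (Suc j) <= ?a ^ Suc j" using ic by (intro power_decreasing) auto
  thus ?thesis unfolding w_def using rh B by (intro mult_left_mono) auto
 qed
 have wsum: "(SUM j<J. w j) <= 1" for J
 proof -
  have "(SUM j<J. ?a ^ Suc j) = ?a * ((1 - ?a ^ J) / (1 - ?a))"
   using ic c by (simp add: sum_gp_strict flip: sum_distrib_left)
  also have "... <= ?a * (1 / (1 - ?a))"
   using ic by (intro mult_left_mono divide_right_mono) auto
  also have "... = 1 / (cmod c - 1)" using c ic by (simp add: field_simps)
  finally have "(SUM j<J. w j) <= rh / B * (1 / (cmod c - 1))"
   unfolding w_def sum_distrib_left[symmetric] using rh B by (intro mult_left_mono) auto
  also have "... <= 1" using rh B c by (simp add: field_simps)
  finally show ?thesis .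
 qed
 show "dec_kernel w" using w0 wdec wsum by (simp add: dec_kernel_def)
 assume m: "m < h"
 let ?b = "cmod (SUM j<=N. of_real rh * coeff (rpoly c N) j * v (m + j) k)"
 let ?d = "%j. w j * (if m + j < h + N then cmod (v (m + j) k) else 0)"
 have "?b <= (SUM j<=N. B * (?d j))"
 proof (rule sum_norm_le)
  fix j assume j: "j : {..N}"
  let ?c = "coeff (rpoly c N) j"
  have "cmod ?c <= ?a ^ Suc j" using c by (simp add: coeff_res_poly norm_inverse norm_power norm_mult)
  hence "rh * cmod ?c * cmod (v (m + j) k) <= rh * ?a ^ Suc j * cmod (v (m + j) k)"
   using rh by (intro mult_right_mono mult_left_mono) auto
  thus "cmod (of_real rh * ?c * v (m + j) k) <= B * (?d j)"
   using rh B m j by (simp add: norm_mult w_def mult_ac)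
 qed
 thus "?b <= B * conv (Suc N) w (%l. if l < h + N then cmod (v l k) else 0) m"
  by (simp add: conv_def lessThan_Suc_atMost sum_distrib_left)
qed

context contr_regular
begin

lemma res_kernel_transference:
 fixes c :: "'k => complex" and x :: "'k => 'a => complex"
 assumes s: "0 < s" "s < 1" and S: "finite S" and x: "!!k. k : S ==> x k : Lp M p"
  and be: "csemi be" "!!f. (!!l. f l : borel_measurable M) ==> (%w. be (%l. f l w)) : borel_measurable M"
  "!!v. be v <= (SUM l:S. cmod (v l))" "!!u v. (!!l. l : S ==> u l = v l) ==> be u = be v" and C: "0 <= C"
  and H: "!!h v. (SUM m<h. be (%l. SUM j<=N. of_real (rh l) * coeff (rpoly (c l) N) j * v (m + j) l) powr p) <= C powr p * (SUM m<h + N. be (v m) powr p)"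
 shows "Ln M p (%w. of_real (be (%k. of_real (rh k) * op s T (rpoly (c k) N) (x k) w))) <= C * Ln M p (%w. of_real (be (%k. x k w)))"
proof -
 let ?a = "%k. rpoly (c k) N"
 let ?b = "%k. of_real (rh k)"
 define d where "d l k j = (if l = k then ?b k * coeff (?a k) j else 0)" for l k j
 have dsum: "(SUM k:S. SUM j<=N. d l k j * g k j) = (SUM j<=N. ?b l * coeff (?a l) j * g l j)" if "l : S" for l g
 proof -
  have "(SUM k:S. SUM j<=N. d l k j * g k j) = (SUM k:S. if k = l then SUM j<=N. ?b l * coeff (?a l) j * g l j else 0)"
   by (intro sum.cong refl) (simp add: d_def)
  thus ?thesis using that S by simp
 qed
 have "Ln M p (%w. of_real (be (%l. SUM k:S. SUM j<=N. d l k j * (of_real (s ^ j) * (T ^^ j) (x k) w))))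
  <= (C powr p) powr (1 / p) * Ln M p (%w. of_real (be (%k. if k : S then x k w else 0)))"
 proof (rule transference[OF s S S x be(1-3) be(1-3)])
  fix h and v :: "nat => 'k => complex"
  let ?c = "%m. be (%l. SUM k:S. SUM j<=N. d l k j * v (m + j) k)"
  have "?c m = be (%l. SUM j<=N. ?b l * coeff (?a l) j * v (m + j) l)" for m
   by (intro be(4) dsum)
  with H show "(SUM m<h. ?c m powr p) <= C powr p * (SUM m<h + N. be (v m) powr p)" by simp
 qed simp_all
 moreover have "be (%l. SUM k:S. SUM j<=N. d l k j * (of_real (s ^ j) * (T ^^ j) (x k) w)) = be (%k. ?b k * op s T (?a k) (x k) w)" for w
 proof (rule be(4))
  fix l assume l: "l : S"
  have "degree (?a l) <= N" by (rule degree_le) (simp add: coeff_res_poly)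
  thus "(SUM k:S. SUM j<=N. d l k j * (of_real (s ^ j) * (T ^^ j) (x k) w)) = ?b l * op s T (?a l) (x l) w"
   by (simp add: dsum[OF l] op_eq sum_distrib_left mult.assoc)
 qed
 moreover have "be (%k. if k : S then x k w else 0) = be (%k. x k w)" for w by (rule be(4)) simp
 ultimately show ?thesis using C p0 by (simp add: powr_powr)
qed

lemma res_sup_bound:
 fixes c :: "'k => complex" and x :: "'k => 'a => complex"
 assumes s: "0 < s" "s < 1" and S: "finite S" and x: "!!k. k : S ==> x k : Lp M p"
  and c: "!!k. k : S ==> 1 < cmod (c k)" and rh: "!!k. k : S ==> 0 <= rh k" "!!k. k : S ==> rh k <= B * (cmod (c k) - 1)" and B: "0 < B"
 shows "Ln M p (%w. of_real (sup_set S (%k. of_real (rh k) * op s T (rpoly (c k) N) (x k) w))) <= (B * (p / (p - 1))) * Ln M p (%w. of_real (sup_set S (%k. x k w)))"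
proof (rule res_kernel_transference[OF s S x])
 show "sup_set S u = sup_set S v" if "!!k. k : S ==> u k = v k" for u v :: "'k => complex"
  unfolding sup_set_def using that by (intro arg_cong[where f = Max] arg_cong[where f = "insert 0"] image_cong) auto
 fix h and v :: "nat => 'k => complex"
 define b where "b l = (if l < h + N then sup_set S (v l) else 0)" for l
 define w where "w k = (%j. rh k / B * inverse (cmod (c k)) ^ Suc j)" for k
 have b0: "0 <= b l" for l by (simp add: b_def sup_set_nonneg[OF S])
 let ?a = "%m. sup_set S (%l. SUM j<=N. of_real (rh l) * coeff (rpoly (c l) N) j * v (m + j) l)"
 let ?b = "%m. max_avg (h + N) b m"
 have le: "?a m <= B * ?b m" if m: "m < h" for m
 proof -
  have "cmod (SUM j<=N. of_real (rh k) * coeff (rpoly (c k) N) j * v (m + j) k) <= B * ?b m" if k: "k : S" for k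
  proof -
   note R = cseminorm_res[OF c[OF k] rh[OF k] B, folded w_def]
   let ?c = "conv (Suc N) (w k) (%l. if l < h + N then cmod (v l k) else 0) m"
   have "?c <= ?b m"
    using m k by (intro conv_sup_bound[OF R(1)]) (auto simp: b_def sup_set_nonneg[OF S] sup_set_ge[OF S])
   hence "B * ?c <= B * ?b m" using B by simp
   with R(2)[OF m, of N v k] show ?thesis by linarith
  qed
  moreover have "0 <= B * ?b m" using B b0 m by (intro mult_nonneg_nonneg max_avg_nonneg) auto
  ultimately show ?thesis by (simp add: sup_set_le[OF S])
 qed
 let ?d = "SUM m<h + N. sup_set S (v m) powr p"
 let ?e = "SUM m<=h + N. b m powr p"
 have "(SUM m<h. ?a m powr p) <= (SUM m<h. (B * ?b m) powr p)"
  using p0 le by (intro sum_mono powr_mono2) (auto simp: sup_set_nonneg[OF S])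
 also have "... <= (SUM m<=h + N. (B * ?b m) powr p)" by (intro sum_mono2) auto
 also have "... = B powr p * (SUM m<=h + N. ?b m powr p)"
  using B b0 by (simp add: powr_mult max_avg_nonneg sum_distrib_left)
 also have "... <= B powr p * ((p / (p - 1)) powr p * ?e)"
  using max_avg_strong[OF p b0] by (intro mult_left_mono) auto
 also have "?e = (SUM m<h + N. b m powr p)" by (intro sum.mono_neutral_right) (auto simp: b_def)
 also have "... = ?d" by (intro sum.cong) (auto simp: b_def)
 finally show "(SUM m<h. ?a m powr p) <= (B * (p / (p - 1))) powr p * ?d"
  using B p by (simp add: powr_mult powr_divide)
 show "(%w. sup_set S (%l. f l w)) : borel_measurable M" if "!!l. f l : borel_measurable M" for f
  by (rule sup_set_measurable[OF S that])
 show "0 <= B * (p / (p - 1))" using B p by simp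
qed (simp_all add: sup_set_cseminorm[OF S] sup_set_le_sum[OF S])

lemma res_sum_bound:
 fixes c :: "'k => complex" and x :: "'k => 'a => complex"
 assumes s: "0 < s" "s < 1" and S: "finite S" and x: "!!k. k : S ==> x k : Lp M p"
  and c: "!!k. k : S ==> 1 < cmod (c k)" and rh: "!!k. k : S ==> 0 <= rh k" "!!k. k : S ==> rh k <= B * (cmod (c k) - 1)" and B: "0 < B"
 shows "Ln M p (%w. of_real (SUM k:S. cmod (of_real (rh k) * op s T (rpoly (c k) N) (x k) w))) <= (B * p) * Ln M p (%w. of_real (SUM k:S. cmod (x k w)))"
proof (rule res_kernel_transference[OF s S x sum_cseminorm])
 show "(%w. SUM l:S. cmod (f l w)) : borel_measurable M" if "!!l. f l : borel_measurable M" for f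
  using that by measurable
 fix h and v :: "nat => 'k => complex"
 define w where "w k = (%j. rh k / B * inverse (cmod (c k)) ^ Suc j)" for k
 define A where "A k l = (if l < h + N then cmod (v l k) else 0)" for k l
 let ?a = "%k m. cmod (SUM j<=N. of_real (rh k) * coeff (rpoly (c k) N) j * v (m + j) k)"
 let ?b = "%k m. conv (Suc N) (w k) (A k) m"
 have R: "dec_kernel (w k)" "m < h ==> ?a k m <= B * ?b k m" if k: "k : S" for k m
  using cseminorm_res(1)[OF c[OF k] rh[OF k] B] cseminorm_res(2)[OF c[OF k] rh[OF k] B, of m h N v k] unfolding w_def A_def by auto
 have A0: "0 <= A k l" for k l by (simp add: A_def)
 let ?c = "SUM m<h + N. (SUM k:S. cmod (v m k)) powr p"
 let ?d = "SUM m<=h + N. (SUM k:S. A k m) powr p"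
 let ?e = "SUM m<h. (SUM l:S. ?a l m) powr p"
 have "?e <= (SUM m<h. (SUM l:S. B * ?b l m) powr p)"
  using p0 R(2) by (intro sum_mono powr_mono2) (auto intro: sum_nonneg)
 also have "... <= (SUM m<=h + N. (SUM l:S. B * ?b l m) powr p)" by (intro sum_mono2) auto
 also have "... = B powr p * (SUM m<=h + N. (SUM l:S. ?b l m) powr p)"
 proof -
  have "0 <= (SUM l:S. ?b l m)" for m using R(1) A0 by (intro sum_nonneg conv_nonneg) auto
  thus ?thesis using B by (simp add: powr_mult sum_distrib_left[symmetric])
 qed
 also have "... <= B powr p * (p powr p * ?d)"
  by (intro mult_left_mono conv_l1_bound[OF p S R(1)]) (auto simp: A_def)
 also have "?d = (SUM m<h + N. (SUM k:S. A k m) powr p)" by (intro sum.mono_neutral_right) (auto simp: A_def)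
 also have "... = ?c" by (intro sum.cong) (auto simp: A_def)
 finally show "?e <= (B * p) powr p * ?c"
  using B p by (simp add: powr_mult)
qed (use B p in auto)

lemma op_linear:
 assumes f: "f : Lp M p" and g: "g : Lp M p"
 shows "AE w in M. op s T Q (%w. a * f w + b * g w) w = a * op s T Q f w + b * op s T Q g w"
proof -
 have "AE w in M. ALL j:{..degree Q}. (T ^^ j) (%w. a * f w + b * g w) w = a * (T ^^ j) f w + b * (T ^^ j) g w"
  using Tn_sum[of "UNIV :: bool set" "%b. if b then f else g" _ "%t. if t then a else b"] f g
  by (intro AE_finite_allI) (auto simp: UNIV_bool add.commute)
 thus ?thesis
  by eventually_elim (simp add: op_def sum_distrib_left algebra_simps flip: sum.distrib)
qed

text \<open>Interpolates between the maximal bounds, with \<open>B\<close> times a factor depending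
  on \<open>p\<close>, and the bound \<open>A\<close> for single vectors. The gain is that
  \<open>B\<close> enters with a power less than 1: later \<open>B\<close> grows like
  \<open>1 / sin e\<close> while \<open>A\<close> is fixed.\<close>

theorem res_l2_bound:
 fixes c :: "'k => complex" and x :: "'k => 'a => complex"
 assumes s: "0 < s" "s < 1" and S: "finite S" and x: "!!k. k : S ==> x k : Lp M p"
  and c: "!!k. k : S ==> 1 < cmod (c k)" and rh: "!!k. k : S ==> 0 <= rh k" "!!k. k : S ==> rh k <= B * (cmod (c k) - 1)" and B: "0 < B"
  and A: "0 < A" "!!k f. k : S ==> f : Lp M p ==> rh k * Ln M p (op s T (rpoly (c k) N) f) <= A * Ln M p f"
 defines "t \<equiv> (if p <= 2 then p / 2 else p / (p - 1) / 2)"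
 shows "L2n M p S (%k w. of_real (rh k) * op s T (rpoly (c k) N) (x k) w)
  <= ((B * (if p <= 2 then p / (p - 1) else p)) powr (1 - t) * A powr t) * L2n M p S x"
 unfolding t_def
proof (rule Lp_interpolation[OF p S _ _ A(1) _ _ _ _ x])
 let ?V = "%k f w. of_real (rh k) * op s T (rpoly (c k) N) f w"
 show "?V k f : Lp M p" if "f : Lp M p" for k f using that by (intro Lp_scale(1)[OF p0] op_Lp)
 show "AE w in M. ?V k (%w. a * f w + b * g w) w = a * ?V k f w + b * ?V k g w" if "f : Lp M p" "g : Lp M p" for k f g a b
  using op_linear[OF that, of s "rpoly (c k) N" a b] by eventually_elim (simp add: algebra_simps)
 show "Ln M p (?V k f) <= A * Ln M p f" if "k : S" "f : Lp M p" for k f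
  using A(2)[OF that] rh(1)[OF that(1)] by (simp add: Lp_scale(2)[OF p0 op_Lp[OF that(2)]])
 let ?a = "if p <= 2 then p / (p - 1) else p"
 show "0 < B * ?a" using B p by simp
 show "Ln M p (%w. of_real (sup_set S (%k. ?V k (f k) w))) <= B * ?a * Ln M p (%w. of_real (sup_set S (%k. f k w)))"
  if "p <= 2" "!!k. k : S ==> f k : Lp M p" for f
 proof -
  have e: "?a = p / (p - 1)" using that(1) by simp
  show ?thesis unfolding e by (rule res_sup_bound[OF s S that(2) c rh B])
 qed
 show "Ln M p (%w. of_real (SUM k:S. cmod (?V k (f k) w))) <= B * ?a * Ln M p (%w. of_real (SUM k:S. cmod (f k w)))"
  if "2 < p" "!!k. k : S ==> f k : Lp M p" for f
 proof -
  have e: "?a = p" using that(1) by simp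
  show ?thesis unfolding e by (rule res_sum_bound[OF s S that(2) c rh B])
 qed
qed

end

section \<open>Algebra of polynomials in the operator and its resolvent bound\<close>

lemma pmoment_eq: "degree P <= J ==> pmoment g P = (SUM n<=J. coeff P n * g n)"
 unfolding pmoment_def by (rule sum_coeff_extend[symmetric])

lemma pmoment_add: "pmoment g (P + Q) = pmoment g P + pmoment g Q"
 using degree_add_le_max[of P Q]
 by (simp add: pmoment_eq[of _ "max (degree P) (degree Q)"] distrib_right sum.distrib)

lemma pmoment_smult: "pmoment g (smult c P) = c * pmoment g P"
 using degree_smult_le[of c P] by (simp add: pmoment_eq[of _ "degree P"] sum_distrib_left mult.assoc)

lemma pmoment_0: "pmoment g 0 = 0" by (simp add: pmoment_def)

lemma pmoment_sum: "pmoment g (SUM i:I. P i) = (SUM i:I. pmoment g (P i))"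
 by (induction I rule: infinite_finite_induct) (simp_all add: pmoment_0 pmoment_add)

lemma pmoment_diff: "pmoment g (P - Q) = pmoment g P - pmoment g Q"
proof -
 have "P - Q = P + smult (-1) Q" by simp
 thus ?thesis by (simp only: pmoment_add pmoment_smult) simp
qed

lemma pmoment_monom: "pmoment g (monom c n) = c * g n"
 by (subst pmoment_eq[of _ n]) (auto simp: degree_monom_le coeff_monom if_distrib[of "%x. x * _"] sum.delta cong: if_cong)

lemma pmoment_mult: "pmoment g (P * Q) = (SUM i<=degree P. SUM j<=degree Q. coeff P i * coeff Q j * g (i + j))"
proof -
 have "P * Q = (SUM i<=degree P. monom (coeff P i) i) * (SUM j<=degree Q. monom (coeff Q j) j)"
  by (simp add: poly_as_sum_of_monoms)
 also have "... = (SUM i<=degree P. SUM j<=degree Q. monom (coeff P i * coeff Q j) (i + j))"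
  by (simp add: sum_product mult_monom)
 finally show ?thesis by (simp add: pmoment_sum pmoment_monom)
qed

lemma op_pmoment: "op s T Q x w = pmoment (%n. of_real (s ^ n) * (T ^^ n) x w) Q"
 by (simp add: op_def pmoment_def)

lemma op_sum: "op s T (SUM i:I. P i) x w = (SUM i:I. op s T (P i) x w)"
 by (simp add: op_pmoment pmoment_sum)

lemma op_add: "op s T (P + Q) x w = op s T P x w + op s T Q x w"
 by (simp add: op_pmoment pmoment_add)

lemma op_diff: "op s T (P - Q) x w = op s T P x w - op s T Q x w"
 by (simp add: op_pmoment pmoment_diff)

lemma op_smult: "op s T (smult c P) x w = c * op s T P x w"
 by (simp add: op_pmoment pmoment_smult)

lemma op_monom: "op s T (monom c n) x w = c * (of_real (s ^ n) * (T ^^ n) x w)"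
 by (simp add: op_pmoment pmoment_monom)

lemma summation_by_parts:
 fixes a :: complex and u :: "nat => complex"
 shows "(1 - a) * (SUM n=A..<A + Suc L. a ^ n * u n) = a ^ A * u A - a ^ (A + Suc L) * u (A + L) + a * (SUM n=A..<A + L. a ^ n * (u (Suc n) - u n))"
proof (induction L)
 case (Suc L)
 let ?a = "SUM n=A..<A + L. a ^ n * (u (Suc n) - u n)"
 let ?b = "a ^ (A + Suc L) * u (A + Suc L)"
 have "(1 - a) * (SUM n=A..<A + Suc (Suc L). a ^ n * u n) = (1 - a) * (SUM n=A..<A + Suc L. a ^ n * u n) + (1 - a) * ?b"
  by (simp add: distrib_left)
 also have "... = a ^ A * u A - a ^ (A + Suc L) * u (A + L) + a * ?a + (1 - a) * ?b"
  unfolding Suc ..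
 also have "... = a ^ A * u A - a ^ (A + Suc (Suc L)) * u (A + Suc L) + a * (?a + a ^ (A + L) * (u (Suc (A + L)) - u (A + L)))"
  by (simp add: algebra_simps)
 finally show ?case by simp
qed (simp add: algebra_simps)

lemma sum_inverse_squares: "(SUM n=A..<A + L. 1 / (real n + 1)^2) <= 2 / (real A + 1)"
proof -
 have "(SUM n=A..<A + L. 1 / (real n + 1)^2) <= 2 / (real A + 1) - 2 / (real (A + L) + 1)"
 proof (induction L)
  case (Suc L)
  define m where "m = real (A + L) + 1"
  have m: "1 <= m" by (simp add: m_def)
  have "1 / m^2 = 2 / (2 * (m * m))" using m by (simp add: power2_eq_square)
  also have "... <= 2 / (m * (m + 1))" using m by (intro divide_left_mono mult_pos_pos) (auto simp: algebra_simps)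
  also have "... = 2 / m - 2 / (m + 1)" using m by (simp add: field_simps)
  finally have "1 / m^2 <= 2 / m - 2 / (m + 1)" .
  with Suc show ?case by (simp add: m_def add_ac)
 qed simp
 moreover have "0 <= 2 / (real (A + L) + 1)" by simp
 ultimately show ?thesis by linarith
qed

lemma Ln_weighted_sum:
 assumes p: "1 < p" and "finite S" and "!!n. n : S ==> f n : Lp M p" and "!!n. n : S ==> cmod (a n) <= 1"
  and "!!n. n : S ==> Ln M p (f n) <= b n"
 shows "Ln M p (%w. SUM n:S. a n * f n w) <= (SUM n:S. b n)"
proof -
 have p0: "0 < p" using p by simp
 let ?a = "%n. Ln M p (%w. a n * f n w)"
 have "Ln M p (%w. SUM n:S. a n * f n w) <= (SUM n:S. ?a n)"
  using assms by (intro conjunct2[OF Lp_sum[OF p]] Lp_scale(1)[OF p0]) auto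
 also have "... <= (SUM n:S. b n)"
 proof (rule sum_mono)
  fix n assume n: "n : S"
  have "?a n <= 1 * Ln M p (f n)"
   unfolding Lp_scale(2)[OF p0 assms(3)[OF n]] using assms(4)[OF n] by (intro mult_right_mono Ln_nonneg)
  with assms(5)[OF n] show "?a n <= b n" by simp
 qed
 finally show ?thesis .
qed

lemma Ln_by_parts:
 assumes p: "1 < p" and u: "!!n. u n : Lp M p" and a: "cmod a <= 1"
  and b1: "Ln M p (u A) <= X" "Ln M p (u (A + L)) <= X" and b2: "Ln M p (%w. SUM n=A..<A + L. a ^ n * (u (Suc n) w - u n w)) <= Y"
 shows "cmod (1 - a) * Ln M p (%w. SUM n=A..<A + Suc L. a ^ n * u n w) <= 2 * X + Y"
proof -
 have p0: "0 < p" using p by simp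
 have an: "cmod (a ^ n) <= 1" for n using a by (simp add: norm_power power_le_one)
 have SL: "(%w. SUM n=A..<B. a ^ n * f n w) : Lp M p" if "!!n. f n : Lp M p" for f :: "nat => 'a => complex" and B
  using that by (intro conjunct1[OF Lp_sum[OF p]] Lp_scale(1)[OF p0]) auto
 define v where "v (i::nat) = (if i = 0 then u A else if i = 1 then u (A + L) else (%w. SUM n=A..<A + L. a ^ n * (u (Suc n) w - u n w)))" for i
 define c where "c (i::nat) = (if i = 0 then a ^ A else if i = 1 then - (a ^ (A + Suc L)) else a)" for i
 let ?a = "%w. (1 - a) * (SUM n=A..<A + Suc L. a ^ n * u n w)"
 have e: "?a = (%w. SUM i:{0,1,2::nat}. c i * v i w)"
  unfolding summation_by_parts by (rule ext) (simp add: c_def v_def algebra_simps)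
 have "cmod (1 - a) * Ln M p (%w. SUM n=A..<A + Suc L. a ^ n * u n w) = Ln M p ?a"
  by (rule Lp_scale(2)[OF p0 SL[OF u], symmetric])
 also have "... <= (SUM i:{0,1,2::nat}. if i = 2 then Y else X)"
  unfolding e
 proof (rule Ln_weighted_sum[OF p])
  show "v i : Lp M p" for i using u SL[OF Lp_diff(1)[OF p u u]] by (auto simp: v_def)
  show "cmod (c i) <= 1" for i using an[of A] an[of "A + Suc L"] a by (auto simp: c_def simp del: add_Suc_right power_Suc)
  show "Ln M p (v i) <= (if i = 2 then Y else X)" if "i : {0,1,2}" for i using that b1 b2 by (auto simp: v_def)
 qed simp
 finally show ?thesis by simp
qed

text \<open>The sum is cut at \<open>A\<close>, about \<open>1 / |1 - a|\<close>. The first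
  \<open>A\<close> terms are estimated trivially. In the tail one summation by parts leaves first
  differences, whose bounds would add up to a logarithm; a second one leaves second differences, and
  their sum, at most \<open>2 * K2 * X / (A + 1)\<close>, is again of order
  \<open>|1 - a|\<close>.\<close>

lemma ritt_sum_bound:
 assumes p: "1 < p" and u: "!!n. u n : Lp M p" and X: "0 <= X" "0 <= K1" "0 <= K2" and u0: "!!n. Ln M p (u n) <= X"
  and u1: "!!n. Ln M p (%w. u (Suc n) w - u n w) <= K1 * X / (real n + 1)"
  and u2: "!!n. Ln M p (%w. u (Suc (Suc n)) w - 2 * u (Suc n) w + u n w) <= K2 * X / (real n + 1)^2"
  and a: "cmod a <= 1" "a ~= 1"
 shows "cmod (1 - a) * Ln M p (%w. SUM n<N. a ^ n * u n w) <= (3 + 2 * K1 + 2 * K2) * X"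
proof -
 have p0: "0 < p" using p by simp
 define b where "b = cmod (1 - a)"
 have b: "0 < b" using a by (simp add: b_def)
 have an: "cmod (a ^ n) <= 1" for n using a by (simp add: norm_power power_le_one)
 define A where "A = nat \<lfloor>1 / b\<rfloor>"
 let ?e = "real A + 1"
 have A: "real A <= 1 / b" "1 / b <= real A + 1" using b by (auto simp: A_def)
 hence bA: "b * real A <= 1" "1 <= b * ?e" using b by (auto simp: field_simps)
 let ?d = "%B. Ln M p (%w. SUM n<B. a ^ n * u n w)"
 have first: "b * ?d B <= X" if "B <= A" for B
 proof -
  have "?d B <= (SUM n<B. X)" by (rule Ln_weighted_sum[OF p]) (use u an u0 in auto)
  also have "... <= real A * X" using that X by (simp add: mult_right_mono)
  finally have "b * ?d B <= b * (real A * X)" using b by simp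
  also have "... = (b * real A) * X" by simp
  also have "... <= 1 * X" using bA X by (intro mult_right_mono)
  finally show ?thesis by simp
 qed
 let ?f = "2 * K1 + 2 * K2"
 let ?h = "%L. Ln M p (%w. SUM n=A..<A + L. a ^ n * (u (Suc n) w - u n w))"
 have second: "b * ?h L <= b * (?f * X)" for L
 proof (cases L)
  case 0
  thus ?thesis using b X Lp_zero(2)[OF p0, of M] by simp
 next
  case (Suc L')
  let ?a = "Ln M p (%w. SUM n=A..<A + L'. a ^ n * (u (Suc (Suc n)) w - u (Suc n) w - (u (Suc n) w - u n w)))"
  let ?g = "Ln M p (%w. u (Suc (A + L')) w - u (A + L') w)"
  have "b * Ln M p (%w. SUM n=A..<A + Suc L'. a ^ n * (u (Suc n) w - u n w)) <= 2 * (K1 * X / ?e) + 2 * K2 * X / ?e"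
   unfolding b_def
  proof (rule Ln_by_parts[OF p _ a(1), where u = "%n w. u (Suc n) w - u n w"])
   show "(%w. u (Suc n) w - u n w) : Lp M p" for n by (rule Lp_diff(1)[OF p u u])
   show "Ln M p (%w. u (Suc A) w - u A w) <= K1 * X / ?e" by (rule u1)
   have "?g <= K1 * X / (real (A + L') + 1)" by (rule u1)
   also have "... <= K1 * X / ?e" using X by (intro divide_left_mono mult_pos_pos) auto
   finally show "?g <= K1 * X / ?e" .
   have L: "(%w. u (Suc (Suc n)) w - u (Suc n) w - (u (Suc n) w - u n w)) : Lp M p" for n
    by (intro Lp_diff(1)[OF p] u)
   have "?a <= (SUM n=A..<A + L'. K2 * X / (real n + 1)^2)"
    using L an u2 by (intro Ln_weighted_sum[OF p]) (auto simp: algebra_simps)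
   also have "... = K2 * X * (SUM n=A..<A + L'. 1 / (real n + 1)^2)" by (simp add: sum_distrib_left)
   also have "... <= K2 * X * (2 / ?e)" using X by (intro mult_left_mono sum_inverse_squares) auto
   finally show "?a <= 2 * K2 * X / ?e" by (simp add: mult_ac)
  qed
  also have "... = ?f * X * (1 / ?e)" by (simp add: distrib_right add_divide_distrib mult.assoc)
  also have "... <= ?f * X * b" using X b bA(2) by (intro mult_left_mono) (auto simp: field_simps)
  finally show ?thesis using Suc by (simp add: mult_ac)
 qed
 let ?b = "%L. Ln M p (%w. SUM n=A..<A + Suc L. a ^ n * u n w)"
 let ?c = "Ln M p (%w. SUM n<N. a ^ n * u n w)"
 let ?i = "Ln M p (%w. SUM n<A. a ^ n * u n w)"
 show ?thesis
 proof (cases "N <= A")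
  case True
  have "0 <= (2 + 2 * K1 + 2 * K2) * X" using X by simp
  with first[OF True] show ?thesis by (simp add: b_def algebra_simps)
 next
  case False
  then obtain L where N: "N = A + Suc L" by (metis add_Suc_right less_imp_Suc_add not_le)
  have SL: "(%w. SUM n:B. a ^ n * u n w) : Lp M p" if "finite B" for B
   using that u by (intro conjunct1[OF Lp_sum[OF p]] Lp_scale(1)[OF p0]) auto
  have "?h L <= ?f * X" using second[of L] b by simp
  from Ln_by_parts[OF p u a(1) u0 u0 this]
  have 2: "b * ?b L <= 2 * X + ?f * X" by (simp add: b_def)
  have e: "(SUM n<N. a ^ n * u n w) = (SUM n<A. a ^ n * u n w) + (SUM n=A..<A + Suc L. a ^ n * u n w)" for w
   unfolding N lessThan_atLeast0 by (rule sum.atLeastLessThan_concat[symmetric]) auto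
  have "?c <= ?i + ?b L"
   unfolding e by (intro Lp_add(2)[OF p] SL) auto
  hence "b * ?c <= b * ?i + b * ?b L"
   using b by (simp flip: distrib_left)
  with first[of A] 2 have "b * ?c <= X + (2 * X + ?f * X)" by simp
  thus ?thesis by (simp add: b_def algebra_simps)
 qed
qed

context contr_regular
begin

lemma op_mult:
 assumes x: "x : Lp M p"
 shows "AE w in M. op s T (P * Q) x w = op s T P (op s T Q x) w"
proof -
 have e: "op s T Q x = (%w. SUM j:{..degree Q}. (coeff Q j * of_real (s ^ j)) * (T ^^ j) x w)"
  by (simp add: op_def fun_eq_iff mult.assoc)
 let ?a = "%i w. SUM j<=degree Q. (coeff Q j * of_real (s ^ j)) * (T ^^ i) ((T ^^ j) x) w"
 have "AE w in M. ALL i:{..degree P}. (T ^^ i) (op s T Q x) w = (?a i w)"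
  unfolding e using x by (intro AE_finite_allI Tn_sum Tn_Lp) auto
 thus ?thesis
 proof eventually_elim
  case (elim w)
  have "op s T P (op s T Q x) w = (SUM i<=degree P. coeff P i * (of_real (s ^ i) * (?a i w)))"
   unfolding op_def[of s T P] by (rule sum.cong[OF refl]) (use elim in simp)
  also have "... = op s T (P * Q) x w"
   unfolding op_pmoment pmoment_mult
   by (simp add: sum_distrib_left funpow_add power_add mult_ac)
  finally show ?case by simp
 qed
qed

lemma op_AE:
 assumes "AE w in M. x w = y w" "x : Lp M p" "y : Lp M p"
 shows "AE w in M. op s T Q x w = op s T Q y w"
proof -
 have "AE w in M. ALL j:{..degree Q}. (T ^^ j) x w = (T ^^ j) y w"
  using assms by (intro AE_finite_allI Tn_AE) auto
 thus ?thesis by eventually_elim (simp add: op_def)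
qed

lemma op_mult_norm:
 assumes P: "!!x. x : Lp M p ==> Ln M p (op s T P x) <= a * Ln M p x" and Q: "!!x. x : Lp M p ==> Ln M p (op s T Q x) <= b * Ln M p x"
  and a: "0 <= a" and x: "x : Lp M p"
 shows "Ln M p (op s T (P * Q) x) <= a * b * Ln M p x"
proof -
 have "Ln M p (op s T (P * Q) x) = Ln M p (op s T P (op s T Q x))"
  by (rule Lp_cong_AE(2)[OF p0 op_Lp[OF op_Lp[OF x]] LpD[OF op_Lp[OF x]] op_mult[OF x]])
 also have "... <= a * Ln M p (op s T Q x)" by (rule P[OF op_Lp[OF x]])
 also have "... <= a * (b * Ln M p x)" using Q[OF x] a by (rule mult_left_mono)
 finally show ?thesis by (simp add: mult.assoc)
qed

lemma op_power_norm:
 assumes P: "!!x. x : Lp M p ==> Ln M p (op s T P x) <= a * Ln M p x" and a: "0 <= a" and x: "x : Lp M p"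
 shows "Ln M p (op s T (P ^ j) x) <= a ^ j * Ln M p x"
 using x
proof (induction j arbitrary: x)
 case 0
 have "op s T 1 x = x" by (simp add: fun_eq_iff op_def)
 thus ?case by simp
next
 case (Suc j)
 show ?case using op_mult_norm[OF P Suc.IH a Suc.prems] by simp
qed

end

locale ritt_regular = contr_regular +
 fixes K0 :: real
 assumes K0: "0 <= K0" and ritt: "!!n f. f : Lp M p ==> 1 <= n ==> real n * Ln M p (%w. (T ^^ n) f w - (T ^^ (n - 1)) f w) <= K0 * Ln M p f"
begin

text \<open>Uniform in \<open>s\<close>: besides \<open>s^(n+1) (T^(n+1) - T^n)\<close> there is the
  term \<open>s^n (1 - s) T^n\<close>, and \<open>(n + 1) * s^n * (1 - s) <= 1 - s^(n+1)\<close>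
  because a geometric sum is at least the number of its terms times the last one.\<close>

lemma op_difference:
 assumes s: "0 < s" "s < 1" and x: "x : Lp M p"
 shows "Ln M p (op s T (monom 1 (Suc n) - monom 1 n) x) <= (K0 + 1) / (real n + 1) * Ln M p x"
proof -
 define d where "d = (%w. (T ^^ Suc n) x w - (T ^^ n) x w)"
 have dL: "d : Lp M p" unfolding d_def by (intro Lp_diff(1)[OF p] Tn_Lp x)
 let ?e = "real n + 1"
 have dn: "Ln M p d <= K0 * Ln M p x / ?e"
  using ritt[OF x, of "Suc n"] by (simp add: d_def field_simps)
 let ?a = "s ^ n * (1 - s)"
 let ?d = "op s T (monom 1 (Suc n) - monom 1 n) x"
 have e: "?d = (%w. of_real (s ^ Suc n) * d w - of_real ?a * (T ^^ n) x w)"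
  by (simp add: fun_eq_iff op_diff op_monom d_def algebra_simps)
 let ?b = "Ln M p (%w. of_real (s ^ Suc n) * d w)"
 let ?c = "Ln M p (%w. of_real ?a * (T ^^ n) x w)"
 have "Ln M p ?d <= ?b + ?c"
  unfolding e by (intro Lp_diff(2)[OF p] Lp_scale(1)[OF p0] dL Tn_Lp x)
 also have "?b <= 1 * Ln M p d"
  unfolding Lp_scale(2)[OF p0 dL] using s by (intro mult_right_mono Ln_nonneg) (auto simp: norm_power norm_mult mult_le_one power_le_one)
 also have "?c <= 1 / ?e * Ln M p x"
 proof -
  have "?e * ?a = (1 - s) * (SUM j<Suc n. s ^ n)" by simp
  also have "... <= (1 - s) * (SUM j<Suc n. s ^ j)" using s by (intro mult_left_mono sum_mono power_decreasing) auto
  also have "... = 1 - s ^ Suc n" by (rule one_diff_power_eq[symmetric])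
  also have "... <= 1" using s by simp
  finally have "?a <= 1 / ?e" by (simp add: field_simps)
  moreover have "cmod (of_real ?a) = ?a" using s by (simp only: norm_of_real) simp
  ultimately show ?thesis
   unfolding Lp_scale(2)[OF p0 Tn_Lp[OF x]] using Tn_contr[OF x, of n] s by (intro mult_mono) (auto simp: Ln_nonneg)
 qed
 finally show ?thesis using dn by (simp add: field_simps)
qed

text \<open>Three times the constant of \<open>ritt_sum_bound\<close> with
  \<open>K1 = K0 + 1\<close> from \<open>op_difference\<close> and
  \<open>K2 = 4 * (K0 + 1)^2\<close> for the second differences; it does not depend on
  \<open>s\<close>.\<close>

definition "KR = 3 * (3 + 2 * (K0 + 1) + 2 * (4 * (K0 + 1)^2))"

lemma KR: "1 <= KR" using K0 by (simp add: KR_def add_increasing2)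

theorem resolvent_bound:
 assumes s: "0 < s" "s < 1" and x: "x : Lp M p" and c: "1 <= cmod c" "cmod c <= 3" "c ~= 1"
 shows "Ln M p (op s T (rpoly c N) x) <= KR / cmod (c - 1) * Ln M p x"
proof -
 define u where "u n = op s T (monom 1 n) x" for n
 have uL: "u n : Lp M p" for n unfolding u_def by (rule op_Lp[OF x])
 have u0: "Ln M p (u n) <= Ln M p x" for n
 proof -
  have "u n = (%w. of_real (s ^ n) * (T ^^ n) x w)" by (simp add: u_def op_monom fun_eq_iff)
  hence "Ln M p (u n) = cmod (of_real (s ^ n)) * Ln M p ((T ^^ n) x)" by (simp add: Lp_scale(2)[OF p0 Tn_Lp[OF x]])
  also have "... <= 1 * Ln M p x" using s Tn_contr[OF x] by (intro mult_mono) (auto simp: norm_power power_le_one Ln_nonneg)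
  finally show ?thesis by simp
 qed
 let ?a = "%n. real n + 1"
 have u1: "Ln M p (%w. u (Suc n) w - u n w) <= (K0 + 1) * Ln M p x / (?a n)" for n
  using op_difference[OF s x, of n] by (simp add: u_def op_diff[abs_def])
 let ?d = "4 * (K0 + 1)^2"
 \<comment> \<open>The second difference at \<open>n\<close> is the product of the first differences
   at the two halves \<open>i\<close> and \<open>j\<close> of \<open>n\<close>; since
   \<open>i + 1\<close> and \<open>j + 1\<close> are at least half of \<open>n + 1\<close>, the
   factor 4 appears.\<close>
 have u2: "Ln M p (%w. u (Suc (Suc n)) w - 2 * u (Suc n) w + u n w) <= ?d * Ln M p x / (?a n)^2" for n
 proof -
  define i where "i = n div 2"
  define j where "j = n - i"
  have "n <= 2 * i + 1" "n <= 2 * j + 1" unfolding i_def j_def by linarith+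
  hence "real n <= real (2 * i + 1)" "real n <= real (2 * j + 1)" by (simp_all only: of_nat_le_iff)
  hence ij: "n = i + j" "real n + 1 <= 2 * (?a i)" "real n + 1 <= 2 * (?a j)" by (simp_all add: i_def j_def)
  have m2: "smult 2 q = q + q" for q :: "complex poly" using smult_add_left[of 1 1 q] by simp
  let ?c = "(monom 1 (Suc i) - monom 1 i) * (monom 1 (Suc j) - monom 1 j)"
  have pe: "?c = monom 1 (Suc (Suc n)) - smult 2 (monom 1 (Suc n)) + (monom 1 n :: complex poly)"
   by (simp add: m2 ij(1) left_diff_distrib right_diff_distrib mult_monom del: smult_monom)
  let ?e = "4 * ((?a i) * (?a j))"
  let ?g = "(K0 + 1) / (?a i) * ((K0 + 1) / (?a j))"
  let ?h = "4 * (K0 + 1)^2 / (?a n)^2"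
  have "Ln M p (op s T ?c x) <= (K0 + 1) / (?a i) * ((K0 + 1) / (?a j)) * Ln M p x"
   using K0 by (intro op_mult_norm op_difference s x) auto
  also have "... <= ?d / (?a n)^2 * Ln M p x"
  proof (intro mult_right_mono Ln_nonneg)
   have "(?a n) * (?a n) <= (2 * (?a i)) * (2 * (?a j))" using ij by (intro mult_mono) auto
   also have "... = ?e" by (simp add: algebra_simps)
   finally have le: "(?a n)^2 <= ?e" by (simp add: power2_eq_square)
   have "?g = 4 * (K0 + 1)^2 / ?e" by (simp add: power2_eq_square)
   also have "... <= ?h" using le by (intro divide_left_mono) (auto intro!: mult_pos_pos)
   finally show "?g <= ?h" .
  qed
  finally show ?thesis unfolding pe by (simp add: u_def op_diff[abs_def] op_add[abs_def] op_smult[abs_def])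
 qed
 define a where "a = inverse c"
 have c0: "c ~= 0" using c by auto
 have a: "cmod a <= 1" "a ~= 1" using c by (auto simp: a_def norm_inverse inverse_le_1_iff)
 note R = ritt_sum_bound[OF p uL Ln_nonneg _ _ u0 u1 u2 a, of N]
 let ?b = "%w. SUM n<N. a ^ n * u n w"
 have R': "cmod (1 - a) * Ln M p ?b <= KR / 3 * Ln M p x"
 proof -
  have "KR / 3 = 3 + 2 * (K0 + 1) + 2 * ?d" by (simp add: KR_def)
  thus ?thesis by (simp only:) (rule R; use K0 in simp)
 qed
 let ?f = "rpoly c N"
 have e: "op s T ?f x = (%w. a * (SUM n<N. a ^ n * u n w))"
 proof
  fix w
  have "op s T ?f x w = (SUM n<N. a ^ Suc n * (of_real (s ^ n) * (T ^^ n) x w))"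
   by (simp only: rpoly_def op_sum op_monom a_def)
  thus "op s T ?f x w = a * (SUM n<N. a ^ n * u n w)"
   by (simp add: u_def op_monom sum_distrib_left mult.assoc)
 qed
 have SL: "?b : Lp M p" by (intro conjunct1[OF Lp_sum[OF p]] Lp_scale(1)[OF p0] uL) auto
 have "1 - a = (c - 1) / c" using c0 by (simp add: a_def field_simps)
 hence na: "cmod (1 - a) = cmod (c - 1) / cmod c" by (simp add: norm_divide)
 have na': "cmod a = 1 / cmod c" by (simp add: a_def norm_inverse inverse_eq_divide norm_divide)
 have "cmod (c - 1) * Ln M p (op s T ?f x) = cmod (1 - a) * Ln M p ?b"
  unfolding e Lp_scale(2)[OF p0 SL] na using na' by simp
 also note R'
 also have "KR / 3 * Ln M p x <= KR * Ln M p x" using KR by (intro mult_right_mono Ln_nonneg) auto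
 finally show ?thesis using c by (simp add: field_simps)
qed

end

section \<open>Contour integrals for families of vectors\<close>

text \<open>What \<open>contour_representation\<close> provides, as a property of three functions on
  the two rays and the arc. In this form the continuations can be chosen for every pair of indices,
  outside the locale of a single moment sequence.\<close>

definition contour_ext :: "real => (nat => complex) => (real => complex) => (real => complex) => (real => complex) => bool" where
 "contour_ext e m E1 E2 E3 \<longleftrightarrow>
  (ALL G. 2 * pi * \<i> * pmoment m G =
   integral {0..1} (%t. poly G (ray e t) * E1 t * (of_real (sin e) * (\<i> * cis e)))
  + integral {0..1} (%t. poly G (cnj (ray e t)) * E2 t * (of_real (sin e) * (\<i> * cis (- e))))
  + integral {e..2*pi-e} (%th. poly G (of_real (cos e) * cis th) * E3 th * (of_real (cos e) * \<i> * cis th))) &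
  continuous_on {0..1} E1 & continuous_on {0..1} E2 & continuous_on {e..2*pi-e} E3 &
  (ALL t. 0 < t & t <= 1 --> E1 t = (\<Sum>j. moment m (gfps (ray_center e t) ^ Suc j) * of_real (2 * t * (sin e)^2) ^ j)) &
  (ALL t. 0 < t & t <= 1 --> E2 t = (\<Sum>j. moment m (gfps (cnj (ray_center e t)) ^ Suc j) * of_real (2 * t * (sin e)^2) ^ j)) &
  (ALL th. e <= th & th <= 2 * pi - e --> E3 th = (\<Sum>j. moment m (gfps (cis th) ^ Suc j) * (of_real (1 - cos e) * cis th) ^ j))"

lemma (in resolvent_moment) contour_ext_exists:
 assumes e: "0 < e" "16 * K * e < 1"
 shows "EX E1 E2 E3. contour_ext e m E1 E2 E3"
proof (intro exI)
 show "contour_ext e m (%t. ext (ray e t)) (%t. ext (cnj (ray e t))) (%th. ext (of_real (cos e) * cis th))"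
  unfolding contour_ext_def
  by (intro conjI allI impI contour_representation[OF e] ray_value[OF e, unfolded tcoeff_def] arc_value[OF e, unfolded tcoeff_def]) auto
qed

text \<open>The substitution \<open>ta = 2^k * t\<close> puts all scales on one axis. The sum over
  \<open>k\<close> is then estimated for fixed \<open>ta\<close>, where it involves one point per
  scale, and \<open>C * min 1 (1 / ta^2)\<close> is integrable: it lies below
  \<open>4 * C / (1 + ta)^2\<close>, with integral at most \<open>4 * C\<close>.\<close>

lemma dyadic_integral_bound:
 fixes h :: "nat => real => complex"
 assumes cont: "!!k. k < K ==> continuous_on {0..1} (h k)" and h0: "!!k. k < K ==> h k 0 = 0" and C: "0 <= C"
  and bd: "!!ta. 0 < ta ==> norm (SUM k:{k. k < K & ta <= 2 ^ k}. h k (ta / 2 ^ k) / 2 ^ k) <= C * min 1 (1 / ta\<^sup>2)"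
 shows "norm (SUM k<K. integral {0..1} (h k)) <= 4 * C"
proof -
 define A where "A = (2::real) ^ K"
 have A: "0 <= A" "2 ^ k <= A" if "k < K" for k using that by (auto simp: A_def intro!: power_increasing)
 have A0: "0 <= A" by (simp add: A_def)
 define H where "H k ta = (if ta : {0..2 ^ k} then h k (ta / 2 ^ k) / 2 ^ k else 0)" for k and ta :: real
 let ?c = "%k. integral {0..1} (h k)"
 have int: "(H k has_integral integral {0..1} (h k)) {0..A}" if k: "k < K" for k
 proof -
  have "(h k has_integral integral {0..1} (h k)) (cbox 0 1)"
   using integrable_continuous_real[OF cont[OF k]] by (simp add: integrable_integral)
  from has_integral_affinity[OF this, of "1 / 2 ^ k" 0]
  have "((%ta. h k (1 / 2 ^ k * ta)) has_integral (2 ^ k * ?c k)) ((%x. 2 ^ k * x) ` {0..1})"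
   by (simp add: scaleR_conv_of_real)
  moreover have "(%x::real. 2 ^ k * x) ` {0..1} = {0..2 ^ k}" by (simp add: image_mult_atLeastAtMost)
  ultimately have "((%ta. h k (ta / 2 ^ k)) has_integral (2 ^ k * ?c k)) {0..2 ^ k}" by simp
  from has_integral_mult_left[OF this, of "1 / 2 ^ k"]
  have "((%ta. h k (ta / 2 ^ k) / 2 ^ k) has_integral integral {0..1} (h k)) {0..2 ^ k}" by simp
  thus ?thesis unfolding H_def
   by (rule has_integral_restrict[THEN iffD2, rotated]) (use A(2)[OF k] in auto)
 qed
 have sum: "((%ta. SUM k<K. H k ta) has_integral (SUM k<K. ?c k)) {0..A}"
  by (rule has_integral_sum) (use int in auto)
 let ?b = "C * (- 4 / (1 + A)) - C * (- 4 / (1 + 0))"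
 have G: "((%ta. C * (4 / (1 + ta)^2)) has_integral ?b) {0..A}"
  by (rule fundamental_theorem_of_calculus[OF A0])
   (auto intro!: derivative_eq_intros simp: has_real_derivative_iff_has_vector_derivative[symmetric] power2_eq_square field_simps)
 have le: "norm (SUM k<K. H k ta) <= C * (4 / (1 + ta)^2)" if ta: "ta : {0..A}" for ta
 proof (cases "ta = 0")
  case True
  hence "(SUM k<K. H k ta) = 0" using h0 by (intro sum.neutral) (auto simp: H_def)
  thus ?thesis using C by simp
 next
  case False
  hence t: "0 < ta" using ta by auto
  let ?a = "4 / (1 + ta)^2"
  let ?d = "1 / ta\<^sup>2"
  have "(SUM k<K. H k ta) = (SUM k:{k. k < K & ta <= 2 ^ k}. h k (ta / 2 ^ k) / 2 ^ k)"
   using t by (intro sum.mono_neutral_cong_right) (auto simp: H_def)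
  hence "norm (SUM k<K. H k ta) <= C * min 1 ?d" using bd[OF t] by simp
  also have "... <= C * ?a"
  proof (rule mult_left_mono[OF _ C])
   show "min 1 ?d <= ?a"
   proof (cases "ta <= 1")
    case True
    have "(1 + ta)^2 <= 2^2" using True t by (intro power_mono) auto
    hence "1 <= ?a" using t by (simp add: field_simps)
    thus ?thesis by simp
   next
    case False
    have "(1 + ta)^2 <= (2 * ta)^2" using False t by (intro power_mono) auto
    hence "?d <= ?a" using t by (simp add: field_simps power_mult_distrib)
    thus ?thesis by simp
   qed
  qed
  finally show ?thesis .
 qed
 have "norm (SUM k<K. ?c k) <= ?b"
  using integral_norm_bound_integral[OF has_integral_integrable[OF sum] has_integral_integrable[OF G] le]
  unfolding integral_unique[OF sum] integral_unique[OF G] .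
 also have "... <= 4 * C" using A0 C by (simp add: field_simps)
 finally show ?thesis .
qed

context ritt_regular
begin

definition mom :: "real => ('a => complex) => ('a => complex) => nat => complex" where
 "mom s x y n = (\<integral>w. of_real (s ^ n) * (T ^^ n) x w * y w \<partial>M)"

lemma pmoment_mom:
 assumes pq: "1 < q" "1/p + 1/q = 1" and x: "x : Lp M p" and y: "y : Lp M q"
 shows "pmoment (mom s x y) Q = (\<integral>w. op s T Q x w * y w \<partial>M)"
proof -
 note I = Lp_Holder(1)[OF p pq Lp_scale(1)[OF p0 Tn_Lp[OF x]] y]
 have "(\<integral>w. op s T Q x w * y w \<partial>M) = (\<integral>w. (SUM j<=degree Q. coeff Q j * (of_real (s ^ j) * (T ^^ j) x w * y w)) \<partial>M)"
  by (simp add: op_def sum_distrib_right mult.assoc)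
 also have "... = (SUM j<=degree Q. coeff Q j * mom s x y j)"
  unfolding mom_def using I by (subst Bochner_Integration.integral_sum) (auto simp del: of_real_power)
 finally show ?thesis by (simp add: pmoment_def)
qed

lemma mom_resolvent:
 assumes pq: "1 < q" "1/p + 1/q = 1" and s: "0 < s" "s < 1" and x: "x : Lp M p" and y: "y : Lp M q"
 shows "resolvent_moment (mom s x y) s (Ln M p x * Ln M q y) KR (Ln M p x * Ln M q y)"
proof
 show "cmod (mom s x y n) <= Ln M p x * Ln M q y * s ^ n" for n
 proof -
  have "cmod (mom s x y n) <= Ln M p (%w. of_real (s ^ n) * (T ^^ n) x w) * Ln M q y"
   unfolding mom_def by (rule Lp_Holder(2)[OF p pq Lp_scale(1)[OF p0 Tn_Lp[OF x]] y])
  also have "... = s ^ n * Ln M p ((T ^^ n) x) * Ln M q y" using s by (simp add: Lp_scale(2)[OF p0 Tn_Lp[OF x]] norm_power)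
  also have "... <= s ^ n * Ln M p x * Ln M q y" using s by (intro mult_right_mono mult_left_mono Tn_contr x Ln_nonneg) auto
  finally show ?thesis by (simp add: mult_ac)
 qed
 show "cmod (pmoment (mom s x y) (rpoly c N ^ Suc j)) <= Ln M p x * Ln M q y * (KR / cmod (c - 1)) ^ Suc j"
  if c: "1 <= cmod c" "cmod c <= 3" "c ~= 1" for c N j
 proof -
  have "cmod (pmoment (mom s x y) (rpoly c N ^ Suc j)) <= Ln M p (op s T (rpoly c N ^ Suc j) x) * Ln M q y"
   unfolding pmoment_mom[OF pq x y] by (rule Lp_Holder(2)[OF p pq op_Lp[OF x] y])
  also have "... <= ((KR / cmod (c - 1)) ^ Suc j * Ln M p x) * Ln M q y"
   using KR by (intro mult_right_mono Ln_nonneg op_power_norm resolvent_bound s c x) auto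
  finally show ?thesis by (simp add: mult_ac)
 qed
qed (use s KR Ln_nonneg[of M p x] Ln_nonneg[of M q y] in auto)

text \<open>The \<open>j\<close>-th terms of all Neumann series are estimated together. One factor
  \<open>|c k - 1|\<close> from \<open>u\<close> and \<open>j\<close> of them from the powers of
  \<open>d\<close> supply the weight \<open>|c k - 1|^(j+1)\<close> that the resolvent power needs
  in \<open>HD\<close>. The sum over \<open>n\<close> costs \<open>B0\<close>, and the pairing in
  \<open>l^2\<close> over \<open>V \<times> S\<close> brings in \<open>y\<close>. The ratio
  \<open>th * D <= 1/2\<close> makes the bounds geometric in \<open>j\<close>, which gives the
  factor 2.\<close>

lemma pointwise_bound:
 fixes S :: "'k set" and V :: "'n set"
 assumes pq: "1 < q" "1/p + 1/q = 1" and s: "0 < s" "s < 1" and S: "finite S" and V: "finite V"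
  and x: "!!k. k : S ==> x k : Lp M p" and y: "!!n k. n : V ==> k : S ==> y n k : Lp M q"
  and c: "!!k. k : S ==> 1 <= cmod (c k) & cmod (c k) <= 3 & c k ~= 1"
  and d: "!!k. k : S ==> cmod (d k) * KR <= cmod (c k - 1) / 2" "!!k. k : S ==> cmod (d k) <= th * cmod (c k - 1)"
  and D: "0 <= D" "th * D <= 1 / 2" "0 <= th" and W: "0 <= W" "!!k. k : S ==> cmod (u k) <= W * cmod (c k - 1)"
  and B0: "0 <= B0" "!!k. k : S ==> (SUM n:V. (cmod (a n k))\<^sup>2) <= B0^2"
  and HD: "!!N j. L2n M p S (%k w. of_real (cmod (c k - 1) ^ j) * op s T (rpoly (c k) N ^ j) (x k) w) <= D ^ j * L2n M p S x"
 shows "cmod (SUM k:S. u k * (SUM n:V. a n k * (\<Sum>j. moment (mom s (x k) (y n k)) (gfps (c k) ^ Suc j) * d k ^ j)))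
  <= 2 * W * D * B0 * L2n M p S x * L2n M q (V \<times> S) (%(n, k). y n k)"
proof -
 let ?a = "L2n M q (V \<times> S) (%(n, k). y n k)"
 define Z where "Z = W * D * B0 * L2n M p S x * ?a"
 have Z: "0 <= Z" using D W B0 by (simp add: Z_def L2n_nonneg)
 let ?h = "%k n. mom s (x k) (y n k)"
 define tc where "tc n k j = moment (?h k n) (gfps (c k) ^ Suc j)" for n k j
 define v where "v n k j = u k * a n k * d k ^ j" for n k j
 let ?b = "%k. cmod (c k - 1)"
 have A: "summable (%j. tc n k j * d k ^ j) & (%N. pmoment (?h k n) (rpoly (c k) N ^ Suc j)) \<longlonglongrightarrow> tc n k j"
  if nk: "n : V" "k : S" for n k j
 proof -
  let ?e = "Ln M q (y n k)"
  let ?g = "Ln M p (x k)"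
  interpret R: resolvent_moment "?h k n" s "?g * ?e" KR "?g * ?e"
   by (rule mom_resolvent[OF pq s x[OF nk(2)] y[OF nk]])
  have cc: "c k : R.centers" and c1: "0 < ?b k" using c[OF nk(2)] by (auto simp: R.centers_def)
  have "norm (tc n k j * d k ^ j) <= ?g * ?e * (KR / ?b k) * (1 / 2) ^ j" for j
  proof -
   have "norm (tc n k j * d k ^ j) <= (?g * ?e * (KR / ?b k) ^ Suc j) * cmod (d k) ^ j"
    using R.tcoeff_bound[OF cc, of j] unfolding R.tcoeff_def tc_def norm_mult norm_power by (intro mult_right_mono) auto
   also have "... = ?g * ?e * (KR / ?b k) * (cmod (d k) * KR / ?b k) ^ j"
    by (simp add: power_mult_distrib power_divide)
   also have "... <= ?g * ?e * (KR / ?b k) * (1 / 2) ^ j"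
    using d(1)[OF nk(2)] KR c1 by (intro mult_left_mono power_mono) (auto simp: Ln_nonneg field_simps)
   finally show ?thesis .
  qed
  hence "summable (%j. tc n k j * d k ^ j)"
   by - (rule summable_comparison_test'[where N = 0, OF summable_mult[OF summable_geometric[of "1/2 :: real"]]], simp, blast)
  moreover have "s < cmod (c k)" using c[OF nk(2)] s by linarith
  ultimately show ?thesis using R.res_poly_power_tendsto unfolding tc_def by blast
 qed
 have "cmod (SUM (n, k):V \<times> S. v n k j * pmoment (?h k n) (rpoly (c k) N ^ Suc j)) <= Z * (1 / 2) ^ j" for j N
 proof -
  define f where "f k = op s T (rpoly (c k) N ^ Suc j) (x k)" for k
  have f: "f k : Lp M p" if "k : S" for k unfolding f_def by (rule op_Lp[OF x[OF that]])
  let ?d = "L2n M p (V \<times> S) (%nk w. v (fst nk) (snd nk) j * f (snd nk) w)"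
  let ?f = "L2n M p S (%k w. of_real (?b k ^ Suc j) * f k w)"
  have "(SUM (n, k):V \<times> S. v n k j * pmoment (mom s (x k) (y n k)) (rpoly (c k) N ^ Suc j))
   = (SUM nk:V \<times> S. \<integral>w. (v (fst nk) (snd nk) j * f (snd nk) w) * (case nk of (n, k) => y n k) w \<partial>M)"
   by (intro sum.cong refl) (auto simp: pmoment_mom[OF pq x y] f_def mult.assoc simp del: power_Suc)
  also have "cmod ... <= ?d * ?a"
   using S V by (intro L2n_pairing[OF p pq]) (auto intro!: Lp_scale(1)[OF p0] f y)
  also have "?d <= (W * th ^ j * B0) * ?f"
  proof (rule L2n_mono[OF p])
   fix w
   let ?c = "SUM nk:V \<times> S. (cmod (v (fst nk) (snd nk) j * f (snd nk) w))\<^sup>2"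
   have "?c = (SUM k:S. (SUM n:V. (cmod (a n k))\<^sup>2) * (cmod (u k) * cmod (d k) ^ j * cmod (f k w))^2)"
    by (simp add: sum_pairs sum.swap[of _ S] sum_distrib_left sum_distrib_right v_def norm_mult norm_power power_mult_distrib mult_ac)
   also have "... <= (SUM k:S. B0\<^sup>2 * ((W * ?b k) * (th * ?b k) ^ j * cmod (f k w))^2)"
    using d(2) W B0 D by (intro sum_mono mult_mono power_mono) (auto intro!: mult_nonneg_nonneg sum_nonneg)
   also have "... = (W * th ^ j * B0)^2 * (SUM k:S. (cmod (of_real (?b k ^ Suc j) * f k w))\<^sup>2)"
    by (simp add: sum_distrib_left norm_mult norm_power power_mult_distrib mult_ac)
   finally show "?c <= ..." .
  qed (use S V D W B0 in "auto intro!: Lp_scale(1)[OF p0] f simp del: power_Suc")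
  also have "?f <= D ^ Suc j * L2n M p S x"
   unfolding f_def by (rule HD)
  also have "W * th ^ j * B0 * (D ^ Suc j * L2n M p S x) * ?a = Z * (th * D) ^ j"
   by (simp add: Z_def power_mult_distrib mult_ac)
  also have "... <= Z * (1 / 2) ^ j" using D Z by (intro mult_left_mono power_mono) auto
  finally show ?thesis using D W B0 by (simp add: mult_left_mono mult_right_mono L2n_nonneg)
 qed
 note fin = this
 let ?i = "%j. SUM (n, k):V \<times> S. v n k j * tc n k j"
 have "(%N. SUM (n, k):V \<times> S. v n k j * pmoment (?h k n) (rpoly (c k) N ^ Suc j)) \<longlonglongrightarrow> (?i j)" for j
  unfolding case_prod_beta by (intro tendsto_sum tendsto_mult_left conjunct2[OF A]) auto
 from LIMSEQ_le_const2[OF tendsto_norm[OF this]] fin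
 have lim: "cmod (?i j) <= Z * (1 / 2) ^ j" for j by blast
 have g: "summable (%j. Z * (1 / 2) ^ j)" by (intro summable_mult summable_geometric) auto
 have "(SUM k:S. u k * (SUM n:V. a n k * (\<Sum>j. tc n k j * d k ^ j))) = (SUM (n, k):V \<times> S. \<Sum>j. v n k j * tc n k j)"
  using A by (auto simp: sum_pairs sum.swap[of _ S] sum_distrib_left v_def mult_ac suminf_mult intro!: sum.cong simp flip: suminf_mult)
 also have "... = (\<Sum>j. SUM (n, k):V \<times> S. v n k j * tc n k j)"
  unfolding case_prod_beta using A by (intro suminf_sum[symmetric]) (auto simp: v_def mult_ac intro!: summable_mult)
 also have "cmod ... <= (\<Sum>j. Z * (1 / 2) ^ j)" using lim g by (rule norm_suminf_le)
 also have "... = 2 * Z" by (simp add: suminf_mult suminf_geometric)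
 finally show ?thesis by (simp add: tc_def Z_def mult_ac)
qed

end

context ritt_regular
begin

definition "tR = (if p <= 2 then p / 2 else p / (p - 1) / 2)"
definition "pR = (if p <= 2 then p / (p - 1) else p)"
text \<open>Constant of \<open>res_l2_bound\<close> with \<open>A = KR\<close> and
  \<open>B = 2 / sin e\<close>, the latter from \<open>|c - 1| <= (2 / sin e) * (|c| - 1)\<close>
  for the centers \<open>ray_center e t\<close> and their conjugates.\<close>

definition "DR e = (2 / sin e * pR) powr (1 - tR) * KR powr tR"

text \<open>The condition \<open>16 * KR * e < 1\<close> keeps the boundary path inside the domain
  of \<open>ext\<close>; the last one makes the Neumann series on the rays converge in
  \<open>L^p(l^2)\<close>.\<close>

definition "good e \<longleftrightarrow> 0 < e & 16 * KR * e < 1 & 2 * sin e * DR e <= 1 / 2"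

text \<open>\<open>DR e\<close> grows only like \<open>(sin e)^(tR - 1)\<close>, so
  \<open>sin e * DR e = Q * (sin e)^tR\<close> tends to 0 with \<open>e\<close>. Without
  interpolation, that is for \<open>tR = 0\<close>, it would stay constant and no small angle would
  help.\<close>

lemma good_angle: "EX e. good e"
proof -
 have t: "0 < tR" and pR: "0 < pR" using p by (auto simp: tR_def pR_def)
 define Q where "Q = (2 * pR) powr (1 - tR) * KR powr tR"
 have Q: "0 < Q" using pR KR by (simp add: Q_def)
 define e where "e = min ((1 / (4 * Q)) powr (1 / tR)) (1 / (32 * KR))"
 have e: "0 < e" "e <= 1 / (32 * KR)" using Q KR by (auto simp: e_def)
 hence e1: "16 * KR * e < 1" using KR by (simp add: field_simps)
 have "1 / (32 * KR) <= 1" using KR by (simp add: field_simps)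
 hence se: "0 < sin e" "sin e <= e" using e pi_gt3 by (auto intro!: sin_gt_zero sin_x_le_x)
 have "sin e * DR e = Q * sin e powr tR"
  using se pR by (simp add: DR_def Q_def powr_divide powr_mult powr_diff)
 also have "... <= Q * ((1 / (4 * Q)) powr (1 / tR)) powr tR"
  using se Q t by (intro mult_left_mono powr_mono2) (auto simp: e_def)
 also have "... = 1 / 4" using Q t by (simp add: powr_powr)
 finally show ?thesis using e e1 unfolding good_def by (intro exI[of _ e]) auto
qed

lemma good_facts:
 assumes "good e"
 shows "0 < e" "16 * KR * e < 1" "2 * sin e * DR e <= 1 / 2" "e < 1 / 16" "0 < sin e" "4 * (sin e * KR) <= 1" "0 <= DR e"
  "sin e <= 1" "0 < cos e" "1 - cos e <= 2 * sin e * sin e"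
proof -
 show e: "0 < e" "16 * KR * e < 1" "2 * sin e * DR e <= 1 / 2" using assms by (auto simp: good_def)
 hence "16 * e <= 16 * KR * e" using KR by simp
 with e show e16: "e < 1 / 16" by linarith
 thus s: "0 < sin e" "0 < cos e" using e pi_gt3 by (auto intro!: sin_gt_zero cos_gt_zero)
 have "sin e <= e" using e by (intro sin_x_le_x) simp
 hence "sin e * KR <= e * KR" using KR by (intro mult_right_mono) auto
 thus "4 * (sin e * KR) <= 1" using e by (simp add: mult_ac)
 have "(cos e)^2 <= cos e" using s by (simp add: power2_eq_square mult_left_le_one_le)
 thus "1 - cos e <= 2 * sin e * sin e" using sin_cos_squared_add[of e] zero_le_power2[of "sin e"] by (simp only: power2_eq_square mult.assoc)
qed (auto simp: DR_def)

lemma res_power_l2: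
 assumes S: "finite S" and x: "!!k. k : S ==> x k : Lp M p" and D: "0 <= D"
  and step: "!!x. (!!k. k : S ==> x k : Lp M p) ==> L2n M p S (%k w. of_real (r k) * op s T (P k) (x k) w) <= D * L2n M p S x"
 shows "L2n M p S (%k w. of_real (r k ^ j) * op s T (P k ^ j) (x k) w) <= D ^ j * L2n M p S x"
proof (induction j)
 case 0
 have "op s T 1 y = y" for y by (simp add: fun_eq_iff op_def)
 thus ?case by simp
next
 case (Suc j)
 let ?z = "%k w. of_real (r k ^ j) * op s T (P k ^ j) (x k) w"
 have z: "?z k : Lp M p" if "k : S" for k by (intro Lp_scale(1)[OF p0] op_Lp x that)
 have "L2n M p S (%k w. of_real (r k ^ Suc j) * op s T (P k ^ Suc j) (x k) w) = L2n M p S (%k w. of_real (r k) * op s T (P k) (?z k) w)"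
 proof (rule L2n_cong_AE[OF p S])
  fix k assume k: "k : S"
  note o = op_Lp[OF x[OF k], of s "P k ^ j"]
  show "AE w in M. of_real (r k ^ Suc j) * op s T (P k ^ Suc j) (x k) w = of_real (r k) * op s T (P k) (?z k) w"
   using op_mult[OF x[OF k], of s "P k" "P k ^ j"] op_linear[OF o o, of s "P k" "of_real (r k ^ j)" 0]
   by eventually_elim (simp add: mult_ac)
 qed (auto intro!: Lp_scale(1)[OF p0] op_Lp x simp del: power_Suc)
 also have "... <= D * L2n M p S ?z" by (rule step[OF z])
 also have "... <= D * (D ^ j * L2n M p S x)" by (rule mult_left_mono[OF Suc.IH D])
 finally show ?case by (simp add: mult_ac)
qed

text \<open>\<open>g\<close> selects the upper or the lower ray. For fixed \<open>ta\<close> the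
  scales \<open>k\<close> with \<open>ta <= 2^k\<close> contribute the centers at parameter
  \<open>ta / 2^k\<close>, a different one for each \<open>k\<close>; this is where the bound for
  sequences of resolvents is needed.\<close>

lemma ray_part:
 fixes V :: "'n set" and g :: "complex => complex"
 assumes e: "good e" and g: "g = id | g = cnj"
  and pq: "1 < q" "1/p + 1/q = 1" and s: "0 < s" "s < 1" and V: "finite V"
  and x: "!!k. k < K ==> x k : Lp M p" and y: "!!n k. n : V ==> k < K ==> y n k : Lp M q"
  and F: "0 <= B0" "!!t. 0 < t ==> t <= 1 ==> (SUM n:V. (cmod (poly (F n) (g (ray e t))))\<^sup>2) <= B0^2"
  and eta: "0 <= C" "!!k t. k < K ==> 0 <= t ==> t <= 1 ==> cmod (poly (eta k) (g (ray e t))) <= C * (2 ^ k * t * min 1 (1 / (2 ^ k * t)^2))"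
  and E: "!!n k. n : V ==> k < K ==> continuous_on {0..1} (E n k)"
   "!!n k t. n : V ==> k < K ==> 0 < t ==> t <= 1 ==> E n k t = (\<Sum>j. moment (mom s (x k) (y n k)) (gfps (g (ray_center e t)) ^ Suc j) * of_real (2 * t * (sin e)^2) ^ j)"
  and ka: "cmod ka = sin e"
 shows "cmod (SUM k<K. SUM n:V. integral {0..1} (%t. poly (F n * eta k) (g (ray e t)) * E n k t * ka))
  <= 8 * (C * DR e * B0 * L2n M p {..<K} x * L2n M q (V \<times> {..<K}) (%(n, k). y n k))"
proof -
 define Z where "Z = L2n M p {..<K} x * L2n M q (V \<times> {..<K}) (%(n, k). y n k)"
 note G = good_facts[OF e]
 have gn: "cmod (g z) = cmod z" "cmod (g z - 1) = cmod (z - 1)" for z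
  using g by (auto, metis complex_cnj_diff complex_cnj_one complex_mod_cnj)
 have gc: "continuous_on {0..1} (%t. g (ray e t))" using g by (auto simp: ray_def intro!: continuous_intros)
 define h where "h k t = (SUM n:V. poly (F n * eta k) (g (ray e t)) * E n k t * ka)" for k t
 let ?c = "%n k. %t. poly (F n * eta k) (g (ray e t)) * E n k t * ka"
 have cE: "continuous_on {0..1} (?c n k)" if "n : V" "k < K" for n k
  using that by (intro continuous_intros gc E)
 have "(SUM k<K. SUM n:V. integral {0..1} (?c n k)) = (SUM k<K. integral {0..1} (h k))"
  unfolding h_def[abs_def] using V by (intro sum.cong refl integral_sum[symmetric] integrable_continuous_real cE) auto
 also have "cmod ... <= 4 * (2 * C * DR e * B0 * Z)"
 proof (rule dyadic_integral_bound)
  show "continuous_on {0..1} (h k)" if "k < K" for k unfolding h_def[abs_def] by (intro continuous_on_sum cE that)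
  show "h k 0 = 0" if "k < K" for k using eta(2)[OF that, of 0] by (simp add: h_def)
  show "0 <= 2 * C * DR e * B0 * Z" using eta F G by (simp add: Z_def L2n_nonneg)
  fix ta :: real assume ta: "0 < ta"
  define S where "S = {k. k < K & ta <= 2 ^ k}"
  define t where "t k = ta / 2 ^ k" for k :: nat
  have S: "finite S" "S \<subseteq> {..<K}" by (auto simp: S_def)
  have t: "0 < t k" "t k <= 1" "k < K" "2 ^ k * t k = ta" if "k : S" for k using ta that by (auto simp: S_def t_def)
  define c where "c k = g (ray_center e (t k))" for k
  let ?b = "%k. cmod (c k - 1)"
  have cf: "?b k = t k * sin e" "1 <= cmod (c k)" "cmod (c k) <= 2" "1 + (t k * sin e) * sin e / 2 <= cmod (c k)" if "k : S" for k
   using ray_facts[OF G(1,4) t(1,2)[OF that]] by (simp_all add: c_def gn)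
  have c1: "0 < t k * sin e" if "k : S" for k using t[OF that] G by simp
  have xS: "x k : Lp M p" if "k : S" for k using that S x by auto
  have HD: "L2n M p S (%k w. of_real (?b k ^ j) * op s T (rpoly (c k) N ^ j) (x k) w) <= DR e ^ j * L2n M p S x" for N j
  proof (rule res_power_l2[OF S(1) xS G(7)])
   fix x :: "nat => 'a => complex" assume x: "!!k. k : S ==> x k : Lp M p"
   show "L2n M p S (%k w. of_real (?b k) * op s T (rpoly (c k) N) (x k) w) <= DR e * L2n M p S x"
    unfolding DR_def tR_def pR_def
   proof (rule res_l2_bound[OF s S(1) x])
    show "1 < cmod (c k)" if "k : S" for k using cf[OF that] mult_pos_pos[OF c1[OF that] G(5)] by linarith
    show "0 <= ?b k" "?b k <= 2 / sin e * (cmod (c k) - 1)" if "k : S" for k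
     using cf[OF that] G(5) t(1)[OF that] by (auto simp: field_simps)
    show "?b k * Ln M p (op s T (rpoly (c k) N) f) <= KR * Ln M p f" if "k : S" "f : Lp M p" for k f
     using resolvent_bound[OF s that(2), of "c k" N] cf[OF that(1)] c1[OF that(1)] by (force simp: field_simps)
   qed (use G KR in auto)
  qed
  define u where "u k = poly (eta k) (g (ray e (t k))) * ka / 2 ^ k" for k
  have "cmod (SUM k:S. u k * (SUM n:V. poly (F n) (g (ray e (t k))) * (\<Sum>j. moment (mom s (x k) (y n k)) (gfps (c k) ^ Suc j) * of_real (2 * t k * (sin e)^2) ^ j)))
   <= 2 * (C * min 1 (1 / ta\<^sup>2)) * DR e * B0 * L2n M p S x * L2n M q (V \<times> S) (%(n, k). y n k)"
  proof (rule pointwise_bound[OF pq s S(1) V xS _ _ _ _ G(7,3) _ _ _ F(1) _ HD])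
   fix k assume k: "k : S"
   note c1 = c1[OF k] and cf = cf[OF k] and t = t[OF k]
   show "1 <= cmod (c k) & cmod (c k) <= 3 & c k ~= 1" using cf c1 by auto
   let ?a = "cmod (of_real (2 * t k * (sin e)^2))"
   have d: "?a = 2 * sin e * ?b k"
    using t G cf by (simp add: power2_eq_square norm_mult)
   show "?a <= 2 * sin e * ?b k" unfolding d ..
   show "?a * KR <= ?b k / 2"
    unfolding d cf using mult_left_mono[OF G(6), of "t k * sin e"] c1 by (simp add: mult_ac)
   have "cmod (u k) <= C * (2 ^ k * t k * min 1 (1 / (2 ^ k * t k)^2)) * sin e / 2 ^ k"
    unfolding u_def norm_divide norm_mult ka using t G eta(2)[of k "t k"] by (intro divide_mono mult_right_mono) (auto simp: norm_power)
   thus "cmod (u k) <= C * min 1 (1 / ta\<^sup>2) * ?b k" unfolding t(4) cf by (simp add: t_def mult_ac)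
   show "(SUM n:V. (cmod (poly (F n) (g (ray e (t k)))))\<^sup>2) <= B0^2" using F t by simp
   show "y n k : Lp M q" if "n : V" for n using y that t by simp
  qed (use eta G ta in auto)
  also have "(SUM k:S. u k * (SUM n:V. poly (F n) (g (ray e (t k))) * (\<Sum>j. moment (mom s (x k) (y n k)) (gfps (c k) ^ Suc j) * of_real (2 * t k * (sin e)^2) ^ j)))
   = (SUM k:S. h k (t k) / 2 ^ k)"
   using t by (intro sum.cong refl) (simp add: h_def E u_def c_def sum_distrib_left sum_divide_distrib mult_ac del: power_Suc)
  also have "2 * (C * min 1 (1 / ta\<^sup>2)) * DR e * B0 * L2n M p S x * L2n M q (V \<times> S) (%(n, k). y n k)
   <= 2 * (C * min 1 (1 / ta\<^sup>2)) * DR e * B0 * L2n M p {..<K} x * L2n M q (V \<times> {..<K}) (%(n, k). y n k)"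
   using eta F G S V x y p pq ta by (intro mult_mono L2n_subset) (auto simp: L2n_nonneg)
  finally show "cmod (SUM k:{k. k < K & ta <= 2 ^ k}. h k (ta / 2 ^ k) / 2 ^ k) <= 2 * C * DR e * B0 * Z * min 1 (1 / ta\<^sup>2)"
   by (simp add: S_def t_def Z_def mult_ac)
 qed
 finally show ?thesis by (simp add: Z_def mult_ac)
qed

text \<open>On the arc the centers stay away from 1, so each \<open>k\<close> is treated alone, with
  the constant \<open>KR\<close> of a single resolvent. The sum over \<open>k\<close> is taken later
  and converges by the decay of the functions \<open>eta k\<close>.\<close>

lemma arc_part:
 fixes V :: "'n set"
 assumes e: "good e" and pq: "1 < q" "1/p + 1/q = 1" and s: "0 < s" "s < 1" and V: "finite V"
  and x: "x k : Lp M p" and y: "!!n. n : V ==> y n k : Lp M q"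
  and F: "0 <= B0" "!!th. e <= th ==> th <= 2 * pi - e ==> (SUM n:V. (cmod (poly (F n) (of_real (cos e) * cis th)))\<^sup>2) <= B0^2"
  and eta: "0 <= C" "!!th. e <= th ==> th <= 2 * pi - e ==> cmod (poly eta (of_real (cos e) * cis th)) <= C"
  and E: "!!n. n : V ==> continuous_on {e..2*pi-e} (E n)"
   "!!n th. n : V ==> e <= th ==> th <= 2 * pi - e ==> E n th = (\<Sum>j. moment (mom s (x k) (y n k)) (gfps (cis th) ^ Suc j) * (of_real (1 - cos e) * cis th) ^ j)"
 shows "cmod (SUM n:V. integral {e..2*pi-e} (%th. poly (F n * eta) (of_real (cos e) * cis th) * E n th * (of_real (cos e) * \<i> * cis th)))
  <= 2 * pi * (2 * (C / sin e) * KR * B0 * Ln M p (x k) * L2n M q (V \<times> {k}) (%(n, k). y n k))"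
proof -
 note G = good_facts[OF e]
 define Z where "Z = 2 * (C / sin e) * KR * B0 * Ln M p (x k) * L2n M q (V \<times> {k}) (%(n, k). y n k)"
 have Z: "0 <= Z" using eta G KR F by (simp add: Z_def Ln_nonneg L2n_nonneg)
 let ?b = "of_real (cos e)"
 have c: "continuous_on {e..2*pi-e} (%th. poly (F n * eta) (?b * cis th) * E n th * (?b * \<i> * cis th))" if "n : V" for n
  using E(1)[OF that] by (intro continuous_intros)
 \<comment> \<open>The geometric facts of the locale are reached through its simplest instance, the
   zero sequence.\<close>
 interpret R: resolvent_moment "%_. 0" s 0 KR 0 by standard (use s KR in "auto simp: pmoment_def")
 let ?c = "of_real (1 - cos e)"
 have "(SUM n:V. integral {e..2*pi-e} (%th. poly (F n * eta) (of_real (cos e) * cis th) * E n th * (of_real (cos e) * \<i> * cis th)))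
  = integral {e..2*pi-e} (%th. SUM n:V. poly (F n * eta) (of_real (cos e) * cis th) * E n th * (of_real (cos e) * \<i> * cis th))"
  using V by (intro integral_sum[symmetric] integrable_continuous_real c)
 also have "cmod ... <= Z * (2 * pi - e - e)"
 proof (rule integral_bound)
  show "e <= 2 * pi - e" using G pi_gt3 by simp
  show "continuous_on {e..2*pi-e} (%th. SUM n:V. poly (F n * eta) (?b * cis th) * E n th * (?b * \<i> * cis th))"
   by (intro continuous_on_sum c)
  fix th assume "th : {e..2*pi-e}"
  hence th: "e <= th" "th <= 2 * pi - e" by auto
  let ?a = "cis th"
  have c1: "sin e <= cmod (?a - 1)" by (rule R.arc_radial(4)[OF G(1,2) th])
  have ne: "?a ~= 1" using c1 G(5) by (metis diff_self linorder_not_le norm_zero)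
  define u where "u = poly eta (?b * ?a) * (?b * \<i> * ?a)"
  have "cmod (SUM k:{k}. u * (SUM n:V. poly (F n) (of_real (cos e) * cis th) * (\<Sum>j. moment (mom s (x k) (y n k)) (gfps (cis th) ^ Suc j) * (of_real (1 - cos e) * cis th) ^ j)))
   <= 2 * (C / sin e) * KR * B0 * L2n M p {k} x * L2n M q (V \<times> {k}) (%(n, k). y n k)"
  proof (rule pointwise_bound[OF pq s _ V, where th = "2 * sin e"])
   have d: "cmod (?c * ?a) <= 2 * sin e * cmod (?a - 1)"
   proof -
    have "cmod (?c * ?a) = 1 - cos e" unfolding norm_mult norm_of_real by simp
    also have "... <= 2 * sin e * sin e" by (rule G)
    also have "... <= 2 * sin e * cmod (?a - 1)" using c1 G by (intro mult_left_mono) auto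
    finally show ?thesis .
   qed
   thus "cmod (?c * ?a) <= 2 * sin e * cmod (?a - 1)" .
   have "cmod (?c * ?a) * KR <= 2 * sin e * cmod (?a - 1) * KR" using d KR by (intro mult_right_mono) auto
   also have "... <= cmod (?a - 1) / 2" using mult_left_mono[OF G(6), of "cmod (?a - 1)"] by (simp add: mult_ac)
   finally show "cmod (?c * ?a) * KR <= cmod (?a - 1) / 2" .
   have "cmod u = cmod (poly eta (?b * ?a)) * cos e" using G by (simp add: u_def norm_mult)
   also have "... <= C * 1" using eta th G by (intro mult_mono) auto
   also have "... <= C / sin e * cmod (?a - 1)" using c1 G eta mult_left_mono[OF c1, of C] by (simp add: field_simps)
   finally show "cmod u <= C / sin e * cmod (?a - 1)" .
   show "2 * sin e * KR <= 1 / 2" using G by simp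
   fix N j
   have "Ln M p (op s T (rpoly ?a N ^ j) (x k)) <= (KR / cmod (?a - 1)) ^ j * Ln M p (x k)"
    using KR ne by (intro op_power_norm resolvent_bound s x) auto
   moreover have "0 < cmod (?a - 1)" using ne by simp
   ultimately show "L2n M p {k} (%k w. of_real (cmod (?a - 1) ^ j) * op s T (rpoly ?a N ^ j) (x k) w) <= KR ^ j * L2n M p {k} x"
    unfolding L2n_single Lp_scale(2)[OF p0 op_Lp[OF x]] by (simp add: norm_power power_divide field_simps)
  qed (use x y F th eta G KR ne in auto)
  thus "cmod (SUM n:V. poly (F n * eta) (?b * ?a) * E n th * (?b * \<i> * ?a)) <= Z"
   using th by (simp add: E L2n_single Z_def u_def sum_distrib_left mult_ac del: power_Suc)
 qed
 also have "... <= Z * (2 * pi)" using Z G by (intro mult_left_mono) auto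
 finally show ?thesis by (simp add: Z_def mult_ac)
qed

end

section \<open>Duality and the estimate for weighted polynomials\<close>

text \<open>Tested with the extremal \<open>y = cnj f * W^(p-2)\<close>, whose
  \<open>L^q(l^2)\<close> norm is the norm of \<open>f\<close> to the power
  \<open>p / q = p - 1\<close>; exactly one power of the norm is left.\<close>

lemma L2n_duality:
 assumes pq: "1 < p" "1 < q" "1/p + 1/q = 1" and S: "finite S" and f: "!!k. k : S ==> f k : Lp M p" and B: "0 <= B"
  and dual: "!!y. (!!k. k : S ==> y k : Lp M q) ==> cmod (SUM k:S. \<integral>w. f k w * y k w \<partial>M) <= B * L2n M q S y"
 shows "L2n M p S f <= B"
proof -
 define W where "W w = L2_set (%k. cmod (f k w)) S" for w
 have W0: "0 <= W w" for w by (simp add: W_def L2_set_nonneg)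
 have WL: "(%w. complex_of_real (W w)) : Lp M p" unfolding W_def by (rule L2n_Lp[OF pq(1) S f])
 have p0: "0 < p" "0 < q" using pq by auto
 have pq1: "(p - 1) * q = p" using pq by (simp add: field_simps)
 have int: "integrable M (%w. W w powr p)" using WL W0 by (simp add: Lp_iff[OF p0(1)])
 let ?a = "borel_measurable M"
 have Wm[measurable]: "W : ?a" unfolding W_def by (rule L2_set_measurable) (use LpD[OF f] in auto)
 define y where "y k w = cnj (f k w) * of_real (W w powr (p - 2))" for k w
 have fW: "cmod (f k w) <= W w" if "k : S" for k w unfolding W_def using S that L2_set_ge[of S k "%k. cmod (f k w)"] by simp
 have W2: "W w * W w powr (p - 2) = W w powr (p - 1)" "W w * W w powr (p - 1) = W w powr p" for w
  using powr_mult_base[OF W0, of w "p - 2"] powr_mult_base[OF W0, of w "p - 1"] by simp_all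
 have WqL: "(%w. complex_of_real (W w powr (p - 1))) : Lp M q"
  using int by (simp add: Lp_iff[OF p0(2)] powr_powr pq1)
 have yL: "y k : Lp M q" if k: "k : S" for k
 proof (rule Lp_mono(1)[OF p0(2) WqL])
  have [measurable]: "f k : ?a" by (rule LpD[OF f[OF k]])
  have "(%w. cnj (f k w)) : ?a" by (rule borel_measurable_continuous_on[OF continuous_on_cnj[OF continuous_on_id]]) measurable
  thus "y k : ?a" unfolding y_def[abs_def] by measurable
  show "cmod (y k w) <= cmod (complex_of_real (W w powr (p - 1)))" for w
   using mult_right_mono[OF fW[OF k], of "W w powr (p - 2)" w] by (simp add: y_def norm_mult W2)
 qed
 have Ly: "L2n M q S y = Ln M p (%w. of_real (W w)) powr (p / q)"
 proof -
  have "L2_set (%k. cmod (y k w)) S = W w powr (p - 1)" for w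
   using L2_set_right_distrib[of "W w powr (p - 2)" "%k. cmod (f k w)" S] W2(1)[of w] by (simp add: y_def norm_mult W_def mult.commute)
  thus ?thesis using W0 p0 by (simp add: L2n_def Ln_def powr_powr pq1)
 qed
 have e: "f k w * y k w = of_real ((cmod (f k w))^2 * W w powr (p - 2))" for k w
  by (simp add: y_def complex_norm_square[symmetric] flip: mult.assoc)
 let ?b = "\<integral>w. W w powr p \<partial>M"
 have "(SUM k:S. \<integral>w. f k w * y k w \<partial>M) = (\<integral>w. (SUM k:S. f k w * y k w) \<partial>M)"
  by (rule Bochner_Integration.integral_sum[symmetric]) (rule Lp_Holder(1)[OF pq f yL])
 also have "... = (\<integral>w. complex_of_real (W w powr p) \<partial>M)"
 proof (rule Bochner_Integration.integral_cong[OF refl])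
  fix w
  have "(SUM k:S. (cmod (f k w))\<^sup>2) = W w * W w" unfolding W_def power2_eq_square[symmetric] L2_set_sq ..
  thus "(SUM k:S. f k w * y k w) = complex_of_real (W w powr p)"
   by (simp add: e sum_distrib_right[symmetric] W2 mult.assoc del: of_real_mult flip: of_real_sum)
 qed
 also have "... = of_real ?b" using integral_of_real[OF int] .
 also have "?b = L2n M p S f powr p"
  unfolding L2n_def Ln_powr[OF p0(1)] by (simp add: W_def L2_set_nonneg)
 finally have "L2n M p S f powr p <= B * L2n M p S f powr (p / q)"
  using dual[of y] yL Ly by (simp add: L2n_def W_def)
 moreover have "p = 1 + p / q" using pq by (simp add: field_simps)
 ultimately have "L2n M p S f * L2n M p S f powr (p / q) <= B * L2n M p S f powr (p / q)"
  using powr_mult_base[OF L2n_nonneg, of M p S f "p / q"] by simp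
 thus ?thesis using B by (cases "L2n M p S f = 0") (auto simp: mult_le_cancel_right)
qed

text \<open>The ray bound has the shape that \<open>ray_part\<close> asks for: with
  \<open>ta = 2^k * t\<close>, one factor \<open>ta\<close> compensates the singularity of the
  resolvent at 1, and \<open>min 1 (1 / ta^2)\<close> remains to be integrated. On the arc a
  summable bound in \<open>k\<close> is enough.\<close>

definition contour_bounds :: "real => real => nat => (nat => complex poly) => bool" where
 "contour_bounds e C K eta \<longleftrightarrow> (ALL k<K. ALL t. 0 <= t & t <= 1 --> (ALL z:{ray e t, cnj (ray e t)}. cmod (poly (eta k) z) <= C * (2 ^ k * t * min 1 (1 / (2 ^ k * t)^2)))) &
  (EX b. (ALL k<K. 0 <= b k & (ALL th. cmod (poly (eta k) (of_real (cos e) * cis th)) <= b k)) & (SUM k<K. b k) <= C)"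

context ritt_regular
begin

text \<open>By duality the norm becomes a sum of moments; each is a contour integral, and the two
  rays and the arc are estimated separately. Each ray gives \<open>8 * DR e\<close>, the arc
  \<open>2 * pi * (2 / sin e) * KR\<close>.\<close>

lemma l2_functional_bound:
 fixes V :: "'n set"
 assumes e: "good e" and s: "0 < s" "s < 1" and V: "finite V" and x: "!!k. k < K ==> x k : Lp M p"
  and F: "0 <= B0" "!!z. z : stolz (pi / 2 - e) ==> (SUM n:V. (cmod (poly (F n) z))\<^sup>2) <= B0^2"
  and C: "0 <= C" "contour_bounds e C K eta"
 shows "L2n M p (V \<times> {..<K}) (%(n, k). op s T (F n * eta k) (x k)) <= (16 * DR e + 4 * pi / sin e * KR) * C * B0 * L2n M p {..<K} x"
proof -
 define q where "q = p / (p - 1)"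
 have pq: "1 < q" "1/p + 1/q = 1" using p by (auto simp: q_def field_simps)
 note G = good_facts[OF e]
 let ?d = "of_real (cos e)"
 obtain b where b: "!!k. k < K ==> 0 <= b k" "!!k th. k < K ==> cmod (poly (eta k) (?d * cis th)) <= b k" "(SUM k<K. b k) <= C"
  using C(2) unfolding contour_bounds_def by blast
 let ?D = "ball 0 (cos e) :: complex set"
 let ?a = "stolz (pi / 2 - e)"
 have sub: "closure ?D \<subseteq> ?a" "convex ?a" "1 : ?a"
  using hull_subset[of "insert 1 ?D" convex] closure_subset[of "convex hull insert 1 ?D"]
  by (auto simp: stolz_def sin_diff convex_closure intro!: closure_mono)
 have arc: "?d * cis th : ?a" for th
  using sub(1) G(9) by (auto simp: norm_mult)
 have rays: "ray e t : ?a" "cnj (ray e t) : ?a" if "0 <= t" "t <= 1" for t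
 proof -
  have "linepath 1 (?d * cis e) t : ?a" "linepath 1 (?d * cis (- e)) t : ?a"
   unfolding linepath_def by (rule convexD[OF sub(2,3) arc]; use that in simp)+
  moreover have "linepath 1 (?d * cis (- e)) t = cnj (linepath 1 (?d * cis e) t)"
   by (simp add: linepath_def complex_eq_iff)
  ultimately show "ray e t : ?a" "cnj (ray e t) : ?a" by (simp_all add: ray_conv)
 qed
 define X where "X = L2n M p {..<K} x"
 let ?c = "16 * DR e + 4 * pi / sin e * KR"
 show ?thesis
 proof (rule L2n_duality[OF p pq])
  show "0 <= ?c * C * B0 * L2n M p {..<K} x"
   using G KR C F by (simp add: L2n_nonneg)
  fix y assume y: "!!k. k : V \<times> {..<K} ==> y k : Lp M q"
  define Y where "Y = L2n M q (V \<times> {..<K}) y"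
  define m where "m n k = mom s (x k) (y (n, k))" for n k
  have ex: "EX E. contour_ext e (m n k) (fst E) (fst (snd E)) (snd (snd E))" if nk: "n : V" "k < K" for n k
  proof -
   let ?f = "Ln M p (x k) * Ln M q (y (n, k))"
   interpret R: resolvent_moment "m n k" s "?f" KR "?f"
    unfolding m_def using nk by (intro mom_resolvent pq s x y) auto
   show ?thesis using R.contour_ext_exists[OF G(1,2)] by auto
  qed
  define E where "E n k = (SOME E. contour_ext e (m n k) (fst E) (fst (snd E)) (snd (snd E)))" for n k
  define E1 E2 E3 where "E1 n k = fst (E n k)" "E2 n k = fst (snd (E n k))" "E3 n k = snd (snd (E n k))" for n k
  have E: "contour_ext e (m n k) (E1 n k) (E2 n k) (E3 n k)" if "n : V" "k < K" for n k
   using someI_ex[OF ex[OF that]] by (simp add: E1_E2_E3_def E_def)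
  let ?I1 = "%n k. integral {0..1} (%t. poly (F n * eta k) (ray e t) * E1 n k t * (of_real (sin e) * (\<i> * cis e)))"
  let ?I2 = "%n k. integral {0..1} (%t. poly (F n * eta k) (cnj (ray e t)) * E2 n k t * (of_real (sin e) * (\<i> * cis (- e))))"
  let ?I3 = "%n k. integral {e..2*pi-e} (%th. poly (F n * eta k) (of_real (cos e) * cis th) * E3 n k th * (of_real (cos e) * \<i> * cis th))"
  have YL: "y (n, k) : Lp M q" if "n : V" "k < K" for n k using y that by simp
  have Yk: "L2n M q (V \<times> {k}) y <= Y" if "k < K" for k unfolding Y_def using that V y pq by (intro L2n_subset) auto
  have Xk: "Ln M p (x k) <= X" if "k < K" for k
   unfolding X_def L2n_single[of M p k x, symmetric] using that x p by (intro L2n_subset) auto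
  have cy: "(%(n, k). y (n, k)) = y" by auto
  let ?e = "8 * (C * DR e * B0 * X * Y)"
  have ray: "cmod (SUM k<K. SUM n:V. integral {0..1} (%t. poly (F n * eta k) (g (ray e t)) * E n k t * ka)) <= ?e"
   if g: "g = id | g = cnj" and E: "!!n k. n : V ==> k < K ==> continuous_on {0..1} (E n k)"
    "!!n k t. n : V ==> k < K ==> 0 < t ==> t <= 1 ==> E n k t = (\<Sum>j. moment (m n k) (gfps (g (ray_center e t)) ^ Suc j) * of_real (2 * t * (sin e)^2) ^ j)"
    and ka: "cmod ka = sin e" for g E ka
   unfolding X_def Y_def
   by (rule ray_part[where y = "%n k. y (n, k)", OF e g pq s V x YL F(1) F(2) C(1) _ E[unfolded m_def] ka, unfolded cy])
    (use g rays C(2) in "auto simp: contour_bounds_def")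
  have 1: "cmod (SUM k<K. SUM n:V. ?I1 n k) <= ?e"
   by (rule ray[of id, unfolded id_apply]) (use E G in "auto simp: contour_ext_def norm_mult simp del: power_Suc")
  have 2: "cmod (SUM k<K. SUM n:V. ?I2 n k) <= ?e"
   by (rule ray) (use E G in "auto simp: contour_ext_def norm_mult simp del: power_Suc")
  let ?b = "4 * pi / sin e * KR * B0 * X * Y"
  have "cmod (SUM n:V. ?I3 n k) <= b k * ?b" if k: "k < K" for k
  proof -
   have "cmod (SUM n:V. ?I3 n k) <= 2 * pi * (2 * (b k / sin e) * KR * B0 * Ln M p (x k) * L2n M q (V \<times> {k}) y)"
    by (rule arc_part[where x = x and k = k and y = "%n k. y (n, k)", OF e pq s V x[OF k] YL[OF _ k] F(1) F(2)[OF arc] b(1,2)[OF k], unfolded cy])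
     (use E k in "auto simp: contour_ext_def m_def simp del: power_Suc")
   also have "... <= 2 * pi * (2 * (b k / sin e) * KR * B0 * X * Y)"
    using Xk[OF k] Yk[OF k] b(1)[OF k] F(1) KR G by (intro mult_left_mono mult_mono) (auto simp: Ln_nonneg L2n_nonneg X_def)
   finally show ?thesis by (simp add: mult_ac)
  qed
  hence "cmod (SUM k<K. SUM n:V. ?I3 n k) <= (SUM k<K. b k) * ?b"
   unfolding sum_distrib_right by (intro sum_norm_le) auto
  also have "... <= C * ?b"
   using b(3) F(1) KR G by (intro mult_right_mono) (auto simp: X_def Y_def L2n_nonneg)
  finally have 3: "cmod (SUM k<K. SUM n:V. ?I3 n k) <= C * ?b" .
  let ?P = "SUM k:V \<times> {..<K}. \<integral>w. (case k of (n, k) => op s T (F n * eta k) (x k)) w * y k w \<partial>M"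
  have I: "2 * pi * \<i> * pmoment (m n k) (F n * eta k) = ?I1 n k + ?I2 n k + ?I3 n k" if "n : V" "k < K" for n k
   using E[OF that] unfolding contour_ext_def by blast
  have P: "?P = (SUM k<K. SUM n:V. pmoment (m n k) (F n * eta k))"
   unfolding sum_pairs sum.swap[of _ "{..<K}" V] using pmoment_mom[OF pq x YL] by (intro sum.cong refl) (simp add: m_def)
  have "2 * pi * \<i> * ?P = (SUM k<K. SUM n:V. ?I1 n k) + (SUM k<K. SUM n:V. ?I2 n k) + (SUM k<K. SUM n:V. ?I3 n k)"
   unfolding P sum_distrib_left sum.distrib[symmetric] by (intro sum.cong refl I) auto
  hence "cmod (2 * pi * \<i> * ?P) = cmod ((SUM k<K. SUM n:V. ?I1 n k) + (SUM k<K. SUM n:V. ?I2 n k) + (SUM k<K. SUM n:V. ?I3 n k))"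
   by (rule arg_cong[where f = cmod])
  also have "... <= ?c * C * B0 * X * Y"
   using add_mono[OF 1 2] norm_triangle_ineq[of "SUM k<K. SUM n:V. ?I1 n k" "SUM k<K. SUM n:V. ?I2 n k"] 3 by (intro norm_triangle_le) (simp add: algebra_simps)
  finally have "2 * pi * cmod ?P <= ?c * C * B0 * X * Y" unfolding norm_mult by simp
  moreover have "1 * cmod ?P <= 2 * pi * cmod ?P" using pi_gt3 by (intro mult_right_mono) auto
  ultimately show "cmod ?P <= ?c * C * B0 * L2n M p {..<K} x * L2n M q (V \<times> {..<K}) y"
   by (simp add: X_def Y_def)
 qed (use V x in "auto intro: op_Lp")
qed

end

section \<open>The dyadic partition of unity\<close>

text \<open>\<open>r^n\<close> is at most \<open>exp (- a n u)\<close>, while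
  \<open>y^7 <= exp (a n u)\<close> for \<open>y = 1 + a n u / 7\<close>. Exponent 7 is the largest
  that occurs: of the six powers of \<open>ta\<close> in \<open>dy_eta\<close> one is set aside, and
  two more are spent on the decay at large \<open>ta\<close>.\<close>

lemma decay_bound:
 fixes a u r :: real
 assumes "0 < a" "a <= 1" "0 <= u" "0 <= r" "r <= 1 - a * u" "j <= 7"
 shows "(real n * u) ^ j * r ^ n <= (7 / a) ^ 7"
proof -
 define y where "y = 1 + a * (real n * u) / 7"
 have y: "1 <= y" "real n * u <= 7 / a * y" using assms by (auto simp: y_def field_simps)
 have "1 <= 7 / a" using assms by simp
 hence y1: "1 <= 7 / a * y" using y(1) mult_mono[of 1 "7 / a" 1 y] assms(1) by simp
 let ?a = "a * (real n * u)"
 have "r <= exp (- (a * u))" using assms(5) exp_ge_add_one_self[of "- (a * u)"] by linarith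
 hence "r ^ n <= exp (- (a * u)) ^ n" using assms by (intro power_mono) auto
 also have "... = exp (- ?a)" by (simp add: mult_ac flip: exp_of_nat_mult)
 finally have r: "r ^ n <= exp (- ?a)" .
 have "0 <= ?a" using assms by simp
 hence E: "y ^ 7 <= exp ?a" using exp_ge_one_plus_x_over_n_power_n[of 7 "?a"] by (simp add: y_def)
 have "(real n * u) ^ j <= (7 / a * y) ^ j" using y assms by (intro power_mono) auto
 also have "... <= (7 / a * y) ^ 7" using y1 assms by (intro power_increasing) auto
 also have "... <= (7 / a) ^ 7 * exp ?a"
  unfolding power_mult_distrib using E assms by (intro mult_left_mono) auto
 finally have "(real n * u) ^ j * r ^ n <= ((7 / a) ^ 7 * exp ?a) * exp (- ?a)"
  using r assms by (intro mult_mono) auto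
 thus ?thesis by (simp add: exp_minus field_simps)
qed

lemma cpoly_mult: "cpoly (P * Q) = cpoly P * cpoly Q" by (simp add: poly_eq_iff coeff_mult)
lemma cpoly_diff: "cpoly (P - Q) = cpoly P - cpoly Q" by (simp add: poly_eq_iff)
lemma cpoly_monom: "cpoly (monom 1 n) = monom 1 n" by (simp add: poly_eq_iff)

lemma cpoly_avg_poly: "0 < n ==> of_nat n * ([:1, -1:] * cpoly (avg_poly n)) = 1 - monom 1 n"
proof -
 assume n: "0 < n"
 have "of_nat n * cpoly (avg_poly n) = (SUM j<n. monom 1 j)"
  using n by (simp add: poly_eq_iff avg_poly_def coeff_sum of_nat_poly flip: sum_distrib_left sum_divide_distrib)
 moreover have "[:1, -1:] = 1 - monom (1 :: complex) 1" by (simp add: monom_altdef one_pCons)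
 ultimately show ?thesis
  using one_diff_power_eq[of "monom (1 :: complex) 1" n] by (simp add: monom_power mult.left_commute)
qed

text \<open>With \<open>n = 2^k\<close> and \<open>w = z^n\<close> one has
  \<open>4 * P_k = M_n^3 * (1 - w)^2\<close>, and \<open>n * (1 - z) * M_n = 1 - w\<close>. So
  \<open>16 * (n * (1 - z))^6 * P_k^2 = (1 - w)^10\<close>, which explains the numbers 16, 6 and
  10.\<close>

definition dy_eta :: "nat => complex poly" where
 "dy_eta k = 16 * of_nat (2 ^ k) ^ 6 * [:1, -1:] ^ 6 * ((1 + monom 1 (2 ^ k)) ^ 10 - 1)"

lemma dyadic_partition:
 "[:1, -1:] ^ 10 + (SUM k<K. dy_eta k * (cpoly (lp_poly k) * cpoly (lp_poly k))) + (1 - (1 - monom 1 (2 ^ K)) ^ 10) = 1"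
proof -
 define d :: "complex poly" where "d = [:1, -1:]"
 let ?a = "%k. cpoly (lp_poly k)"
 have "dy_eta k * (?a k * ?a k) = (1 - monom 1 (2 ^ Suc k)) ^ 10 - (1 - monom 1 (2 ^ k)) ^ 10" for k
 proof -
  define N :: "complex poly" where "N = of_nat (2 ^ k)"
  define w :: "complex poly" where "w = monom 1 (2 ^ k)"
  define a where "a = cpoly (avg_poly (2 ^ k))"
  define b where "b = cpoly (avg_poly (2 ^ Suc k))"
  have w2: "w * w = monom 1 (2 ^ Suc k)" by (simp add: w_def mult_monom mult_2)
  have a: "N * (d * a) = 1 - w" using cpoly_avg_poly[of "2 ^ k"] by (simp add: N_def d_def a_def w_def)
  have "of_nat (2 ^ Suc k) * (d * b) = 1 - w * w" unfolding d_def b_def w2 by (rule cpoly_avg_poly) simp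
  moreover have "of_nat (2 ^ Suc k) = 2 * N" by (simp add: N_def)
  ultimately have "2 * N * (d * b) = 1 - w * w" by simp
  \<comment> \<open>\<open>M_2n = M_n * (1 + w) / 2\<close>, obtained by cancelling
    \<open>n * (1 - z)\<close>.\<close>
  hence "N * d * (2 * b) = N * d * (a * (1 + w))" using a by algebra
  moreover have "N * d ~= 0" unfolding N_def d_def of_nat_poly by simp
  ultimately have b: "2 * b = a * (1 + w)" by (metis mult_left_cancel)
  have P: "?a k = a * (b * b - w * (a * a))"
   by (simp add: lp_poly_def cpoly_mult cpoly_diff cpoly_monom power2_eq_square a_def b_def w_def)
  have P4: "4 * ?a k = a ^ 3 * (1 - w)^2" unfolding P using b by algebra
  define X where "X = (1 + w) ^ 10 - 1"
  have "dy_eta k = 16 * N ^ 6 * d ^ 6 * X" by (simp only: dy_eta_def N_def d_def w_def X_def)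
  hence "dy_eta k * (?a k * ?a k) = (N * (d * a)) ^ 6 * ((1 - w)^2)^2 * X"
   using arg_cong[OF P4, of power2] by (simp add: power_mult_distrib power2_eq_square)
  also have "... = (1 - w) ^ 10 * X" unfolding a by (simp flip: power_mult power_add)
  also have "... = ((1 - w) * (1 + w)) ^ 10 - (1 - w) ^ 10" unfolding X_def power_mult_distrib by (simp only: right_diff_distrib mult_1_right)
  also have "(1 - w) * (1 + w) = 1 - monom 1 (2 ^ Suc k)" unfolding w2[symmetric] by (simp add: algebra_simps)
  finally show ?thesis by (simp only: w_def)
 qed
 moreover have "[:1, -1:] = 1 - monom (1 :: complex) 1" by (simp add: monom_altdef one_pCons)
 ultimately show ?thesis using sum_lessThan_telescope[of "%k. (1 - monom (1 :: complex) (2 ^ k)) ^ 10" K] by (simp del: power_Suc)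
qed

lemma poly_dy_eta: "poly (dy_eta k) z = 16 * (2 ^ k) ^ 6 * (1 - z) ^ 6 * ((1 + z ^ 2 ^ k) ^ 10 - 1)"
 by (simp add: dy_eta_def poly_monom)

text \<open>\<open>(1 + w)^10 - 1\<close> has the factor \<open>w\<close>, which is the source of
  the decay \<open>|z|^(2^k)\<close>; the cofactor is at most
  \<open>1 + 2 + ... + 2^9 = 1023\<close>.\<close>

lemma norm_dy_eta:
 assumes "cmod z <= 1"
 shows "cmod (poly (dy_eta k) z) <= 2 ^ 14 * ((2 ^ k * cmod (1 - z)) ^ 6 * cmod z ^ 2 ^ k)"
proof -
 define w where "w = z ^ 2 ^ k"
 have w: "cmod w <= 1" using assms by (simp add: w_def norm_power power_le_one)
 let ?a = "(1 + w) ^ 10 - 1"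
 have "?a = w * (SUM i<10. (1 + w) ^ i)" using power_diff_1_eq[of "1 + w" 10] by simp
 moreover have "cmod (SUM i<10. (1 + w) ^ i) <= (SUM i<10::nat. 2 ^ i)"
  using w norm_triangle_ineq[of 1 w] by (intro sum_norm_le) (auto simp: norm_power intro!: power_mono)
 moreover have "(SUM i<10::nat. 2 ^ i) = (1023 :: real)" by (simp add: eval_nat_numeral)
 ultimately have "cmod ?a <= cmod w * 1024" by (simp add: norm_mult mult_left_mono)
 hence "16 * (2 ^ k * cmod (1 - z)) ^ 6 * cmod ?a <= 16 * (2 ^ k * cmod (1 - z)) ^ 6 * (cmod w * 1024)"
  by (intro mult_left_mono) auto
 thus ?thesis by (simp add: poly_dy_eta norm_mult norm_power power_mult_distrib w_def)
qed

text \<open>Along the rays \<open>|1 - z| <= t\<close> and \<open>|z| <= 1 - a * t\<close>; on the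
  arc \<open>|z| = cos e <= 1 - a\<close>, with the same \<open>a\<close>. The powers of 2 are
  \<open>2^14 = 16 * 1024\<close> from \<open>norm_dy_eta\<close>, \<open>2^6\<close> from
  \<open>|1 - z| <= 2\<close> on the arc, and 2 from the geometric series over
  \<open>k\<close>.\<close>

lemma contour_bounds_dyadic:
 assumes e: "0 < e" "e < 1 / 16"
 defines "a \<equiv> (sin e)\<^sup>2 / 2"
 shows "contour_bounds e (2 ^ 21 * (7 / a) ^ 7) K dy_eta" "contour_bounds e (2 ^ 21 * (7 / a) ^ 7) 1 (%_. [:1, -1:] ^ 10)"
proof -
 define B where "B = (7 / a) ^ 7"
 have se: "0 < sin e" "0 <= cos e" using e pi_gt3 by (auto intro!: sin_gt_zero cos_ge_zero)
 have a: "0 < a" "a <= 1" using se power_le_one[of "sin e" 2] by (auto simp: a_def)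
 have B: "1 <= B" unfolding B_def using a by (intro one_le_power) simp
 have ac: "cos e <= 1 - a * 1"
 proof -
  have "0 <= 1 - 2 * cos e + (cos e)^2" using zero_le_power2[of "1 - cos e"] by (simp add: power2_diff)
  thus ?thesis using sin_cos_squared_add[of e] unfolding a_def by linarith
 qed
 let ?e = "%z. cmod (1 - z)"
 have z: "?e z <= t" "cmod z <= 1 - a * t" if "0 <= t" "t <= 1" "z : {ray e t, cnj (ray e t)}" for z t
 proof -
  let ?g = "cmod (ray e t - 1)"
  have "cmod (cnj y - 1) = cmod (y - 1)" for y by (metis complex_cnj_diff complex_cnj_one complex_mod_cnj)
  hence "cmod z = cmod (ray e t)" "?e z = ?g" using that(3) by (auto simp: norm_minus_commute)
  moreover have "?g <= t & cmod (ray e t) <= 1 - a * t"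
  proof (cases "t = 0")
   case False
   hence "?g = t * sin e" "cmod (ray e t) <= 1 - sin e / 2 * (t * sin e)" using ray_facts[OF e, of t] that by auto
   thus ?thesis using that by (simp add: a_def power2_eq_square mult_ac mult_left_le)
  qed (simp add: ray_def)
  ultimately show "?e z <= t" "cmod z <= 1 - a * t" by auto
 qed
 let ?a = "of_real (cos e)"
 let ?f = "%k t. 2 ^ 21 * B * (2 ^ k * t * min 1 (1 / (2 ^ k * t)^2))"
 show "contour_bounds e (2 ^ 21 * (7 / a) ^ 7) K dy_eta"
  unfolding contour_bounds_def B_def[symmetric]
 proof (intro conjI allI impI ballI exI)
  fix k t z assume "0 <= t & t <= 1" and zz: "z : {ray e t, cnj (ray e t)}"
  hence t: "0 <= t" "t <= 1" by auto
  note z = z[OF t zz]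
  have z1: "cmod z <= 1" using z(2) mult_nonneg_nonneg[of a t] a t by linarith
  define ta where "ta = 2 ^ k * t"
  have ta: "0 <= ta" using t by (simp add: ta_def)
  have D: "ta ^ j * cmod z ^ 2 ^ k <= B" if "j <= 7" for j
   using decay_bound[OF a t(1) norm_ge_zero z(2) that, of "2 ^ k"] by (simp add: ta_def B_def)
  let ?b = "ta ^ 5 * cmod z ^ 2 ^ k"
  let ?c = "min 1 (1 / ta\<^sup>2)"
  have "cmod (poly (dy_eta k) z) <= 2 ^ 14 * ((2 ^ k * ?e z) ^ 6 * cmod z ^ 2 ^ k)" by (rule norm_dy_eta[OF z1])
  also have "... <= 2 ^ 14 * (ta ^ 6 * cmod z ^ 2 ^ k)"
   using z(1) by (intro mult_left_mono mult_right_mono power_mono) (auto simp: ta_def)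
  also have "... = 2 ^ 14 * (ta * ?b)" by (simp add: eval_nat_numeral)
  also have "... <= 2 ^ 14 * (ta * (B * ?c))"
  proof (cases "ta = 0")
   case False
   hence "?b = ta ^ 7 * cmod z ^ 2 ^ k / ta\<^sup>2" by (simp add: eval_nat_numeral)
   also have "... <= B / ta\<^sup>2" using D[of 7] by (intro divide_right_mono) auto
   finally have "?b <= B * ?c" using D[of 5] by (simp add: min_def)
   thus ?thesis using ta by (intro mult_left_mono) auto
  qed simp
  also have "... <= 2 ^ 21 * B * (ta * ?c)" using B ta by simp
  finally show "cmod (poly (dy_eta k) z) <= ?f k t" by (simp add: ta_def)
 next
  fix k th
  let ?d = "2 ^ 20 * B * (1 / 2) ^ k"
  show "0 <= ?d" using B by simp
  define z where "z = ?a * cis th"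
  have nz: "cmod z = cos e" using se by (simp add: z_def norm_mult)
  hence z2: "?e z <= 2" using norm_triangle_ineq4[of 1 z] cos_le_one[of e] unfolding norm_one by linarith
  have "cmod (poly (dy_eta k) z) <= 2 ^ 14 * ((2 ^ k * ?e z) ^ 6 * cmod z ^ 2 ^ k)" by (rule norm_dy_eta) (simp add: nz)
  also have "... <= 2 ^ 14 * ((2 ^ k * 2) ^ 6 * cmod z ^ 2 ^ k)"
   using z2 se nz by (intro mult_left_mono mult_right_mono power_mono) auto
  also have "... = 2 ^ 20 * ((2 ^ k) ^ 7 * cos e ^ 2 ^ k) * (1 / 2) ^ k" by (simp add: nz power_mult_distrib power_divide eval_nat_numeral)
  also have "... <= ?d"
   using decay_bound[OF a zero_le_one se(2) ac, of 7 "2 ^ k"] by (intro mult_right_mono mult_left_mono) (auto simp: B_def)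
  finally show "cmod (poly (dy_eta k) (?a * cis th)) <= ?d" by (simp add: z_def)
 next
  have "(SUM k<K. (1 / 2 :: real) ^ k) <= 2" by (simp add: sum_gp_strict)
  thus "(SUM k<K. 2 ^ 20 * B * (1 / 2) ^ k) <= 2 ^ 21 * B" using B by (simp add: sum_distrib_left[symmetric] mult_left_mono)
 qed
 let ?h = "[:1, -1:] ^ 10"
 show "contour_bounds e (2 ^ 21 * (7 / a) ^ 7) 1 (%_. [:1, -1:] ^ 10)"
  unfolding contour_bounds_def B_def[symmetric]
 proof (intro conjI allI impI ballI exI[of _ "%_. 1024"])
  fix k :: nat and t z assume k: "k < 1" and "0 <= t & t <= 1" and zz: "z : {ray e t, cnj (ray e t)}"
  hence t: "0 <= t" "t <= 1" by auto
  have "cmod (poly ?h z) = ?e z ^ 10" by (simp add: norm_power)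
  also have "... <= t ^ 10" using z(1)[OF t zz] by (intro power_mono) auto
  also have "... <= t ^ 1" using t by (intro power_decreasing) auto
  also have "... <= 2 ^ 21 * B * (t * min 1 (1 / t^2))"
  proof (cases "t = 0")
   case False
   hence "min 1 (1 / t^2) = 1" using t by (simp add: min_def field_simps power_le_one)
   thus ?thesis using B mult_right_mono[of 1 "2 ^ 21 * B" t] t by simp
  qed simp
  finally show "cmod (poly ?h z) <= ?f k t" using k by simp
 next
  fix th
  let ?i = "cis th"
  have "cmod (1 - ?a * ?i) <= 1 + cmod (?a * ?i)" using norm_triangle_ineq4[of "1 :: complex"] by simp
  also have "... <= 2" using se by (simp add: norm_mult)
  finally have "cmod (1 - ?a * ?i) ^ 10 <= 2 ^ 10" by (intro power_mono) auto
  thus "cmod (poly ?h (?a * ?i)) <= 1024" by (simp add: norm_power)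
 qed (use B in auto)
qed

context contr_regular
begin

lemma op_bound:
 assumes s: "0 <= s" "s <= 1" and x: "x : Lp M p"
 shows "Ln M p (op s T Q x) <= (SUM j<=degree Q. cmod (coeff Q j) * s ^ j) * Ln M p x"
proof -
 have "Ln M p (op s T Q x) <= (SUM j<=degree Q. Ln M p (%w. (coeff Q j * of_real (s ^ j)) * (T ^^ j) x w))"
  using Lp_sum[OF p, of "{..degree Q}" "%j w. (coeff Q j * of_real (s ^ j)) * (T ^^ j) x w" M] x
  by (simp add: op_def[abs_def] mult.assoc Lp_scale(1)[OF p0] Tn_Lp)
 also have "... <= (SUM j<=degree Q. (cmod (coeff Q j) * s ^ j) * Ln M p x)"
  using s by (intro sum_mono) (simp add: Lp_scale(2)[OF p0 Tn_Lp[OF x]] norm_mult norm_power mult_left_mono Tn_contr x)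
 finally show ?thesis by (simp add: sum_distrib_right)
qed

text \<open>The remainder contains the factor \<open>z^(2^K)\<close>, which becomes
  \<open>s^(2^K) T^(2^K)\<close>; this is one of the reasons for working with
  \<open>s < 1\<close>.\<close>

lemma op_remainder:
 assumes s: "0 < s" "s < 1" and x: "x : Lp M p"
 shows "(%K. Ln M p (op s T (F * (1 - (1 - monom 1 (2 ^ K)) ^ 10)) x)) \<longlonglongrightarrow> 0"
proof -
 define a where "a = (SUM j<=degree F. cmod (coeff F j) * s ^ j)"
 have a: "0 <= a" using s by (auto simp: a_def intro!: sum_nonneg)
 have "Ln M p (op s T (F * (1 - (1 - monom 1 m) ^ 10)) x) <= a * (s ^ m * 1023) * Ln M p x" for m
 proof (rule op_mult_norm[OF _ _ a x])
  fix y assume y: "y : Lp M p"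
  show "Ln M p (op s T F y) <= a * Ln M p y" unfolding a_def using s y by (intro op_bound) auto
  let ?b = "%z. Ln M p (op s T (monom 1 m) z)"
  have w: "?b z <= s ^ m * Ln M p z" if "z : Lp M p" for z
   using Lp_scale(2)[OF p0 Tn_Lp[OF that, of m], of "of_real (s ^ m)"] s Tn_contr[OF that, of m]
   by (simp add: op_monom[abs_def] norm_power mult_left_mono del: of_real_power)
  let ?a = "1 - monom 1 m"
  have w2: "Ln M p (op s T ?a z) <= 2 * Ln M p z" if z: "z : Lp M p" for z
  proof -
   have "Ln M p (op s T ?a z) <= Ln M p (op s T 1 z) + ?b z"
    unfolding op_diff[abs_def] by (intro Lp_diff(2)[OF p] op_Lp z)
   also have "op s T 1 z = z" by (simp add: op_def fun_eq_iff)
   also have "?b z <= 1 * Ln M p z"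
    using s by (intro order_trans[OF w[OF z]] mult_right_mono) (auto simp: power_le_one Ln_nonneg)
   finally show ?thesis by simp
  qed
  have S: "Ln M p (op s T (SUM i<10. ?a ^ i) z) <= 1023 * Ln M p z" if z: "z : Lp M p" for z
  proof -
   have "Ln M p (op s T (SUM i<10. ?a ^ i) z) <= (SUM i<10. Ln M p (op s T (?a ^ i) z))"
    unfolding op_sum[abs_def] by (rule conjunct2[OF Lp_sum[OF p]]) (auto intro: op_Lp z)
   also have "... <= (SUM i<10. 2 ^ i * Ln M p z)" by (intro sum_mono op_power_norm w2 z) auto
   also have "... = 1023 * Ln M p z" by (simp add: eval_nat_numeral)
   finally show ?thesis .
  qed
  have e: "1 - ?a ^ 10 = monom 1 m * (SUM i<10. (1 - monom (1 :: complex) m) ^ i)"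
   by (simp add: one_diff_power_eq)
  show "Ln M p (op s T (1 - ?a ^ 10) y) <= s ^ m * 1023 * Ln M p y"
   unfolding e by (rule op_mult_norm[OF w S zero_le_power[OF less_imp_le[OF s(1)]] y])
 qed
 note le = this
 have lim: "(%K. a * (s ^ 2 ^ K * 1023) * Ln M p x) \<longlonglongrightarrow> a * (0 * 1023) * Ln M p x"
  using LIMSEQ_subseq_LIMSEQ[OF LIMSEQ_realpow_zero[of s], of "%K. 2 ^ K"] s
  by (intro tendsto_intros) (auto simp: o_def strict_mono_def)
 show ?thesis by (rule tendsto_sandwich[OF _ _ tendsto_const lim[simplified]]) (use le in "auto simp: Ln_nonneg")
qed

end

section \<open>The square function estimate for finitely many polynomials\<close>

context ritt_regular
begin

text \<open>In the dyadic terms of the partition \<open>P_k^2\<close> is split: one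
  \<open>P_k\<close> acts on \<open>x\<close> and is summed by the square function, the other is
  taken out by the dual one, and \<open>F * dy_eta k\<close> in between is controlled by
  \<open>l2_functional_bound\<close>. The term with \<open>(1 - z)^10\<close> is the same bound with
  a single index. The constants do not depend on \<open>K\<close> or \<open>s\<close>, so
  \<open>K\<close> can tend to infinity.\<close>

lemma op_L2n_bound:
 assumes e: "good e"
 shows "EX C>=0. ALL s (N::nat) F x B0. 0 < s --> s < 1 --> x : Lp M p --> 0 <= B0 --> (ALL z:stolz (pi / 2 - e). (SUM n<N. (cmod (poly (F n) z))\<^sup>2) <= B0^2) -->
  L2n M p {..<N} (%n. op s T (F n) x) <= C * (B0 * Ln M p x)"
proof -
 note G = good_facts[OF e]
 define Ce where "Ce = 2 ^ 21 * (7 / ((sin e)^2 / 2)) ^ 7"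
 define R where "R = (16 * DR e + 4 * pi / sin e * KR) * Ce"
 note cb = contour_bounds_dyadic[OF G(1,4), folded Ce_def]
 have Ce: "0 <= Ce" by (simp add: Ce_def)
 have R: "0 <= R" using G KR Ce by (simp add: R_def)
 obtain Cs where Cs: "0 <= Cs" "!!s K x. 0 < s ==> s < 1 ==> x : Lp M p ==> L2n M p {..<K} (%k. op s T (cpoly (lp_poly k)) x) <= Cs * Ln M p x"
  using square_function by blast
 obtain Cd where Cd: "0 <= Cd" "!!s K V x. 0 < s ==> s < 1 ==> finite V ==> (ALL n k. x n k : Lp M p) ==>
  L2n M p (V :: nat set) (%n w. SUM k<K. op s T (cpoly (lp_poly k)) (x n k) w) <= Cd * L2n M p (V \<times> {..<K}) (%(n, k). x n k)"
  using dual_square_function by blast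
 let ?f = "%K. 1 - (1 - monom 1 (2 ^ K)) ^ 10"
 have "L2n M p {..<N} (%n. op s T (F n) x) <= (R + Cd * R * Cs) * (B0 * Ln M p x)"
  if s: "0 < s" "s < 1" and x: "x : Lp M p" and B0: "0 <= B0" and F: "!!z. z : stolz (pi / 2 - e) ==> (SUM n<N. (cmod (poly (F n) z))\<^sup>2) <= B0^2" for s and N :: nat and F x B0
 proof -
  note fb = l2_functional_bound[OF e s finite_lessThan[of N] _ B0 F Ce]
  let ?P = "%k. cpoly (lp_poly k)"
  define u where "u n = op s T (F n * [:1, -1:] ^ 10) x" for n
  define v where "v n k = op s T (F n * dy_eta k) (op s T (?P k) x)" for n k
  define r where "r K n = op s T (F n * (?f K)) x" for K n
  have L: "u n : Lp M p" "v n k : Lp M p" "r K n : Lp M p" for n k K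
   unfolding u_def v_def r_def by (intro op_Lp x)+
  let ?g = "%k n w. op s T (?P k) (v n k) w"
  have LP: "(%w. SUM k<K. ?g k n w) : Lp M p" for K n
   by (rule conjunct1[OF Lp_sum[OF p]]) (auto intro: op_Lp L)
  have "L2n M p ({..<N} \<times> {..<1 :: nat}) (%(n, k). op s T (F n * [:1, -1:] ^ 10) x) <= R * B0 * L2n M p {..<1 :: nat} (%_. x)"
   unfolding R_def by (rule fb[OF x _ cb(2)])
  hence 1: "L2n M p {..<N} u <= R * B0 * Ln M p x"
   unfolding L2n_single[of M p "0 :: nat" "%_. x", symmetric] by (simp add: L2n_def L2_set_def sum_pairs u_def lessThan_Suc)
  let ?a = "%K. L2n M p {..<N} (%n w. SUM k<K. op s T (?P k) (v n k) w)"
  let ?i = "B0 * Ln M p x"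
  have 2: "?a K <= Cd * R * Cs * ?i" for K
  proof -
   let ?c = "L2n M p ({..<N} \<times> {..<K}) (%(n, k). v n k)"
   let ?d = "L2n M p {..<K} (%k. op s T (?P k) x)"
   have "?a K <= Cd * ?c"
    using Cd(2)[OF s, of "{..<N}" v K] L by simp
   also have "?c <= R * B0 * ?d"
    unfolding R_def v_def by (rule fb[OF op_Lp[OF x] _ cb(1)])
   also have "?d <= Cs * Ln M p x" by (rule Cs(2)[OF s x])
   finally show ?thesis using Cd(1) R B0 by (simp add: mult_right_mono mult_ac)
  qed
  have 3: "(%K. R * B0 * Ln M p x + Cd * R * Cs * ?i + (SUM n<N. Ln M p (r K n))) \<longlonglongrightarrow> R * B0 * Ln M p x + Cd * R * Cs * ?i + (SUM n<N. 0)"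
   unfolding r_def by (intro tendsto_intros op_remainder s x)
  let ?b = "%K. R * B0 * Ln M p x + Cd * R * Cs * (B0 * Ln M p x) + (SUM n<N. Ln M p (r K n))"
  let ?e = "L2n M p {..<N} (%n. op s T (F n) x)"
  have 4: "?e <= ?b K" for K
  proof -
   have "AE w in M. op s T (F n) x w = u n w + (SUM k<K. ?g k n w) + r K n w" for n
   proof -
    let ?h = "%k. F n * dy_eta k * ?P k"
    have "F n * ([:1, -1:] ^ 10 + (SUM k<K. dy_eta k * (?P k * ?P k)) + (?f K)) = F n" unfolding dyadic_partition by simp
    hence Fn: "F n = F n * [:1, -1:] ^ 10 + (SUM k<K. ?P k * (?h k)) + F n * (?f K)"
     by (simp add: distrib_left sum_distrib_left mult_ac)
    have "AE w in M. ALL k:{..<K}. op s T (?P k * (?h k)) x w = ?g k n w"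
    proof (intro AE_finite_allI)
     fix k
     show "AE w in M. op s T (?P k * (?h k)) x w = ?g k n w"
      using op_mult[OF x, of s "?P k" "?h k"] op_AE[OF op_mult[OF x, of s "F n * dy_eta k" "?P k"] op_Lp[OF x] op_Lp[OF op_Lp[OF x]], of s "?P k"]
      by eventually_elim (simp add: v_def)
    qed simp
    thus ?thesis
     by eventually_elim (subst Fn, simp only: op_add op_sum u_def r_def, simp)
   qed
   hence "?e = L2n M p {..<N} (%n w. u n w + (SUM k<K. ?g k n w) + r K n w)"
    by (intro L2n_cong_AE[OF p]) (auto intro!: Lp_add(1)[OF p] L LP op_Lp x)
   also have "... <= L2n M p {..<N} u + ?a K + L2n M p {..<N} (r K)"
    by (intro order_trans[OF L2n_triangle[OF p]] add_right_mono L2n_triangle[OF p]) (auto intro!: Lp_add(1)[OF p] L LP)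
   also have "... <= ?b K"
    using 1 2[of K] L2n_le_sum[OF p, of "{..<N}" "r K" M] L by (intro add_mono) auto
   finally show ?thesis .
  qed
  from LIMSEQ_le_const[OF 3] 4 show ?thesis by (auto simp: algebra_simps)
 qed
 thus ?thesis using R Cd Cs by (intro exI[of _ "R + Cd * R * Cs"]) auto
qed

lemma op_one_L2n_bound:
 fixes N :: nat
 assumes x: "x : Lp M p" and b: "!!s. 0 < s ==> s < 1 ==> L2n M p {..<N} (%n. op s T (F n) x) <= B"
 shows "L2n M p {..<N} (%n. op 1 T (F n) x) <= B"
proof -
 define d where "d s n w = op 1 T (F n) x w - op s T (F n) x w" for s n w
 define h where "h s n = (SUM j<=degree (F n). cmod (coeff (F n) j) * (1 - s ^ j)) * Ln M p x" for s n
 let ?a = "L2n M p {..<N} (%n. op 1 T (F n) x)"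
 have "?a <= B + (SUM n<N. h s n)" if s: "0 < s" "s < 1" for s
 proof -
  have dn: "d s n : Lp M p & Ln M p (d s n) <= h s n" for n
  proof -
   let ?b = "%j. coeff (F n) j * of_real (1 - s ^ j)"
   have e: "d s n = (%w. SUM j<=degree (F n). (?b j) * (T ^^ j) x w)"
    by (simp add: d_def op_def fun_eq_iff algebra_simps flip: sum_subtractf)
   have L: "(%w. (?b j) * (T ^^ j) x w) : Lp M p" for j by (intro Lp_scale(1)[OF p0] Tn_Lp x)
   have c: "Ln M p (%w. (?b j) * (T ^^ j) x w) <= cmod (coeff (F n) j) * (1 - s ^ j) * Ln M p x" for j
    unfolding Lp_scale(2)[OF p0 Tn_Lp[OF x]] norm_mult norm_of_real using s power_le_one[of s j] Tn_contr[OF x, of j] by (intro mult_mono) (auto simp: Ln_nonneg)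
   show ?thesis unfolding e h_def sum_distrib_right
    by (intro conjI conjunct1[OF Lp_sum[OF p]] order_trans[OF conjunct2[OF Lp_sum[OF p]] sum_mono] c L) auto
  qed
  have "?a = L2n M p {..<N} (%n w. op s T (F n) x w + d s n w)" by (simp add: d_def)
  also have "... <= L2n M p {..<N} (%n. op s T (F n) x) + L2n M p {..<N} (d s)" using dn by (intro L2n_triangle[OF p]) (auto intro: op_Lp x)
  also have "... <= B + (SUM n<N. h s n)" using b[OF s] L2n_le_sum[OF p, of "{..<N}" "d s" M] dn sum_mono[of "{..<N}" "%n. Ln M p (d s n)" "h s"]
   by (intro add_mono) auto
  finally show ?thesis .
 qed
 hence "\<forall>\<^sub>F s in at_left 1. ?a <= B + (SUM n<N. h s n)"
  by (intro eventually_at_leftI[of 0]) auto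
 moreover have "((%s. B + (SUM n<N. h s n)) \<longlongrightarrow> B + (SUM n<N. (SUM j<=degree (F n). cmod (coeff (F n) j) * (1 - 1 ^ j)) * Ln M p x)) (at_left 1)"
  unfolding h_def by (intro tendsto_intros)
 ultimately show ?thesis using tendsto_lowerbound[of _ _ "at_left (1::real)"] by fastforce
qed

end

section \<open>Infinite sums and the two statements\<close>

lemma enn_powr_SUP:
 fixes f :: "nat => real"
 assumes r: "0 < r" and f: "incseq f" "!!n. 0 <= f n"
 shows "enn_powr (SUP n. ennreal (f n)) r = (SUP n. ennreal (f n powr r))"
proof -
 have i: "incseq (%n. ennreal (f n))" "incseq (%n. ennreal (f n powr r))"
  using f r by (auto simp: incseq_def intro!: ennreal_leI powr_mono2)
 let ?a = "SUP n. f n"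
 show ?thesis
 proof (cases "bdd_above (range f)")
  case True
  hence lim: "f \<longlonglongrightarrow> ?a" using f(1) by (rule LIMSEQ_incseq_SUP)
  hence "0 <= ?a" using f(2) by (intro LIMSEQ_le_const) auto
  moreover have "(SUP n. ennreal (f n)) = ennreal ?a"
   using LIMSEQ_unique[OF LIMSEQ_SUP[OF i(1)] tendsto_ennrealI[OF lim]] .
  moreover have "(SUP n. ennreal (f n powr r)) = ennreal (?a powr r)"
   using LIMSEQ_unique[OF LIMSEQ_SUP[OF i(2)] tendsto_ennrealI[OF tendsto_powr'[OF lim tendsto_const]]] r f(2) by simp
  ultimately show ?thesis by (simp add: enn_powr_ennreal)
 next
  case False
  have u: "EX n. c < f n" for c using False by (auto simp: bdd_above_def) (meson le_less_linear)
  have top: "(SUP n. ennreal (g n)) = \<infinity>" if g: "!!c. 0 <= c ==> EX n. c < g n" for g :: "nat => real"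
   unfolding infinity_ennreal_def SUP_eq_top_iff
  proof (intro allI impI)
   fix y :: ennreal assume "y < top"
   then obtain c where c: "0 <= c" "y = ennreal c" by (cases y) auto
   thus "EX n:UNIV. y < ennreal (g n)" using g[OF c(1)] c by (auto simp: ennreal_less_iff)
  qed
  have "EX n. c < f n powr r" if c: "0 <= c" for c
  proof -
   obtain n where "c powr (1 / r) < f n" using u by blast
   hence "(c powr (1 / r)) powr r < f n powr r" using r by (intro powr_less_mono2) auto
   thus ?thesis using r c by (auto simp: powr_powr)
  qed
  thus ?thesis using u by (simp add: top enn_powr_def)
 qed
qed

lemma enn_powr_half_le:
 assumes "enn_powr X (1/2) <= ennreal B" "0 <= B"
 shows "X <= ennreal (B^2)"
proof (cases X)
 case (real y)
 hence "sqrt y <= B" using assms by (simp add: enn_powr_ennreal powr_half_sqrt)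
 thus ?thesis using real by (simp add: sqrt_le_D ennreal_leI)
qed (use assms in "simp add: enn_powr_def top_unique")

text \<open>Monotone convergence: the powers commute with increasing suprema, so bounds for all
  finite sections carry over to the series.\<close>

lemma lpn_square_le:
 fixes f :: "nat => 'a => complex"
 assumes p: "1 < p" and f: "!!n. f n : Lp M p" and B: "0 <= B" "!!N. L2n M p {..<N} f <= B"
 shows "lpn M p (%w. enn_powr (\<Sum>n. ennreal ((cmod (f n w))^2)) (1/2)) <= ennreal B"
proof -
 define S where "S N w = (SUM n<N. (cmod (f n w))\<^sup>2)" for N w
 have p0: "0 < p" using p by simp
 have [measurable]: "f n : borel_measurable M" for n by (rule LpD[OF f])
 have iS: "incseq (%N. S N w)" "0 <= S N w" for N w by (auto simp: S_def incseq_def intro!: sum_mono2 sum_nonneg)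
 have "(\<Sum>n. ennreal ((cmod (f n w))^2)) = (SUP N. ennreal (S N w))" for w
  by (simp add: suminf_eq_SUP S_def sum_ennreal)
 hence e: "enn_powr (enn_powr (\<Sum>n. ennreal ((cmod (f n w))^2)) (1/2)) p = (SUP N. ennreal (S N w powr (p / 2)))" for w
  using p0 iS by (simp add: enn_powr_SUP powr_powr incseq_def powr_mono2)
 let ?a = "\<integral>\<^sup>+w. (SUP N. ennreal (S N w powr (p / 2))) \<partial>M"
 let ?b = "%N. \<integral>\<^sup>+w. ennreal (S N w powr (p / 2)) \<partial>M"
 let ?c = "ennreal (B powr p)"
 have "?a = (SUP N. (?b N))"
  using iS p0 by (intro nn_integral_monotone_convergence_SUP) (auto simp: incseq_def le_fun_def S_def intro!: ennreal_leI powr_mono2 sum_mono2 sum_nonneg)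
 also have "... <= ?c"
 proof (rule SUP_least)
  fix N
  have L: "(%w. complex_of_real (L2_set (%n. cmod (f n w)) {..<N})) : Lp M p" by (rule L2n_Lp[OF p _ f]) simp
  have "(?b N) = (\<integral>\<^sup>+w. ennreal (L2_set (%n. cmod (f n w)) {..<N} powr p) \<partial>M)"
   by (simp add: L2_powr S_def)
  also have "... = ennreal (L2n M p {..<N} f powr p)"
   using L p0 unfolding L2n_def Ln_powr[OF p0] Lp_iff[OF p0] by (subst nn_integral_eq_integral) (auto simp: L2_set_nonneg)
  also have "... <= ?c" using B(2)[of N] p0 by (intro ennreal_leI powr_mono2) (auto simp: L2n_nonneg)
  finally show "(?b N) <= ?c" .
 qed
 finally have le: "?a <= ?c" .
 define I where "I = ?a"
 obtain i where i: "I = ennreal i" "0 <= i" "i <= B powr p" using le by (cases I) (auto simp: I_def top_unique)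
 have "enn_powr I (1 / p) = ennreal (i powr (1 / p))" using i by (simp add: enn_powr_ennreal)
 also have "... <= ennreal ((B powr p) powr (1 / p))" using i p0 by (intro ennreal_leI powr_mono2) auto
 also have "... = ennreal B" using B p0 by (simp add: powr_powr)
 finally show ?thesis by (simp add: lpn_def e I_def)
qed

text \<open>Summation by parts lowers the exponent, by
  \<open>(n+1)^(a+1) - n^(a+1) <= (a+1) * (n+1)^a\<close>, and the boundary term has the right sign.
  Finite sums avoid convergence questions at \<open>r = 1\<close>.\<close>

lemma abel_power_sum:
 fixes r :: real
 assumes "0 <= r" "r <= 1"
 shows "(SUM n<N. real (n + 1) ^ a * r ^ n) * (1 - r) ^ Suc a <= fact a"
proof (induction a)
 case 0
 show ?case using one_diff_power_eq[of r N] zero_le_power[OF assms(1), of N] by (simp add: mult.commute)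
next
 case (Suc a)
 let ?a = "%n. real (n + 1)"
 let ?b = "SUM n<N. ?a n ^ Suc a * r ^ n"
 let ?c = "SUM n<N. (real (Suc a) * ?a n ^ a) * r ^ n"
 let ?e = "%n. ?a n ^ Suc a - real n ^ Suc a"
 let ?f = "(1 - r) * ?b + real N ^ Suc a * r ^ N"
 have "?f = (SUM n<N. (?e n) * r ^ n)"
  by (induction N) (simp_all add: algebra_simps)
 also have "... <= ?c"
 proof (intro sum_mono mult_right_mono)
  fix n
  have "?e n = (SUM i<Suc a. ?a n ^ i * real n ^ (a - i))"
   using power_diff_sumr2[of "?a n" "Suc a" "real n"] by (simp add: mult.commute)
  also have "... <= (SUM i<Suc a. ?a n ^ i * ?a n ^ (a - i))" by (intro sum_mono mult_left_mono power_mono) auto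
  also have "... = real (Suc a) * ?a n ^ a" by (simp flip: power_add)
  finally show "?e n <= real (Suc a) * ?a n ^ a" .
 qed (use assms in auto)
 finally have le: "?f <= ?c" .
 let ?d = "real (Suc a) * (SUM n<N. ?a n ^ a * r ^ n)"
 have "(1 - r) * ?b <= ?d"
 proof -
  have "0 <= real N ^ Suc a * r ^ N" using assms by simp
  moreover have "?c = ?d" by (simp only: sum_distrib_left mult.assoc)
  ultimately show ?thesis using le by linarith
 qed
 hence "((1 - r) * ?b) * (1 - r) ^ Suc a <= ?d * (1 - r) ^ Suc a"
  using assms by (intro mult_right_mono) auto
 also have "... <= real (Suc a) * fact a" using Suc.IH by (simp only: mult.assoc mult_left_mono of_nat_0_le_iff)
 finally show ?case by (simp add: mult_ac)
qed

text \<open>The inequality defines a closed convex set, so it is enough to check the point 1, where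
  both sides vanish, and the disc of radius \<open>cos e\<close>, where the left side is at most 2
  and the constant makes the right side at least 2.\<close>

lemma stolz_bound:
 assumes e: "0 < e" "e < pi / 2" and z: "z : stolz (pi / 2 - e)"
 shows "cmod (1 - z) <= 2 / (1 - cos e) * (1 - cmod z)"
proof -
 define c where "c = 2 / (1 - cos e)"
 have ce: "0 <= cos e" "cos e < 1" using e cos_monotone_0_pi[of 0 e] by (auto intro: cos_ge_zero)
 define K where "K = {z. cmod (1 - z) + c * cmod z <= c}"
 have c: "c * cos e + 2 = c" using ce by (simp add: c_def field_simps)
 have "convex K"
 proof (rule convexI)
  fix x y and u v :: real assume a: "x : K" "y : K" "0 <= u" "0 <= v" "u + v = 1"
  let ?a = "u *\<^sub>R x + v *\<^sub>R y"
  have "1 - ?a = u *\<^sub>R (1 - x) + v *\<^sub>R (1 - y)" using a(5) by (simp add: scaleR_right_diff_distrib flip: scaleR_add_left)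
  hence "cmod (1 - ?a) <= u * cmod (1 - x) + v * cmod (1 - y)"
   using a norm_triangle_ineq[of "u *\<^sub>R (1 - x)" "v *\<^sub>R (1 - y)"] by simp
  moreover have "c * cmod ?a <= c * (u * cmod x + v * cmod y)"
   using a ce norm_triangle_ineq[of "u *\<^sub>R x" "v *\<^sub>R y"] by (intro mult_left_mono) (auto simp: c_def)
  moreover have "u * (cmod (1 - x) + c * cmod x) + v * (cmod (1 - y) + c * cmod y) <= u * c + v * c"
   using a by (intro add_mono mult_left_mono) (auto simp: K_def)
  moreover have "u * c + v * c = c" using a(5) by (simp flip: distrib_right)
  ultimately show "?a : K" by (simp add: K_def algebra_simps)
 qed
 moreover have "closed K" unfolding K_def by (intro closed_Collect_le continuous_intros)
 moreover have "insert 1 (ball 0 (sin (pi / 2 - e))) \<subseteq> K"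
 proof -
  have "z : K" if "cmod z < cos e" for z
  proof -
   have "c * cmod z <= c * cos e" using that ce by (intro mult_left_mono) (auto simp: c_def)
   thus ?thesis using norm_triangle_ineq4[of 1 z] that ce c by (simp add: K_def)
  qed
  thus ?thesis by (auto simp: K_def sin_diff)
 qed
 ultimately have "stolz (pi / 2 - e) \<subseteq> K" unfolding stolz_def by (intro closure_minimal hull_minimal)
 hence "cmod (1 - z) + c * cmod z <= c" using z by (auto simp: K_def)
 thus ?thesis unfolding c_def[symmetric] by (simp add: right_diff_distrib)
qed

context ritt_regular
begin

definition "calculus_const e C \<longleftrightarrow> 0 <= C &
 (ALL F x B0. x : Lp M p --> 0 <= B0 --> (ALL z:stolz (pi / 2 - e). ALL N. (SUM n<N. (cmod (poly (F n) z))\<^sup>2) <= B0^2) -->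
  lpn M p (%w. enn_powr (\<Sum>n. ennreal ((cmod (op 1 T (F n) x w))^2)) (1/2)) <= ennreal (C * (B0 * Ln M p x)))"

lemma calculus_const_exists:
 assumes e: "good e"
 shows "EX C. calculus_const e C"
proof -
 obtain C where C: "0 <= C" "!!s (N::nat) F x B0. 0 < s ==> s < 1 ==> x : Lp M p ==> 0 <= B0 ==> (ALL z:stolz (pi / 2 - e). (SUM n<N. (cmod (poly (F n) z))\<^sup>2) <= B0^2) ==>
  L2n M p {..<N} (%n. op s T (F n) x) <= C * (B0 * Ln M p x)"
  using op_L2n_bound[OF e] by blast
 show ?thesis unfolding calculus_const_def
  by (intro exI[of _ C] conjI allI impI lpn_square_le op_one_L2n_bound C(1) p op_Lp) (use C in "auto simp: Ln_nonneg")
qed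

lemma calculus_constD:
 assumes "calculus_const e C" "x : Lp M p" "0 <= B0" "!!z N. z : stolz (pi / 2 - e) ==> (SUM n<N. (cmod (poly (F n) z))\<^sup>2) <= B0^2"
 shows "0 <= C" "lpn M p (%w. enn_powr (\<Sum>n. ennreal ((cmod (op 1 T (F n) x w))^2)) (1/2)) <= ennreal (C * (B0 * Ln M p x))"
 using assms unfolding calculus_const_def by simp_all

text \<open>On representatives \<open>T\<close> is linear only almost everywhere, so the iterated
  difference agrees with the polynomial \<open>(z - 1)^m\<close> in \<open>T\<close> only up to a
  null set.\<close>

lemma difference_power_AE:
 assumes x: "x : Lp M p"
 shows "((%y w. T y w - y w) ^^ m) x : Lp M p & (AE w in M. ((%y w. T y w - y w) ^^ m) x w = op 1 T ([:-1, 1:] ^ m) x w)"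
proof (induction m)
 case 0
 show ?case using x by (simp add: op_def)
next
 case (Suc m)
 let ?D = "%y w. T y w - y w"
 have e: "?D = op 1 T [:-1, 1:]" by (simp add: op_def fun_eq_iff)
 have "AE w in M. op 1 T [:-1, 1:] ((?D ^^ m) x) w = op 1 T [:-1, 1:] (op 1 T ([:-1, 1:] ^ m) x) w"
  using Suc by (intro op_AE op_Lp x) auto
 with op_mult[OF x, of 1 "[:-1, 1:]" "[:-1, 1:] ^ m"]
 have "AE w in M. op 1 T [:-1, 1:] ((?D ^^ m) x) w = op 1 T ([:-1, 1:] ^ Suc m) x w"
  unfolding power_Suc by eventually_elim simp
 thus ?case using Suc op_Lp[of "(?D ^^ m) x" 1 "[:-1, 1:]"] by (simp only: e funpow.simps o_apply simp_thms)
qed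

text \<open>\<open>C + 1\<close> keeps the constant at least 1; it also keeps the right side
  infinite when the supremum is infinite and the norm of \<open>x\<close> is not 0.\<close>

lemma poly_op_square_function:
 assumes e: "good e"
 shows "EX C>=1. ALL F x. x : Lp M p --> lpn M p (%w. enn_powr (\<Sum>n. ennreal ((cmod (poly_op (F n) T x w))^2)) (1/2))
   <= ennreal C * lp_norm M p x * (SUP z\<in>stolz (pi / 2 - e). enn_powr (\<Sum>n. ennreal ((cmod (poly (F n) z))^2)) (1/2))"
proof -
 obtain C where C: "calculus_const e C" using calculus_const_exists[OF e] ..
 hence C0: "0 <= C" by (simp add: calculus_const_def)
 have "lpn M p (%w. enn_powr (\<Sum>n. ennreal ((cmod (poly_op (F n) T x w))^2)) (1/2))
   <= ennreal (C + 1) * lp_norm M p x * (SUP z\<in>stolz (pi / 2 - e). enn_powr (\<Sum>n. ennreal ((cmod (poly (F n) z))^2)) (1/2))" (is "?l <= _ * ?S")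
  if x: "x : Lp M p" for F x
 proof -
  have op: "poly_op Q T x = op 1 T Q x" for Q by (simp add: poly_op_def op_def fun_eq_iff)
  show ?thesis
  proof (cases ?S)
   case (real B0)
   have "(SUM n<N. (cmod (poly (F n) z))\<^sup>2) <= B0^2" if z: "z : stolz (pi / 2 - e)" for z N
   proof -
    let ?X = "\<Sum>n. ennreal ((cmod (poly (F n) z))^2)"
    have "ennreal (SUM n<N. (cmod (poly (F n) z))\<^sup>2) <= ?X"
     unfolding sum_ennreal[OF zero_le_power2, symmetric] by (rule sum_le_suminf) auto
    also have "?X <= ennreal (B0^2)"
     by (rule enn_powr_half_le[OF _ real(1)], unfold real(2)[symmetric], rule SUP_upper[OF z])
    finally show ?thesis by (simp add: ennreal_le_iff)
   qed
   hence "?l <= ennreal (C * (B0 * Ln M p x))" unfolding op by (rule calculus_constD(2)[OF C x real(1)])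
   also have "... <= ennreal ((C + 1) * Ln M p x * B0)" using mult_nonneg_nonneg[OF Ln_nonneg real(1), of M p x] by (intro ennreal_leI) (simp add: algebra_simps)
   finally show ?thesis using C0 real(1) unfolding lp_norm_Ln[OF p0 x] real(2) by (simp only: ennreal_mult[symmetric] Ln_nonneg mult_nonneg_nonneg add_nonneg_nonneg zero_le_one)
  next
   case top
   show ?thesis
   proof (cases "Ln M p x = 0")
    \<comment> \<open>Here the right side is 0 times infinity, which is 0, so the left side has to
      be shown to vanish.\<close>
    case True
    have "L2n M p {..<N} (%n. op 1 T (F n) x) <= (SUM n<N. Ln M p (op 1 T (F n) x))" for N :: nat
     by (intro L2n_le_sum p op_Lp x) auto
    also have "(SUM n<N. Ln M p (op 1 T (F n) x)) <= 0" for N :: nat using op_bound[OF _ _ x, of 1] True by (intro sum_nonpos) simp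
    finally have "L2n M p {..<N} (%n. op 1 T (F n) x) <= 0" for N :: nat .
    hence "?l <= ennreal 0" unfolding op by (intro lpn_square_le p op_Lp x order_refl)
    thus ?thesis by (simp only: ennreal_0 le_zero_eq zero_le)
   next
    case False
    hence "ennreal (C + 1) * ennreal (Ln M p x) ~= 0" using C0 Ln_nonneg[of M p x] by (simp add: ennreal_eq_0_iff)
    thus ?thesis unfolding top lp_norm_Ln[OF p0 x] by (simp add: ennreal_mult_top)
   qed
  qed
 qed
 thus ?thesis using C0 by (intro exI[of _ "C + 1"]) auto
qed

text \<open>The weight is the one that keeps the supremum finite: on the Stolz domain
  \<open>|1 - z| <= c * (1 - |z|)\<close>, so after \<open>|z|^(2n) <= |z|^n\<close> the sum of
  squares is bounded by \<open>abel_power_sum\<close> with exponent \<open>2 * m - 1\<close>, whose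
  power \<open>2 * m\<close> of \<open>1 - |z|\<close> is just available.\<close>

lemma difference_square_function:
 assumes e: "good e" and m: "1 <= m"
 shows "EX Cm. ALL x:Lp M p. lpn M p (%w. enn_powr (\<Sum>n. ennreal (real (n + 1) ^ (2 * m - 1) *
   (cmod ((T ^^ n) (((%y w'. T y w' - y w') ^^ m) x) w))\<^sup>2)) (1/2)) <= ennreal Cm * lp_norm M p x"
proof -
 note G = good_facts[OF e]
 obtain C where C: "calculus_const e C" using calculus_const_exists[OF e] ..
 hence C0: "0 <= C" by (simp add: calculus_const_def)
 define c where "c = 2 / (1 - cos e)"
 define F :: "nat => complex poly" where "F n = smult (of_real (sqrt (real (n + 1) ^ (2 * m - 1)))) (monom 1 n * [:-1, 1:] ^ m)" for n
 let ?b = "c ^ (2 * m) * fact (2 * m - 1)"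
 define B where "B = sqrt ?b"
 have m2: "Suc (2 * m - 1) = 2 * m" using m by simp
 have F: "(SUM n<N. (cmod (poly (F n) z))\<^sup>2) <= B^2" if z: "z : stolz (pi / 2 - e)" for z N
 proof -
  have zb: "cmod (1 - z) <= c * (1 - cmod z)" unfolding c_def using G(1,4) pi_gt3 by (intro stolz_bound z) linarith+
  moreover have cp: "0 < c" using G cos_monotone_0_pi[of 0 e] pi_gt3 by (simp add: c_def)
  ultimately have z1: "cmod z <= 1" using order_trans[OF norm_ge_zero zb] by (simp add: zero_le_mult_iff)
  let ?a = "%n. real (n + 1) ^ (2 * m - 1) * cmod z ^ n * (c * (1 - cmod z)) ^ (2 * m)"
  have "(cmod (poly (F n) z))^2 <= ?a n" for n
  proof -
   have "(cmod (poly (F n) z))^2 = real (n + 1) ^ (2 * m - 1) * cmod z ^ (n + n) * cmod (1 - z) ^ (2 * m)"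
    by (simp add: F_def poly_monom norm_mult norm_power power_mult_distrib norm_minus_commute mult_2 power_add power2_eq_square)
   also have "... <= ?a n"
    using z1 zb by (intro mult_mono power_mono power_decreasing) auto
   finally show ?thesis .
  qed
  hence "(SUM n<N. (cmod (poly (F n) z))\<^sup>2) <= (SUM n<N. real (n + 1) ^ (2 * m - 1) * cmod z ^ n * (c * (1 - cmod z)) ^ (2 * m))" by (rule sum_mono)
  also have "... = c ^ (2 * m) * ((SUM n<N. real (n + 1) ^ (2 * m - 1) * cmod z ^ n) * (1 - cmod z) ^ Suc (2 * m - 1))"
   unfolding m2 by (simp add: sum_distrib_left sum_distrib_right power_mult_distrib mult_ac)
  also have "... <= ?b" by (rule mult_left_mono[OF abel_power_sum]) (use z1 in auto)
  also have "... = B^2" by (simp add: B_def)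
  finally show ?thesis .
 qed
 have "lpn M p (%w. enn_powr (\<Sum>n. ennreal (real (n + 1) ^ (2 * m - 1) * (cmod ((T ^^ n) (((%y w'. T y w' - y w') ^^ m) x) w))^2)) (1/2))
  <= ennreal (C * B) * lp_norm M p x" if x: "x : Lp M p" for x
 proof -
  let ?y = "((%y w'. T y w' - y w') ^^ m) x"
  note D = difference_power_AE[OF x, of m]
  have "AE w in M. ALL n. real (n + 1) ^ (2 * m - 1) * (cmod ((T ^^ n) ?y w))^2 = (cmod (op 1 T (F n) x w))^2"
   unfolding AE_all_countable
  proof
   fix n
   show "AE w in M. real (n + 1) ^ (2 * m - 1) * (cmod ((T ^^ n) ?y w))^2 = (cmod (op 1 T (F n) x w))^2"
    using Tn_AE[OF conjunct2[OF D] conjunct1[OF D] op_Lp[OF x], of n] op_mult[OF x, of 1 "monom 1 n" "[:-1, 1:] ^ m"]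
    by eventually_elim (simp add: F_def op_smult op_monom norm_mult power_mult_distrib)
  qed
  hence "lpn M p (%w. enn_powr (\<Sum>n. ennreal (real (n + 1) ^ (2 * m - 1) * (cmod ((T ^^ n) ?y w))^2)) (1/2))
   = lpn M p (%w. enn_powr (\<Sum>n. ennreal ((cmod (op 1 T (F n) x w))^2)) (1/2))"
   unfolding lpn_def by (intro arg_cong2[where f = enn_powr] nn_integral_cong_AE refl) (auto elim: eventually_mono)
  also have "... <= ennreal (C * (B * Ln M p x))" by (rule calculus_constD(2)[OF C x _ F]) (auto simp: B_def c_def)
  finally show ?thesis using C0 by (simp add: lp_norm_Ln[OF p0 x] B_def c_def Ln_nonneg ennreal_mult[symmetric] mult.assoc)
 qed
 thus ?thesis by blast
qed

end

lemma ritt_regularI: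
 assumes "1 < p" "analytic_op M p T" "contractively_regular M p T"
 shows "EX K. ritt_regular M p T K"
proof -
 interpret contr_regular M p T by (rule contr_regular.intro[OF assms(1,3)])
 obtain K where K: "!!n f. 1 <= n ==> f : Lp M p ==> of_nat n * lp_norm M p (%w. (T ^^ n) f w - (T ^^ (n - 1)) f w) <= ennreal K * lp_norm M p f"
  using assms(2) unfolding analytic_op_def by blast
 \<comment> \<open>The constant in \<open>analytic_op\<close> is an arbitrary real; under
   \<open>ennreal\<close> a negative one acts as 0.\<close>
 have "ritt_regular M p T (max K 0)"
 proof
  fix n :: nat and f assume f: "f : Lp M p" and n: "1 <= n"
  let ?d = "%w. (T ^^ n) f w - (T ^^ (n - 1)) f w"
  have d: "?d : Lp M p" by (intro Lp_diff(1)[OF p] Tn_Lp f)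
  let ?a = "max K 0 * Ln M p f"
  have "ennreal (real n * Ln M p ?d) = of_nat n * lp_norm M p ?d"
   unfolding lp_norm_Ln[OF p0 d] ennreal_of_nat_eq_real_of_nat by (intro ennreal_mult) (auto simp: Ln_nonneg)
  also have "... <= ennreal K * ennreal (Ln M p f)" using K[OF n f] unfolding lp_norm_Ln[OF p0 f] .
  also have "... <= ennreal (max K 0) * ennreal (Ln M p f)" by (intro mult_right_mono ennreal_leI) auto
  also have "... = ennreal ?a" by (intro ennreal_mult[symmetric]) (auto simp: Ln_nonneg)
  finally have "ennreal (real n * Ln M p ?d) <= ennreal ?a" .
  thus "real n * Ln M p (%w. (T ^^ n) f w - (T ^^ (n - 1)) f w) <= ?a"
   by (subst (asm) ennreal_le_iff) (auto simp: Ln_nonneg)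
 qed simp
 thus ?thesis ..
qed

theorem theorem3p3:
  fixes M :: "'a measure" and p :: real
    and T :: "('a \<Rightarrow> complex) \<Rightarrow> ('a \<Rightarrow> complex)"
  assumes "1 < p"
    and "analytic_op M p T"
    and "contractively_regular M p T"
  shows "(\<exists>\<gamma> C. 0 < \<gamma> \<and> \<gamma> < pi / 2 \<and> 1 \<le> C \<and>
            (\<forall>(F :: nat \<Rightarrow> complex poly) x. x \<in> Lp M p \<longrightarrow>
               lpn M p (\<lambda>\<omega>. enn_powr (\<Sum>n. ennreal ((cmod (poly_op (F n) T x \<omega>))\<^sup>2)) (1/2))
                 \<le> ennreal C * lp_norm M p x *
                   (SUP z\<in>stolz \<gamma>. enn_powr (\<Sum>n. ennreal ((cmod (poly (F n) z))\<^sup>2)) (1/2))))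
       \<and> (\<forall>m::nat. 1 \<le> m \<longrightarrow> (\<exists>Cm::real. \<forall>x\<in>Lp M p.
            lpn M p (\<lambda>\<omega>. enn_powr (\<Sum>n. ennreal (real (n + 1) ^ (2 * m - 1) *
                 (cmod ((T ^^ n) (((\<lambda>y \<omega>'. T y \<omega>' - y \<omega>') ^^ m) x) \<omega>))\<^sup>2)) (1/2))
              \<le> ennreal Cm * lp_norm M p x))"
proof -
 obtain K where "ritt_regular M p T K" using ritt_regularI[OF assms] ..
 then interpret ritt_regular M p T K .
 obtain e where e: "good e" using good_angle by blast
 \<comment> \<open>The angle is \<open>pi / 2 - e\<close>; its sine is \<open>cos e\<close>, the
   radius of the arc of the contour.\<close>
 have "0 < pi / 2 - e" "pi / 2 - e < pi / 2" using good_facts[OF e] pi_gt3 by auto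
 thus ?thesis using poly_op_square_function[OF e] difference_square_function[OF e] by blast
qed

end
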